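(* Let $1\le p\le q\le\infty$, $1\le s\le\infty$, $\alpha>0$, $\beta>0$ and $m>\alpha-1$. For a double indexed sequence $c=\{c_k^j\}$ the following are equivalent: (1) $c\in M_H(B^{p,1}_\alpha,B^{q,s}_\beta)$; (2) $g_c(rx')=\sum_{k\ge0}r^k\sum_{j=1}^{d_k}c_k^jY^{(k)}_j(x')$ is harmonic in $\mathbb B$ and $$N_s(g_c)=\sup_{0\le\rho<1}\sup_{y'\in\mathbb S}(1-\rho)^{\beta-\alpha+m+1}\Big\|\Lambda_{m+1}(g_c*P_{x'})(\rho y')\Big\|_{L^s(dx')}<\infty.$$
   Context: $n\ge2$; $\mathbb B$ is the open unit ball of $\mathbb R^n$, $\mathbb S$ the unit sphere, $dx'$ normalized surface measure on $\mathbb S$; points of $\mathbb B$ are written $x=rx'$ with $r=|x|$, $x'\in\mathbb S$. $h(\mathbb B)$ is the space of harmonic functions on $\mathbb B$. $\{Y^{(k)}_j:k\ge0,\,1\le j\le d_k\}$ is a real orthonormal basis of $L^2(\mathbb S,dx')$ with $Y^{(k)}_j$ spherical harmonics of degree $k$. Every $f\in h(\mathbb B)$ expands as $f(rx')=\sum_k r^k\sum_j b_k^j(f)Y^{(k)}_j(x')$. For a double indexed sequence $c$ and $f\in h(\mathbb B)$, $(c*f)(rx')=\sum_k r^k\sum_j c_k^jb_k^j(f)Y^{(k)}_j(x')$ (when the series converges in $\mathbb B$). For spaces $X,Y\subset h(\mathbb B)$, $M_H(X,Y)$ is the set of sequences $c$ with $c*f\in Y$ for every $f\in X$. For $x'\in\mathbb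 S$, $t>0$ and $0\le\rho<1$, $y'\in\mathbb S$, $$\Lambda_{t}(g_c*P_{x'})(\rho y')=\sum_{k\ge0}\rho^k\frac{\Gamma(k+n/2+t)}{\Gamma(k+n/2)\Gamma(t)}\sum_{j=1}^{d_k}c_k^jY^{(k)}_j(x')Y^{(k)}_j(y'),$$ and $\|F(x')\|_{L^s(dx')}=(\int_{\mathbb S}|F(x')|^sdx')^{1/s}$ (supremum if $s=\infty$). $M_q(f,r)=(\int_{\mathbb S}|f(rx')|^qdx')^{1/q}$ (sup if $q=\infty$). For $0<p<\infty$, $0<q\le\infty$, $\alpha>0$: $B^{p,q}_\alpha=\{f\in h(\mathbb B):\|f\|_{p,q,\alpha}^p=\int_0^1M_q(f,r)^p(1-r^2)^{\alpha p-1}r^{n-1}dr<\infty\}$. For $\alpha\ge0$, $0<p\le\infty$: $H^p_\alpha=\{f\in h(\mathbb B):\sup_{r<1}M_p(f,r)(1-r)^\alpha<\infty\}$, and $B^{\infty,p}_\alpha:=H^p_\alpha$. *)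

theory Defs
  imports "HOL-Analysis.Analysis"
begin

definition dpart :: "'n::finite \<Rightarrow> (real^'n \<Rightarrow> real) \<Rightarrow> real^'n \<Rightarrow> real" where
  "dpart i f x = deriv (\<lambda>t. f (x + t *\<^sub>R axis i 1)) 0"

definition harmonic_on :: "(real^'n::finite) set \<Rightarrow> (real^'n \<Rightarrow> real) \<Rightarrow> bool" where
  "harmonic_on U f \<longleftrightarrow> open U \<and>
     (\<forall>x\<in>U. \<forall>i. (\<lambda>t. f (x + t *\<^sub>R axis i 1)) differentiable (at 0)) \<and>
     (\<forall>x\<in>U. \<forall>i j. (\<lambda>t. dpart j f (x + t *\<^sub>R axis i 1)) differentiable (at 0)) \<and>
     (\<forall>i j. continuous_on U (dpart i (dpart j f))) \<and>
     (\<forall>x\<in>U. (\<Sum>i\<in>UNIV. dpart i (dpart i f) x) = 0)"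

definition sphere_measure :: "(real^'n::finite) measure" where
  "sphere_measure = distr (uniform_measure lborel (ball 0 1)) borel (\<lambda>x. x /\<^sub>R norm x)"

inductive_set poly_fun :: "(real^'n::finite \<Rightarrow> real) set" where
  pconst: "(\<lambda>x. a) \<in> poly_fun"
| pcoord: "(\<lambda>x. x $ i) \<in> poly_fun"
| padd: "f \<in> poly_fun \<Longrightarrow> g \<in> poly_fun \<Longrightarrow> (\<lambda>x. f x + g x) \<in> poly_fun"
| pmult: "f \<in> poly_fun \<Longrightarrow> g \<in> poly_fun \<Longrightarrow> (\<lambda>x. f x * g x) \<in> poly_fun"

text \<open>Homogeneous harmonic polynomials of degree k (spherical harmonics of degree k are their
  restrictions to the sphere).\<close>
definition sph_harm :: "nat \<Rightarrow> (real^'n::finite \<Rightarrow> real) set" where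
  "sph_harm k = {P. P \<in> poly_fun \<and> (\<forall>t x. P (t *\<^sub>R x) = t ^ k * P x) \<and> harmonic_on UNIV P}"

text \<open>Y k j (1 \<le> j \<le> d k) is a real orthonormal basis of L2(sphere) with Y k j of degree k:
  orthonormal, each Y k j a spherical harmonic of degree k, and Y k 1..Y k (d k) span the
  spherical harmonics of degree k (hence the whole family is complete in L2).\<close>
definition sph_basis :: "(nat \<Rightarrow> nat \<Rightarrow> real^'n::finite \<Rightarrow> real) \<Rightarrow> (nat \<Rightarrow> nat) \<Rightarrow> bool" where
  "sph_basis Y d \<longleftrightarrow>
     (\<forall>k j. j \<in> {1..d k} \<longrightarrow> Y k j \<in> sph_harm k) \<and>
     (\<forall>k j k' j'. j \<in> {1..d k} \<longrightarrow> j' \<in> {1..d k'} \<longrightarrow>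
        integral\<^sup>L sphere_measure (\<lambda>x. Y k j x * Y k' j' x) = (if k = k' \<and> j = j' then 1 else 0)) \<and>
     (\<forall>k P. P \<in> sph_harm k \<longrightarrow> (\<exists>a. \<forall>x\<in>sphere 0 1. P x = (\<Sum>j=1..d k. a j * Y k j x)))"

definition hterm :: "(nat \<Rightarrow> nat \<Rightarrow> real^'n::finite \<Rightarrow> real) \<Rightarrow> (nat \<Rightarrow> nat) \<Rightarrow>
    (nat \<Rightarrow> nat \<Rightarrow> real) \<Rightarrow> real \<Rightarrow> real^'n \<Rightarrow> nat \<Rightarrow> real" where
  "hterm Y d a r x' k = r ^ k * (\<Sum>j=1..d k. a k j * Y k j x')"

definition hseries_conv where
  "hseries_conv Y d a \<longleftrightarrow> (\<forall>r\<in>{0..<1}. \<forall>x'\<in>sphere 0 1. summable (hterm Y d a r x'))"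

definition hseries :: "(nat \<Rightarrow> nat \<Rightarrow> real^'n::finite \<Rightarrow> real) \<Rightarrow> (nat \<Rightarrow> nat) \<Rightarrow>
    (nat \<Rightarrow> nat \<Rightarrow> real) \<Rightarrow> real^'n \<Rightarrow> real" where
  "hseries Y d a x = suminf (hterm Y d a (norm x) (x /\<^sub>R norm x))"

definition hcoef where
  "hcoef Y d f = (SOME b. \<forall>r\<in>{0..<1}. \<forall>x'\<in>sphere 0 1. hterm Y d b r x' sums f (r *\<^sub>R x'))"

definition hconv where
  "hconv Y d c f = (\<lambda>k j. c k j * hcoef Y d f k j)"

definition MH where
  "MH Y d X Z = {c. \<forall>f\<in>X. hseries_conv Y d (hconv Y d c f) \<and> hseries Y d (hconv Y d c f) \<in> Z}"

definition enn_powr :: "ennreal \<Rightarrow> real \<Rightarrow> ennreal" where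
  "enn_powr x a = (if x = \<infinity> then \<infinity> else ennreal (enn2real x powr a))"

definition Lnorm :: "ennreal \<Rightarrow> (real^'n::finite \<Rightarrow> real) \<Rightarrow> ennreal" where
  "Lnorm s F = (if s = \<infinity> then (SUP x'\<in>sphere 0 1. ennreal \<bar>F x'\<bar>)
     else enn_powr (\<integral>\<^sup>+ x'. ennreal (\<bar>F x'\<bar> powr enn2real s) \<partial>sphere_measure) (1 / enn2real s))"

definition Mq :: "ennreal \<Rightarrow> (real^'n::finite \<Rightarrow> real) \<Rightarrow> real \<Rightarrow> ennreal" where
  "Mq q f r = Lnorm q (\<lambda>x'. f (r *\<^sub>R x'))"

definition Bspace :: "ennreal \<Rightarrow> ennreal \<Rightarrow> real \<Rightarrow> (real^'n::finite \<Rightarrow> real) set" where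
  "Bspace p q \<alpha> = {f. harmonic_on (ball 0 1) f \<and>
     (if p = \<infinity> then (SUP r\<in>{0..<1}. Mq q f r * ennreal ((1 - r) powr \<alpha>)) < \<infinity>
      else (\<integral>\<^sup>+ r\<in>{0<..<1}. enn_powr (Mq q f r) (enn2real p)
              * ennreal ((1 - r\<^sup>2) powr (\<alpha> * enn2real p - 1) * r ^ (CARD('n) - 1)) \<partial>lborel) < \<infinity>)}"

definition Lam :: "(nat \<Rightarrow> nat \<Rightarrow> real^'n::finite \<Rightarrow> real) \<Rightarrow> (nat \<Rightarrow> nat) \<Rightarrow>
    (nat \<Rightarrow> nat \<Rightarrow> real) \<Rightarrow> real \<Rightarrow> real^'n \<Rightarrow> real \<Rightarrow> real^'n \<Rightarrow> real" where
  "Lam Y d c t x' \<rho> y' = (\<Sum>k. \<rho> ^ k *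
      (Gamma (real k + real CARD('n) / 2 + t) / (Gamma (real k + real CARD('n) / 2) * Gamma t)) *
      (\<Sum>j=1..d k. c k j * Y k j x' * Y k j y'))"

definition Nnorm :: "(nat \<Rightarrow> nat \<Rightarrow> real^'n::finite \<Rightarrow> real) \<Rightarrow> (nat \<Rightarrow> nat) \<Rightarrow>
    (nat \<Rightarrow> nat \<Rightarrow> real) \<Rightarrow> ennreal \<Rightarrow> real \<Rightarrow> real \<Rightarrow> real \<Rightarrow> ennreal" where
  "Nnorm Y d c s \<alpha> \<beta> m = (SUP \<rho>\<in>{0..<1}. SUP y'\<in>sphere 0 1.
      ennreal ((1 - \<rho>) powr (\<beta> - \<alpha> + m + 1)) * Lnorm s (\<lambda>x'. Lam Y d c (m + 1) x' \<rho> y'))"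

end

(* Harmonic functions on the ball are the expansions whose coefficients grow subexponentially: the
   Fischer decomposition and the Stone-Weierstrass theorem give density of the spherical harmonics on
   the sphere, and the maximum principle transfers it to the ball.  The L^1 norm of a zonal kernel is
   the norm of its multiplier on bounded harmonic polynomials; together with a gradient estimate (for
   integer orders) and a Beta integral over dilations (for fractional ones) this bounds the L^1 norm of
   Lambda_t P by C (1 - r)^(-t).

   (2) ==> (1).  With t = m + 1,
     (c*f)(R x') = int_0^1 int_S Lambda_t(g_c*P_x')(R rho y') f(rho y') dy' 2 rho^(n-1) (1-rho^2)^(t-1) drho;
   Minkowski's inequality and the Schur test for the kernel
   (1-R^2)^beta (1-rho^2)^(t-alpha) (1-R rho)^(-(beta+t-alpha)) give c*f in B^{q,s}_beta.

   (1) ==> (2).  Apply c to (1-R)^(t-alpha) Lambda_t P_y(R .), which is bounded in B^{p,1}_alpha, and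
   evaluate on the sphere of radius R = sqrt rho.  A gliding hump argument supplies the uniform bound
   for which one would otherwise invoke the closed graph theorem. *)

theory Submission imports Defs begin

section \<open>Polynomials and the Fischer decomposition\<close>

text \<open>Coefficient arrays carry the work. \<open>harmonic_on\<close> speaks of partial
  derivatives along the axes, multipliers and \<open>Lam\<close> speak of coefficients; the bridge
  is the class \<open>adm\<close>, which describes the coefficients of harmonic functions and is
  closed under products. Both sides of the equivalence force \<open>adm c\<close>, after which all
  series converge absolutely on smaller balls and may be interchanged.

  With \<open>t = m + 1\<close> the hypothesis on \<open>m\<close> says \<open>t > \<alpha>\<close>:
  the radial kernels have the two positive exponents \<open>t - \<alpha>\<close> and \<beta>, whose
  sum is the exponent of the kernel condition. The relation \<open>p \<le> q\<close> acts through
  the growth bound of order \<alpha> on the means of members of the source space, which makes their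
  weighted radial means bounded, so that p-integrability yields q-integrability.

  The obstacle in the converse is uniformity: membership of an image in the target space is
  qualitative for each single function, while the bound has to be uniform in pole and radius of the
  test functions. The coefficients \<open>3^(-i)\<close> keep signed superpositions of them in the
  source space and leave a margin that later summands cannot cancel.\<close>

lemma poly_fun_cmult: "f \<in> poly_fun \<Longrightarrow> (\<lambda>x. c * f x) \<in> poly_fun"
  using pmult[OF pconst] by blast

lemma poly_fun_diff: "f \<in> poly_fun \<Longrightarrow> g \<in> poly_fun \<Longrightarrow> (\<lambda>x. f x - g x) \<in> poly_fun"
  using padd[OF _ poly_fun_cmult[of g "-1"], of f] by simp

lemma poly_fun_uminus: "f \<in> poly_fun \<Longrightarrow> (\<lambda>x. - f x) \<in> poly_fun"
  using poly_fun_cmult[of f "-1"] by simp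

lemma poly_fun_sum:
  "(\<And>i. i \<in> I \<Longrightarrow> f i \<in> poly_fun) \<Longrightarrow> (\<lambda>x. \<Sum>i\<in>I. f i x) \<in> poly_fun"
  by (induction I rule: infinite_finite_induct) (simp_all add: pconst padd)

lemma poly_fun_power: "f \<in> poly_fun \<Longrightarrow> (\<lambda>x. f x ^ k) \<in> poly_fun"
  by (induction k) (simp_all add: pconst pmult)

lemma poly_fun_inner: "(\<lambda>x. x \<bullet> x) \<in> poly_fun"
  unfolding inner_vec_def by (intro poly_fun_sum) (auto intro: pmult pcoord)

lemma poly_fun_continuous: "f \<in> poly_fun \<Longrightarrow> continuous_on S f"
  by (induction rule: poly_fun.induct) (auto intro!: continuous_intros)

lemma poly_fun_measurable: "f \<in> poly_fun \<Longrightarrow> f \<in> borel_measurable borel"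
  by (simp add: borel_measurable_continuous_onI poly_fun_continuous)

lemma poly_fun_of_real_polynomial:
  fixes g :: "real^'n::finite \<Rightarrow> real"
  assumes "real_polynomial_function g" shows "g \<in> poly_fun"
  using assms
proof induction
  case (linear f)
  then interpret bounded_linear f .
  have eq: "f = (\<lambda>x. \<Sum>i\<in>UNIV. f (axis i 1) * x $ i)"
  proof
    fix x :: "real^'n"
    have "f x = f (\<Sum>i\<in>UNIV. x $ i *\<^sub>R axis i 1)"
      using basis_expansion[of x] by (simp add: scalar_mult_eq_scaleR)
    then show "f x = (\<Sum>i\<in>UNIV. f (axis i 1) * x $ i)"
      by (simp add: sum scaleR mult.commute)
  qed
  show ?case
    by (subst eq) (intro poly_fun_sum poly_fun_cmult pcoord)
qed (auto intro: poly_fun.intros)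

text \<open>\<open>dpart\<close> is a \<open>deriv\<close>, which carries information only where
  differentiability is known. The induction therefore constructs an anonymous polynomial gradient
  \<open>G\<close>, and \<open>poly_fun_dpart\<close> identifies it with \<open>dpart\<close>
  afterwards. All directions \<open>v\<close> are covered because Euler's identity and mean value
  estimates on segments use directions other than the axes.\<close>

lemma poly_fun_line:
  fixes f :: "real^'n::finite \<Rightarrow> real"
  assumes "f \<in> poly_fun"
  shows "\<exists>G. (\<forall>i. G i \<in> poly_fun) \<and>
    (\<forall>x v. ((\<lambda>t. f (x + t *\<^sub>R v)) has_real_derivative (\<Sum>i\<in>UNIV. v $ i * G i x)) (at 0))"
  using assms
proof induction
  case (pconst a)
  show ?case by (rule exI[of _ "\<lambda>i x. 0"]) (auto intro: poly_fun.intros)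
next
  case (pcoord j)
  have "(\<Sum>i\<in>UNIV. v $ i * (if i = j then 1 else 0)) = v $ j" for v :: "real^'n"
    by (simp add: if_distrib cong: if_cong)
  then show ?case
    by (intro exI[of _ "\<lambda>i x. if i = j then 1 else 0"]) (auto intro!: poly_fun.intros derivative_eq_intros)
next
  case (padd f g)
  then obtain F G where *: "\<forall>i. F i \<in> poly_fun" "\<forall>i. G i \<in> poly_fun"
    "\<And>x v. ((\<lambda>t. f (x + t *\<^sub>R v)) has_real_derivative (\<Sum>i\<in>UNIV. v $ i * F i x)) (at 0)"
    "\<And>x v. ((\<lambda>t. g (x + t *\<^sub>R v)) has_real_derivative (\<Sum>i\<in>UNIV. v $ i * G i x)) (at 0)"
    by blast
  have "((\<lambda>t. f (x + t *\<^sub>R v) + g (x + t *\<^sub>R v)) has_real_derivative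
        (\<Sum>i\<in>UNIV. v $ i * (F i x + G i x))) (at 0)" for x v
    using DERIV_add[OF *(3)[of x v] *(4)[of x v]] by (simp add: sum.distrib distrib_left)
  then show ?case
    using * by (intro exI[of _ "\<lambda>i x. F i x + G i x"]) (auto intro: poly_fun.padd)
next
  case (pmult f g)
  then obtain F G where *: "\<forall>i. F i \<in> poly_fun" "\<forall>i. G i \<in> poly_fun"
    "\<And>x v. ((\<lambda>t. f (x + t *\<^sub>R v)) has_real_derivative (\<Sum>i\<in>UNIV. v $ i * F i x)) (at 0)"
    "\<And>x v. ((\<lambda>t. g (x + t *\<^sub>R v)) has_real_derivative (\<Sum>i\<in>UNIV. v $ i * G i x)) (at 0)"
    by blast
  have "((\<lambda>t. f (x + t *\<^sub>R v) * g (x + t *\<^sub>R v)) has_real_derivative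
        (\<Sum>i\<in>UNIV. v $ i * (F i x * g x + f x * G i x))) (at 0)" for x v
  proof -
    have "(\<Sum>i\<in>UNIV. v $ i * F i x) * g x + (\<Sum>i\<in>UNIV. v $ i * G i x) * f x
      = (\<Sum>i\<in>UNIV. v $ i * (F i x * g x + f x * G i x))"
      by (simp add: sum_distrib_right sum_distrib_left sum.distrib[symmetric] algebra_simps)
    then show ?thesis
      using DERIV_mult[OF *(3)[of x v] *(4)[of x v]] by simp
  qed
  then show ?case
    using * pmult.hyps
    by (intro exI[of _ "\<lambda>i x. F i x * g x + f x * G i x"]) (auto intro!: poly_fun.padd poly_fun.pmult)
qed

lemma sum_axis: "(\<Sum>i\<in>UNIV. (axis j (c::real) :: real^'n::finite) $ i * G i) = c * G j"
  by (simp add: axis_def if_distrib if_distribR cong: if_cong)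

lemma poly_fun_dpart:
  fixes f :: "real^'n::finite \<Rightarrow> real"
  assumes "f \<in> poly_fun"
  shows "dpart i f \<in> poly_fun"
    and "((\<lambda>t. f (x + t *\<^sub>R v)) has_real_derivative (\<Sum>i\<in>UNIV. v $ i * dpart i f x)) (at 0)"
proof -
  obtain G where G: "\<forall>i. G i \<in> poly_fun" and
    D: "\<And>x v. ((\<lambda>t. f (x + t *\<^sub>R v)) has_real_derivative (\<Sum>i\<in>UNIV. v $ i * G i x)) (at 0)"
    using poly_fun_line[OF assms] by blast
  have "dpart i f x = G i x" for i x
    unfolding dpart_def using DERIV_imp_deriv[OF D[of x "axis i 1"]] by (simp add: sum_axis)
  then have "dpart i f = G i" for i by blast
  then show "dpart i f \<in> poly_fun"
    "((\<lambda>t. f (x + t *\<^sub>R v)) has_real_derivative (\<Sum>i\<in>UNIV. v $ i * dpart i f x)) (at 0)"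
    using G D by auto
qed

lemma poly_fun_dpart_axis:
  assumes "f \<in> poly_fun"
  shows "((\<lambda>t. f (x + t *\<^sub>R axis i 1)) has_real_derivative dpart i f x) (at 0)"
  using poly_fun_dpart(2)[OF assms, of x "axis i 1"] by (simp add: sum_axis)

lemma poly_fun_line_at:
  assumes "f \<in> poly_fun"
  shows "((\<lambda>t. f (x + t *\<^sub>R v)) has_real_derivative (\<Sum>i\<in>UNIV. v $ i * dpart i f (x + s *\<^sub>R v))) (at s)"
proof -
  have "((\<lambda>t. f (x + s *\<^sub>R v + t *\<^sub>R v)) has_real_derivative
      (\<Sum>i\<in>UNIV. v $ i * dpart i f (x + s *\<^sub>R v))) (at 0)"
    by (rule poly_fun_dpart(2)[OF assms])
  then have "((\<lambda>t. f (x + (t + s) *\<^sub>R v)) has_real_derivative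
      (\<Sum>i\<in>UNIV. v $ i * dpart i f (x + s *\<^sub>R v))) (at 0)"
    by (simp add: algebra_simps)
  then show ?thesis
    using DERIV_shift[of "\<lambda>t. f (x + t *\<^sub>R v)" _ 0 s] by simp
qed

lemma dpart_add: "f \<in> poly_fun \<Longrightarrow> g \<in> poly_fun \<Longrightarrow> dpart i (\<lambda>x. f x + g x) = (\<lambda>x. dpart i f x + dpart i g x)"
  unfolding fun_eq_iff
  by (subst dpart_def) (auto intro!: DERIV_imp_deriv DERIV_add poly_fun_dpart_axis)

lemma dpart_diff: "f \<in> poly_fun \<Longrightarrow> g \<in> poly_fun \<Longrightarrow> dpart i (\<lambda>x. f x - g x) = (\<lambda>x. dpart i f x - dpart i g x)"
  unfolding fun_eq_iff
  by (subst dpart_def) (auto intro!: DERIV_imp_deriv DERIV_diff poly_fun_dpart_axis)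

lemma dpart_const: "dpart i (\<lambda>x. c) = (\<lambda>x. 0)"
  unfolding fun_eq_iff by (subst dpart_def) (auto intro!: DERIV_imp_deriv)

lemma dpart_coord: "dpart i (\<lambda>x. x $ j) = (\<lambda>x. if i = j then 1 else 0)"
  unfolding fun_eq_iff by (subst dpart_def) (auto intro!: DERIV_imp_deriv derivative_eq_intros simp: axis_def)

lemma dpart_mult: "f \<in> poly_fun \<Longrightarrow> g \<in> poly_fun \<Longrightarrow>
    dpart i (\<lambda>x. f x * g x) = (\<lambda>x. dpart i f x * g x + f x * dpart i g x)"
proof
  fix x assume fg: "f \<in> poly_fun" "g \<in> poly_fun"
  show "dpart i (\<lambda>x. f x * g x) x = dpart i f x * g x + f x * dpart i g x"
    unfolding dpart_def[of i "\<lambda>x. f x * g x"]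
    using DERIV_mult[OF poly_fun_dpart_axis[OF fg(1), of x i] poly_fun_dpart_axis[OF fg(2), of x i]]
    by (intro DERIV_imp_deriv) (simp add: algebra_simps)
qed

lemma dpart_cmult: "f \<in> poly_fun \<Longrightarrow> dpart i (\<lambda>x. c * f x) = (\<lambda>x. c * dpart i f x)"
  using dpart_mult[OF pconst[of c], of f i] by (simp add: dpart_const)

lemma dpart_uminus: "f \<in> poly_fun \<Longrightarrow> dpart i (\<lambda>x. - f x) = (\<lambda>x. - dpart i f x)"
  using dpart_cmult[of f i "-1"] by simp

lemma dpart_sum: "(\<And>j. j \<in> I \<Longrightarrow> f j \<in> poly_fun) \<Longrightarrow>
    dpart i (\<lambda>x. \<Sum>j\<in>I. f j x) = (\<lambda>x. \<Sum>j\<in>I. dpart i (f j) x)"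
proof (induction I rule: infinite_finite_induct)
  case (insert a I)
  then have "dpart i (\<lambda>x. \<Sum>j\<in>insert a I. f j x) = dpart i (\<lambda>x. f a x + (\<Sum>j\<in>I. f j x))"
    by simp
  also have "\<dots> = (\<lambda>x. dpart i (f a) x + (\<Sum>j\<in>I. dpart i (f j) x))"
    using insert by (subst dpart_add) (auto intro: poly_fun_sum)
  finally show ?case using insert by simp
qed (simp_all add: dpart_const)

lemma dpart_dpart_commute:
  "f \<in> poly_fun \<Longrightarrow> dpart i (dpart j f) = dpart j (dpart i f)"
proof (induction rule: poly_fun.induct)
  case (pcoord k)
  then show ?case by (simp add: dpart_coord dpart_const)
next
  case (padd f g)
  then show ?case by (simp add: dpart_add poly_fun_dpart)
next
  case (pmult f g)
  then show ?case by (simp add: dpart_mult dpart_add poly_fun_dpart poly_fun.intros algebra_simps)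
qed (simp add: dpart_const)

section \<open>The Laplacian and homogeneous polynomials\<close>

definition lap :: "(real^'n::finite \<Rightarrow> real) \<Rightarrow> real^'n \<Rightarrow> real" where
  "lap f x = (\<Sum>i\<in>UNIV. dpart i (dpart i f) x)"

lemma harmonic_on_poly:
  assumes "f \<in> poly_fun" shows "harmonic_on UNIV f \<longleftrightarrow> (\<forall>x. lap f x = 0)"
proof -
  have D: "(\<lambda>t. g (x + t *\<^sub>R axis i 1)) differentiable (at 0)" if "g \<in> poly_fun" for g i and x :: "real^'a"
    using poly_fun_dpart_axis[OF that] real_differentiable_def by blast
  show ?thesis
    unfolding harmonic_on_def lap_def
    using D assms by (auto intro!: D poly_fun_continuous poly_fun_dpart)
qed

lemma lap_add: "f \<in> poly_fun \<Longrightarrow> g \<in> poly_fun \<Longrightarrow> lap (\<lambda>x. f x + g x) = (\<lambda>x. lap f x + lap g x)"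
  by (simp add: lap_def fun_eq_iff dpart_add poly_fun_dpart sum.distrib)

lemma lap_diff: "f \<in> poly_fun \<Longrightarrow> g \<in> poly_fun \<Longrightarrow> lap (\<lambda>x. f x - g x) = (\<lambda>x. lap f x - lap g x)"
  by (simp add: lap_def fun_eq_iff dpart_diff poly_fun_dpart sum_subtractf)

lemma lap_cmult: "f \<in> poly_fun \<Longrightarrow> lap (\<lambda>x. c * f x) = (\<lambda>x. c * lap f x)"
  by (simp add: lap_def fun_eq_iff dpart_cmult poly_fun_dpart sum_distrib_left)

lemma lap_uminus: "f \<in> poly_fun \<Longrightarrow> lap (\<lambda>x. - f x) = (\<lambda>x. - lap f x)"
  using lap_cmult[of f "-1"] by simp

lemma lap_sum: "(\<And>j. j \<in> I \<Longrightarrow> f j \<in> poly_fun) \<Longrightarrow> lap (\<lambda>x. \<Sum>j\<in>I. f j x) = (\<lambda>x. \<Sum>j\<in>I. lap (f j) x)"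
  unfolding lap_def fun_eq_iff
  by (subst sum.swap) (simp add: dpart_sum poly_fun_dpart)

lemma lap_dpart: "f \<in> poly_fun \<Longrightarrow> lap (dpart j f) = dpart j (lap f)"
proof -
  assume f: "f \<in> poly_fun"
  have "dpart i (dpart i (dpart j f)) = dpart j (dpart i (dpart i f))" for i
    using f by (metis dpart_dpart_commute poly_fun_dpart(1))
  then show ?thesis
    unfolding lap_def[abs_def] using f by (subst dpart_sum) (auto intro!: poly_fun_dpart)
qed

text \<open>Homogeneity is required for every real \<open>t\<close>: with \<open>0 ^ 0 = 1\<close>,
  the instance \<open>t = 0\<close> makes degree 0 mean constant and forces the value 0 at the
  origin in positive degree.\<close>

definition hom_poly :: "nat \<Rightarrow> (real^'n::finite \<Rightarrow> real) set" where
  "hom_poly k = {P. P \<in> poly_fun \<and> (\<forall>t x. P (t *\<^sub>R x) = t ^ k * P x)}"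

lemma sph_harm_iff: "P \<in> sph_harm k \<longleftrightarrow> P \<in> hom_poly k \<and> (\<forall>x. lap P x = 0)"
  using harmonic_on_poly by (auto simp: sph_harm_def hom_poly_def)

lemma hom_polyD: "P \<in> hom_poly k \<Longrightarrow> P \<in> poly_fun" "P \<in> hom_poly k \<Longrightarrow> P (t *\<^sub>R x) = t ^ k * P x"
  by (auto simp: hom_poly_def)

lemma hom_poly_euler:
  assumes "P \<in> hom_poly k" shows "(\<Sum>i\<in>UNIV. x $ i * dpart i P x) = real k * P x"
proof -
  have "((\<lambda>t. P (x + t *\<^sub>R x)) has_real_derivative (\<Sum>i\<in>UNIV. x $ i * dpart i P x)) (at 0)"
    using poly_fun_dpart(2) assms hom_polyD by blast
  moreover have "P (x + t *\<^sub>R x) = (1 + t) ^ k * P x" for t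
    using hom_polyD(2)[OF assms, of "1 + t" x] by (simp add: algebra_simps)
  moreover have "((\<lambda>t. (1 + t) ^ k * P x) has_real_derivative (real k * P x)) (at 0)"
    by (auto intro!: derivative_eq_intros)
  ultimately show ?thesis using DERIV_unique by fastforce
qed

text \<open>Differentiate \<open>P (t *\<^sub>R x) = t ^ k * P x\<close> in a coordinate direction
  and cancel one factor \<open>t\<close>. Since \<open>k - 1\<close> is truncated, degree 0 is
  recorded separately: the derivative then vanishes, which gives the second claim of
  \<open>hom_poly_lap\<close>.\<close>

lemma hom_poly_dpart:
  assumes "P \<in> hom_poly k"
  shows "dpart i P \<in> hom_poly (k - 1)" "k = 0 \<Longrightarrow> dpart i P = (\<lambda>x. 0)"
proof -
  have P: "P \<in> poly_fun" using assms hom_polyD by blast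
  show 0: "dpart i P = (\<lambda>x. 0)" if "k = 0"
  proof -
    have "P x = P 0" for x using hom_polyD(2)[OF assms, of 0 x] that by simp
    then have "P = (\<lambda>x. P 0)" by blast
    then show ?thesis by (metis dpart_const)
  qed
  have "dpart i P (t *\<^sub>R x) = t ^ (k - 1) * dpart i P x" for t x
  proof (cases "k = 0")
    case False
    have nz: "dpart i P (t *\<^sub>R x) = t ^ (k - 1) * dpart i P x" if "t \<noteq> 0" for t
    proof -
      have "((\<lambda>s. P (t *\<^sub>R x + s *\<^sub>R (t *\<^sub>R axis i 1))) has_real_derivative t * dpart i P (t *\<^sub>R x)) (at 0)"
        using poly_fun_dpart(2)[OF P, of "t *\<^sub>R x" "t *\<^sub>R axis i 1"]
        by (simp add: mult.assoc sum_distrib_left[symmetric] sum_axis)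
      moreover have "P (t *\<^sub>R x + s *\<^sub>R (t *\<^sub>R axis i 1)) = t ^ k * P (x + s *\<^sub>R axis i 1)" for s
        using hom_polyD(2)[OF assms, of t "x + s *\<^sub>R axis i 1"] by (simp add: algebra_simps)
      moreover have "((\<lambda>s. t ^ k * P (x + s *\<^sub>R axis i 1)) has_real_derivative t ^ k * dpart i P x) (at 0)"
        by (intro DERIV_cmult poly_fun_dpart_axis P)
      ultimately have "t * dpart i P (t *\<^sub>R x) = t ^ k * dpart i P x"
        using DERIV_unique by fastforce
      moreover have "t ^ k = t * t ^ (k - 1)" using False by (simp add: power_eq_if)
      ultimately show ?thesis using that by simp
    qed
    show ?thesis
    proof (cases "t = 0")
      case True
      \<comment> \<open>The factor \<open>t\<close> cannot be cancelled at \<open>t = 0\<close>;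
        both sides are continuous in \<open>t\<close>, so the identity there is the limit of the
        identity for nonzero \<open>t\<close>.\<close>
      have c: "continuous_on UNIV (dpart i P)" using P poly_fun_continuous poly_fun_dpart(1) by blast
      have "((\<lambda>t. dpart i P (t *\<^sub>R x)) \<longlongrightarrow> dpart i P (0 *\<^sub>R x)) (at 0)"
      proof (rule isCont_tendsto_compose[of _ "dpart i P"])
        show "isCont (dpart i P) (0 *\<^sub>R x)"
          using c by (simp add: continuous_on_eq_continuous_at)
        show "((\<lambda>t. t *\<^sub>R x) \<longlongrightarrow> 0 *\<^sub>R x) (at 0)"
          by (intro tendsto_intros)
      qed
      moreover have "((\<lambda>t. t ^ (k - 1) * dpart i P x) \<longlongrightarrow> 0 ^ (k - 1) * dpart i P x) (at 0)"
        by (intro tendsto_intros)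
      moreover have "\<forall>\<^sub>F t in at 0. dpart i P (t *\<^sub>R x) = t ^ (k - 1) * dpart i P x"
        unfolding eventually_at_filter using nz by simp
      ultimately have "((\<lambda>t. dpart i P (t *\<^sub>R x)) \<longlongrightarrow> dpart i P (0 *\<^sub>R x)) (at 0)"
        "((\<lambda>t. dpart i P (t *\<^sub>R x)) \<longlongrightarrow> 0 ^ (k - 1) * dpart i P x) (at (0::real))"
        by (auto simp: tendsto_cong)
      then have "dpart i P (0 *\<^sub>R x) = 0 ^ (k - 1) * dpart i P x"
        by (rule tendsto_unique[OF trivial_limit_at])
      then show ?thesis using True by simp
    qed (rule nz)
  qed (use 0 in simp)
  then show "dpart i P \<in> hom_poly (k - 1)"
    using P by (simp add: hom_poly_def poly_fun_dpart)
qed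

lemma hom_poly_add: "P \<in> hom_poly k \<Longrightarrow> Q \<in> hom_poly k \<Longrightarrow> (\<lambda>x. P x + Q x) \<in> hom_poly k"
  by (simp add: hom_poly_def padd distrib_left)

lemma hom_poly_diff: "P \<in> hom_poly k \<Longrightarrow> Q \<in> hom_poly k \<Longrightarrow> (\<lambda>x. P x - Q x) \<in> hom_poly k"
  by (simp add: hom_poly_def poly_fun_diff right_diff_distrib)

lemma hom_poly_zero: "(\<lambda>x. 0) \<in> hom_poly k"
  by (simp add: hom_poly_def pconst)

lemma hom_poly_sum: "(\<And>i. i \<in> I \<Longrightarrow> f i \<in> hom_poly k) \<Longrightarrow> (\<lambda>x. \<Sum>i\<in>I. f i x) \<in> hom_poly k"
  by (induction I rule: infinite_finite_induct) (simp_all add: hom_poly_zero hom_poly_add)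

lemma hom_poly_mult: "P \<in> hom_poly k \<Longrightarrow> Q \<in> hom_poly l \<Longrightarrow> (\<lambda>x. P x * Q x) \<in> hom_poly (k + l)"
  by (simp add: hom_poly_def pmult power_add)

lemma hom_poly_lap:
  assumes "P \<in> hom_poly k"
  shows "lap P \<in> hom_poly (k - 2)" "k < 2 \<Longrightarrow> lap P x = 0"
proof -
  have "dpart i (dpart i P) \<in> hom_poly (k - 1 - 1)" for i using assms hom_poly_dpart by blast
  then show "lap P \<in> hom_poly (k - 2)"
    unfolding lap_def[abs_def] by (intro hom_poly_sum) (simp add: numeral_2_eq_2)
  have "dpart i (dpart i P) = (\<lambda>x. 0)" if "k < 2" for i
    using hom_poly_dpart(2)[OF hom_poly_dpart(1)[OF assms]] that by simp
  then show "k < 2 \<Longrightarrow> lap P x = 0" by (simp add: lap_def)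
qed

lemma sph_harm_add: "P \<in> sph_harm k \<Longrightarrow> Q \<in> sph_harm k \<Longrightarrow> (\<lambda>x. P x + Q x) \<in> sph_harm k"
  by (simp add: sph_harm_iff hom_poly_def padd lap_add distrib_left)

lemma sph_harm_cmult: "P \<in> sph_harm k \<Longrightarrow> (\<lambda>x. c * P x) \<in> sph_harm k"
  by (simp add: sph_harm_iff hom_poly_def poly_fun_cmult lap_cmult)

lemma sph_harm_zero: "(\<lambda>x. 0) \<in> sph_harm k"
  by (simp add: sph_harm_iff hom_poly_zero lap_def dpart_const)

lemma sph_harm_sum: "(\<And>i. i \<in> I \<Longrightarrow> f i \<in> sph_harm k) \<Longrightarrow> (\<lambda>x. \<Sum>i\<in>I. f i x) \<in> sph_harm k"
  by (induction I rule: infinite_finite_induct) (simp_all add: sph_harm_zero sph_harm_add)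

section \<open>Products with powers of the squared norm\<close>

lemma dpart_inner_self: "dpart i (\<lambda>x. x \<bullet> x) = (\<lambda>x. 2 * x $ i)"
proof -
  have "dpart i (\<lambda>x. \<Sum>j\<in>UNIV. x $ j * x $ j) = (\<lambda>x. \<Sum>j\<in>UNIV. dpart i (\<lambda>x. x $ j * x $ j) x)"
    by (intro dpart_sum pmult pcoord)
  also have "\<dots> = (\<lambda>x. \<Sum>j\<in>UNIV. if i = j then 2 * x $ j else 0)"
    by (intro ext sum.cong refl) (auto simp: dpart_mult pcoord dpart_coord)
  finally show ?thesis by (simp add: inner_vec_def)
qed

text \<open>By the product rule the cross terms amount to 4 times the sum of
  \<open>x $ i * dpart i G x\<close>, which Euler's identity turns into \<open>4 * m * G x\<close>;
  the remaining \<open>2 * CARD('n)\<close> is the Laplacian of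
  \<open>x \<bullet> x\<close>.\<close>

lemma lap_inner_mult:
  fixes G :: "real^'n::finite \<Rightarrow> real"
  assumes G: "G \<in> hom_poly m"
  shows "lap (\<lambda>x. (x \<bullet> x) * G x) x = (2 * real CARD('n) + 4 * real m) * G x + (x \<bullet> x) * lap G x"
proof -
  have p: "G \<in> poly_fun" using G hom_polyD by blast
  have "dpart i (\<lambda>x. (x \<bullet> x) * G x) = (\<lambda>x. 2 * x $ i * G x + (x \<bullet> x) * dpart i G x)" for i
    by (simp add: dpart_mult p poly_fun_inner dpart_inner_self)
  moreover have "dpart i (\<lambda>x. 2 * x $ i * G x + (x \<bullet> x) * dpart i G x) x
      = 2 * G x + 4 * (x $ i * dpart i G x) + (x \<bullet> x) * dpart i (dpart i G) x" for i
  proof -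
    have "dpart i (\<lambda>x. 2 * x $ i * G x) x = 2 * G x + 2 * x $ i * dpart i G x"
      using p by (simp add: dpart_mult poly_fun_cmult pcoord dpart_cmult dpart_coord)
    moreover have "dpart i (\<lambda>x. (x \<bullet> x) * dpart i G x) x = 2 * x $ i * dpart i G x + (x \<bullet> x) * dpart i (dpart i G) x"
      by (simp add: dpart_mult p poly_fun_inner poly_fun_dpart dpart_inner_self)
    ultimately show ?thesis
      using p by (subst dpart_add) (auto intro!: poly_fun.pmult poly_fun_inner poly_fun_dpart poly_fun_cmult pcoord)
  qed
  ultimately have "lap (\<lambda>x. (x \<bullet> x) * G x) x
      = (\<Sum>i\<in>UNIV. 2 * G x + 4 * (x $ i * dpart i G x) + (x \<bullet> x) * dpart i (dpart i G) x)"
    unfolding lap_def by simp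
  also have "\<dots> = 2 * real CARD('n) * G x + 4 * (\<Sum>i\<in>UNIV. x $ i * dpart i G x) + (x \<bullet> x) * lap G x"
    by (simp add: sum.distrib sum_distrib_left lap_def)
  finally show ?thesis using hom_poly_euler[OF G] by (simp add: algebra_simps)
qed

text \<open>The functions with a Fischer decomposition, i.e. the sums of terms \<open>|x|^(2 i) H(x)\<close>
  with \<open>H\<close> harmonic and homogeneous of degree \<open>k - 2 i\<close>.\<close>

inductive fischer :: "nat \<Rightarrow> (real^'n::finite \<Rightarrow> real) \<Rightarrow> bool" where
  fischer_term: "H \<in> sph_harm j \<Longrightarrow> fischer (j + 2 * i) (\<lambda>x. (x \<bullet> x) ^ i * H x)"
| fischer_add: "fischer k f \<Longrightarrow> fischer k g \<Longrightarrow> fischer k (\<lambda>x. f x + g x)"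

lemma hom_poly_inner_power: "(\<lambda>x. (x \<bullet> x) ^ i) \<in> hom_poly (2 * i)"
  by (simp add: hom_poly_def poly_fun_power poly_fun_inner power_mult power2_eq_square power_mult_distrib mult.assoc)

lemma hom_poly_fischer_term: "H \<in> sph_harm j \<Longrightarrow> (\<lambda>x. (x \<bullet> x) ^ i * H x) \<in> hom_poly (j + 2 * i)"
  using hom_poly_mult[OF hom_poly_inner_power, of H j i] by (simp add: sph_harm_iff add.commute)

lemma fischer_hom: "fischer k f \<Longrightarrow> f \<in> hom_poly k"
  by (induction rule: fischer.induct) (auto intro: hom_poly_add hom_poly_fischer_term)

text \<open>Iterating \<open>lap_inner_mult\<close> from a harmonic \<open>H\<close> leaves a single
  term. The factor \<open>a\<close> accumulates positive summands, and its being nonzero is what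
  lets \<open>fischer_lap_surj\<close> divide by it to invert the Laplacian on such terms.\<close>

lemma lap_fischer_term:
  fixes H :: "real^'n::finite \<Rightarrow> real"
  assumes "H \<in> sph_harm j"
  shows "\<exists>a>0. \<forall>x. lap (\<lambda>x. (x \<bullet> x) ^ Suc i * H x) x = a * ((x \<bullet> x) ^ i * H x)"
proof (induction i)
  case 0
  have "lap (\<lambda>x. (x \<bullet> x) ^ Suc 0 * H x) x = (2 * real CARD('n) + 4 * real j) * ((x \<bullet> x) ^ 0 * H x)" for x
    using lap_inner_mult[of H j x] assms by (simp add: sph_harm_iff)
  then show ?case by (intro exI[of _ "2 * real CARD('n) + 4 * real j"]) (auto intro!: add_pos_nonneg)
next
  case (Suc i)
  then obtain a where a: "a > 0" "\<And>x. lap (\<lambda>x. (x \<bullet> x) ^ Suc i * H x) x = a * ((x \<bullet> x) ^ i * H x)" by blast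
  have "lap (\<lambda>x. (x \<bullet> x) ^ Suc (Suc i) * H x) x
     = (2 * real CARD('n) + 4 * real (j + 2 * Suc i) + a) * ((x \<bullet> x) ^ Suc i * H x)" for x
    using lap_inner_mult[OF hom_poly_fischer_term[OF assms, of "Suc i"], of x] a(2)[of x]
    by (simp add: algebra_simps)
  then show ?case using a(1)
    by (intro exI[of _ "2 * real CARD('n) + 4 * real (j + 2 * Suc i) + a"]) (auto intro!: add_nonneg_pos)
qed

lemma fischer_lap_surj: "fischer k f \<Longrightarrow> \<exists>Q. fischer (k + 2) Q \<and> lap Q = f"
proof (induction rule: fischer.induct)
  case (fischer_term H j i)
  obtain a where a: "a > 0" "\<And>x. lap (\<lambda>x. (x \<bullet> x) ^ Suc i * H x) x = a * ((x \<bullet> x) ^ i * H x)"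
    using lap_fischer_term[OF fischer_term] by blast
  have "(\<lambda>x. H x / a) \<in> sph_harm j" using sph_harm_cmult[OF fischer_term, of "1/a"] by simp
  then have "fischer (j + 2 * Suc i) (\<lambda>x. (x \<bullet> x) ^ Suc i * (H x / a))" by (rule fischer.intros)
  moreover have "lap (\<lambda>x. (x \<bullet> x) ^ Suc i * (H x / a)) = (\<lambda>x. (x \<bullet> x) ^ i * H x)"
    using lap_cmult[OF hom_polyD(1)[OF hom_poly_fischer_term[OF fischer_term, of "Suc i"]], of "1/a"] a
    by (simp add: fun_eq_iff field_simps)
  ultimately show ?case by (intro exI[of _ "\<lambda>x. (x \<bullet> x) ^ Suc i * (H x / a)"]) simp
next
  case (fischer_add k f g)
  then obtain F G where "fischer (k + 2) F" "lap F = f" "fischer (k + 2) G" "lap G = g" by blast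
  then show ?case
    by (intro exI[of _ "\<lambda>x. F x + G x"])
       (auto intro: fischer.fischer_add simp: lap_add hom_polyD(1)[OF fischer_hom])
qed

text \<open>The Laplacian lowers the degree by 2, so by induction \<open>lap P\<close> is
  decomposable and equals \<open>lap Q\<close> for a decomposable \<open>Q\<close> of degree
  \<open>k\<close>; the difference of \<open>P\<close> and \<open>Q\<close> is harmonic and is
  itself a term of the decomposition. Below degree 2 the Laplacian vanishes and \<open>P\<close> is
  already harmonic.\<close>

lemma hom_poly_imp_fischer: "P \<in> hom_poly k \<Longrightarrow> fischer k P"
proof (induction k arbitrary: P rule: less_induct)
  case (less k)
  show ?case
  proof (cases "k < 2")
    case True
    then have "P \<in> sph_harm k" using less hom_poly_lap by (auto simp: sph_harm_iff)
    from fischer_term[OF this, of 0] show ?thesis by simp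
  next
    case False
    then obtain Q where Q: "fischer k Q" "lap Q = lap P"
      using fischer_lap_surj[OF less.IH[OF _ hom_poly_lap(1)[OF less.prems]]]
      by (metis le_add_diff_inverse2 less_imp_diff_less linorder_not_less zero_less_numeral diff_less order.strict_trans2)
    have "(\<lambda>x. P x - Q x) \<in> sph_harm k"
      using less.prems fischer_hom[OF Q(1)] Q(2)
      by (simp add: sph_harm_iff hom_poly_diff lap_diff hom_polyD)
    from fischer_add[OF fischer_term[OF this, of 0, simplified] Q(1)] show ?thesis by simp
  qed
qed

inductive hom_sum :: "(real^'n::finite \<Rightarrow> real) \<Rightarrow> bool" where
  hom_sum_hom: "f \<in> hom_poly k \<Longrightarrow> hom_sum f"
| hom_sum_add: "hom_sum f \<Longrightarrow> hom_sum g \<Longrightarrow> hom_sum (\<lambda>x. f x + g x)"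

lemma hom_sum_mult: "hom_sum f \<Longrightarrow> hom_sum g \<Longrightarrow> hom_sum (\<lambda>x. f x * g x)"
proof (induction rule: hom_sum.induct)
  case (hom_sum_hom f k)
  from hom_sum_hom(2,1) show ?case
    by (induction rule: hom_sum.induct)
       (auto intro: hom_sum.intros hom_poly_mult simp: distrib_left)
qed (auto intro: hom_sum.intros simp: distrib_right)

lemma poly_fun_hom_sum: "f \<in> poly_fun \<Longrightarrow> hom_sum f"
proof (induction rule: poly_fun.induct)
  case (pconst a)
  then show ?case by (intro hom_sum_hom[of _ 0]) (simp add: hom_poly_def poly_fun.pconst)
next
  case (pcoord i)
  then show ?case by (intro hom_sum_hom[of _ 1]) (simp add: hom_poly_def poly_fun.pcoord)
qed (auto intro: hom_sum_add hom_sum_mult)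

section \<open>Maximum principle and gradient estimate\<close>

text \<open>At an interior maximum of the function perturbed by
  \<open>\<epsilon> * (x \<bullet> x)\<close> no pure second derivative is positive, whereas their
  sum is \<open>2 * \<epsilon>\<close> times the dimension; hence the maximum lies in
  \<open>K - U\<close>, and \<epsilon> tends to 0. The derivatives enter as parameters
  \<open>u1\<close> and \<open>u2\<close>, so that differences, dilations and reflections can be
  treated without computing \<open>dpart\<close> of them, and \<open>U\<close> may be any open part
  of \<open>K\<close>, such as a half ball.\<close>

lemma max_principle:
  fixes u :: "real^'n::finite \<Rightarrow> real"
  assumes K: "compact K" "continuous_on K u" and U: "open U" "U \<subseteq> K"
    and d1: "\<And>x i. x \<in> U \<Longrightarrow> ((\<lambda>t. u (x + t *\<^sub>R axis i 1)) has_real_derivative u1 i x) (at 0)"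
    and d2: "\<And>x i. x \<in> U \<Longrightarrow> ((\<lambda>t. u1 i (x + t *\<^sub>R axis i 1)) has_real_derivative u2 i x) (at 0)"
    and lap0: "\<And>x. x \<in> U \<Longrightarrow> (\<Sum>i\<in>UNIV. u2 i x) = 0"
    and M: "\<And>x. x \<in> K - U \<Longrightarrow> u x \<le> M" and x: "x \<in> K"
  shows "u x \<le> M"
proof -
  have pert: "u x + \<epsilon> * (x \<bullet> x) \<le> M + \<epsilon> * B"
    if e: "\<epsilon> > 0" and B: "\<And>y. y \<in> K \<Longrightarrow> y \<bullet> y \<le> B" for \<epsilon> B
  proof -
    define v where "v y = u y + \<epsilon> * (y \<bullet> y)" for y
    have "continuous_on K v" unfolding v_def by (intro continuous_intros K)
    then obtain y0 where y0: "y0 \<in> K" "\<And>y. y \<in> K \<Longrightarrow> v y \<le> v y0"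
      using continuous_attains_sup[OF K(1)] x by blast
    have "y0 \<notin> U"
    proof
      assume y0U: "y0 \<in> U"
      \<comment> \<open>Second derivative test along one axis: if the second derivative of
        \<open>g\<close> at its maximum were positive, \<open>g'\<close> would vanish at 0 and be
        positive just to the right, and the mean value theorem would give
        \<open>g h > g 0\<close>.\<close>
      have "u2 i y0 + 2 * \<epsilon> \<le> 0" for i
      proof (rule ccontr)
        assume "\<not> u2 i y0 + 2 * \<epsilon> \<le> 0"
        then have pos: "u2 i y0 + 2 * \<epsilon> > 0" by simp
        let ?e = "axis i 1 :: real^'n"
        obtain r where r: "r > 0" "ball y0 r \<subseteq> U" using U(1) y0U open_contains_ball by blast
        have inU: "y0 + t *\<^sub>R ?e \<in> U" if "\<bar>t\<bar> < r" for t
          using r(2) that by (auto simp: subset_iff dist_norm)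
        define g where "g t = v (y0 + t *\<^sub>R ?e)" for t
        define g' where "g' t = u1 i (y0 + t *\<^sub>R ?e) + \<epsilon> * (2 * y0 $ i + 2 * t)" for t
        have geq: "g t = u (y0 + t *\<^sub>R ?e) + \<epsilon> * (y0 \<bullet> y0 + 2 * t * y0 $ i + t * t)" for t
          by (simp add: g_def v_def inner_add_left inner_add_right inner_axis inner_axis' algebra_simps)
        have Dg: "(g has_real_derivative g' t) (at t)" if "\<bar>t\<bar> < r" for t
        proof -
          have "((\<lambda>s. u (y0 + t *\<^sub>R ?e + s *\<^sub>R ?e)) has_real_derivative u1 i (y0 + t *\<^sub>R ?e)) (at 0)"
            by (rule d1[OF inU[OF that]])
          then have "((\<lambda>s. u (y0 + (s + t) *\<^sub>R ?e)) has_real_derivative u1 i (y0 + t *\<^sub>R ?e)) (at 0)"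
            by (simp add: algebra_simps)
          then have "((\<lambda>s. u (y0 + s *\<^sub>R ?e)) has_real_derivative u1 i (y0 + t *\<^sub>R ?e)) (at t)"
            using DERIV_shift[of "\<lambda>s. u (y0 + s *\<^sub>R ?e)" _ 0 t] by simp
          then show ?thesis
            unfolding geq[abs_def] g'_def by (auto intro!: derivative_eq_intros)
        qed
        have Dg': "(g' has_real_derivative u2 i y0 + 2 * \<epsilon>) (at 0)"
          unfolding g'_def using d2[OF y0U, of i] by (auto intro!: derivative_eq_intros)
        have gmax: "g t \<le> g 0" if "\<bar>t\<bar> < r" for t
          using y0(2)[of "y0 + t *\<^sub>R ?e"] inU[OF that] U(2) by (auto simp: g_def)
        have "g' 0 = 0"
          by (rule DERIV_local_max[OF Dg[of 0] r(1)]) (use r(1) gmax in auto)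
        obtain d where d: "d > 0" "\<And>h. 0 < h \<Longrightarrow> h < d \<Longrightarrow> g' 0 < g' (0 + h)"
          using DERIV_pos_inc_right[OF Dg' pos] by blast
        define h where "h = min d r / 2"
        have h: "0 < h" "h < d" "h < r" using d(1) r(1) by (auto simp: h_def)
        obtain z where z: "0 < z" "z < h" "g h - g 0 = (h - 0) * g' z"
          using MVT2[of 0 h g g'] Dg h by (auto simp: less_le_trans)
        have "g' z > 0" using d(2)[of z] z h \<open>g' 0 = 0\<close> by simp
        then have "h * g' z > 0" using h by simp
        then have "g h > g 0" using z(3) by simp
        then show False using gmax[of h] h by simp
      qed
      then have "(\<Sum>i\<in>UNIV. u2 i y0 + 2 * \<epsilon>) \<le> 0" by (intro sum_nonpos) auto
      then show False using lap0[OF y0U] e by (simp add: sum.distrib mult_le_0_iff)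
    qed
    then have "u y0 \<le> M" using M y0(1) by blast
    moreover have "\<epsilon> * (y0 \<bullet> y0) \<le> \<epsilon> * B" using e B y0(1) by simp
    ultimately show ?thesis using y0(2)[OF x] by (simp add: v_def)
  qed
  obtain b where b: "\<And>y. y \<in> K \<Longrightarrow> norm y \<le> b" using compact_imp_bounded[OF K(1)] bounded_iff by blast
  define B where "B = b ^ 2 + 1"
  have B: "y \<bullet> y \<le> B" if "y \<in> K" for y
    using power_mono[OF b[OF that], of 2] by (simp add: B_def power2_norm_eq_inner)
  have Bp: "B > 0" by (simp add: B_def add_nonneg_pos)
  show ?thesis
  proof (rule field_le_epsilon)
    fix e :: real assume "e > 0"
    have "u x \<le> u x + e / B * (x \<bullet> x)" using \<open>e > 0\<close> Bp by simp
    also have "\<dots> \<le> M + e / B * B" by (rule pert) (use \<open>e > 0\<close> Bp B in auto)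
    finally show "u x \<le> M + e" using Bp by simp
  qed
qed

lemma poly_harmonic_bound_cball:
  fixes h :: "real^'n::finite \<Rightarrow> real"
  assumes h: "h \<in> poly_fun" "\<And>x. lap h x = 0" and M: "\<And>x. x \<in> sphere 0 1 \<Longrightarrow> \<bar>h x\<bar> \<le> M" and x: "x \<in> cball 0 1"
  shows "\<bar>h x\<bar> \<le> M"
proof -
  have *: "f x \<le> M" if f: "f \<in> poly_fun" "\<And>x. lap f x = 0" "\<And>x. x \<in> sphere 0 1 \<Longrightarrow> f x \<le> M" for f
    by (rule max_principle[where u = f and K = "cball 0 1" and U = "ball 0 1" and ?u1.0 = "\<lambda>i. dpart i f" and ?u2.0 = "\<lambda>i. dpart i (dpart i f)"])
       (use f x in \<open>auto intro!: poly_fun_continuous poly_fun_dpart_axis poly_fun_dpart simp: lap_def\<close>)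
  have "h x \<le> M" by (rule *) (use h M in \<open>auto simp: abs_le_iff\<close>)
  moreover have "- h x \<le> M"
    by (rule *[of "\<lambda>x. - h x"]) (use h M in \<open>auto simp: abs_le_iff poly_fun_uminus lap_uminus\<close>)
  ultimately show ?thesis by simp
qed

text \<open>The half difference of \<open>h\<close> and its reflection vanishes on a hyperplane through the centre; on
  the half ball it is dominated by an explicit harmonic quadratic barrier.\<close>

lemma poly_harmonic_dpart_bound:
  fixes h :: "real^'n::finite \<Rightarrow> real"
  assumes h: "h \<in> poly_fun" "\<And>x. lap h x = 0" and \<delta>: "\<delta> > 0"
    and M: "\<And>y. y \<in> cball x \<delta> \<Longrightarrow> \<bar>h y\<bar> \<le> M"
  shows "\<bar>dpart i h x\<bar> \<le> real CARD('n) * M / \<delta>"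
proof -
  define n where "n = real CARD('n)"
  have n1: "n \<ge> 1" by (simp add: n_def)
  have M0: "M \<ge> 0" using M[of x] \<delta> by simp
  have key: "dpart i f x \<le> n * M / \<delta>"
    if f: "f \<in> poly_fun" "\<And>x. lap f x = 0" "\<And>y. y \<in> cball x \<delta> \<Longrightarrow> \<bar>f y\<bar> \<le> M" for f
  proof -
    let ?e = "axis i 1 :: real^'n"
    define S where "S y = y - (2 * y $ i) *\<^sub>R ?e" for y
    \<comment> \<open>Harmonic by design: the quadratic
      \<open>(y \<bullet> y) / \<delta>\<^sup>2\<close> has Laplacian
      \<open>2 * n / \<delta>\<^sup>2\<close>, and the concave term in \<open>y $ i\<close>
      contributes the negative of this. On the spherical part of the boundary \<psi> is at least
      \<open>M\<close>, on the flat part it is nonnegative, and its slope at 0 in direction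
      \<open>i\<close> is \<open>n * M / \<delta>\<close>, the bound to be proved.\<close>
    define \<psi> where "\<psi> y = M * ((y \<bullet> y) / \<delta>\<^sup>2 + n * (y $ i / \<delta>) * (1 - y $ i / \<delta>))" for y
    define u where "u y = (f (x + y) - f (x + S y)) / 2 - \<psi> y" for y
    \<comment> \<open>Chain rule factors of the reflection \<open>S\<close>: a derivative across the
      hyperplane changes sign once, so pure second derivatives are unaffected and the reflected
      function is again harmonic.\<close>
    define sg :: "'n \<Rightarrow> real" where "sg j = (if j = i then -1 else 1)" for j
    define u1 where "u1 j y = (dpart j f (x + y) - sg j * dpart j f (x + S y)) / 2
        - M * (2 * y $ j / \<delta>\<^sup>2 + (if j = i then n / \<delta> - 2 * n * y $ i / \<delta>\<^sup>2 else 0))" for j y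
    define u2 where "u2 j y = (dpart j (dpart j f) (x + y) - dpart j (dpart j f) (x + S y)) / 2
        - M * (2 / \<delta>\<^sup>2 + (if j = i then - 2 * n / \<delta>\<^sup>2 else 0))" for j y
    have S_line: "x + S (y + t *\<^sub>R axis j 1) = x + S y + t *\<^sub>R (sg j *\<^sub>R axis j 1)" for y t j
      by (vector S_def sg_def axis_def)
    have line: "((\<lambda>t. g (x + (y + t *\<^sub>R axis j 1))) has_real_derivative dpart j g (x + y)) (at 0)"
      if "g \<in> poly_fun" for g j y
      using poly_fun_dpart_axis[OF that, of "x + y" j] by (simp add: add.assoc)
    have lineS: "((\<lambda>t. g (x + S (y + t *\<^sub>R axis j 1))) has_real_derivative sg j * dpart j g (x + S y)) (at 0)"
      if "g \<in> poly_fun" for g j y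
      unfolding S_line using poly_fun_dpart(2)[OF that, of "x + S y" "sg j *\<^sub>R axis j 1"]
      by (simp add: mult.assoc sum_distrib_left[symmetric] sum_axis)
    have coord: "(y + t *\<^sub>R axis j 1) $ k = y $ k + (if k = j then t else 0)" for y :: "real^'n" and t j k
      by (simp add: axis_def)
    have inner: "(y + t *\<^sub>R axis j 1) \<bullet> (y + t *\<^sub>R axis j 1) = y \<bullet> y + 2 * t * y $ j + t * t" for y :: "real^'n" and t j
      by (simp add: inner_add_left inner_add_right inner_axis inner_axis' algebra_simps)
    have d1: "((\<lambda>t. u (y + t *\<^sub>R axis j 1)) has_real_derivative u1 j y) (at 0)" for y j
    proof -
      have "((\<lambda>t. \<psi> (y + t *\<^sub>R axis j 1)) has_real_derivative
         M * (2 * y $ j / \<delta>\<^sup>2 + (if j = i then n / \<delta> - 2 * n * y $ i / \<delta>\<^sup>2 else 0))) (at 0)"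
        unfolding \<psi>_def inner coord using \<delta>
        by (auto intro!: derivative_eq_intros simp: field_simps power2_eq_square)
      moreover have "((\<lambda>t. (f (x + (y + t *\<^sub>R axis j 1)) - f (x + S (y + t *\<^sub>R axis j 1))) / 2) has_real_derivative
         (dpart j f (x + y) - sg j * dpart j f (x + S y)) / 2) (at 0)"
        by (intro DERIV_cdivide DERIV_diff line lineS f)
      ultimately show ?thesis
        unfolding u_def u1_def by (intro DERIV_diff)
    qed
    have d2: "((\<lambda>t. u1 j (y + t *\<^sub>R axis j 1)) has_real_derivative u2 j y) (at 0)" for y j
    proof -
      have "((\<lambda>t. M * (2 * (y + t *\<^sub>R axis j 1) $ j / \<delta>\<^sup>2 + (if j = i then n / \<delta> - 2 * n * (y + t *\<^sub>R axis j 1) $ i / \<delta>\<^sup>2 else 0)))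
        has_real_derivative M * (2 / \<delta>\<^sup>2 + (if j = i then - 2 * n / \<delta>\<^sup>2 else 0))) (at 0)"
        unfolding coord using \<delta>
        by (auto intro!: derivative_eq_intros simp: field_simps power2_eq_square power4_eq_xxxx)
      moreover have "((\<lambda>t. (dpart j f (x + (y + t *\<^sub>R axis j 1)) - sg j * dpart j f (x + S (y + t *\<^sub>R axis j 1))) / 2) has_real_derivative
         (dpart j (dpart j f) (x + y) - sg j * (sg j * dpart j (dpart j f) (x + S y))) / 2) (at 0)"
        by (intro DERIV_cdivide DERIV_diff DERIV_cmult line lineS f poly_fun_dpart)
      moreover have "sg j * (sg j * a) = a" for a by (simp add: sg_def)
      ultimately show ?thesis
        unfolding u1_def u2_def by (simp only:) (intro DERIV_diff)
    qed
    have lap0: "(\<Sum>j\<in>UNIV. u2 j y) = 0" for y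
    proof -
      have "(\<Sum>j\<in>UNIV. u2 j y) = (lap f (x + y) - lap f (x + S y)) / 2
          - M * (\<Sum>j\<in>UNIV. 2 / \<delta>\<^sup>2 + (if j = i then - 2 * n / \<delta>\<^sup>2 else 0))"
        unfolding u2_def lap_def by (simp only: sum_subtractf sum_divide_distrib[symmetric] sum_distrib_left[symmetric])
      also have "(\<Sum>j\<in>UNIV. 2 / \<delta>\<^sup>2 + (if j = i then - 2 * n / \<delta>\<^sup>2 else 0)) = 0"
        by (simp only: sum.distrib) (simp add: n_def)
      finally show ?thesis using f(2) by simp
    qed
    have normS: "norm (S y) = norm y" for y
    proof -
      have "S y \<bullet> S y = y \<bullet> y"
        by (simp add: S_def inner_diff_left inner_diff_right inner_axis inner_axis' algebra_simps)
      then show ?thesis by (simp add: norm_eq_sqrt_inner)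
    qed
    have fb: "\<bar>f (x + y)\<bar> \<le> M" if "norm y \<le> \<delta>" for y
      using f(3)[of "x + y"] that by (simp add: dist_norm)
    have comp: "u y \<le> 0" if y: "norm y \<le> \<delta>" "y $ i \<ge> 0" for y
    proof (rule max_principle[where u = u and K = "cball 0 \<delta> \<inter> {y. y $ i \<ge> 0}" and U = "ball 0 \<delta> \<inter> {y. y $ i > 0}"
          and ?u1.0 = u1 and ?u2.0 = u2])
      show "compact (cball 0 \<delta> \<inter> {y::real^'n. y $ i \<ge> 0})"
        by (intro compact_Int_closed compact_cball closed_halfspace_component_ge_cart)
      have "continuous_on UNIV f" using f poly_fun_continuous by blast
      then have fc: "continuous_on K (\<lambda>y. f (g y))" if "continuous_on K g" for g :: "real^'n \<Rightarrow> real^'n" and K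
        using continuous_on_compose2 that by blast
      then show "continuous_on (cball 0 \<delta> \<inter> {y. 0 \<le> y $ i}) u"
        unfolding u_def \<psi>_def S_def using \<delta> by (intro continuous_intros fc) auto
      show "open (ball 0 \<delta> \<inter> {y::real^'n. y $ i > 0})"
        by (intro open_Int open_ball open_halfspace_component_gt_cart)
      fix y :: "real^'n" assume "y \<in> (cball 0 \<delta> \<inter> {y. 0 \<le> y $ i}) - (ball 0 \<delta> \<inter> {y. 0 < y $ i})"
      then have y: "norm y \<le> \<delta>" "y $ i \<ge> 0" "norm y = \<delta> \<or> y $ i = 0" by auto
      have yi: "y $ i \<le> \<delta>" using component_le_norm_cart[of y i] y(1) by simp
      then have t: "0 \<le> n * (y $ i / \<delta>) * (1 - y $ i / \<delta>)" using y \<delta> n1 by simp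
      show "u y \<le> 0"
      proof (cases "y $ i = 0")
        case True
        then have "S y = y" by (simp add: S_def)
        moreover have "\<psi> y \<ge> 0" unfolding \<psi>_def by (intro mult_nonneg_nonneg[OF M0] add_nonneg_nonneg t) simp
        ultimately show ?thesis by (simp add: u_def)
      next
        case False
        then have "y \<bullet> y = \<delta>\<^sup>2" using y(3) by (simp add: power2_norm_eq_inner[symmetric])
        then have "\<psi> y = M * (1 + n * (y $ i / \<delta>) * (1 - y $ i / \<delta>))" using \<delta> by (simp add: \<psi>_def)
        moreover have "M * 1 \<le> \<dots>" using M0 t by (intro mult_left_mono) auto
        ultimately have "M \<le> \<psi> y" by simp
        moreover have "f (x + y) \<le> M" "- f (x + S y) \<le> M"
          using fb[OF y(1)] fb[of "S y"] y(1) normS by (auto simp: abs_le_iff)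
        ultimately have "f (x + y) - f (x + S y) \<le> 2 * \<psi> y" by simp
        then show ?thesis by (simp add: u_def)
      qed
    qed (use d1 d2 lap0 y in auto)
    \<comment> \<open>\<open>G\<close> is \<open>-2 * u\<close> along the axis. It is nonnegative on
      the interval from 0 to \<delta> and vanishes at 0, so its derivative at 0, which is twice the
      difference between the bound and \<open>dpart i f x\<close>, cannot be negative.\<close>
    define G where "G t = 2 * (M * (t\<^sup>2 / \<delta>\<^sup>2 + n * (t / \<delta>) * (1 - t / \<delta>))) - (f (x + t *\<^sub>R ?e) - f (x + (- t) *\<^sub>R ?e))" for t
    have Gnn: "G t \<ge> 0" if t: "0 \<le> t" "t \<le> \<delta>" for t
    proof -
      have "S (t *\<^sub>R ?e) = (- t) *\<^sub>R ?e" by (vector S_def axis_def)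
      moreover have "\<psi> (t *\<^sub>R ?e) = M * (t\<^sup>2 / \<delta>\<^sup>2 + n * (t / \<delta>) * (1 - t / \<delta>))"
        by (simp add: \<psi>_def inner_axis power2_eq_square)
      ultimately show ?thesis
        using comp[of "t *\<^sub>R ?e"] t by (simp add: u_def G_def mult_ac)
    qed
    have D1: "((\<lambda>t. f (x + t *\<^sub>R ?e)) has_real_derivative dpart i f x) (at 0)"
      by (rule poly_fun_dpart_axis[OF f(1)])
    have D2: "((\<lambda>t. f (x + (- t) *\<^sub>R ?e)) has_real_derivative - dpart i f x) (at 0)"
      using DERIV_chain2[of "\<lambda>t. f (x + t *\<^sub>R ?e)" "dpart i f x" "\<lambda>t. - t" 0 "-1" UNIV]
        D1 DERIV_minus[OF DERIV_ident, of "0::real" UNIV] by simp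
    have "(G has_real_derivative 2 * (M * (n / \<delta>)) - (dpart i f x - - dpart i f x)) (at 0)"
      unfolding G_def using D1 D2 \<delta> by (intro DERIV_diff) (auto intro!: derivative_eq_intros)
    then have DG: "(G has_real_derivative 2 * (n * M / \<delta> - dpart i f x)) (at 0)"
      by (simp add: algebra_simps)
    show ?thesis
    proof (rule ccontr)
      assume "\<not> ?thesis"
      then obtain d where d: "d > 0" "\<And>h. 0 < h \<Longrightarrow> h < d \<Longrightarrow> G 0 > G (0 + h)"
        using DERIV_neg_dec_right[OF DG] by auto
      have "G 0 = 0" by (simp add: G_def)
      moreover have "0 < min d \<delta> / 2" "min d \<delta> / 2 < d" "min d \<delta> / 2 \<le> \<delta>" using d(1) \<delta> by auto
      ultimately show False using d(2)[of "min d \<delta> / 2"] Gnn[of "min d \<delta> / 2"] by simp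
    qed
  qed
  have "dpart i h x \<le> n * M / \<delta>" by (rule key) (use h M in auto)
  moreover have "dpart i (\<lambda>x. - h x) x \<le> n * M / \<delta>"
    by (rule key) (use h M in \<open>auto simp: poly_fun_uminus lap_uminus\<close>)
  ultimately show ?thesis using dpart_uminus[OF h(1)] by (simp add: n_def)
qed

section \<open>Surface measure and growth of spherical harmonics\<close>

declare One_nat_def [simp del]

lemma one_le_card_finite [simp]: "1 \<le> CARD('n::finite)"
  by (simp add: One_nat_def Suc_leI)

lemma radial_projection_measurable [measurable]:
  "(\<lambda>x::real^'n::finite. x /\<^sub>R norm x) \<in> borel_measurable borel"
  by measurable

lemma sets_sphere_measure [simp, measurable_cong]: "sets sphere_measure = sets borel"
  by (simp add: sphere_measure_def)

lemma space_sphere_measure [simp]: "space sphere_measure = UNIV"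
  by (simp add: sphere_measure_def)

lemma emeasure_unit_ball: 
  "emeasure lborel (ball 0 1 :: (real^'n::finite) set) \<noteq> 0"
  "emeasure lborel (ball 0 1 :: (real^'n::finite) set) \<noteq> \<infinity>"
proof -
  show "emeasure lborel (ball 0 1 :: (real^'n::finite) set) \<noteq> \<infinity>"
    using emeasure_lborel_ball_finite[of 0 1] by (simp add: less_top)
  have "measure lborel (ball 0 1 :: (real^'n::finite) set) > 0" by simp
  then show "emeasure lborel (ball 0 1 :: (real^'n::finite) set) \<noteq> 0"
    by (metis enn2real_0 measure_def less_irrefl)
qed

lemma emeasure_sphere_measure:
  fixes A :: "(real^'n::finite) set"
  assumes "A \<in> sets borel"
  shows "emeasure sphere_measure A = emeasure lborel (ball 0 1 \<inter> {x. x /\<^sub>R norm x \<in> A}) / emeasure lborel (ball 0 1 :: (real^'n) set)"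
proof -
  have "(\<lambda>x::real^'n. x /\<^sub>R norm x) -` A \<inter> space borel \<in> sets borel"
    by (rule measurable_sets[OF radial_projection_measurable assms])
  moreover have "(\<lambda>x::real^'n. x /\<^sub>R norm x) -` A = {x. x /\<^sub>R norm x \<in> A}" by auto
  ultimately show ?thesis
    unfolding sphere_measure_def using assms
    by (subst emeasure_distr) (auto simp: Int_def)
qed

lemma emeasure_sphere_measure_UNIV [simp]: "emeasure sphere_measure UNIV = 1"
  using emeasure_unit_ball by (subst emeasure_sphere_measure) (auto intro: ennreal_divide_self simp: top.not_eq_extremum)

lemma finite_measure_sphere_measure: "finite_measure sphere_measure"
  by (rule finite_measureI) simp

lemma measure_sphere_measure_UNIV [simp]: "measure sphere_measure UNIV = 1"
  by (simp add: measure_def)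

lemma sigma_finite_sphere_measure: "sigma_finite_measure sphere_measure"
  using finite_measure_sphere_measure finite_measure_def by blast

text \<open>The origin, which the projection sends to 0, is the only point of the ball that does not
  land on the sphere, and it is a null set. \<open>sphere_measure\<close> lives on the whole space,
  so estimates on the sphere reach integrals through this statement.\<close>

lemma AE_sphere_measure: "AE x in sphere_measure. x \<in> sphere 0 1"
proof -
  have "AE x in uniform_measure lborel (ball 0 1 :: (real^'n) set). x /\<^sub>R norm x \<in> sphere 0 1"
    using AE_lborel_singleton[of "0::real^'n"] emeasure_unit_ball[where 'n = 'n]
    by (subst AE_uniform_measure) (auto simp: less_top elim: eventually_mono)
  moreover have "{x \<in> space borel. x \<in> sphere 0 (1::real)} \<in> sets (borel :: (real^'n) measure)"
    by (simp add: borel_closed)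
  ultimately show ?thesis
    unfolding sphere_measure_def
    by (subst AE_distr_iff) auto
qed

text \<open>The Euclidean ball of radius \<open>\<epsilon> / 4\<close> about
  \<open>(1 - \<epsilon> / 4) *\<^sub>R x0\<close> lies in the unit ball and projects radially into
  the cap, so comparing Lebesgue volumes suffices. The exponent is that of the ambient space, one
  more than the true order of a cap; the loss affects only polynomial degrees later.\<close>

lemma sphere_cap_measure:
  fixes x0 :: "real^'n::finite"
  assumes x0: "norm x0 = 1" and e: "0 < \<epsilon>" "\<epsilon> \<le> 1"
  shows "(\<epsilon> / 4) ^ CARD('n) \<le> measure sphere_measure (ball x0 \<epsilon>)"
proof -
  let ?B = "ball 0 1 :: (real^'n) set"
  have sub: "ball ((1 - \<epsilon> / 4) *\<^sub>R x0) (\<epsilon> / 4) \<subseteq> ?B \<inter> {x. x /\<^sub>R norm x \<in> ball x0 \<epsilon>}"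
  proof
    fix x assume "x \<in> ball ((1 - \<epsilon> / 4) *\<^sub>R x0) (\<epsilon> / 4)"
    then have x: "norm (x - (1 - \<epsilon> / 4) *\<^sub>R x0) < \<epsilon> / 4" by (simp add: dist_norm norm_minus_commute)
    have n1: "norm ((1 - \<epsilon> / 4) *\<^sub>R x0) = 1 - \<epsilon> / 4" using x0 e by simp
    have "x - x0 = (x - (1 - \<epsilon> / 4) *\<^sub>R x0) - (\<epsilon> / 4) *\<^sub>R x0" by (simp add: algebra_simps)
    then have "norm (x - x0) \<le> norm (x - (1 - \<epsilon> / 4) *\<^sub>R x0) + norm ((\<epsilon> / 4) *\<^sub>R x0)"
      by (metis norm_triangle_ineq4)
    then have a: "norm (x - x0) < \<epsilon> / 2" using x x0 e by simp
    have b: "norm x < 1" using norm_triangle_sub[of x "(1 - \<epsilon> / 4) *\<^sub>R x0"] x n1 by simp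
    have c: "1 - norm x < \<epsilon> / 2" using norm_triangle_sub[of x0 x] a x0 by (simp add: norm_minus_commute)
    then have nz: "x \<noteq> 0" "norm x > 0" using e by auto
    have "x /\<^sub>R norm x - x = ((1 - norm x) / norm x) *\<^sub>R x"
      using nz by (simp add: algebra_simps divide_simps) (simp add: scaleR_left_diff_distrib divide_inverse algebra_simps)
    then have "norm (x /\<^sub>R norm x - x) = 1 - norm x" using nz b by simp
    then have "norm (x /\<^sub>R norm x - x0) < \<epsilon>"
      using norm_triangle_ineq[of "x /\<^sub>R norm x - x" "x - x0"] a c by simp
    then show "x \<in> ?B \<inter> {x. x /\<^sub>R norm x \<in> ball x0 \<epsilon>}"
      using b by (simp add: dist_norm norm_minus_commute)
  qed
  have meas: "{x::real^'n. x /\<^sub>R norm x \<in> ball x0 \<epsilon>} \<in> sets borel"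
    using measurable_sets[OF radial_projection_measurable, of "ball x0 \<epsilon>"] by (simp add: vimage_def)
  have eq: "measure sphere_measure (ball x0 \<epsilon>)
      = measure lborel (?B \<inter> {x. x /\<^sub>R norm x \<in> ball x0 \<epsilon>}) / measure lborel ?B"
  proof -
    have "emeasure lborel (?B \<inter> {x. x /\<^sub>R norm x \<in> ball x0 \<epsilon>}) \<le> emeasure lborel ?B"
      by (intro emeasure_mono) auto
    then have "emeasure lborel (?B \<inter> {x. x /\<^sub>R norm x \<in> ball x0 \<epsilon>}) \<noteq> \<infinity>"
      using emeasure_unit_ball[where 'n = 'n] by (auto simp: top_unique)
    then have "emeasure sphere_measure (ball x0 \<epsilon>)
      = ennreal (measure lborel (?B \<inter> {x. x /\<^sub>R norm x \<in> ball x0 \<epsilon>})) / ennreal (measure lborel ?B)"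
      using emeasure_unit_ball[where 'n = 'n]
      by (simp add: emeasure_sphere_measure emeasure_eq_ennreal_measure)
    then show ?thesis
      using content_ball_gt_0_iff[of "0::real^'n" 1] by (simp add: measure_def[of sphere_measure] divide_ennreal)
  qed
  have "emeasure lborel (?B \<inter> {x. x /\<^sub>R norm x \<in> ball x0 \<epsilon>}) < \<infinity>"
    using emeasure_mono[of "?B \<inter> {x. x /\<^sub>R norm x \<in> ball x0 \<epsilon>}" ?B lborel] emeasure_lborel_ball_finite[of "0::real^'n" 1]
    by (auto intro: order.strict_trans1)
  then have "measure lborel (ball ((1 - \<epsilon> / 4) *\<^sub>R x0) (\<epsilon> / 4)) \<le> measure lborel (?B \<inter> {x. x /\<^sub>R norm x \<in> ball x0 \<epsilon>})"
    unfolding measure_def using meas by (intro enn2real_mono emeasure_mono sub) auto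
  moreover have "measure lborel (ball ((1 - \<epsilon> / 4) *\<^sub>R x0) (\<epsilon> / 4)) = (\<epsilon> / 4) ^ CARD('n) * measure lborel ?B"
    using e by (simp add: content_ball)
  moreover have "measure lborel ?B > 0" by simp
  ultimately show ?thesis unfolding eq by (simp add: le_divide_eq)
qed

lemma sphere_integrable:
  fixes f :: "real^'n::finite \<Rightarrow> real"
  assumes "f \<in> borel_measurable borel" "\<And>x. x \<in> sphere 0 1 \<Longrightarrow> \<bar>f x\<bar> \<le> B"
  shows "integrable sphere_measure f" "\<bar>integral\<^sup>L sphere_measure f\<bar> \<le> B"
proof -
  interpret finite_measure "sphere_measure :: (real^'n) measure" by (rule finite_measure_sphere_measure)
  have ae: "AE x in sphere_measure. \<bar>f x\<bar> \<le> B"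
    using AE_sphere_measure by (rule AE_mp) (use assms(2) in auto)
  show i: "integrable sphere_measure f"
    by (rule integrable_const_bound[of _ B]) (use assms ae in auto)
  have "(\<integral>x. \<bar>f x\<bar> \<partial>sphere_measure) \<le> (\<integral>x. B \<partial>(sphere_measure :: (real^'n) measure))"
    by (intro integral_mono_AE integrable_abs[OF i] integrable_const ae)
  then show "\<bar>integral\<^sup>L sphere_measure f\<bar> \<le> B"
    by (auto intro: order_trans[OF integral_abs_bound])
qed

lemma poly_fun_bounded_sphere:
  assumes "f \<in> poly_fun" obtains B where "\<And>x::real^'n::finite. x \<in> sphere 0 1 \<Longrightarrow> \<bar>f x\<bar> \<le> B"
proof -
  have "bounded (f ` sphere 0 1)"
    by (intro compact_imp_bounded compact_continuous_image poly_fun_continuous assms compact_sphere)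
  then obtain B where B: "\<forall>y\<in>f ` sphere 0 1. norm y \<le> B" unfolding bounded_iff by blast
  show ?thesis by (rule that[of B]) (use B in force)
qed

lemma poly_fun_integrable_sphere: "f \<in> poly_fun \<Longrightarrow> integrable sphere_measure f"
  by (metis poly_fun_bounded_sphere poly_fun_measurable sphere_integrable(1))

lemma integral_cong_sphere:
  fixes f g :: "real^'n::finite \<Rightarrow> real"
  assumes "f \<in> borel_measurable borel" "g \<in> borel_measurable borel" "\<And>x. x \<in> sphere 0 1 \<Longrightarrow> f x = g x"
  shows "integral\<^sup>L sphere_measure f = integral\<^sup>L sphere_measure g"
  using assms AE_sphere_measure by (intro integral_cong_AE) (auto elim: eventually_mono)

lemma sph_harm_norm_bound:
  assumes P: "P \<in> sph_harm k" and M: "\<And>x. x \<in> sphere 0 1 \<Longrightarrow> \<bar>P x\<bar> \<le> M"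
  shows "\<bar>P x\<bar> \<le> M * norm x ^ k"
proof (cases "x = 0")
  case False
  have "P x = norm x ^ k * P (x /\<^sub>R norm x)"
    using P hom_polyD(2)[of P k "norm x" "x /\<^sub>R norm x"] False by (simp add: sph_harm_iff)
  moreover have "\<bar>P (x /\<^sub>R norm x)\<bar> \<le> M" using False by (intro M) simp
  ultimately show ?thesis by (simp add: abs_mult mult.commute[of M] mult_left_mono)
next
  case True
  have M0: "M \<ge> 0" using M[of "axis undefined 1"] by (simp add: norm_axis_1)
  have "P 0 = 0 ^ k * P (axis undefined 1)" using P hom_polyD(2)[of P k 0 "axis undefined 1"] by (simp add: sph_harm_iff)
  then show ?thesis using True M0 M[of "axis undefined 1"] by (cases k) (auto simp: norm_axis_1)
qed

lemma poly_segment_bound: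
  fixes f :: "real^'n::finite \<Rightarrow> real"
  assumes f: "f \<in> poly_fun" and L: "\<And>y i. dist x y < r \<Longrightarrow> \<bar>dpart i f y\<bar> \<le> L" and z: "dist x z < r"
  shows "\<bar>f z - f x\<bar> \<le> real CARD('n) * L * dist x z"
proof -
  have "\<exists>t. 0 < t \<and> t < 1 \<and> f (x + 1 *\<^sub>R (z - x)) - f (x + 0 *\<^sub>R (z - x))
      = (1 - 0) * (\<Sum>i\<in>UNIV. (z - x) $ i * dpart i f (x + t *\<^sub>R (z - x)))"
    by (rule MVT2) (use poly_fun_line_at[OF f, of x "z - x"] in auto)
  then obtain t where t: "0 < t" "t < 1" "f z - f x = (\<Sum>i\<in>UNIV. (z - x) $ i * dpart i f (x + t *\<^sub>R (z - x)))"
    by auto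
  have "dist x (x + t *\<^sub>R (z - x)) \<le> 1 * dist x z"
    using t by (simp add: dist_norm norm_minus_commute mult_left_le_one_le)
  then have d: "dist x (x + t *\<^sub>R (z - x)) < r" using z by simp
  have "\<bar>f z - f x\<bar> \<le> (\<Sum>i\<in>UNIV. \<bar>(z - x) $ i * dpart i f (x + t *\<^sub>R (z - x))\<bar>)"
    unfolding t(3) by (rule sum_abs)
  also have "\<dots> \<le> (\<Sum>i\<in>(UNIV::'n set). dist x z * L)"
  proof (rule sum_mono)
    fix i
    have "\<bar>(z - x) $ i\<bar> \<le> dist x z" using component_le_norm_cart[of "z - x" i] by (simp add: dist_norm norm_minus_commute)
    then show "\<bar>(z - x) $ i * dpart i f (x + t *\<^sub>R (z - x))\<bar> \<le> dist x z * L"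
      unfolding abs_mult using L[OF d] by (intro mult_mono) auto
  qed
  finally show ?thesis by (simp add: mult_ac)
qed

text \<open>On the ball of radius \<open>1 + 1 / (k + 1)\<close> a spherical harmonic of degree
  \<open>k\<close> exceeds its maximum on the sphere by at most this factor; the bound is
  \<open>exp 1\<close> rounded up.\<close>

lemma one_plus_inverse_power_le: "(1 + 1 / (real k + 1)) ^ k \<le> 3"
proof -
  have "(1 + 1 / (real k + 1)) ^ k \<le> exp (1 / (real k + 1)) ^ k"
    by (intro power_mono) (auto simp: add.commute exp_ge_add_one_self)
  also have "\<dots> = exp (real k * (1 / (real k + 1)))" by (rule exp_of_nat_mult[symmetric])
  also have "\<dots> \<le> exp 1" by simp
  also have "\<dots> \<le> 3" by (rule exp_le)
  finally show ?thesis .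
qed

text \<open>By the gradient estimate a spherical harmonic of degree \<open>k\<close> keeps half of its maximum on a cap of radius of
  order \<open>1/k\<close>.\<close>

lemma sph_harm_sup_le_L2:
  fixes P :: "real^'n::finite \<Rightarrow> real"
  assumes P: "P \<in> sph_harm k" and x: "x \<in> sphere 0 1"
  defines "n \<equiv> CARD('n)"
  shows "(P x)\<^sup>2 \<le> (4 * (48 * real n ^ 2) ^ n) * (real k + 1) ^ n * (\<integral>y. (P y)\<^sup>2 \<partial>sphere_measure)"
proof -
  have Pp: "P \<in> poly_fun" "\<And>x. lap P x = 0" using P hom_polyD by (auto simp: sph_harm_iff)
  have n1: "n \<ge> 1" by (simp add: n_def One_nat_def Suc_leI)
  have "continuous_on (sphere 0 1) (\<lambda>x. \<bar>P x\<bar>)" using Pp poly_fun_continuous by (intro continuous_intros) blast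
  then obtain x0 where x0: "x0 \<in> sphere 0 1" "\<And>y. y \<in> sphere 0 1 \<Longrightarrow> \<bar>P y\<bar> \<le> \<bar>P x0\<bar>"
    using continuous_attains_sup[of "sphere 0 1" "\<lambda>x. \<bar>P x\<bar>"] x by auto
  define M where "M = \<bar>P x0\<bar>"
  \<comment> \<open>\<open>1 + 2 * \<delta>\<close> is the radius \<open>1 + 1 / (k + 1)\<close> up
    to which \<open>P\<close> is at most \<open>3 * M\<close>. Then \<epsilon> is chosen so that the
    gradient bound \<open>n * (3 * M) / \<delta>\<close>, times the factor \<open>n\<close> of
    \<open>poly_segment_bound\<close>, times \<epsilon> equals \<open>M / 2\<close>. The 48 in the
    statement is \<open>2 * 6 * 4\<close>.\<close>
  define \<delta> where "\<delta> = 1 / (2 * (real k + 1))"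
  define \<epsilon> where "\<epsilon> = \<delta> / (6 * real n ^ 2)"
  have pos: "\<delta> > 0" "\<epsilon> > 0" "M \<ge> 0" using n1 by (auto simp: \<delta>_def \<epsilon>_def M_def)
  have "\<delta> \<le> 1" by (simp add: \<delta>_def)
  moreover have "real n ^ 2 \<ge> 1" using n1 by (intro one_le_power) simp
  then have "6 * real n ^ 2 \<ge> 1" by linarith
  ultimately have eps: "\<epsilon> \<le> 1" "\<epsilon> \<le> \<delta>"
    unfolding \<epsilon>_def using pos(1) by (auto simp: divide_le_eq mult_le_cancel_left1 intro: order_trans)
  have big: "\<bar>P y\<bar> \<le> 3 * M" if "norm y \<le> 1 + 2 * \<delta>" for y
  proof -
    have "\<bar>P y\<bar> \<le> M * norm y ^ k" using sph_harm_norm_bound[OF P] x0 M_def by blast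
    also have "\<dots> \<le> M * (1 + 1 / (real k + 1)) ^ k"
      using that pos by (intro mult_left_mono power_mono) (auto simp: \<delta>_def field_simps)
    also have "\<dots> \<le> M * 3" using one_plus_inverse_power_le pos by (intro mult_left_mono)
    finally show ?thesis by simp
  qed
  have grad: "\<bar>dpart i P y\<bar> \<le> real n * (3 * M) / \<delta>" if "dist x0 y < \<delta>" for y i
    unfolding n_def
  proof (rule poly_harmonic_dpart_bound[OF Pp pos(1)])
    fix z assume "z \<in> cball y \<delta>"
    then have "norm z \<le> norm x0 + dist x0 y + dist y z"
      using norm_triangle_sub[of z x0] dist_triangle[of x0 z y] by (simp add: dist_norm norm_minus_commute)
    also have "\<dots> \<le> 1 + 2 * \<delta>" using x0 that \<open>z \<in> cball y \<delta>\<close> by simp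
    finally show "\<bar>P z\<bar> \<le> 3 * M" by (rule big)
  qed
  have cap: "M / 2 \<le> \<bar>P z\<bar>" if "z \<in> ball x0 \<epsilon>" for z
  proof -
    have dz: "dist x0 z < \<epsilon>" using that by simp
    have "\<bar>P z - P x0\<bar> \<le> real n * (real n * (3 * M) / \<delta>) * dist x0 z"
      unfolding n_def by (rule poly_segment_bound[OF Pp(1), where r = \<delta>]) (use grad dz eps in \<open>auto simp: n_def\<close>)
    also have "\<dots> \<le> real n * (real n * (3 * M) / \<delta>) * \<epsilon>"
      using dz pos by (intro mult_left_mono) auto
    also have "\<dots> = M / 2" using n1 pos by (simp add: \<epsilon>_def field_simps power2_eq_square)
    finally show ?thesis unfolding M_def by linarith
  qed
  have P2: "(\<lambda>y. (P y)\<^sup>2) \<in> poly_fun" using Pp by (intro poly_fun_power)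
  have "(M / 2)\<^sup>2 * (\<epsilon> / 4) ^ n \<le> (M / 2)\<^sup>2 * measure sphere_measure (ball x0 \<epsilon>)"
    unfolding n_def using x0 pos eps by (intro mult_left_mono sphere_cap_measure) auto
  also have "\<dots> = (\<integral>y. (M / 2)\<^sup>2 * indicator (ball x0 \<epsilon>) y \<partial>sphere_measure)"
    by simp
  also have "\<dots> \<le> (\<integral>y. (P y)\<^sup>2 \<partial>sphere_measure)"
  proof (rule integral_mono)
    show "integrable sphere_measure (\<lambda>y. (M / 2)\<^sup>2 * indicator (ball x0 \<epsilon>) y)"
      by (rule sphere_integrable(1)[where B = "(M/2)\<^sup>2"]) (auto simp: indicator_def)
    show "integrable sphere_measure (\<lambda>y. (P y)\<^sup>2)" by (rule poly_fun_integrable_sphere[OF P2])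
    fix y
    show "(M / 2)\<^sup>2 * indicator (ball x0 \<epsilon>) y \<le> (P y)\<^sup>2"
    proof (cases "y \<in> ball x0 \<epsilon>")
      case True
      then show ?thesis using power_mono[OF cap[OF True], of 2] pos by simp
    qed simp
  qed
  finally have "(M / 2)\<^sup>2 * (\<epsilon> / 4) ^ n \<le> (\<integral>y. (P y)\<^sup>2 \<partial>sphere_measure)" .
  moreover have "\<epsilon> / 4 = 1 / (48 * real n ^ 2 * (real k + 1))"
    by (simp add: \<epsilon>_def \<delta>_def)
  ultimately have "M\<^sup>2 / (4 * (48 * real n ^ 2 * (real k + 1)) ^ n) \<le> (\<integral>y. (P y)\<^sup>2 \<partial>sphere_measure)"
    by (simp add: power_divide)
  moreover have "4 * (48 * real n ^ 2 * (real k + 1)) ^ n > 0" using n1 by simp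
  ultimately have "M\<^sup>2 \<le> (4 * (48 * real n ^ 2) ^ n) * (real k + 1) ^ n * (\<integral>y. (P y)\<^sup>2 \<partial>sphere_measure)"
    by (simp add: divide_le_eq power_mult_distrib mult_ac)
  moreover have "(P x)\<^sup>2 \<le> M\<^sup>2" using power_mono[OF x0(2)[OF x], of 2] by (simp add: M_def)
  ultimately show ?thesis by simp
qed

section \<open>Orthonormal bases of spherical harmonics\<close>

locale sph =
  fixes Y :: "nat \<Rightarrow> nat \<Rightarrow> real^'n::finite \<Rightarrow> real" and d :: "nat \<Rightarrow> nat"
  assumes basis: "sph_basis Y d"
begin

lemma Y_sph_harm: "j \<in> {1..d k} \<Longrightarrow> Y k j \<in> sph_harm k"
  using basis by (auto simp: sph_basis_def)

lemma Y_poly: "j \<in> {1..d k} \<Longrightarrow> Y k j \<in> poly_fun"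
  using Y_sph_harm sph_harm_iff hom_polyD by blast

lemma Y_orth: "j \<in> {1..d k} \<Longrightarrow> j' \<in> {1..d k'} \<Longrightarrow>
    (\<integral>x. Y k j x * Y k' j' x \<partial>sphere_measure) = (if k = k' \<and> j = j' then 1 else 0)"
  using basis unfolding sph_basis_def by blast

lemma Y_span: "P \<in> sph_harm k \<Longrightarrow> \<exists>a. \<forall>x\<in>sphere 0 1. P x = (\<Sum>j=1..d k. a j * Y k j x)"
  using basis unfolding sph_basis_def by blast

lemma Y_comb_sph_harm: "(\<lambda>x. \<Sum>j=1..d k. a j * Y k j x) \<in> sph_harm k"
  by (intro sph_harm_sum sph_harm_cmult Y_sph_harm)

lemma Y_comb_poly: "(\<lambda>x. \<Sum>j=1..d k. a j * Y k j x) \<in> poly_fun"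
  using Y_comb_sph_harm sph_harm_iff hom_polyD by blast

lemma integrable_Y_mult: "f \<in> poly_fun \<Longrightarrow> j \<in> {1..d k} \<Longrightarrow> integrable sphere_measure (\<lambda>x. f x * Y k j x)"
  by (intro poly_fun_integrable_sphere pmult Y_poly)

lemma integral_Y_comb_Y:
  assumes "j \<in> {1..d k'}"
  shows "(\<integral>x. (\<Sum>i=1..d k. a i * Y k i x) * Y k' j x \<partial>sphere_measure) = (if k = k' then a j else 0)"
proof -
  have "(\<integral>x. (\<Sum>i=1..d k. a i * Y k i x) * Y k' j x \<partial>sphere_measure)
      = (\<integral>x. (\<Sum>i=1..d k. a i * (Y k i x * Y k' j x)) \<partial>sphere_measure)"
    by (simp add: sum_distrib_right mult.assoc)
  also have "\<dots> = (\<Sum>i=1..d k. a i * (\<integral>x. Y k i x * Y k' j x \<partial>sphere_measure))"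
    using assms by (subst Bochner_Integration.integral_sum) (auto intro!: integrable_mult_right integrable_Y_mult Y_poly)
  also have "\<dots> = (\<Sum>i=1..d k. if k = k' \<and> i = j then a i else 0)"
    using assms by (intro sum.cong refl) (auto simp: Y_orth)
  finally show ?thesis using assms by auto
qed

lemma integral_Y_comb_sq: "(\<integral>x. (\<Sum>i=1..d k. a i * Y k i x)\<^sup>2 \<partial>sphere_measure) = (\<Sum>i=1..d k. (a i)\<^sup>2)"
proof -
  have "(\<integral>x. (\<Sum>i=1..d k. a i * Y k i x)\<^sup>2 \<partial>sphere_measure)
      = (\<integral>x. (\<Sum>j=1..d k. a j * ((\<Sum>i=1..d k. a i * Y k i x) * Y k j x)) \<partial>sphere_measure)"
    by (intro Bochner_Integration.integral_cong refl) (simp add: power2_eq_square sum_distrib_left mult_ac)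
  also have "\<dots> = (\<Sum>j=1..d k. a j * (\<integral>x. (\<Sum>i=1..d k. a i * Y k i x) * Y k j x \<partial>sphere_measure))"
    by (subst Bochner_Integration.integral_sum) (auto intro!: integrable_mult_right integrable_Y_mult Y_comb_poly)
  also have "\<dots> = (\<Sum>j=1..d k. a j * a j)"
    by (intro sum.cong refl) (simp add: integral_Y_comb_Y)
  finally show ?thesis by (simp add: power2_eq_square)
qed

text \<open>For fixed \<open>x\<close> the sum \<open>Z\<close> of the squares of
  \<open>Y k j x\<close> is both the value at \<open>x\<close> and the squared L^2 norm of the
  spherical harmonic with coefficients \<open>Y k j x\<close>. The sup bound then reads
  \<open>Z\<^sup>2 \<le> C * (real k + 1) ^ CARD('n) * Z\<close>, which bounds \<open>Z\<close>;
  integrating \<open>Z\<close> over the sphere bounds \<open>d k\<close>.\<close>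

lemma growth_bounds:
  obtains C :: real where "C \<ge> 1" "\<And>k. real (d k) \<le> C * (real k + 1) ^ CARD('n)"
    "\<And>k j x. j \<in> {1..d k} \<Longrightarrow> x \<in> sphere 0 1 \<Longrightarrow> \<bar>Y k j x\<bar> \<le> C * (real k + 1) ^ CARD('n)"
proof -
  define C where "C = 4 * (48 * real CARD('n) ^ 2) ^ CARD('n)"
  have "(1::real) ^ CARD('n) \<le> (48 * real CARD('n) ^ 2) ^ CARD('n)"
  proof (intro power_mono)
    have "1 \<le> real CARD('n) ^ 2" by (intro one_le_power) simp
    then show "1 \<le> 48 * real CARD('n) ^ 2" by linarith
  qed simp
  then have C1: "C \<ge> 1" by (simp add: C_def)
  have Z: "(\<Sum>j=1..d k. (Y k j x)\<^sup>2) \<le> C * (real k + 1) ^ CARD('n)" if x: "x \<in> sphere 0 1" for k x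
  proof -
    define Z where "Z = (\<Sum>j=1..d k. (Y k j x)\<^sup>2)"
    have "Z\<^sup>2 \<le> C * (real k + 1) ^ CARD('n) * Z"
      using sph_harm_sup_le_L2[OF Y_comb_sph_harm[of "\<lambda>j. Y k j x" k] x] integral_Y_comb_sq[where k = k and a = "\<lambda>j. Y k j x"]
      by (simp add: Z_def C_def power2_eq_square)
    moreover have "Z \<ge> 0" by (simp add: Z_def sum_nonneg)
    ultimately have "Z \<le> C * (real k + 1) ^ CARD('n)"
      using C1 by (cases "Z = 0") (auto simp: power2_eq_square)
    then show ?thesis by (simp add: Z_def)
  qed
  have dk: "real (d k) \<le> C * (real k + 1) ^ CARD('n)" for k
  proof -
    have "real (d k) = (\<Sum>j=1..d k. (\<integral>x. (Y k j x)\<^sup>2 \<partial>sphere_measure))"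
      by (simp add: power2_eq_square Y_orth)
    also have "\<dots> = (\<integral>x. (\<Sum>j=1..d k. (Y k j x)\<^sup>2) \<partial>sphere_measure)"
      by (subst Bochner_Integration.integral_sum) (auto intro!: poly_fun_integrable_sphere poly_fun_power Y_poly)
    also have "\<dots> \<le> C * (real k + 1) ^ CARD('n)"
      by (rule abs_le_D1, rule sphere_integrable(2))
         (auto intro!: Z poly_fun_measurable poly_fun_sum poly_fun_power Y_poly simp: abs_of_nonneg sum_nonneg simp del: mem_sphere)
    finally show ?thesis .
  qed
  have Yb: "\<bar>Y k j x\<bar> \<le> C * (real k + 1) ^ CARD('n)" if "j \<in> {1..d k}" "x \<in> sphere 0 1" for k j x
  proof -
    let ?D = "C * (real k + 1) ^ CARD('n)"
    \<comment> \<open>As \<open>?D\<close> is at least 1, the bound \<open>?D\<close> on the square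
      may be weakened to \<open>?D\<^sup>2\<close>, which bounds \<open>Y k j x\<close> itself with
      the same constant.\<close>
    have "1 * 1 \<le> ?D" using C1 by (intro mult_mono) auto
    have "(Y k j x)\<^sup>2 \<le> (\<Sum>j=1..d k. (Y k j x)\<^sup>2)"
      using that(1) by (intro member_le_sum) auto
    also have "\<dots> \<le> ?D" using Z that by blast
    also have "\<dots> \<le> ?D\<^sup>2" using \<open>1 * 1 \<le> ?D\<close> by (intro self_le_power) auto
    finally show ?thesis using \<open>1 * 1 \<le> ?D\<close> by (metis abs_le_square_iff abs_of_nonneg linear mult_1 order_trans zero_le_one)
  qed
  show ?thesis using that[OF C1 dk Yb] .
qed

end

section \<open>Expansions of harmonic functions\<close>

text \<open>Differentiating a power series multiplies its coefficients by about \<open>k\<close>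
  without shrinking the disc of convergence. The induction on \<open>p\<close> therefore carries a
  dominating coefficient sequence \<open>c\<close> and passes to \<open>diffs c\<close>.\<close>

lemma summable_poly_geometric:
  fixes x :: real
  assumes "0 \<le> x" "x < 1" shows "summable (\<lambda>k. (real k + 1) ^ p * x ^ k)"
proof -
  have "\<exists>c. (\<forall>k. (real k + 1) ^ p \<le> c k) \<and> (\<forall>x. norm x < 1 \<longrightarrow> summable (\<lambda>k. c k * x ^ k :: real))"
  proof (induction p)
    case 0
    then show ?case by (intro exI[of _ "\<lambda>k. 1"]) (auto intro: summable_geometric)
  next
    case (Suc p)
    then obtain c where c: "\<And>k. (real k + 1) ^ p \<le> c k"
      "\<And>x. norm x < 1 \<Longrightarrow> summable (\<lambda>k. c k * x ^ k :: real)" by blast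
    have "(real k + 1) ^ Suc p \<le> diffs c k" for k
    proof -
      have "(real k + 1) ^ p \<le> (real (Suc k) + 1) ^ p" by (intro power_mono) auto
      also have "\<dots> \<le> c (Suc k)" by (rule c)
      finally show ?thesis by (simp add: diffs_def mult_left_mono add.commute)
    qed
    moreover have "summable (\<lambda>k. diffs c k * x ^ k)" if "norm x < 1" for x :: real
      by (rule termdiff_converges[OF that]) (use c in auto)
    ultimately show ?case by blast
  qed
  then obtain c where c: "\<And>k. (real k + 1) ^ p \<le> c k" "summable (\<lambda>k. c k * x ^ k)"
    using assms by force
  show ?thesis
    by (rule summable_comparison_test'[OF c(2), of 0]) (use c(1) assms in \<open>auto intro!: mult_right_mono\<close>)
qed

lemma bounded_poly_geometric:
  fixes x :: real
  assumes "0 \<le> x" "x < 1" obtains C where "\<And>k. (real k + 1) ^ p * x ^ k \<le> C"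
proof -
  have "bounded (range (\<lambda>k. (real k + 1) ^ p * x ^ k))"
    using summable_LIMSEQ_zero[OF summable_poly_geometric[OF assms]] convergent_imp_bounded by blast
  then obtain C where C: "\<forall>y\<in>range (\<lambda>k. (real k + 1) ^ p * x ^ k). norm y \<le> C" unfolding bounded_iff by blast
  show ?thesis by (rule that[of C]) (use C in \<open>auto dest!: abs_le_D1\<close>)
qed

text \<open>Only positive radii are available, since the series come from radial expansions; the
  constant term is the limit from the right of a function that is 0 there.\<close>

lemma power_series_zero_coeff_0:
  fixes c :: "nat \<Rightarrow> real"
  assumes s: "s > 0" and c: "\<And>r. 0 < r \<Longrightarrow> r < s \<Longrightarrow> (\<lambda>k. c k * r ^ k) sums 0"
  shows "c 0 = 0"
proof -
  have sm: "summable (\<lambda>k. c k * x ^ k)" if "norm x < s" for x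
  proof -
    define y where "y = (norm x + s) / 2"
    have y: "norm x < y" "y < s" using that by (auto simp: y_def)
    then have y0: "0 < y" by (meson norm_ge_zero order.strict_trans1)
    show ?thesis
      by (rule powser_inside[OF sums_summable[OF c[OF y0 y(2)]]]) (use y y0 in simp)
  qed
  have "((\<lambda>x. \<Sum>k. c k * x ^ k) \<longlongrightarrow> c 0) (at 0)"
    by (rule powser_limit_0[OF s]) (use sm in \<open>auto intro: summable_sums\<close>)
  then have "((\<lambda>x. \<Sum>k. c k * x ^ k) \<longlongrightarrow> c 0) (at_right 0)"
    by (rule tendsto_mono[rotated]) (simp add: at_le)
  moreover have "\<forall>\<^sub>F x in at_right 0. (\<Sum>k. c k * x ^ k) = 0"
    unfolding eventually_at_right_field
    by (intro exI[of _ s] conjI s allI impI) (rule sums_unique[OF c, symmetric])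
  ultimately have "((\<lambda>x. 0) \<longlongrightarrow> c 0) (at_right (0::real))"
    by (rule Lim_transform_eventually)
  then show ?thesis
    by (metis tendsto_const_iff trivial_limit_at_right_real)
qed

lemma power_series_zero_coeff:
  fixes c :: "nat \<Rightarrow> real"
  assumes "s > 0" "\<And>r. 0 < r \<Longrightarrow> r < s \<Longrightarrow> (\<lambda>k. c k * r ^ k) sums 0"
  shows "c k = 0"
  using assms(2)
proof (induction k arbitrary: c)
  case 0
  then show ?case by (rule power_series_zero_coeff_0[OF assms(1)])
next
  case (Suc k)
  have c0: "c 0 = 0" by (rule power_series_zero_coeff_0[OF assms(1) Suc.prems])
  show ?case
  proof (rule Suc.IH)
    fix r :: real assume r: "0 < r" "r < s"
    have "(\<lambda>k. c (Suc k) * r ^ Suc k) sums 0"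
      using Suc.prems[OF r] sums_Suc_iff[of "\<lambda>k. c k * r ^ k" 0] c0 by simp
    then have "(\<lambda>k. r * (c (Suc k) * r ^ k)) sums 0" by (simp add: mult_ac)
    then show "(\<lambda>k. c (Suc k) * r ^ k) sums 0" using sums_mult_D r by fastforce
  qed
qed

section \<open>Partial derivatives and locally uniform series\<close>

lemma has_partial_cong:
  fixes f g :: "real^'n::finite \<Rightarrow> real"
  assumes "open U" "x \<in> U" "\<And>y. y \<in> U \<Longrightarrow> f y = g y"
    and "((\<lambda>t. g (x + t *\<^sub>R axis i 1)) has_real_derivative D) (at 0)"
  shows "((\<lambda>t. f (x + t *\<^sub>R axis i 1)) has_real_derivative D) (at 0)"
proof (rule has_field_derivative_transform_within_open[OF assms(4)])
  show "open ((\<lambda>t. x + t *\<^sub>R axis i (1::real)) -` U)"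
    by (intro open_vimage assms continuous_intros)
qed (use assms in auto)

lemma has_partial_imp_dpart:
  "((\<lambda>t. f (x + t *\<^sub>R axis i 1)) has_real_derivative D) (at 0) \<Longrightarrow> dpart i f x = D"
  unfolding dpart_def by (rule DERIV_imp_deriv)

text \<open>\<open>harmonic_on\<close> provides partial derivatives rather than joint
  differentiability, so continuity is proved by travelling from \<open>x\<close> to \<open>z\<close>
  one coordinate at a time and applying the mean value theorem on each edge. The local bounds on the
  partial derivatives come from their continuity on a compact ball.\<close>

lemma continuous_on_of_partials:
  fixes g :: "real^'n::finite \<Rightarrow> real"
  assumes U: "open U"
    and D: "\<And>x i. x \<in> U \<Longrightarrow> ((\<lambda>t. g (x + t *\<^sub>R axis i 1)) has_real_derivative G i x) (at 0)"
    and G: "\<And>i. continuous_on U (G i)"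
  shows "continuous_on U g"
proof -
  have "isCont g x" if x: "x \<in> U" for x
  proof -
    obtain e where e: "e > 0" "cball x e \<subseteq> U" using U x open_contains_cball by blast
    have "\<exists>B. \<forall>y\<in>cball x e. \<bar>G i y\<bar> \<le> B" for i
    proof -
      have "bounded (G i ` cball x e)"
        by (intro compact_imp_bounded compact_continuous_image continuous_on_subset[OF G e(2)] compact_cball)
      then show ?thesis by (auto simp: bounded_iff)
    qed
    then obtain B where B: "\<And>i y. y \<in> cball x e \<Longrightarrow> \<bar>G i y\<bar> \<le> B i" by metis
    define L where "L = (\<Sum>i\<in>UNIV. \<bar>B i\<bar>)"
    have L: "\<bar>G i y\<bar> \<le> L" if "y \<in> cball x e" for i y
    proof -
      have "\<bar>G i y\<bar> \<le> \<bar>B i\<bar>" using B[OF that, of i] by simp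
      also have "\<dots> \<le> L" unfolding L_def by (intro member_le_sum) auto
      finally show ?thesis .
    qed
    have L0: "L \<ge> 0" by (simp add: L_def sum_nonneg)
    have est: "\<bar>g z - g x\<bar> \<le> L * (real CARD('n) * dist x z)" if z: "dist x z * real CARD('n) < e" for z
    proof -
      \<comment> \<open>\<open>w I\<close> is the vertex of the path reached after the coordinates
        in \<open>I\<close> have been changed. At most \<open>CARD('n)\<close> edges of length at
        most \<open>dist x z\<close> occur, so the assumption on \<open>z\<close> keeps the whole
        path in the compact ball.\<close>
      define w where "w I = x + (\<Sum>i\<in>I. ((z - x) $ i) *\<^sub>R axis i (1::real))" for I
      have comp: "\<bar>(z - x) $ i\<bar> \<le> dist x z" for i
        using component_le_norm_cart[of "z - x" i] by (simp add: dist_norm norm_minus_commute)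
      have near: "x + (\<Sum>i\<in>I. (t i * (z - x) $ i) *\<^sub>R axis i (1::real)) \<in> cball x e"
        if "\<And>i. \<bar>t i\<bar> \<le> 1" for I t
      proof -
        have "norm (\<Sum>i\<in>I. (t i * (z - x) $ i) *\<^sub>R axis i (1::real)) \<le> (\<Sum>i\<in>I. dist x z)"
        proof (rule sum_norm_le)
          fix i
          have "\<bar>t i\<bar> * \<bar>(z - x) $ i\<bar> \<le> 1 * dist x z"
            using that comp by (intro mult_mono) auto
          then show "norm ((t i * (z - x) $ i) *\<^sub>R axis i (1::real) :: real^'n) \<le> dist x z"
            by (simp add: abs_mult)
        qed
        also have "\<dots> \<le> (\<Sum>i\<in>(UNIV::'n set). dist x z)" by (intro sum_mono2) auto
        finally show ?thesis using z by (simp add: dist_norm mult.commute)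
      qed
      have "\<bar>g (w I) - g x\<bar> \<le> L * (\<Sum>i\<in>I. \<bar>(z - x) $ i\<bar>)" for I
      proof (induction I rule: infinite_finite_induct)
        case (insert i I)
        let ?c = "(z - x) $ i"
        have wi: "w (insert i I) = w I + ?c *\<^sub>R axis i 1" using insert by (simp add: w_def algebra_simps)
        have inU: "w I + (s * ?c) *\<^sub>R axis i 1 \<in> cball x e" if "\<bar>s\<bar> \<le> 1" for s
        proof -
          have "w I + (s * ?c) *\<^sub>R axis i 1
            = x + (\<Sum>j\<in>insert i I. ((if j = i then s else 1) * (z - x) $ j) *\<^sub>R axis j (1::real))"
          proof -
            have "(\<Sum>j\<in>I. ((if j = i then s else 1) * (z - x) $ j) *\<^sub>R axis j (1::real))
               = (\<Sum>j\<in>I. ((z - x) $ j) *\<^sub>R axis j (1::real))"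
              using insert by (intro sum.cong) auto
            then show ?thesis using insert(1,2) by (simp add: w_def algebra_simps)
          qed
          then show ?thesis using near[of "\<lambda>j. if j = i then s else 1" "insert i I"] that by simp
        qed
        have Dl: "((\<lambda>s. g (w I + (s * ?c) *\<^sub>R axis i 1)) has_real_derivative ?c * G i (w I + (s * ?c) *\<^sub>R axis i 1)) (at s)"
          if "0 \<le> s" "s \<le> 1" for s
        proof -
          have "w I + (s * ?c) *\<^sub>R axis i 1 \<in> U" using inU[of s] that e by auto
          from D[OF this, of i]
          have "((\<lambda>t. g (w I + (t + s * ?c) *\<^sub>R axis i 1)) has_real_derivative G i (w I + (s * ?c) *\<^sub>R axis i 1)) (at 0)"
            by (simp add: algebra_simps)
          then have A: "((\<lambda>t. g (w I + t *\<^sub>R axis i 1)) has_real_derivative G i (w I + (s * ?c) *\<^sub>R axis i 1)) (at (s * ?c))"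
            using DERIV_shift[of "\<lambda>t. g (w I + t *\<^sub>R axis i 1)" _ 0 "s * ?c"] by simp
          have B: "((\<lambda>s. s * ?c) has_real_derivative ?c) (at s)" by (auto intro!: derivative_eq_intros)
          from DERIV_chain2[of "\<lambda>t. g (w I + t *\<^sub>R axis i 1)" _ "\<lambda>s. s * ?c", OF A B]
          show ?thesis by (simp only: mult.commute)
        qed
        obtain s where s: "0 < s" "s < 1"
          "g (w I + (1 * ?c) *\<^sub>R axis i 1) - g (w I + (0 * ?c) *\<^sub>R axis i 1) = (1 - 0) * (?c * G i (w I + (s * ?c) *\<^sub>R axis i 1))"
          using MVT2[of 0 1 "\<lambda>s. g (w I + (s * ?c) *\<^sub>R axis i 1)" "\<lambda>s. ?c * G i (w I + (s * ?c) *\<^sub>R axis i 1)"] Dl by auto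
        have "\<bar>?c * G i (w I + (s * ?c) *\<^sub>R axis i 1)\<bar> \<le> \<bar>?c\<bar> * L"
          unfolding abs_mult by (intro mult_left_mono L inU) (use s in auto)
        then have "\<bar>g (w (insert i I)) - g (w I)\<bar> \<le> L * \<bar>?c\<bar>"
          using s(3) wi by (simp add: mult.commute)
        then have "\<bar>g (w (insert i I)) - g x\<bar> \<le> L * (\<Sum>i\<in>I. \<bar>(z - x) $ i\<bar>) + L * \<bar>?c\<bar>"
          using insert.IH by linarith
        then show ?case using insert(1,2) by (simp add: algebra_simps)
      qed (simp_all add: w_def)
      moreover have "w UNIV = z"
        using basis_expansion[of "z - x"] by (simp add: w_def scalar_mult_eq_scaleR)
      moreover have "(\<Sum>i\<in>UNIV. \<bar>(z - x) $ i\<bar>) \<le> (\<Sum>i\<in>(UNIV::'n set). dist x z)"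
        by (intro sum_mono comp)
      ultimately have "\<bar>g z - g x\<bar> \<le> L * (\<Sum>i\<in>UNIV. \<bar>(z - x) $ i\<bar>)"
        "L * (\<Sum>i\<in>UNIV. \<bar>(z - x) $ i\<bar>) \<le> L * (\<Sum>i\<in>(UNIV::'n set). dist x z)"
        using L0 by (auto simp: mult_left_mono)
      then show ?thesis by simp
    qed
    have lim0: "((\<lambda>z. g z - g x) \<longlongrightarrow> 0) (at x)"
    proof (rule Lim_null_comparison)
      show "\<forall>\<^sub>F z in at x. norm (g z - g x) \<le> L * (real CARD('n) * dist x z)"
        unfolding eventually_at using e(1) est
        by (intro exI[of _ "e / real CARD('n)"]) (auto simp: field_simps dist_commute)
      have "((\<lambda>z. L * (real CARD('n) * dist x z)) \<longlongrightarrow> L * (real CARD('n) * dist x x)) (at x)"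
        by (intro tendsto_intros)
      then show "((\<lambda>z. L * (real CARD('n) * dist x z)) \<longlongrightarrow> 0) (at x)" by simp
    qed
    then show ?thesis by (simp add: isCont_def LIM_zero_iff)
  qed
  then show ?thesis by (simp add: continuous_at_imp_continuous_on)
qed

lemma harmonic_on_partials:
  assumes "harmonic_on U f" "x \<in> U"
  shows "((\<lambda>t. f (x + t *\<^sub>R axis i 1)) has_real_derivative dpart i f x) (at 0)"
    and "((\<lambda>t. dpart j f (x + t *\<^sub>R axis i 1)) has_real_derivative dpart i (dpart j f) x) (at 0)"
  using assms DERIV_deriv_iff_real_differentiable unfolding harmonic_on_def dpart_def by blast+

text \<open>Continuity climbs two steps: from the second derivatives to the first ones, and from
  these to \<open>f\<close>.\<close>

lemma harmonic_on_continuous: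
  assumes "harmonic_on U f" shows "continuous_on U f"
proof -
  have U: "open U" and c: "\<And>i j. continuous_on U (dpart i (dpart j f))"
    using assms by (auto simp: harmonic_on_def)
  have d: "continuous_on U (dpart j f)" for j
    by (rule continuous_on_of_partials[OF U harmonic_on_partials(2)[OF assms] c])
  show ?thesis
    by (rule continuous_on_of_partials[OF U harmonic_on_partials(1)[OF assms] d])
qed

text \<open>Summable bounds on the terms over smaller balls suffice: by the gradient estimate the
  derivatives satisfy bounds of the same kind, half of the distance from the ball of radius
  \<open>r\<close> to the unit sphere serving as radius. The property \<open>good\<close> records
  this and is preserved by \<open>dpart\<close>, so termwise differentiation can be applied
  twice.\<close>

lemma poly_harmonic_series:
  fixes p :: "nat \<Rightarrow> real^'n::finite \<Rightarrow> real"
  assumes p: "\<And>k. p k \<in> poly_fun" "\<And>k x. lap (p k) x = 0"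
    and bd: "\<And>r. 0 < r \<Longrightarrow> r < 1 \<Longrightarrow> \<exists>w. summable w \<and> (\<forall>k x. norm x \<le> r \<longrightarrow> \<bar>p k x\<bar> \<le> w k)"
    and f: "\<And>x. x \<in> ball 0 1 \<Longrightarrow> f x = (\<Sum>k. p k x)"
  shows "harmonic_on (ball 0 1) f"
proof -
  define good where "good q \<longleftrightarrow> (\<forall>k. q k \<in> poly_fun) \<and> (\<forall>k x. lap (q k) x = 0) \<and>
      (\<forall>r. 0 < r \<and> r < 1 \<longrightarrow> (\<exists>w. summable w \<and> (\<forall>k x. norm x \<le> r \<longrightarrow> \<bar>q k x\<bar> \<le> w k)))"
    for q :: "nat \<Rightarrow> real^'n \<Rightarrow> real"
  have good_dpart: "good (\<lambda>k. dpart i (q k))" if q: "good q" for q i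
    unfolding good_def
  proof (intro conjI allI impI)
    fix k x show "dpart i (q k) \<in> poly_fun" using q by (simp add: good_def poly_fun_dpart(1))
    have "lap (q k) = (\<lambda>x. 0)" using q by (auto simp: good_def)
    then show "lap (dpart i (q k)) x = 0" using q by (simp add: lap_dpart good_def dpart_const)
  next
    fix r :: real assume r: "0 < r \<and> r < 1"
    define \<delta> where "\<delta> = (1 - r) / 2"
    have \<delta>: "\<delta> > 0" "0 < r + \<delta>" "r + \<delta> < 1" using r by (auto simp: \<delta>_def field_simps)
    then obtain w where w: "summable w" "\<And>k x. norm x \<le> r + \<delta> \<Longrightarrow> \<bar>q k x\<bar> \<le> w k"
      using q unfolding good_def by blast
    have "\<bar>dpart i (q k) x\<bar> \<le> real CARD('n) * w k / \<delta>" if "norm x \<le> r" for k x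
    proof (rule poly_harmonic_dpart_bound[OF _ _ \<delta>(1)])
      fix y assume "y \<in> cball x \<delta>"
      then show "\<bar>q k y\<bar> \<le> w k"
        using that norm_triangle_sub[of y x] by (intro w) (simp add: dist_norm norm_minus_commute)
    qed (use q in \<open>auto simp: good_def\<close>)
    moreover have "summable (\<lambda>k. real CARD('n) * w k / \<delta>)"
      using w(1) by (intro summable_divide summable_mult)
    ultimately show "\<exists>w. summable w \<and> (\<forall>k x. norm x \<le> r \<longrightarrow> \<bar>dpart i (q k) x\<bar> \<le> w k)" by blast
  qed
  have good_summable: "summable (\<lambda>k. q k x)" if q: "good q" and x: "norm x < 1" for q x
  proof -
    define r where "r = (norm x + 1) / 2"
    have r: "norm x < r" "r < 1" using x by (auto simp: r_def)
    then have "0 < r" by (meson norm_ge_zero order.strict_trans1)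
    then obtain w where w: "summable w" "\<And>k x. norm x \<le> r \<Longrightarrow> \<bar>q k x\<bar> \<le> w k"
      using q r unfolding good_def by blast
    show ?thesis by (rule summable_comparison_test'[OF w(1), of 0]) (use w(2) r in auto)
  qed
  have good_deriv: "((\<lambda>t. \<Sum>k. q k (x + t *\<^sub>R axis i 1)) has_real_derivative (\<Sum>k. dpart i (q k) x)) (at 0)"
    if q: "good q" and x: "x \<in> ball 0 1" for q i x
  proof -
    define \<delta> where "\<delta> = (1 - norm x) / 2"
    have \<delta>: "\<delta> > 0" "0 < norm x + \<delta>" "norm x + \<delta> < 1" using x by (auto simp: \<delta>_def field_simps add_pos_nonneg)
    obtain w where w: "summable w" "\<And>k y. norm y \<le> norm x + \<delta> \<Longrightarrow> \<bar>dpart i (q k) y\<bar> \<le> w k"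
      using good_dpart[OF q, of i] \<delta> unfolding good_def by blast
    have nb: "norm (x + t *\<^sub>R axis i (1::real)) \<le> norm x + \<delta>" if "\<bar>t\<bar> < \<delta>" for t
      using norm_triangle_ineq[of x "t *\<^sub>R axis i (1::real)"] that by simp
    have "((\<lambda>t. \<Sum>k. q k (x + t *\<^sub>R axis i 1)) has_real_derivative (\<Sum>k. dpart i (q k) (x + 0 *\<^sub>R axis i 1))) (at 0)"
    proof (rule has_field_derivative_series'(2)[where S = "ball 0 \<delta>" and ?x0.0 = 0])
      fix k and t :: real assume "t \<in> ball 0 \<delta>"
      have "((\<lambda>t. q k (x + t *\<^sub>R axis i 1)) has_real_derivative dpart i (q k) (x + t *\<^sub>R axis i 1)) (at t)"
        using poly_fun_line_at[of "q k" x "axis i 1" t] q by (simp add: sum_axis good_def)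
      then show "((\<lambda>t. q k (x + t *\<^sub>R axis i 1)) has_real_derivative dpart i (q k) (x + t *\<^sub>R axis i 1)) (at t within ball 0 \<delta>)"
        by (rule has_field_derivative_at_within)
    next
      show "uniformly_convergent_on (ball 0 \<delta>) (\<lambda>n t. \<Sum>k<n. dpart i (q k) (x + t *\<^sub>R axis i 1))"
        by (rule Weierstrass_m_test'[OF _ w(1)]) (use w(2) nb in auto)
      show "summable (\<lambda>n. q n (x + 0 *\<^sub>R axis i 1))" using good_summable[OF q] x by simp
      show "0 \<in> interior (ball 0 \<delta>)" using \<delta> by (simp add: interior_open)
    qed (use \<delta> in auto)
    then show ?thesis by simp
  qed
  have good_cont: "continuous_on (ball 0 1) (\<lambda>x. \<Sum>k. q k x)" if q: "good q" for q
  proof -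
    have "continuous_on (ball 0 r) (\<lambda>x. \<Sum>k. q k x)" if r: "0 < r" "r < 1" for r
    proof -
      obtain w where w: "summable w" "\<And>k x. norm x \<le> r \<Longrightarrow> \<bar>q k x\<bar> \<le> w k"
        using q r unfolding good_def by blast
      show ?thesis
      proof (rule uniform_limit_theorem)
        show "uniform_limit (ball 0 r) (\<lambda>n x. \<Sum>k<n. q k x) (\<lambda>x. \<Sum>k. q k x) sequentially"
          by (rule Weierstrass_m_test[OF _ w(1)]) (use w(2) in auto)
        show "\<forall>\<^sub>F n in sequentially. continuous_on (ball 0 r) (\<lambda>x. \<Sum>k<n. q k x)"
          using q by (intro always_eventually allI poly_fun_continuous poly_fun_sum) (simp add: good_def)
      qed simp
    qed
    then have "isCont (\<lambda>x. \<Sum>k. q k x) x" if "x \<in> ball 0 1" for x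
    proof -
      define r where "r = (norm x + 1) / 2"
      have r: "norm x < r" "r < 1" using that by (auto simp: r_def)
      then have "0 < r" by (meson norm_ge_zero order.strict_trans1)
      show ?thesis
        using \<open>\<And>r. 0 < r \<Longrightarrow> r < 1 \<Longrightarrow> continuous_on (ball 0 r) (\<lambda>x. \<Sum>k. q k x)\<close>[OF \<open>0 < r\<close> r(2)] r(1)
        by (simp add: continuous_on_eq_continuous_at)
    qed
    then show ?thesis by (simp add: continuous_at_imp_continuous_on)
  qed
  have gp: "good p" using p bd by (auto simp: good_def)
  note g1 = good_dpart[OF gp] note g2 = good_dpart[OF g1]
  have D1: "((\<lambda>t. f (x + t *\<^sub>R axis i 1)) has_real_derivative (\<Sum>k. dpart i (p k) x)) (at 0)" if "x \<in> ball 0 1" for x i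
    by (rule has_partial_cong[OF open_ball that f good_deriv[OF gp that]])
  have d1: "dpart i f x = (\<Sum>k. dpart i (p k) x)" if "x \<in> ball 0 1" for x i
    using has_partial_imp_dpart[OF D1[OF that]] .
  have D2: "((\<lambda>t. dpart j f (x + t *\<^sub>R axis i 1)) has_real_derivative (\<Sum>k. dpart i (dpart j (p k)) x)) (at 0)"
    if "x \<in> ball 0 1" for x i j
    by (rule has_partial_cong[OF open_ball that d1 good_deriv[OF g1 that]])
  have d2: "dpart i (dpart j f) x = (\<Sum>k. dpart i (dpart j (p k)) x)" if "x \<in> ball 0 1" for x i j
    using has_partial_imp_dpart[OF D2[OF that]] .
  show ?thesis
    unfolding harmonic_on_def
  proof (intro conjI ballI allI)
    fix x :: "real^'n" and i j assume x: "x \<in> ball 0 1"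
    show "(\<lambda>t. f (x + t *\<^sub>R axis i 1)) differentiable at 0"
      using D1[OF x] real_differentiable_def by blast
    show "(\<lambda>t. dpart j f (x + t *\<^sub>R axis i 1)) differentiable at 0"
      using D2[OF x] real_differentiable_def by blast
    have "(\<Sum>i\<in>UNIV. dpart i (dpart i f) x) = (\<Sum>i\<in>UNIV. \<Sum>k. dpart i (dpart i (p k)) x)"
      using d2[OF x] by simp
    also have "\<dots> = (\<Sum>k. \<Sum>i\<in>UNIV. dpart i (dpart i (p k)) x)"
      by (rule suminf_sum[symmetric]) (use good_summable[OF g2] x in auto)
    also have "\<dots> = 0" using p(2) by (simp add: lap_def)
    finally show "(\<Sum>i\<in>UNIV. dpart i (dpart i f) x) = 0" .
  next
    fix i j
    show "continuous_on (ball 0 1) (dpart i (dpart j f))"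
      by (subst continuous_on_cong[OF refl d2]) (auto intro: good_cont[OF g2])
  qed simp
qed

section \<open>Admissible coefficient arrays\<close>

context sph
begin

definition gC :: real where
  "gC = (SOME C. C \<ge> 1 \<and> (\<forall>k. real (d k) \<le> C * (real k + 1) ^ CARD('n)) \<and>
    (\<forall>k. \<forall>j\<in>{1..d k}. \<forall>x\<in>sphere 0 1. \<bar>Y k j x\<bar> \<le> C * (real k + 1) ^ CARD('n)))"

lemma gC: "gC \<ge> 1" "real (d k) \<le> gC * (real k + 1) ^ CARD('n)"
    "j \<in> {1..d k} \<Longrightarrow> x \<in> sphere 0 1 \<Longrightarrow> \<bar>Y k j x\<bar> \<le> gC * (real k + 1) ^ CARD('n)"
proof -
  obtain C where C: "C \<ge> 1" "\<And>k. real (d k) \<le> C * (real k + 1) ^ CARD('n)"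
    "\<And>k j x. j \<in> {1..d k} \<Longrightarrow> x \<in> sphere 0 1 \<Longrightarrow> \<bar>Y k j x\<bar> \<le> C * (real k + 1) ^ CARD('n)"
    using growth_bounds by blast
  have "gC \<ge> 1 \<and> (\<forall>k. real (d k) \<le> gC * (real k + 1) ^ CARD('n)) \<and>
    (\<forall>k. \<forall>j\<in>{1..d k}. \<forall>x\<in>sphere 0 1. \<bar>Y k j x\<bar> \<le> gC * (real k + 1) ^ CARD('n))"
    unfolding gC_def by (rule someI[of _ C]) (use C in blast)
  then show "gC \<ge> 1" "real (d k) \<le> gC * (real k + 1) ^ CARD('n)"
    "j \<in> {1..d k} \<Longrightarrow> x \<in> sphere 0 1 \<Longrightarrow> \<bar>Y k j x\<bar> \<le> gC * (real k + 1) ^ CARD('n)"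
    by blast+
qed

definition hcomp :: "(nat \<Rightarrow> nat \<Rightarrow> real) \<Rightarrow> nat \<Rightarrow> real^'n \<Rightarrow> real" where
  "hcomp a k x = (\<Sum>j=1..d k. a k j * Y k j x)"

text \<open>A bound for the component of degree \<open>k\<close> on the whole sphere, computed from
  the absolute values of the coefficients alone. It is the Weierstrass majorant of nearly every
  termwise argument below.\<close>

definition wt :: "(nat \<Rightarrow> nat \<Rightarrow> real) \<Rightarrow> nat \<Rightarrow> real" where
  "wt a k = (\<Sum>j=1..d k. \<bar>a k j\<bar>) * (gC * (real k + 1) ^ CARD('n))"

text \<open>Coefficient sequences whose expansion converges absolutely on every smaller ball.\<close>

definition adm :: "(nat \<Rightarrow> nat \<Rightarrow> real) \<Rightarrow> bool" where
  "adm a \<longleftrightarrow> (\<forall>R. 0 < R \<and> R < 1 \<longrightarrow> (\<exists>C. \<forall>k. \<forall>j\<in>{1..d k}. \<bar>a k j\<bar> * R ^ k \<le> C))"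

lemma hterm_eq: "hterm Y d a r x k = r ^ k * hcomp a k x"
  by (simp add: hterm_def hcomp_def)

lemma hcomp_sph_harm: "hcomp a k \<in> sph_harm k"
  unfolding hcomp_def[abs_def] by (rule Y_comb_sph_harm)

lemma hcomp_poly: "hcomp a k \<in> poly_fun"
  unfolding hcomp_def[abs_def] by (rule Y_comb_poly)

lemma hcomp_lap: "lap (hcomp a k) x = 0"
  using hcomp_sph_harm by (simp add: sph_harm_iff)

lemma hcomp_scale: "hcomp a k (r *\<^sub>R x) = r ^ k * hcomp a k x"
  using hcomp_sph_harm[of a k] hom_polyD(2)[of "hcomp a k" k] by (simp add: sph_harm_iff)

lemma hcomp_measurable [measurable]: "hcomp a k \<in> borel_measurable borel"
  by (rule poly_fun_measurable[OF hcomp_poly])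

lemma Y_measurable: "j \<in> {1..d k} \<Longrightarrow> Y k j \<in> borel_measurable borel"
  by (rule poly_fun_measurable[OF Y_poly])

lemma hcomp_cong: "(\<And>j. j \<in> {1..d k} \<Longrightarrow> a k j = b k j) \<Longrightarrow> hcomp a k x = hcomp b k x"
  unfolding hcomp_def by (intro sum.cong) auto

lemma hcomp_diff: "hcomp (\<lambda>k j. a k j - b k j) k x = hcomp a k x - hcomp b k x"
  by (simp add: hcomp_def left_diff_distrib sum_subtractf)

lemma hcomp_add: "hcomp (\<lambda>k j. a k j + b k j) k x = hcomp a k x + hcomp b k x"
  by (simp add: hcomp_def distrib_right sum.distrib)

lemma hcomp_mult: "hcomp (\<lambda>k j. m k * a k j) k x = m k * hcomp a k x"
  by (simp add: hcomp_def sum_distrib_left mult_ac)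

lemma wt_nonneg: "wt a k \<ge> 0"
  using gC(1) by (simp add: wt_def sum_nonneg)

lemma abs_hcomp_le: "x \<in> sphere 0 1 \<Longrightarrow> \<bar>hcomp a k x\<bar> \<le> wt a k"
proof -
  assume x: "x \<in> sphere 0 1"
  have "\<bar>hcomp a k x\<bar> \<le> (\<Sum>j=1..d k. \<bar>a k j * Y k j x\<bar>)" unfolding hcomp_def by (rule sum_abs)
  also have "\<dots> \<le> (\<Sum>j=1..d k. \<bar>a k j\<bar> * (gC * (real k + 1) ^ CARD('n)))"
    unfolding abs_mult using gC(3) x by (intro sum_mono mult_left_mono) auto
  finally show ?thesis by (simp add: wt_def sum_distrib_right)
qed

lemma abs_hcomp_norm_le: "\<bar>hcomp a k x\<bar> \<le> wt a k * norm x ^ k"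
  by (rule sph_harm_norm_bound[OF hcomp_sph_harm abs_hcomp_le])

lemma wt_le:
  assumes "\<And>j. j \<in> {1..d k} \<Longrightarrow> \<bar>a k j\<bar> \<le> B" "B \<ge> 0"
  shows "wt a k \<le> B * gC\<^sup>2 * (real k + 1) ^ (2 * CARD('n))"
proof -
  let ?D = "gC * (real k + 1) ^ CARD('n)"
  have D0: "?D \<ge> 0" using gC(1) by simp
  have "(\<Sum>j=1..d k. \<bar>a k j\<bar>) \<le> (\<Sum>j=1..d k. B)" using assms by (intro sum_mono) auto
  also have "\<dots> = real (d k) * B" by simp
  also have "\<dots> \<le> ?D * B" using gC(2) assms(2) by (intro mult_right_mono)
  finally have "wt a k \<le> (?D * B) * ?D" unfolding wt_def using D0 by (intro mult_right_mono)
  also have "\<dots> = B * gC\<^sup>2 * (real k + 1) ^ (2 * CARD('n))"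
    by (simp only: power2_eq_square mult_2 power_add) (simp only: mult_ac)
  finally show ?thesis .
qed

lemma adm_wt_summable:
  assumes a: "adm a" and r: "0 \<le> r" "r < 1"
  shows "summable (\<lambda>k. (real k + 1) ^ l * wt a k * r ^ k)"
proof -
  define R where "R = (1 + r) / 2"
  have R: "0 < R" "R < 1" "r < R" using r by (auto simp: R_def)
  obtain C where C: "\<And>k j. j \<in> {1..d k} \<Longrightarrow> \<bar>a k j\<bar> * R ^ k \<le> C" using a R unfolding adm_def by blast
  define B where "B = max C 0"
  have B: "B \<ge> 0" by (simp add: B_def)
  have aB: "\<bar>a k j\<bar> \<le> B / R ^ k" if "j \<in> {1..d k}" for k j
    using C[OF that] R by (simp add: B_def le_divide_eq)
  have "norm ((real k + 1) ^ l * wt a k * r ^ k) \<le> B * gC\<^sup>2 * ((real k + 1) ^ (l + 2 * CARD('n)) * (r / R) ^ k)" for k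
  proof -
    have "wt a k \<le> B / R ^ k * gC\<^sup>2 * (real k + 1) ^ (2 * CARD('n))"
      by (rule wt_le) (use B aB R in auto)
    then have "(real k + 1) ^ l * wt a k * r ^ k \<le> (real k + 1) ^ l * (B / R ^ k * gC\<^sup>2 * (real k + 1) ^ (2 * CARD('n))) * r ^ k"
      using r by (intro mult_right_mono mult_left_mono) auto
    also have "\<dots> = B * gC\<^sup>2 * ((real k + 1) ^ (l + 2 * CARD('n)) * (r / R) ^ k)"
      by (simp add: power_add power_divide)
    finally show ?thesis using wt_nonneg[of a k] r by (simp add: abs_mult)
  qed
  moreover have "summable (\<lambda>k. B * gC\<^sup>2 * ((real k + 1) ^ (l + 2 * CARD('n)) * (r / R) ^ k))"
    using r R by (intro summable_mult summable_poly_geometric) auto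
  ultimately show ?thesis by (meson summable_comparison_test')
qed

lemma adm_wt_summable0: "adm a \<Longrightarrow> 0 \<le> r \<Longrightarrow> r < 1 \<Longrightarrow> summable (\<lambda>k. wt a k * r ^ k)"
  using adm_wt_summable[of a r 0] by simp

lemma adm_poly:
  assumes "\<And>k j. j \<in> {1..d k} \<Longrightarrow> \<bar>a k j\<bar> \<le> C * (real k + 1) ^ p" "C \<ge> 0"
  shows "adm a"
  unfolding adm_def
proof (intro allI impI)
  fix R :: real assume R: "0 < R \<and> R < 1"
  then obtain B where B: "\<And>k. (real k + 1) ^ p * R ^ k \<le> B" using bounded_poly_geometric[of R p] by auto
  have "\<bar>a k j\<bar> * R ^ k \<le> C * B" if "j \<in> {1..d k}" for k j
  proof -
    have "\<bar>a k j\<bar> * R ^ k \<le> C * (real k + 1) ^ p * R ^ k" using assms that R by (intro mult_right_mono) auto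
    also have "\<dots> \<le> C * B" using B[of k] assms(2) by (simp add: mult.assoc mult_left_mono)
    finally show ?thesis .
  qed
  then show "\<exists>C. \<forall>k. \<forall>j\<in>{1..d k}. \<bar>a k j\<bar> * R ^ k \<le> C" by blast
qed

text \<open>Radius \<open>R\<close> for the product is bought with radius \<open>sqrt R\<close> for
  each factor. Closure under products is what keeps the image of an admissible array under an
  admissible multiplier admissible.\<close>

lemma adm_mult:
  assumes "adm a" "adm b" shows "adm (\<lambda>k j. a k j * b k j)"
  unfolding adm_def
proof (intro allI impI)
  fix R :: real assume R: "0 < R \<and> R < 1"
  then have s: "0 < sqrt R" "sqrt R < 1" by auto
  obtain A where A: "\<And>k j. j \<in> {1..d k} \<Longrightarrow> \<bar>a k j\<bar> * sqrt R ^ k \<le> A"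
    using assms(1)[unfolded adm_def, rule_format, of "sqrt R"] s by blast
  obtain B where B: "\<And>k j. j \<in> {1..d k} \<Longrightarrow> \<bar>b k j\<bar> * sqrt R ^ k \<le> B"
    using assms(2)[unfolded adm_def, rule_format, of "sqrt R"] s by blast
  have "\<bar>a k j * b k j\<bar> * R ^ k \<le> A * B" if j: "j \<in> {1..d k}" for k j
  proof -
    have "sqrt R ^ k * sqrt R ^ k = R ^ k" using R by (simp only: power_mult_distrib[symmetric]) simp
    then have "\<bar>a k j * b k j\<bar> * R ^ k = (\<bar>a k j\<bar> * sqrt R ^ k) * (\<bar>b k j\<bar> * sqrt R ^ k)"
      by (metis abs_mult mult.assoc mult.left_commute)
    also have "\<dots> \<le> A * B"
    proof (rule mult_mono[OF A[OF j] B[OF j]])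
      have "0 \<le> \<bar>a k j\<bar> * sqrt R ^ k" using s by simp
      then show "0 \<le> A" using A[OF j] by simp
    qed (use s in simp)
    finally show ?thesis .
  qed
  then show "\<exists>C. \<forall>k. \<forall>j\<in>{1..d k}. \<bar>a k j * b k j\<bar> * R ^ k \<le> C" by blast
qed

text \<open>Homogeneity absorbs the radius, so the polar form becomes a series of harmonic
  polynomials in \<open>x\<close>. The origin conforms because dividing it by its norm gives 0
  again.\<close>

lemma hseries_eq: "hseries Y d a x = (\<Sum>k. hcomp a k x)"
proof -
  have "hterm Y d a (norm x) (x /\<^sub>R norm x) k = hcomp a k x" for k
    unfolding hterm_eq hcomp_scale[symmetric] by (cases "x = 0") auto
  then have "hterm Y d a (norm x) (x /\<^sub>R norm x) = (\<lambda>k. hcomp a k x)" by (rule ext)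
  then show ?thesis by (simp add: hseries_def)
qed

lemma adm_hcomp_summable:
  assumes "adm a" "norm x < 1" shows "summable (\<lambda>k. \<bar>hcomp a k x\<bar>)"
  by (rule summable_comparison_test'[OF adm_wt_summable0[OF assms(1) norm_ge_zero assms(2)], of 0])
     (simp add: abs_hcomp_norm_le)

lemma adm_sums:
  assumes a: "adm a" and r: "0 \<le> r" "r < 1" and x: "x \<in> sphere 0 1"
  shows "hterm Y d a r x sums hseries Y d a (r *\<^sub>R x)"
proof -
  have "norm (r *\<^sub>R x) < 1" using r x by simp
  then have "summable (\<lambda>k. hcomp a k (r *\<^sub>R x))"
    by (intro summable_rabs_cancel[OF adm_hcomp_summable[OF a]])
  then have "(\<lambda>k. hcomp a k (r *\<^sub>R x)) sums hseries Y d a (r *\<^sub>R x)"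
    unfolding hseries_eq by (rule summable_sums)
  then show ?thesis by (simp add: hcomp_scale hterm_eq[abs_def])
qed

lemma adm_hseries_conv: "adm a \<Longrightarrow> hseries_conv Y d a"
  unfolding hseries_conv_def by (auto intro!: sums_summable[OF adm_sums])

lemma adm_harmonic:
  assumes a: "adm a" shows "harmonic_on (ball 0 1) (hseries Y d a)"
proof (rule poly_harmonic_series[where p = "hcomp a"])
  fix r :: real assume r: "0 < r" "r < 1"
  have "\<bar>hcomp a k x\<bar> \<le> wt a k * r ^ k" if "norm x \<le> r" for k x
  proof -
    have "wt a k * norm x ^ k \<le> wt a k * r ^ k"
      by (intro mult_left_mono power_mono that norm_ge_zero wt_nonneg)
    then show ?thesis using abs_hcomp_norm_le[of a k x] by simp
  qed
  then show "\<exists>w. summable w \<and> (\<forall>k x. norm x \<le> r \<longrightarrow> \<bar>hcomp a k x\<bar> \<le> w k)"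
    using adm_wt_summable0[OF a] r by (intro exI[of _ "\<lambda>k. wt a k * r ^ k"]) auto
qed (auto simp: hcomp_poly hcomp_lap hseries_eq)

lemma integral_hcomp_Y: "j \<in> {1..d k'} \<Longrightarrow> (\<integral>x. hcomp a k x * Y k' j x \<partial>sphere_measure) = (if k = k' then a k j else 0)"
  unfolding hcomp_def by (rule integral_Y_comb_Y)

text \<open>In a fixed direction the difference of the expansions is a power series in
  \<open>r\<close> vanishing near 0, so every component vanishes on the sphere, and integration
  against \<open>Y k j\<close> isolates one coefficient. Agreement for small radii is enough, which
  allows expansions obtained on balls of different sizes to be compared.\<close>

lemma expansion_unique:
  assumes s: "s > 0"
    and ab: "\<And>r x. 0 < r \<Longrightarrow> r < s \<Longrightarrow> x \<in> sphere 0 1 \<Longrightarrow> hterm Y d a r x sums v r x \<and> hterm Y d b r x sums v r x"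
    and j: "j \<in> {1..d k}"
  shows "a k j = b k j"
proof -
  let ?c = "\<lambda>k j. a k j - b k j"
  have z: "hcomp ?c k x = 0" if x: "x \<in> sphere 0 1" for x
  proof (rule power_series_zero_coeff[OF s])
    fix r assume r: "0 < r" "r < s"
    have "(\<lambda>k. hterm Y d a r x k - hterm Y d b r x k) sums (v r x - v r x)"
      using ab[OF r x] by (intro sums_diff) auto
    then show "(\<lambda>k. hcomp ?c k x * r ^ k) sums 0"
      by (simp add: hterm_eq hcomp_diff algebra_simps)
  qed
  have "?c k j = (\<integral>x. hcomp ?c k x * Y k j x \<partial>sphere_measure)"
    using integral_hcomp_Y[OF j, of ?c k] by simp
  also have "\<dots> = (\<integral>x. 0 \<partial>(sphere_measure :: (real^'n) measure))"
    by (rule integral_cong_sphere) (use z Y_measurable[OF j] in auto)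
  finally show ?thesis by simp
qed

text \<open>\<open>hcoef\<close> is a choice among expansions, pinned down only at indices
  \<open>j \<in> {1..d k}\<close>. Later comparisons of coefficients are therefore restricted to
  that range.\<close>

lemma hcoef_eq:
  assumes "\<And>r x. 0 \<le> r \<Longrightarrow> r < 1 \<Longrightarrow> x \<in> sphere 0 1 \<Longrightarrow> hterm Y d b r x sums f (r *\<^sub>R x)" and j: "j \<in> {1..d k}"
  shows "hcoef Y d f k j = b k j"
proof -
  have "\<forall>r\<in>{0..<1}. \<forall>x'\<in>sphere 0 1. hterm Y d (hcoef Y d f) r x' sums f (r *\<^sub>R x')"
    unfolding hcoef_def by (rule someI[of _ b]) (use assms in auto)
  then show ?thesis
    by (intro expansion_unique[of 1 "hcoef Y d f" "\<lambda>r x. f (r *\<^sub>R x)" b, OF _ _ j]) (use assms in auto)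
qed

section \<open>Finite expansions and their density on the sphere\<close>

definition trig :: "(nat \<Rightarrow> nat \<Rightarrow> real) \<Rightarrow> nat \<Rightarrow> real^'n \<Rightarrow> real" where
  "trig b K x = (\<Sum>k<K. hcomp b k x)"

lemma trig_poly: "trig b K \<in> poly_fun"
  unfolding trig_def[abs_def] by (intro poly_fun_sum hcomp_poly)

text \<open>A \<open>trig\<close> is harmonic on the whole space, hence its own harmonic extension
  from the sphere to the ball. This makes it comparable with harmonic functions by the maximum
  principle.\<close>

lemma trig_lap: "lap (trig b K) x = 0"
  unfolding trig_def[abs_def] by (subst lap_sum) (auto simp: hcomp_poly hcomp_lap)

lemma trig_scale: "trig b K (r *\<^sub>R x) = (\<Sum>k<K. r ^ k * hcomp b k x)"
  by (simp add: trig_def hcomp_scale)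

lemma trig_extend:
  assumes "\<forall>k\<ge>K. \<forall>j. b k j = 0" "K \<le> L" shows "trig b L x = trig b K x"
  unfolding trig_def
  by (rule sum.mono_neutral_right) (use assms in \<open>auto simp: hcomp_def\<close>)

text \<open>On the sphere the factors \<open>(x \<bullet> x) ^ i\<close> of a Fischer decomposition
  equal 1, and each harmonic factor is a combination of the \<open>Y k j\<close> by the spanning
  hypothesis. The identity is thus one of functions on the sphere, not of polynomials.\<close>

lemma poly_fun_eq_trig:
  assumes "f \<in> poly_fun"
  shows "\<exists>b K. (\<forall>k\<ge>K. \<forall>j. b k j = 0) \<and> (\<forall>x\<in>sphere 0 1. f x = trig b K x)"
proof -
  define Q where "Q f \<longleftrightarrow> (\<exists>b K. (\<forall>k\<ge>K. \<forall>j. b k j = 0) \<and> (\<forall>x\<in>sphere 0 1. f x = trig b K x))"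
    for f :: "real^'n \<Rightarrow> real"
  have add: "Q (\<lambda>x. f x + g x)" if fg: "Q f" "Q g" for f g
  proof -
    obtain a K b L where a: "\<forall>k\<ge>K. \<forall>j. a k j = 0" "\<forall>x\<in>sphere 0 1. f x = trig a K x"
      and b: "\<forall>k\<ge>L. \<forall>j. b k j = 0" "\<forall>x\<in>sphere 0 1. g x = trig b L x"
      using fg unfolding Q_def by metis
    let ?c = "\<lambda>k j. a k j + b k j"
    have "trig a K x + trig b L x = trig ?c (max K L) x" for x
      using trig_extend[OF a(1), of "max K L" x] trig_extend[OF b(1), of "max K L" x]
      by (simp add: trig_def hcomp_add sum.distrib)
    then show ?thesis
      unfolding Q_def by (intro exI[of _ ?c] exI[of _ "max K L"]) (use a b in auto)
  qed
  have "Q f" if "fischer k f" for k f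
    using that
  proof induction
    case (fischer_term H k i)
    obtain a where a: "\<forall>x\<in>sphere 0 1. H x = (\<Sum>j=1..d k. a j * Y k j x)" using Y_span[OF fischer_term] by blast
    define b where "b k' j = (if k' = k then a j else 0)" for k' j
    have "trig b (Suc k) x = hcomp b k x" for x
      unfolding trig_def by (simp add: b_def hcomp_def)
    then have "trig b (Suc k) x = (\<Sum>j=1..d k. a j * Y k j x)" for x
      by (simp add: b_def hcomp_def)
    moreover have "x \<bullet> x = 1" if "x \<in> sphere 0 1" for x :: "real^'n"
      using that by (simp add: power2_norm_eq_inner[symmetric])
    ultimately show ?case
      unfolding Q_def using a
      by (intro exI[of _ b] exI[of _ "Suc k"]) (auto simp: b_def)
  qed (rule add)
  then have hom: "Q f" if "f \<in> hom_poly k" for f k using hom_poly_imp_fischer[OF that] by blast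
  have "hom_sum f" by (rule poly_fun_hom_sum[OF assms])
  then have "Q f" by induction (auto intro: hom add)
  then show ?thesis by (simp add: Q_def)
qed

lemma trig_dense:
  assumes "continuous_on (sphere 0 1) g" "\<epsilon> > 0"
  obtains b K where "\<forall>k\<ge>K. \<forall>j. b k j = 0" "\<And>x. x \<in> sphere 0 1 \<Longrightarrow> \<bar>g x - trig b K x\<bar> \<le> \<epsilon>"
proof -
  obtain p where p: "real_polynomial_function p" "\<And>x. x \<in> sphere 0 1 \<Longrightarrow> \<bar>g x - p x\<bar> < \<epsilon>"
    using Stone_Weierstrass_real_polynomial_function[OF compact_sphere assms] by blast
  obtain b K where b: "\<forall>k\<ge>K. \<forall>j. b k j = 0" "\<forall>x\<in>sphere 0 1. p x = trig b K x"
    using poly_fun_eq_trig[OF poly_fun_of_real_polynomial[OF p(1)]] by blast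
  show ?thesis by (rule that[OF b(1)]) (use b(2) p(2) in \<open>force intro: less_imp_le\<close>)
qed

lemma integral_trig_Y:
  assumes "\<forall>k\<ge>K. \<forall>j. b k j = 0" "j \<in> {1..d k}"
  shows "(\<integral>x. trig b K x * Y k j x \<partial>sphere_measure) = b k j"
proof -
  have "(\<integral>x. trig b K x * Y k j x \<partial>sphere_measure) = (\<Sum>k'<K. (\<integral>x. hcomp b k' x * Y k j x \<partial>sphere_measure))"
    unfolding trig_def sum_distrib_right
    using assms by (intro Bochner_Integration.integral_sum integrable_Y_mult hcomp_poly)
  also have "\<dots> = (\<Sum>k'<K. if k' = k then b k' j else 0)"
    by (intro sum.cong refl) (simp add: integral_hcomp_Y[OF assms(2)])
  finally show ?thesis using assms by simp
qed


text \<open>The coefficients are those of the boundary values. Approximating these within \<epsilon>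
  by a finite expansion changes the function in the ball by at most \<epsilon> and each coefficient
  by \<epsilon> times a power of \<open>k + 1\<close>; the finite expansion represents itself, so
  the series and \<open>g\<close> differ at a fixed point by a multiple of \<epsilon>.\<close>

lemma harmonic_expansion_cball:
  fixes g :: "real^'n \<Rightarrow> real"
  assumes g: "continuous_on (cball 0 1) g"
    and d1: "\<And>x i. x \<in> ball 0 1 \<Longrightarrow> ((\<lambda>t. g (x + t *\<^sub>R axis i 1)) has_real_derivative u1 i x) (at 0)"
    and d2: "\<And>x i. x \<in> ball 0 1 \<Longrightarrow> ((\<lambda>t. u1 i (x + t *\<^sub>R axis i 1)) has_real_derivative u2 i x) (at 0)"
    and l0: "\<And>x. x \<in> ball 0 1 \<Longrightarrow> (\<Sum>i\<in>UNIV. u2 i x) = 0"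
  obtains \<beta> C where "C \<ge> 0" "\<And>k j. j \<in> {1..d k} \<Longrightarrow> \<bar>\<beta> k j\<bar> \<le> C * (real k + 1) ^ CARD('n)"
    "\<And>r x. 0 \<le> r \<Longrightarrow> r < 1 \<Longrightarrow> x \<in> sphere 0 1 \<Longrightarrow> hterm Y d \<beta> r x sums g (r *\<^sub>R x)"
proof -
  have gS: "continuous_on (sphere 0 1) g" by (rule continuous_on_subset[OF g]) auto
  \<comment> \<open>\<open>g\<close> is known to be continuous on the closed ball only; cutting it
    off to the sphere gives a Borel function on the whole space with the same boundary
    values.\<close>
  define G where "G x = indicator (sphere 0 1) x * g x" for x :: "real^'n"
  have Gm [measurable]: "G \<in> borel_measurable borel"
    using borel_measurable_continuous_on_indicator[OF _ gS] by (simp add: G_def[abs_def] borel_closed)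
  obtain M where M: "\<And>x. x \<in> sphere 0 1 \<Longrightarrow> \<bar>G x\<bar> \<le> M"
  proof -
    have "bounded (g ` sphere 0 1)"
      by (intro compact_imp_bounded compact_continuous_image gS compact_sphere)
    then obtain B where B: "\<forall>y\<in>g ` sphere 0 1. norm y \<le> B" unfolding bounded_iff by blast
    show ?thesis by (rule that[of B]) (use B in \<open>force simp: G_def\<close>)
  qed
  have M0: "M \<ge> 0" using M[of "axis undefined 1"] by simp
  have Ybd: "\<bar>f x * Y k j x\<bar> \<le> B * (gC * (real k + 1) ^ CARD('n))"
    if "\<bar>f x\<bar> \<le> B" "j \<in> {1..d k}" "x \<in> sphere 0 1" for f :: "real^'n \<Rightarrow> real" and B k j x
    unfolding abs_mult using gC(3)[OF that(2,3)] that(1) by (intro mult_mono) auto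
  define \<beta> where "\<beta> k j = (\<integral>x. G x * Y k j x \<partial>sphere_measure)" for k j
  have intG: "integrable sphere_measure (\<lambda>x. G x * Y k j x)" if "j \<in> {1..d k}" for k j
    by (rule sphere_integrable(1)[OF _ Ybd[OF M that]]) (use Y_measurable[OF that] in auto)
  have bb: "\<bar>\<beta> k j\<bar> \<le> M * gC * (real k + 1) ^ CARD('n)" if "j \<in> {1..d k}" for k j
    unfolding \<beta>_def mult.assoc
    by (rule sphere_integrable(2)[OF _ Ybd[OF M that]]) (use Y_measurable[OF that] in auto)
  have adm: "adm \<beta>" by (rule adm_poly[OF bb]) (use M0 gC(1) in auto)
  \<comment> \<open>\<open>D\<close> depends on \<open>r\<close> only, so \<epsilon> can be sent to
    0 at a fixed point. The boundary error is carried into the ball by the maximum principle in both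
    directions (\<open>up\<close>, \<open>dn\<close>) and to the coefficients by integration against
    \<open>Y k j\<close> (\<open>cf\<close>).\<close>
  have close: "\<bar>hseries Y d \<beta> (r *\<^sub>R x) - g (r *\<^sub>R x)\<bar> \<le> \<epsilon> * (1 + D)"
    if r: "0 \<le> r" "r < 1" and x: "x \<in> sphere 0 1" and e: "\<epsilon> > 0"
      and D: "D = (\<Sum>k. gC ^ 3 * ((real k + 1) ^ (3 * CARD('n)) * r ^ k))" for r x \<epsilon> D
  proof -
    obtain b K where b: "\<forall>k\<ge>K. \<forall>j. b k j = 0" "\<And>x. x \<in> sphere 0 1 \<Longrightarrow> \<bar>g x - trig b K x\<bar> \<le> \<epsilon>"
      by (rule trig_dense[OF gS e]) (rule that)
    have trigD: "((\<lambda>t. trig b K (x + t *\<^sub>R axis i 1)) has_real_derivative dpart i (trig b K) x) (at 0)"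
      "((\<lambda>t. dpart i (trig b K) (x + t *\<^sub>R axis i 1)) has_real_derivative dpart i (dpart i (trig b K)) x) (at 0)" for x i
      by (rule poly_fun_dpart_axis[OF trig_poly], rule poly_fun_dpart_axis[OF poly_fun_dpart(1)[OF trig_poly]])
    have tl: "(\<Sum>i\<in>UNIV. dpart i (dpart i (trig b K)) x) = 0" for x
      using trig_lap[of b K x] by (simp add: lap_def)
    have tc: "continuous_on S (trig b K)" for S by (rule poly_fun_continuous[OF trig_poly])
    have up: "g y - trig b K y \<le> \<epsilon>" if y: "y \<in> cball 0 1" for y
    proof (rule max_principle[where u = "\<lambda>y. g y - trig b K y" and K = "cball 0 1" and U = "ball 0 1"
            and ?u1.0 = "\<lambda>i y. u1 i y - dpart i (trig b K) y" and ?u2.0 = "\<lambda>i y. u2 i y - dpart i (dpart i (trig b K)) y"])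
      show "g x - trig b K x \<le> \<epsilon>" if "x \<in> cball 0 1 - ball 0 1" for x
        using b(2)[of x] that by (simp add: abs_le_iff)
    qed (use y in \<open>auto intro!: continuous_on_diff g tc DERIV_diff trigD d1 d2 simp: sum_subtractf l0 tl\<close>)
    have dn: "trig b K y - g y \<le> \<epsilon>" if y: "y \<in> cball 0 1" for y
    proof (rule max_principle[where u = "\<lambda>y. trig b K y - g y" and K = "cball 0 1" and U = "ball 0 1"
            and ?u1.0 = "\<lambda>i y. dpart i (trig b K) y - u1 i y" and ?u2.0 = "\<lambda>i y. dpart i (dpart i (trig b K)) y - u2 i y"])
      show "trig b K x - g x \<le> \<epsilon>" if "x \<in> cball 0 1 - ball 0 1" for x
        using b(2)[of x] that by (simp add: abs_le_iff)
    qed (use y in \<open>auto intro!: continuous_on_diff g tc DERIV_diff trigD d1 d2 simp: sum_subtractf l0 tl\<close>)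
    have rx: "r *\<^sub>R x \<in> cball 0 1" using r x by simp
    have near: "\<bar>trig b K (r *\<^sub>R x) - g (r *\<^sub>R x)\<bar> \<le> \<epsilon>" using up[OF rx] dn[OF rx] by simp
    have cf: "\<bar>\<beta> k j - b k j\<bar> \<le> \<epsilon> * gC * (real k + 1) ^ CARD('n)" if j: "j \<in> {1..d k}" for k j
    proof -
      have "\<beta> k j - b k j = (\<integral>x. G x * Y k j x - trig b K x * Y k j x \<partial>sphere_measure)"
        unfolding \<beta>_def integral_trig_Y[OF b(1) j, symmetric]
        by (intro Bochner_Integration.integral_diff[symmetric] intG integrable_Y_mult trig_poly j)
      moreover have "\<bar>\<integral>x. G x * Y k j x - trig b K x * Y k j x \<partial>sphere_measure\<bar> \<le> \<epsilon> * (gC * (real k + 1) ^ CARD('n))"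
      proof (rule sphere_integrable(2))
        show "(\<lambda>x. G x * Y k j x - trig b K x * Y k j x) \<in> borel_measurable borel"
          using Y_measurable[OF j] poly_fun_measurable[OF trig_poly] by measurable
        fix x :: "real^'n" assume x: "x \<in> sphere 0 1"
        have "\<bar>(G x - trig b K x) * Y k j x\<bar> \<le> \<epsilon> * (gC * (real k + 1) ^ CARD('n))"
          by (rule Ybd[OF _ j x]) (use b(2)[OF x] x in \<open>simp add: G_def\<close>)
        then show "\<bar>G x * Y k j x - trig b K x * Y k j x\<bar> \<le> \<epsilon> * (gC * (real k + 1) ^ CARD('n))"
          by (simp add: left_diff_distrib)
      qed
      ultimately show ?thesis by (simp add: mult_ac)
    qed
    have trm: "\<bar>r ^ k * hcomp (\<lambda>k j. \<beta> k j - b k j) k x\<bar> \<le> \<epsilon> * (gC ^ 3 * ((real k + 1) ^ (3 * CARD('n)) * r ^ k))" for k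
    proof -
      have "\<bar>hcomp (\<lambda>k j. \<beta> k j - b k j) k x\<bar> \<le> wt (\<lambda>k j. \<beta> k j - b k j) k" by (rule abs_hcomp_le[OF x])
      also have "\<dots> \<le> \<epsilon> * gC * (real k + 1) ^ CARD('n) * gC\<^sup>2 * (real k + 1) ^ (2 * CARD('n))"
        by (rule wt_le) (use cf e gC(1) in auto)
      also have "\<dots> = \<epsilon> * ((gC * gC\<^sup>2) * ((real k + 1) ^ CARD('n) * (real k + 1) ^ (2 * CARD('n))))"
        by (simp only: mult_ac)
      also have "\<dots> = \<epsilon> * (gC ^ 3 * (real k + 1) ^ (3 * CARD('n)))"
        by (simp only: power_add[symmetric]) (simp add: power2_eq_square power3_eq_cube)
      finally have "\<bar>hcomp (\<lambda>k j. \<beta> k j - b k j) k x\<bar> * r ^ k \<le> \<epsilon> * (gC ^ 3 * (real k + 1) ^ (3 * CARD('n))) * r ^ k"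
        using r by (intro mult_right_mono) auto
      then show ?thesis using r by (simp add: abs_mult mult_ac)
    qed
    have sD: "summable (\<lambda>k. gC ^ 3 * ((real k + 1) ^ (3 * CARD('n)) * r ^ k))"
      by (intro summable_mult summable_poly_geometric r)
    have tsum: "(\<lambda>k. r ^ k * hcomp b k x) sums trig b K (r *\<^sub>R x)"
      unfolding trig_scale by (rule sums_finite) (use b(1) in \<open>auto simp: hcomp_def\<close>)
    have "(\<lambda>k. r ^ k * hcomp \<beta> k x - r ^ k * hcomp b k x) sums (hseries Y d \<beta> (r *\<^sub>R x) - trig b K (r *\<^sub>R x))"
      using adm_sums[OF adm r x] tsum unfolding hterm_eq[abs_def] by (rule sums_diff)
    then have S: "(\<lambda>k. r ^ k * hcomp (\<lambda>k j. \<beta> k j - b k j) k x) sums (hseries Y d \<beta> (r *\<^sub>R x) - trig b K (r *\<^sub>R x))"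
      by (simp add: hcomp_diff right_diff_distrib)
    have "norm (\<Sum>k. r ^ k * hcomp (\<lambda>k j. \<beta> k j - b k j) k x) \<le> (\<Sum>k. \<epsilon> * (gC ^ 3 * ((real k + 1) ^ (3 * CARD('n)) * r ^ k)))"
      by (rule norm_suminf_le[OF _ summable_mult[OF sD]]) (use trm in simp)
    also have "\<dots> = \<epsilon> * D" unfolding D by (rule suminf_mult[OF sD])
    finally have "\<bar>hseries Y d \<beta> (r *\<^sub>R x) - trig b K (r *\<^sub>R x)\<bar> \<le> \<epsilon> * D"
      using sums_unique[OF S] by simp
    then show ?thesis using near by (simp add: algebra_simps)
  qed
  have eq: "hseries Y d \<beta> (r *\<^sub>R x) = g (r *\<^sub>R x)" if r: "0 \<le> r" "r < 1" and x: "x \<in> sphere 0 1" for r x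
  proof -
    define D where "D = (\<Sum>k. gC ^ 3 * ((real k + 1) ^ (3 * CARD('n)) * r ^ k))"
    have "D \<ge> 0" unfolding D_def using r gC(1) by (intro suminf_nonneg summable_mult summable_poly_geometric) auto
    have "\<bar>hseries Y d \<beta> (r *\<^sub>R x) - g (r *\<^sub>R x)\<bar> \<le> 0 + e" if "e > 0" for e
      using close[OF r x _ D_def, of "e / (1 + D)"] that \<open>D \<ge> 0\<close> by simp
    then have "\<bar>hseries Y d \<beta> (r *\<^sub>R x) - g (r *\<^sub>R x)\<bar> \<le> 0" by (rule field_le_epsilon)
    then show ?thesis by simp
  qed
  show ?thesis
  proof (rule that[of "M * gC" \<beta>])
    show "hterm Y d \<beta> r x sums g (r *\<^sub>R x)" if "0 \<le> r" "r < 1" "x \<in> sphere 0 1" for r x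
      using adm_sums[OF adm that] eq[OF that] by simp
  qed (use M0 gC(1) bb in auto)
qed

text \<open>The dilate of \<open>f\<close> by \<open>R < 1\<close> is continuous on the closed ball
  and has an expansion with coefficients \<open>\<beta> R\<close>. Undoing the dilation divides
  degree \<open>k\<close> by \<open>R ^ k\<close>, and by uniqueness the resulting arrays
  \<open>B R\<close> agree for all \<open>R\<close> on the index range. Since \<open>R\<close> may
  be any radius below 1, the polynomial bounds on \<open>\<beta> R\<close> turn into
  \<open>adm b\<close>.\<close>

theorem harmonic_expansion:
  fixes f :: "real^'n \<Rightarrow> real"
  assumes f: "harmonic_on (ball 0 1) f"
  obtains b where "adm b" "\<And>r x. 0 \<le> r \<Longrightarrow> r < 1 \<Longrightarrow> x \<in> sphere 0 1 \<Longrightarrow> hterm Y d b r x sums f (r *\<^sub>R x)"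
proof -
  have ex: "\<exists>\<beta> C. C \<ge> 0 \<and> (\<forall>k. \<forall>j\<in>{1..d k}. \<bar>\<beta> k j\<bar> \<le> C * (real k + 1) ^ CARD('n)) \<and>
      (\<forall>r x. 0 \<le> r \<longrightarrow> r < 1 \<longrightarrow> x \<in> sphere 0 1 \<longrightarrow> hterm Y d \<beta> r x sums f (R *\<^sub>R (r *\<^sub>R x)))"
    if R: "0 < R" "R < 1" for R
  proof -
    have inb: "R *\<^sub>R x \<in> ball 0 1" if "x \<in> cball 0 1" for x :: "real^'n"
    proof -
      have "R * norm x \<le> R * 1" using that R by (intro mult_left_mono) auto
      also have "\<dots> < 1" using R by simp
      finally show ?thesis using R by simp
    qed
    have chain: "((\<lambda>t. F (R *\<^sub>R (x + t *\<^sub>R axis i 1))) has_real_derivative R * D) (at 0)"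
      if "((\<lambda>t. F (R *\<^sub>R x + t *\<^sub>R axis i 1)) has_real_derivative D) (at 0)" for F :: "real^'n \<Rightarrow> real" and x i D
    proof -
      have A: "((\<lambda>t. F (R *\<^sub>R x + t *\<^sub>R axis i 1)) has_real_derivative D) (at (R * 0))" using that by simp
      have B: "((\<lambda>t. R * t) has_real_derivative R) (at 0)" by (auto intro!: derivative_eq_intros)
      from DERIV_chain2[of "\<lambda>t. F (R *\<^sub>R x + t *\<^sub>R axis i 1)" _ "\<lambda>t. R * t", OF A B]
      show ?thesis by (simp add: scaleR_add_right mult.commute)
    qed
    obtain \<beta> C where "C \<ge> 0" "\<And>k j. j \<in> {1..d k} \<Longrightarrow> \<bar>\<beta> k j\<bar> \<le> C * (real k + 1) ^ CARD('n)"
      "\<And>r x. 0 \<le> r \<Longrightarrow> r < 1 \<Longrightarrow> x \<in> sphere 0 1 \<Longrightarrow> hterm Y d \<beta> r x sums f (R *\<^sub>R (r *\<^sub>R x))"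
    proof (rule harmonic_expansion_cball[where g = "\<lambda>x. f (R *\<^sub>R x)" and ?u1.0 = "\<lambda>i x. R * dpart i f (R *\<^sub>R x)"
          and ?u2.0 = "\<lambda>i x. R * (R * dpart i (dpart i f) (R *\<^sub>R x))"])
      show "continuous_on (cball 0 1) (\<lambda>x. f (R *\<^sub>R x))"
        by (rule continuous_on_compose2[OF harmonic_on_continuous[OF f]]) (use inb in \<open>auto intro!: continuous_intros\<close>)
      fix x :: "real^'n" and i assume "x \<in> ball 0 1"
      then have x: "R *\<^sub>R x \<in> ball 0 1" using inb by simp
      show "((\<lambda>t. f (R *\<^sub>R (x + t *\<^sub>R axis i 1))) has_real_derivative R * dpart i f (R *\<^sub>R x)) (at 0)"
        by (rule chain[OF harmonic_on_partials(1)[OF f x]])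
      show "((\<lambda>t. R * dpart i f (R *\<^sub>R (x + t *\<^sub>R axis i 1))) has_real_derivative R * (R * dpart i (dpart i f) (R *\<^sub>R x))) (at 0)"
        by (rule DERIV_cmult[OF chain[OF harmonic_on_partials(2)[OF f x]]])
      show "(\<Sum>i\<in>UNIV. R * (R * dpart i (dpart i f) (R *\<^sub>R x))) = 0"
        using f x by (simp add: sum_distrib_left[symmetric] harmonic_on_def)
    qed blast
    then show ?thesis by (intro exI[of _ \<beta>] exI[of _ C]) simp
  qed
  then have "\<forall>R. \<exists>\<beta> C. 0 < R \<and> R < 1 \<longrightarrow> C \<ge> 0 \<and> (\<forall>k. \<forall>j\<in>{1..d k}. \<bar>\<beta> k j\<bar> \<le> C * (real k + 1) ^ CARD('n)) \<and>
      (\<forall>r x. 0 \<le> r \<longrightarrow> r < 1 \<longrightarrow> x \<in> sphere 0 1 \<longrightarrow> hterm Y d \<beta> r x sums f (R *\<^sub>R (r *\<^sub>R x)))" by metis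
  then obtain \<beta> C where bC: "\<forall>R. 0 < R \<and> R < 1 \<longrightarrow> C R \<ge> 0 \<and> (\<forall>k. \<forall>j\<in>{1..d k}. \<bar>\<beta> R k j\<bar> \<le> C R * (real k + 1) ^ CARD('n)) \<and>
      (\<forall>r x. 0 \<le> r \<longrightarrow> r < 1 \<longrightarrow> x \<in> sphere 0 1 \<longrightarrow> hterm Y d (\<beta> R) r x sums f (R *\<^sub>R (r *\<^sub>R x)))"
    unfolding choice_iff by blast
  have C: "\<And>R. 0 < R \<Longrightarrow> R < 1 \<Longrightarrow> C R \<ge> 0"
    and bd: "\<And>R k j. 0 < R \<Longrightarrow> R < 1 \<Longrightarrow> j \<in> {1..d k} \<Longrightarrow> \<bar>\<beta> R k j\<bar> \<le> C R * (real k + 1) ^ CARD('n)"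
    and sm: "\<And>R r x. 0 < R \<Longrightarrow> R < 1 \<Longrightarrow> 0 \<le> r \<Longrightarrow> r < 1 \<Longrightarrow> x \<in> sphere 0 1 \<Longrightarrow> hterm Y d (\<beta> R) r x sums f (R *\<^sub>R (r *\<^sub>R x))"
    using bC by blast+
  define B where "B R k j = \<beta> R k j / R ^ k" for R k j
  have Bs: "hterm Y d (B R) \<rho> x sums f (\<rho> *\<^sub>R x)" if R: "0 < R" "R < 1" "0 \<le> \<rho>" "\<rho> < R" "x \<in> sphere 0 1" for R \<rho> x
  proof -
    have "hterm Y d (\<beta> R) (\<rho> / R) x sums f (R *\<^sub>R ((\<rho> / R) *\<^sub>R x))" by (rule sm) (use R in auto)
    moreover have "hterm Y d (\<beta> R) (\<rho> / R) x = hterm Y d (B R) \<rho> x"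
      by (auto simp: hterm_def B_def power_divide sum_distrib_left intro!: sum.cong)
    ultimately show ?thesis using R by simp
  qed
  define b where "b = B (1/2)"
  have same: "B R k j = b k j" if R: "0 < R" "R < 1" and j: "j \<in> {1..d k}" for R k j
    unfolding b_def
    by (rule expansion_unique[where s = "min R (1/2)" and v = "\<lambda>\<rho> x. f (\<rho> *\<^sub>R x)", OF _ _ j]) (use R Bs in auto)
  have "adm b"
    unfolding adm_def
  proof (intro allI impI)
    fix r :: real assume r: "0 < r \<and> r < 1"
    define R where "R = (1 + r) / 2"
    have R: "0 < R" "R < 1" "r < R" using r by (auto simp: R_def)
    obtain E where E: "\<And>k. (real k + 1) ^ CARD('n) * (r / R) ^ k \<le> E"
      using bounded_poly_geometric[of "r / R" "CARD('n)"] r R by auto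
    have "\<bar>b k j\<bar> * r ^ k \<le> C R * E" if j: "j \<in> {1..d k}" for k j
    proof -
      have "\<bar>b k j\<bar> * r ^ k = \<bar>\<beta> R k j\<bar> * (r / R) ^ k"
        unfolding same[OF R(1,2) j, symmetric] using R by (simp add: B_def power_divide abs_divide)
      also have "\<dots> \<le> C R * (real k + 1) ^ CARD('n) * (r / R) ^ k"
        using r R bd[OF R(1,2) j] by (intro mult_right_mono) auto
      also have "\<dots> \<le> C R * E" unfolding mult.assoc by (intro mult_left_mono E C R)
      finally show ?thesis .
    qed
    then show "\<exists>C. \<forall>k. \<forall>j\<in>{1..d k}. \<bar>b k j\<bar> * r ^ k \<le> C" by blast
  qed
  moreover have "hterm Y d b r x sums f (r *\<^sub>R x)" if r: "0 \<le> r" "r < 1" "x \<in> sphere 0 1" for r x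
  proof -
    define R where "R = (1 + r) / 2"
    have R: "0 < R" "R < 1" "r < R" using r by (auto simp: R_def)
    have "hterm Y d b r x = hterm Y d (B R) r x"
    proof
      fix k show "hterm Y d b r x k = hterm Y d (B R) r x k"
        unfolding hterm_eq using hcomp_cong[of k b "B R" x] same[OF R(1,2)] by simp
    qed
    then show ?thesis using Bs[OF R(1,2) r(1) R(3) r(3)] by simp
  qed
  ultimately show ?thesis using that by blast
qed

end

section \<open>Integral inequalities\<close>

lemma enn_powr_ennreal: "0 \<le> a \<Longrightarrow> enn_powr (ennreal a) p = ennreal (a powr p)"
  by (simp add: enn_powr_def)

lemma enn_powr_top [simp]: "enn_powr \<infinity> p = \<infinity>" "enn_powr top p = top"
  by (simp_all add: enn_powr_def)

lemma enn_powr_mono: "x \<le> y \<Longrightarrow> 0 \<le> p \<Longrightarrow> enn_powr x p \<le> enn_powr y p"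
  by (cases x; cases y) (auto simp: enn_powr_ennreal powr_mono2 top_unique)

lemma enn_powr_le_iff:
  assumes "p > 0" "a \<ge> 0" shows "enn_powr x (1 / p) \<le> ennreal a \<longleftrightarrow> x \<le> ennreal (a powr p)"
proof (cases x)
  case (real r)
  have "r powr (1 / p) \<le> a \<longleftrightarrow> r \<le> a powr p"
  proof
    assume "r powr (1 / p) \<le> a"
    then have "(r powr (1 / p)) powr p \<le> a powr p" using assms by (intro powr_mono2) auto
    then show "r \<le> a powr p" using assms real by (simp add: powr_powr)
  next
    assume "r \<le> a powr p"
    then have "r powr (1 / p) \<le> (a powr p) powr (1 / p)" using assms real by (intro powr_mono2) auto
    then show "r powr (1 / p) \<le> a" using assms by (simp add: powr_powr)
  qed
  then show ?thesis using real assms by (simp add: enn_powr_ennreal)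
qed (simp add: top_unique)

lemma enn_powr_mult:
  assumes "a \<ge> 0" "p > 0" shows "enn_powr (ennreal a * x) p = ennreal (a powr p) * enn_powr x p"
proof (cases x)
  case (real r)
  then show ?thesis using assms by (simp add: enn_powr_ennreal powr_mult flip: ennreal_mult)
next
  case top
  then show ?thesis using assms by (cases "a = 0") (auto simp: ennreal_mult_top enn_powr_def)
qed

text \<open>The right-hand side, as a function of \<open>z powr s\<close>, is the tangent at
  \<open>lam powr s\<close> to the concave map sending \<open>v\<close> to
  \<open>v powr (1 / s)\<close>. It is linear in \<open>z powr s\<close> and can be integrated, with
  \<open>lam\<close> left free for optimisation.\<close>

lemma powr_tangent:
  fixes z lam s :: real
  assumes "s \<ge> 1" "z \<ge> 0" "lam > 0"
  shows "z \<le> z powr s * lam powr (1 - s) / s + lam * (1 - 1 / s)"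
proof (cases "z = 0")
  case False
  then have z: "z > 0" using assms by simp
  have "((z / lam) powr s) powr (1 / s) * 1 powr (1 - 1 / s) \<le> (1 / s) * (z / lam) powr s + (1 - 1 / s) * 1"
    using assms z by (intro Youngs_inequality_0) auto
  then have "z / lam \<le> (z / lam) powr s / s + (1 - 1 / s)"
    using assms z by (simp add: powr_powr)
  then have "lam * (z / lam) \<le> lam * ((z / lam) powr s / s + (1 - 1 / s))"
    using assms by (intro mult_left_mono) auto
  also have "\<dots> = z powr s * (lam / lam powr s) / s + lam * (1 - 1 / s)"
    using assms z by (simp add: powr_divide distrib_left)
  also have "lam / lam powr s = lam powr (1 - s)" using assms by (simp add: powr_diff)
  finally show ?thesis using assms by simp
qed (use assms in simp)

text \<open>Integrating \<open>powr_tangent\<close> bounds the left integral by an expression in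
  \<open>lam\<close>, which is then minimised. The weight has mass at most \<open>t\<close> rather
  than 1, so that kernels and unnormalised majorants can serve as weights directly.\<close>

lemma weighted_jensen:
  assumes w [measurable]: "w \<in> borel_measurable M" and h [measurable]: "h \<in> borel_measurable M"
    and wn: "\<And>x. 0 \<le> w x" and hn: "\<And>x. 0 \<le> h x"
    and T: "(\<integral>\<^sup>+x. ennreal (w x) \<partial>M) \<le> ennreal t" and t: "t > 0" and s: "s \<ge> 1"
  shows "enn_powr (\<integral>\<^sup>+x. ennreal (w x * h x) \<partial>M) s
      \<le> ennreal (t powr (s - 1)) * (\<integral>\<^sup>+x. ennreal (w x * h x powr s) \<partial>M)"
proof (cases "(\<integral>\<^sup>+x. ennreal (w x * h x powr s) \<partial>M)")
  case (real i)
  show ?thesis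
  proof (cases "i = 0")
    case True
    have "AE x in M. ennreal (w x * h x powr s) = 0"
      using real(2) True by (simp add: nn_integral_0_iff_AE)
    then have "AE x in M. ennreal (w x * h x) = 0"
      by eventually_elim (use wn hn in \<open>auto simp: ennreal_eq_0_iff mult_le_0_iff\<close>)
    then have "(\<integral>\<^sup>+x. ennreal (w x * h x) \<partial>M) = 0" by (simp add: nn_integral_0_iff_AE)
    then show ?thesis using enn_powr_ennreal[of 0 s] by simp
  next
    case False
    then have i: "i > 0" using real by simp
    \<comment> \<open>The minimising value: with \<open>lam powr s = i / t\<close> the two terms add
      up to \<open>lam * t\<close>, whose power is the claimed bound. The case \<open>i = 0\<close>
      is separated because \<open>lam\<close> would vanish.\<close>
    define lam where "lam = (i / t) powr (1 / s)"
    have l: "lam > 0" using i t by (simp add: lam_def)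
    have ls: "lam powr s = i / t" using i t s by (simp add: lam_def powr_powr)
    have "(\<integral>\<^sup>+x. ennreal (w x * h x) \<partial>M)
       \<le> (\<integral>\<^sup>+x. ennreal (lam powr (1 - s) / s) * ennreal (w x * h x powr s) + ennreal (lam * (1 - 1 / s)) * ennreal (w x) \<partial>M)"
    proof (intro nn_integral_mono)
      fix x
      have "w x * h x \<le> w x * (h x powr s * lam powr (1 - s) / s + lam * (1 - 1 / s))"
        using powr_tangent[OF s hn l] wn by (intro mult_left_mono)
      also have "\<dots> = lam powr (1 - s) / s * (w x * h x powr s) + lam * (1 - 1 / s) * w x"
        by (simp add: algebra_simps)
      finally have le: "w x * h x \<le> lam powr (1 - s) / s * (w x * h x powr s) + lam * (1 - 1 / s) * w x" .
      show "ennreal (w x * h x) \<le> ennreal (lam powr (1 - s) / s) * ennreal (w x * h x powr s) + ennreal (lam * (1 - 1 / s)) * ennreal (w x)"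
      proof -
        have p: "0 \<le> lam powr (1 - s) / s" "0 \<le> lam * (1 - 1 / s)" using s l by auto
        have q: "0 \<le> w x * h x powr s" using wn[of x] by simp
        have "ennreal (lam powr (1 - s) / s) * ennreal (w x * h x powr s) + ennreal (lam * (1 - 1 / s)) * ennreal (w x)
          = ennreal (lam powr (1 - s) / s * (w x * h x powr s) + lam * (1 - 1 / s) * w x)"
          unfolding ennreal_mult[OF p(1) q, symmetric] ennreal_mult[OF p(2) wn, symmetric]
          by (rule ennreal_plus[symmetric, OF mult_nonneg_nonneg[OF p(1) q] mult_nonneg_nonneg[OF p(2) wn]])
        then show ?thesis using ennreal_leI[OF le] by (simp only:)
      qed
    qed
    also have "\<dots> = ennreal (lam powr (1 - s) / s) * ennreal i + ennreal (lam * (1 - 1 / s)) * (\<integral>\<^sup>+x. ennreal (w x) \<partial>M)"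
      using real by (simp add: nn_integral_add nn_integral_cmult)
    also have "\<dots> \<le> ennreal (lam powr (1 - s) / s) * ennreal i + ennreal (lam * (1 - 1 / s)) * ennreal t"
      by (intro add_left_mono mult_left_mono T) auto
    also have "\<dots> = ennreal (lam powr (1 - s) * i / s + lam * (1 - 1 / s) * t)"
      using s l i t by (simp add: ennreal_plus ennreal_mult[symmetric])
    also have "lam powr (1 - s) * i / s + lam * (1 - 1 / s) * t = lam * t"
    proof -
      have "i = lam powr s * t" using ls t by simp
      then have "lam powr (1 - s) * i = lam * t"
        using l by (simp add: powr_diff)
      then show ?thesis using s by (simp add: field_simps)
    qed
    finally have "enn_powr (\<integral>\<^sup>+x. ennreal (w x * h x) \<partial>M) s \<le> enn_powr (ennreal (lam * t)) s"
      using s by (intro enn_powr_mono) auto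
    also have "\<dots> = ennreal ((lam * t) powr s)" using l t by (intro enn_powr_ennreal) simp
    also have "(lam * t) powr s = t powr (s - 1) * i"
      using l t by (simp add: powr_mult ls powr_diff field_simps)
    finally show ?thesis using real by (simp add: ennreal_mult)
  qed
next
  case top
  then show ?thesis using t by (simp add: ennreal_mult_top)
qed

text \<open>Jensen's inequality with weight \<open>k x\<close>, of mass at most \<open>c1\<close>,
  puts the power on \<open>u\<close>; interchanging the integrals leaves the integral of
  \<open>k\<close> in its first variable, at most \<open>c2\<close>. The mass bounds are
  almost-everywhere statements because kernels on the sphere are controlled only at points of the
  sphere.\<close>

lemma schur_test:
  fixes k :: "'a \<Rightarrow> 'b \<Rightarrow> real"
  assumes sfM: "sigma_finite_measure M" and sfN: "sigma_finite_measure N"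
    and k [measurable]: "(\<lambda>(x, y). k x y) \<in> borel_measurable (M \<Otimes>\<^sub>M N)" and u [measurable]: "u \<in> borel_measurable N"
    and kn: "\<And>x y. 0 \<le> k x y" and un: "\<And>y. 0 \<le> u y"
    and c1: "AE x in M. (\<integral>\<^sup>+y. ennreal (k x y) \<partial>N) \<le> ennreal c1" and c2: "AE y in N. (\<integral>\<^sup>+x. ennreal (k x y) \<partial>M) \<le> ennreal c2"
    and c: "c1 > 0" and s: "s \<ge> 1"
  shows "(\<integral>\<^sup>+x. enn_powr (\<integral>\<^sup>+y. ennreal (k x y * u y) \<partial>N) s \<partial>M)
     \<le> ennreal (c1 powr (s - 1)) * (ennreal c2 * (\<integral>\<^sup>+y. ennreal (u y powr s) \<partial>N))"
proof -
  interpret M: sigma_finite_measure M by fact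
  interpret N: sigma_finite_measure N by fact
  interpret pair_sigma_finite M N ..
  have "(\<integral>\<^sup>+x. enn_powr (\<integral>\<^sup>+y. ennreal (k x y * u y) \<partial>N) s \<partial>M)
     \<le> (\<integral>\<^sup>+x. ennreal (c1 powr (s - 1)) * (\<integral>\<^sup>+y. ennreal (k x y * u y powr s) \<partial>N) \<partial>M)"
  proof (rule nn_integral_mono_AE, use c1 AE_space in eventually_elim)
    fix x assume x: "(\<integral>\<^sup>+y. ennreal (k x y) \<partial>N) \<le> ennreal c1" "x \<in> space M"
    have "k x \<in> borel_measurable N"
      using measurable_Pair2[OF k x(2)] by simp
    then show "enn_powr (\<integral>\<^sup>+y. ennreal (k x y * u y) \<partial>N) s
      \<le> ennreal (c1 powr (s - 1)) * (\<integral>\<^sup>+y. ennreal (k x y * u y powr s) \<partial>N)"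
      by (rule weighted_jensen[OF _ u kn un x(1) c s])
  qed
  also have "\<dots> = ennreal (c1 powr (s - 1)) * (\<integral>\<^sup>+x. (\<integral>\<^sup>+y. ennreal (k x y * u y powr s) \<partial>N) \<partial>M)"
    by (subst nn_integral_cmult) auto
  also have "(\<integral>\<^sup>+x. (\<integral>\<^sup>+y. ennreal (k x y * u y powr s) \<partial>N) \<partial>M) = (\<integral>\<^sup>+y. (\<integral>\<^sup>+x. ennreal (k x y * u y powr s) \<partial>M) \<partial>N)"
    by (rule Fubini'[symmetric]) auto
  also have "\<dots> = (\<integral>\<^sup>+y. (\<integral>\<^sup>+x. ennreal (k x y) \<partial>M) * ennreal (u y powr s) \<partial>N)"
    using kn by (intro nn_integral_cong) (simp add: ennreal_mult nn_integral_multc)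
  also have "\<dots> \<le> (\<integral>\<^sup>+y. ennreal c2 * ennreal (u y powr s) \<partial>N)"
    using c2 by (intro nn_integral_mono_AE) (auto intro: mult_right_mono elim!: eventually_mono)
  also have "\<dots> = ennreal c2 * (\<integral>\<^sup>+y. ennreal (u y powr s) \<partial>N)"
    by (rule nn_integral_cmult) auto
  finally show ?thesis by (simp add: mult_left_mono)
qed

text \<open>Jensen's inequality with weight \<open>A\<close>, applied to \<open>G / A\<close>, gives Minkowski's integral inequality.\<close>

lemma minkowski_integral:
  fixes G :: "'a \<Rightarrow> 'b \<Rightarrow> real"
  assumes sfM: "sigma_finite_measure M" and sfN: "sigma_finite_measure N"
    and G [measurable]: "(\<lambda>(x, w). G x w) \<in> borel_measurable (M \<Otimes>\<^sub>M N)" and A [measurable]: "A \<in> borel_measurable N"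
    and Gn: "\<And>x w. 0 \<le> G x w" and An: "\<And>w. 0 \<le> A w" and G0: "\<And>x w. A w = 0 \<Longrightarrow> G x w = 0"
    and GA: "\<And>w. w \<in> space N \<Longrightarrow> (\<integral>\<^sup>+x. ennreal (G x w powr s) \<partial>M) \<le> ennreal (A w powr s)"
    and T: "(\<integral>\<^sup>+w. ennreal (A w) \<partial>N) \<le> ennreal t" and t: "t > 0" and s: "s \<ge> 1"
  shows "(\<integral>\<^sup>+x. enn_powr (\<integral>\<^sup>+w. ennreal (G x w) \<partial>N) s \<partial>M) \<le> ennreal (t powr s)"
proof -
  interpret M: sigma_finite_measure M by fact
  interpret N: sigma_finite_measure N by fact
  interpret pair_sigma_finite M N ..
  have eq: "G x w = A w * (G x w / A w)" for x w using G0[of w x] by (cases "A w = 0") auto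
  have "(\<integral>\<^sup>+x. enn_powr (\<integral>\<^sup>+w. ennreal (G x w) \<partial>N) s \<partial>M)
    \<le> (\<integral>\<^sup>+x. ennreal (t powr (s - 1)) * (\<integral>\<^sup>+w. ennreal (A w * (G x w / A w) powr s) \<partial>N) \<partial>M)"
  proof (intro nn_integral_mono)
    fix x assume x: "x \<in> space M"
    then have [measurable]: "G x \<in> borel_measurable N"
      using measurable_Pair2[OF G x] by simp
    have "enn_powr (\<integral>\<^sup>+w. ennreal (A w * (G x w / A w)) \<partial>N) s
      \<le> ennreal (t powr (s - 1)) * (\<integral>\<^sup>+w. ennreal (A w * (G x w / A w) powr s) \<partial>N)"
      by (rule weighted_jensen[OF _ _ An _ T t s]) (use Gn An in auto)
    then show "enn_powr (\<integral>\<^sup>+w. ennreal (G x w) \<partial>N) s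
      \<le> ennreal (t powr (s - 1)) * (\<integral>\<^sup>+w. ennreal (A w * (G x w / A w) powr s) \<partial>N)"
      by (simp only: eq[symmetric])
  qed
  also have "\<dots> = ennreal (t powr (s - 1)) * (\<integral>\<^sup>+x. (\<integral>\<^sup>+w. ennreal (A w * (G x w / A w) powr s) \<partial>N) \<partial>M)"
    by (subst nn_integral_cmult) auto
  also have "(\<integral>\<^sup>+x. (\<integral>\<^sup>+w. ennreal (A w * (G x w / A w) powr s) \<partial>N) \<partial>M)
     = (\<integral>\<^sup>+w. (\<integral>\<^sup>+x. ennreal (A w * (G x w / A w) powr s) \<partial>M) \<partial>N)"
    by (rule Fubini'[symmetric]) auto
  also have "\<dots> \<le> (\<integral>\<^sup>+w. ennreal (A w) \<partial>N)"
  proof (rule nn_integral_mono)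
    fix w assume w: "w \<in> space N"
    then have [measurable]: "(\<lambda>x. G x w) \<in> borel_measurable M"
      using measurable_Pair1[OF G w] by simp
    have "(\<integral>\<^sup>+x. ennreal (A w * (G x w / A w) powr s) \<partial>M)
       = (\<integral>\<^sup>+x. ennreal (A w / A w powr s) * ennreal (G x w powr s) \<partial>M)"
      using Gn An by (intro nn_integral_cong) (simp add: ennreal_mult[symmetric] powr_divide)
    also have "\<dots> = ennreal (A w / A w powr s) * (\<integral>\<^sup>+x. ennreal (G x w powr s) \<partial>M)"
      by (rule nn_integral_cmult) auto
    also have "\<dots> \<le> ennreal (A w / A w powr s) * ennreal (A w powr s)"
      by (intro mult_left_mono GA w) auto
    also have "\<dots> = ennreal (A w)"
      using An[of w] by (cases "A w = 0") (auto simp: ennreal_mult[symmetric])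
    finally show "(\<integral>\<^sup>+x. ennreal (A w * (G x w / A w) powr s) \<partial>M) \<le> ennreal (A w)" .
  qed
  also have "ennreal (t powr (s - 1)) * (\<integral>\<^sup>+w. ennreal (A w) \<partial>N) \<le> ennreal (t powr (s - 1)) * ennreal t"
    by (intro mult_left_mono T) auto
  also have "\<dots> = ennreal (t powr s)"
    using t by (simp add: ennreal_mult[symmetric] powr_diff)
  finally show ?thesis by (simp add: mult_left_mono)
qed

section \<open>Norms of functions on the sphere\<close>

lemma Lnorm_mono:
  assumes "\<And>x. x \<in> sphere 0 1 \<Longrightarrow> \<bar>F x\<bar> \<le> \<bar>G x\<bar>"
  shows "Lnorm s F \<le> Lnorm s G"
proof (cases "s = \<infinity>")
  case True
  then show ?thesis unfolding Lnorm_def using assms by (auto intro!: SUP_least intro: SUP_upper2 ennreal_leI)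
next
  case False
  have "AE x in sphere_measure. ennreal (\<bar>F x\<bar> powr enn2real s) \<le> ennreal (\<bar>G x\<bar> powr enn2real s)"
    using AE_sphere_measure by eventually_elim (use assms in \<open>auto intro!: ennreal_leI powr_mono2\<close>)
  then show ?thesis
    using False unfolding Lnorm_def by (auto intro!: enn_powr_mono nn_integral_mono_AE)
qed

lemma Lnorm_cong: "(\<And>x. x \<in> sphere 0 1 \<Longrightarrow> F x = G x) \<Longrightarrow> Lnorm s F = Lnorm s G"
  by (intro antisym Lnorm_mono) auto

lemma enn2real_ge_1: "1 \<le> s \<Longrightarrow> s \<noteq> \<infinity> \<Longrightarrow> 1 \<le> enn2real s"
  by (cases s) auto

lemma Lnorm_le_iff:
  assumes s: "1 \<le> s" "s \<noteq> \<infinity>" and a: "a \<ge> 0"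
  shows "Lnorm s F \<le> ennreal a \<longleftrightarrow> (\<integral>\<^sup>+x. ennreal (\<bar>F x\<bar> powr enn2real s) \<partial>sphere_measure) \<le> ennreal (a powr enn2real s)"
  unfolding Lnorm_def using enn_powr_le_iff[of "enn2real s" a] enn2real_ge_1[OF s] s a by simp

lemma Lnorm_top_le_iff:
  "a \<ge> 0 \<Longrightarrow> Lnorm top F \<le> ennreal a \<longleftrightarrow> (\<forall>x\<in>sphere 0 1. \<bar>F x\<bar> \<le> a)"
  by (simp add: Lnorm_def SUP_le_iff)

lemma Lnorm_bounded:
  fixes F :: "real^'n::finite \<Rightarrow> real"
  assumes s: "1 \<le> s" and a: "a \<ge> 0" and F: "\<And>x. x \<in> sphere 0 1 \<Longrightarrow> \<bar>F x\<bar> \<le> a"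
  shows "Lnorm s F \<le> ennreal a"
proof (cases "s = \<infinity>")
  case False
  have "(\<integral>\<^sup>+x. ennreal (\<bar>F x\<bar> powr enn2real s) \<partial>sphere_measure) \<le> (\<integral>\<^sup>+x. ennreal (a powr enn2real s) \<partial>(sphere_measure :: (real^'n) measure))"
    using AE_sphere_measure
    by (intro nn_integral_mono_AE, eventually_elim) (use F in \<open>auto intro!: ennreal_leI powr_mono2\<close>)
  then show ?thesis using False s a by (simp add: Lnorm_le_iff)
qed (use a F in \<open>simp add: Lnorm_top_le_iff\<close>)

lemma Lnorm_cmult:
  assumes s: "1 \<le> s" and a: "a \<ge> 0" and F: "Lnorm s F \<le> ennreal a"
    and F': "F \<in> borel_measurable borel"
  shows "Lnorm s (\<lambda>x. c * F x) \<le> ennreal (\<bar>c\<bar> * a)"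
proof (cases "s = \<infinity>")
  case True
  then show ?thesis using F a by (auto simp: Lnorm_top_le_iff abs_mult intro!: mult_left_mono)
next
  case False
  have "(\<integral>\<^sup>+x. ennreal (\<bar>c * F x\<bar> powr enn2real s) \<partial>sphere_measure)
     = (\<integral>\<^sup>+x. ennreal (\<bar>c\<bar> powr enn2real s) * ennreal (\<bar>F x\<bar> powr enn2real s) \<partial>sphere_measure)"
    by (simp add: abs_mult powr_mult ennreal_mult)
  also have "\<dots> = ennreal (\<bar>c\<bar> powr enn2real s) * (\<integral>\<^sup>+x. ennreal (\<bar>F x\<bar> powr enn2real s) \<partial>sphere_measure)"
    using F' by (intro nn_integral_cmult) simp
  also have "\<dots> \<le> ennreal (\<bar>c\<bar> powr enn2real s) * ennreal (a powr enn2real s)"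
    using F False s a by (intro mult_left_mono) (auto simp: Lnorm_le_iff)
  also have "\<dots> = ennreal ((\<bar>c\<bar> * a) powr enn2real s)" using a by (simp add: powr_mult ennreal_mult)
  finally show ?thesis using False s a by (simp add: Lnorm_le_iff)
qed

text \<open>The norms of the slices are replaced by an explicit measurable majorant
  \<open>A\<close>, so that the statement applies to families whose norms are only estimated.
  \<open>Lnorm \<infinity>\<close> is a supremum over every point of the sphere and is argued
  pointwise; finite \<open>s\<close> goes through \<open>minkowski_integral\<close>.\<close>

lemma Lnorm_minkowski:
  fixes G :: "real^'n::finite \<Rightarrow> 'b \<Rightarrow> real"
  assumes s: "1 \<le> s" and sfN: "sigma_finite_measure N"
    and G: "(\<lambda>(x, w). G x w) \<in> borel_measurable (borel \<Otimes>\<^sub>M N)" and A: "A \<in> borel_measurable N"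
    and Gn: "\<And>x w. 0 \<le> G x w" and An: "\<And>w. 0 \<le> A w" and G0: "\<And>x w. A w = 0 \<Longrightarrow> G x w = 0"
    and GA: "\<And>w. w \<in> space N \<Longrightarrow> Lnorm s (\<lambda>x. G x w) \<le> ennreal (A w)"
    and T: "(\<integral>\<^sup>+w. ennreal (A w) \<partial>N) \<le> ennreal t" and t: "t > 0"
    and F: "\<And>x. x \<in> sphere 0 1 \<Longrightarrow> ennreal \<bar>F x\<bar> \<le> (\<integral>\<^sup>+w. ennreal (G x w) \<partial>N)"
  shows "Lnorm s F \<le> ennreal t"
proof (cases "s = \<infinity>")
  case True
  have "\<bar>F x\<bar> \<le> t" if x: "x \<in> sphere 0 1" for x
  proof -
    have "ennreal \<bar>F x\<bar> \<le> (\<integral>\<^sup>+w. ennreal (A w) \<partial>N)"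
      by (rule order_trans[OF F[OF x]], rule nn_integral_mono)
         (use GA True An Gn x in \<open>auto simp: Lnorm_top_le_iff intro!: ennreal_leI\<close>)
    then show ?thesis using T t by (meson ennreal_le_iff less_imp_le order_trans)
  qed
  then show ?thesis using True t by (simp add: Lnorm_top_le_iff)
next
  case False
  let ?s = "enn2real s"
  have "(\<integral>\<^sup>+x. ennreal (\<bar>F x\<bar> powr ?s) \<partial>sphere_measure)
     \<le> (\<integral>\<^sup>+x. enn_powr (\<integral>\<^sup>+w. ennreal (G x w) \<partial>N) ?s \<partial>sphere_measure)"
  proof (rule nn_integral_mono_AE, use AE_sphere_measure in eventually_elim)
    fix x :: "real^'n" assume "x \<in> sphere 0 1"
    then have "enn_powr (ennreal \<bar>F x\<bar>) ?s \<le> enn_powr (\<integral>\<^sup>+w. ennreal (G x w) \<partial>N) ?s"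
      by (intro enn_powr_mono F) auto
    then show "ennreal (\<bar>F x\<bar> powr ?s) \<le> enn_powr (\<integral>\<^sup>+w. ennreal (G x w) \<partial>N) ?s"
      by (simp add: enn_powr_ennreal)
  qed
  also have "\<dots> \<le> ennreal (t powr ?s)"
  proof (rule minkowski_integral[OF sigma_finite_sphere_measure sfN _ A Gn An G0 _ T t enn2real_ge_1[OF s False]])
    show "(\<lambda>(x, w). G x w) \<in> borel_measurable (sphere_measure \<Otimes>\<^sub>M N)"
      unfolding measurable_cong_sets[OF sets_pair_measure_cong[OF sets_sphere_measure refl] refl] by (rule G)
    fix w assume "w \<in> space N"
    from GA[OF this] show "(\<integral>\<^sup>+x. ennreal (G x w powr ?s) \<partial>sphere_measure) \<le> ennreal (A w powr ?s)"
      using Lnorm_le_iff[OF s False An, of "\<lambda>x. G x w" w] Gn by simp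
  qed auto
  finally show ?thesis using Lnorm_le_iff[OF s False, of t F] t by simp
qed

text \<open>A kernel of mass at most 1 in each variable is a contraction of every L^s: the Schur
  test with both constants 1 for finite \<open>s\<close>, a pointwise estimate for the supremum. It
  is meant for Poisson kernels.\<close>

lemma Lnorm_kernel:
  fixes K :: "real^'n::finite \<Rightarrow> real^'n \<Rightarrow> real"
  assumes s: "1 \<le> s"
    and K: "(\<lambda>(x, y). K x y) \<in> borel_measurable (borel \<Otimes>\<^sub>M borel)" and H: "H \<in> borel_measurable borel"
    and K1: "\<And>x. x \<in> sphere 0 1 \<Longrightarrow> (\<integral>\<^sup>+y. ennreal \<bar>K x y\<bar> \<partial>sphere_measure) \<le> 1"
    and K2: "\<And>y. y \<in> sphere 0 1 \<Longrightarrow> (\<integral>\<^sup>+x. ennreal \<bar>K x y\<bar> \<partial>sphere_measure) \<le> 1"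
    and F: "\<And>x. x \<in> sphere 0 1 \<Longrightarrow> ennreal \<bar>F x\<bar> \<le> (\<integral>\<^sup>+y. ennreal (\<bar>K x y\<bar> * \<bar>H y\<bar>) \<partial>sphere_measure)"
  shows "Lnorm s F \<le> Lnorm s H"
proof (cases "s = \<infinity>")
  case True
  have "ennreal \<bar>F x\<bar> \<le> Lnorm s H" if x: "x \<in> sphere 0 1" for x
  proof -
    have "K x \<in> borel_measurable borel" using measurable_Pair2[OF K, of x] by simp
    have "ennreal \<bar>F x\<bar> \<le> (\<integral>\<^sup>+y. ennreal \<bar>K x y\<bar> * Lnorm s H \<partial>sphere_measure)"
    proof (rule order_trans[OF F[OF x]], rule nn_integral_mono_AE, use AE_sphere_measure in eventually_elim)
      fix y :: "real^'n" assume "y \<in> sphere 0 1"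
      then have "ennreal \<bar>H y\<bar> \<le> Lnorm s H" using True by (auto simp: Lnorm_def intro!: SUP_upper2)
      then show "ennreal (\<bar>K x y\<bar> * \<bar>H y\<bar>) \<le> ennreal \<bar>K x y\<bar> * Lnorm s H"
        by (simp add: ennreal_mult mult_left_mono)
    qed
    also have "\<dots> = (\<integral>\<^sup>+y. ennreal \<bar>K x y\<bar> \<partial>sphere_measure) * Lnorm s H"
      using \<open>K x \<in> borel_measurable borel\<close> by (intro nn_integral_multc) simp
    also have "\<dots> \<le> 1 * Lnorm s H" by (intro mult_right_mono K1 x) simp
    finally show ?thesis by simp
  qed
  then have "(SUP x\<in>sphere 0 1. ennreal \<bar>F x\<bar>) \<le> Lnorm s H" by (intro SUP_least)
  then show ?thesis using True by (simp add: Lnorm_def[of top F])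
next
  case False
  let ?s = "enn2real s"
  have Ks: "(\<lambda>(x, y). \<bar>K x y\<bar>) \<in> borel_measurable (sphere_measure \<Otimes>\<^sub>M sphere_measure)"
  proof -
    have "(\<lambda>z. \<bar>case z of (x, y) \<Rightarrow> K x y\<bar>) \<in> borel_measurable (sphere_measure \<Otimes>\<^sub>M sphere_measure)"
      unfolding measurable_cong_sets[OF sets_pair_measure_cong[OF sets_sphere_measure sets_sphere_measure] refl]
      by (intro borel_measurable_abs K)
    then show ?thesis by (simp add: case_prod_beta)
  qed
  have "(\<integral>\<^sup>+x. ennreal (\<bar>F x\<bar> powr ?s) \<partial>sphere_measure)
     \<le> (\<integral>\<^sup>+x. enn_powr (\<integral>\<^sup>+y. ennreal (\<bar>K x y\<bar> * \<bar>H y\<bar>) \<partial>sphere_measure) ?s \<partial>sphere_measure)"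
  proof (rule nn_integral_mono_AE, use AE_sphere_measure in eventually_elim)
    fix x :: "real^'n" assume "x \<in> sphere 0 1"
    then have "enn_powr (ennreal \<bar>F x\<bar>) ?s \<le> enn_powr (\<integral>\<^sup>+y. ennreal (\<bar>K x y\<bar> * \<bar>H y\<bar>) \<partial>sphere_measure) ?s"
      by (intro enn_powr_mono F) auto
    then show "ennreal (\<bar>F x\<bar> powr ?s) \<le> enn_powr (\<integral>\<^sup>+y. ennreal (\<bar>K x y\<bar> * \<bar>H y\<bar>) \<partial>sphere_measure) ?s"
      by (simp add: enn_powr_ennreal)
  qed
  also have "\<dots> \<le> ennreal (1 powr (?s - 1)) * (ennreal 1 * (\<integral>\<^sup>+y. ennreal (\<bar>H y\<bar> powr ?s) \<partial>sphere_measure))"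
  proof (rule schur_test[OF sigma_finite_sphere_measure sigma_finite_sphere_measure Ks])
    show "AE x in sphere_measure. (\<integral>\<^sup>+y. ennreal \<bar>K x y\<bar> \<partial>sphere_measure) \<le> ennreal 1"
      using AE_sphere_measure by eventually_elim (simp add: K1)
    show "AE y in sphere_measure. (\<integral>\<^sup>+x. ennreal \<bar>K x y\<bar> \<partial>sphere_measure) \<le> ennreal 1"
      using AE_sphere_measure by eventually_elim (simp add: K2)
  qed (use H enn2real_ge_1[OF s False] in auto)
  finally show ?thesis
    using False enn2real_ge_1[OF s False] by (simp add: Lnorm_def enn_powr_mono)
qed

section \<open>Integrals of powers of the distance to the boundary\<close>

lemma nn_integral_one_minus_powr:
  fixes a r :: real
  assumes "a > 0" "r \<le> 1"
  shows "(\<integral>\<^sup>+s. ennreal ((1 - s) powr (a - 1)) * indicator {r..1} s \<partial>lborel) = ennreal ((1 - r) powr a / a)"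
proof -
  have "(\<integral>\<^sup>+s. ennreal ((1 - s) powr (a - 1)) * indicator {r..1} s \<partial>lborel)
    = (\<integral>\<^sup>+u. ennreal (u powr (a - 1)) * indicator {0..1 - r} u \<partial>lborel)"
    by (subst nn_integral_real_affine[where c = "-1" and t = 1])
       (auto intro!: nn_integral_cong simp: indicator_def)
  also have "\<dots> = ennreal ((1 - r) powr (a - 1 + 1) / (a - 1 + 1))"
    by (rule nn_integral_has_integral_lebesgue'[OF _ has_integral_powr_from_0]) (use assms in auto)
  finally show ?thesis by simp
qed

text \<open>Split at \<open>s = r\<close>. For \<open>s \<le> r\<close> use
  \<open>1 - r * s \<ge> 1 - s\<close>, which leaves a power integral producing
  \<open>1 / b\<close>; for \<open>s \<ge> r\<close> use \<open>1 - r * s \<ge> 1 - r\<close>, which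
  leaves one producing \<open>1 / a\<close>.\<close>

lemma beta_kernel_integral:
  fixes a b r :: real
  assumes a: "a > 0" and b: "b > 0" and r: "0 \<le> r" "r < 1"
  shows "(\<integral>\<^sup>+s\<in>{0<..<1}. ennreal ((1 - s) powr (a - 1) * (1 - r * s) powr (- (a + b))) \<partial>lborel)
     \<le> ennreal ((1 / a + 1 / b) * (1 - r) powr (- b))"
proof -
  have I1: "(\<integral>\<^sup>+s. ennreal ((1 - s) powr (a - 1)) * indicator {r..1} s \<partial>lborel) = ennreal ((1 - r) powr a / a)"
    using a r by (intro nn_integral_one_minus_powr) auto
  have I2: "(\<integral>\<^sup>+s. ennreal ((1 - s) powr (- b - 1)) * indicator {0..r} s \<partial>lborel) \<le> ennreal ((1 - r) powr (- b) / b)"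
  proof -
    have "(\<integral>\<^sup>+s. ennreal ((1 - s) powr (- b - 1)) * indicator {0..r} s \<partial>lborel)
      = ennreal ((1 - r) powr (- b) / b - (1 - 0) powr (- b) / b)"
    proof (rule nn_integral_FTC_Icc[where F = "\<lambda>s. (1 - s) powr (- b) / b"])
      fix s assume "s \<in> {0..r}"
      then have s: "0 \<le> s" "s \<le> r" by auto
      then have "((\<lambda>s. (1 - s) powr (- b) / b) has_real_derivative (- b * (1 - s) powr (- b - 1) * (- 1)) / b) (at s)"
        using r by (auto intro!: derivative_eq_intros)
      then show "((\<lambda>s. (1 - s) powr (- b) / b) has_real_derivative (1 - s) powr (- b - 1)) (at s)"
        using b by simp
    qed (use r in auto)
    also have "\<dots> \<le> ennreal ((1 - r) powr (- b) / b)" using b by (intro ennreal_leI) simp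
    finally show ?thesis .
  qed
  have "(\<integral>\<^sup>+s\<in>{0<..<1}. ennreal ((1 - s) powr (a - 1) * (1 - r * s) powr (- (a + b))) \<partial>lborel)
    \<le> (\<integral>\<^sup>+s. ennreal ((1 - s) powr (- b - 1)) * indicator {0..r} s
         + ennreal ((1 - r) powr (- (a + b))) * (ennreal ((1 - s) powr (a - 1)) * indicator {r..1} s) \<partial>lborel)"
  proof (rule nn_integral_mono)
    fix s :: real
    show "ennreal ((1 - s) powr (a - 1) * (1 - r * s) powr (- (a + b))) * indicator {0<..<1} s
      \<le> ennreal ((1 - s) powr (- b - 1)) * indicator {0..r} s
         + ennreal ((1 - r) powr (- (a + b))) * (ennreal ((1 - s) powr (a - 1)) * indicator {r..1} s)"
    proof (cases "0 < s \<and> s < 1")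
      case s: True
      show ?thesis
      proof (cases "s \<le> r")
        case True
        have "r * s \<le> 1 * s" using r s by (intro mult_right_mono) auto
        then have "(1 - r * s) powr (- (a + b)) \<le> (1 - s) powr (- (a + b))"
          using s a b by (intro powr_mono2') auto
        then have "(1 - s) powr (a - 1) * (1 - r * s) powr (- (a + b)) \<le> (1 - s) powr (a - 1) * (1 - s) powr (- (a + b))"
          by (intro mult_left_mono) auto
        also have "\<dots> = (1 - s) powr ((a - 1) + - (a + b))" by (rule powr_add[symmetric])
        also have "(a - 1) + - (a + b) = - b - 1" by simp
        finally show ?thesis using s True by (auto intro!: add_increasing2 ennreal_leI)
      next
        case False
        have "r * s \<le> r * 1" using r s by (intro mult_left_mono) auto
        then have "(1 - r * s) powr (- (a + b)) \<le> (1 - r) powr (- (a + b))"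
          using r a b by (intro powr_mono2') auto
        then have "(1 - s) powr (a - 1) * (1 - r * s) powr (- (a + b)) \<le> (1 - r) powr (- (a + b)) * (1 - s) powr (a - 1)"
          by (subst mult.commute) (intro mult_right_mono, auto)
        then show ?thesis using s False by (auto simp: ennreal_mult[symmetric] intro!: ennreal_leI)
      qed
    qed auto
  qed
  also have "\<dots> = (\<integral>\<^sup>+s. ennreal ((1 - s) powr (- b - 1)) * indicator {0..r} s \<partial>lborel)
       + ennreal ((1 - r) powr (- (a + b))) * ennreal ((1 - r) powr a / a)"
    by (simp add: nn_integral_add nn_integral_cmult I1)
  also have "\<dots> \<le> ennreal ((1 - r) powr (- b) / b) + ennreal ((1 - r) powr (- (a + b)) * ((1 - r) powr a / a))"
    using I2 by (intro add_mono) (simp_all add: ennreal_mult[symmetric] a less_imp_le)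
  also have "\<dots> = ennreal ((1 - r) powr (- b) / b + (1 - r) powr (- (a + b)) * ((1 - r) powr a / a))"
    using a b by (subst ennreal_plus) auto
  also have "(1 - r) powr (- b) / b + (1 - r) powr (- (a + b)) * ((1 - r) powr a / a) = (1 / a + 1 / b) * (1 - r) powr (- b)"
    using r a by (simp add: algebra_simps powr_add[symmetric])
  finally show ?thesis .
qed

section \<open>Zonal kernels\<close>

lemma has_bochner_integral_Beta:
  fixes p q :: real
  assumes "p > 0" "q > 0"
  shows "has_bochner_integral lborel (\<lambda>s. indicator {0<..<1} s * (s powr (p - 1) * (1 - s) powr (q - 1))) (Beta p q)"
proof (rule has_bochner_integral_nn_integral)
  have "((\<lambda>s. s powr (p - 1) * (1 - s) powr (q - 1)) has_integral Beta p q) {0<..<1}"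
    using has_integral_Beta_real[OF assms] by (simp add: has_integral_Icc_iff_Ioo)
  then show "(\<integral>\<^sup>+s. ennreal (indicator {0<..<1} s * (s powr (p - 1) * (1 - s) powr (q - 1))) \<partial>lborel) = ennreal (Beta p q)"
    by (intro nn_integral_has_integral_lebesgue) auto
qed (use assms in \<open>auto simp: Beta_def intro!: less_imp_le Gamma_real_pos divide_nonneg_pos mult_nonneg_nonneg\<close>)

lemma sphere_integral_suminf:
  fixes f :: "nat \<Rightarrow> real^'n::finite \<Rightarrow> real"
  assumes f: "\<And>k. f k \<in> borel_measurable borel" and w: "\<And>k y. y \<in> sphere 0 1 \<Longrightarrow> \<bar>f k y\<bar> \<le> w k" "summable w"
  shows "(\<lambda>k. \<integral>y. f k y \<partial>sphere_measure) sums (\<integral>y. (\<Sum>k. f k y) \<partial>sphere_measure)"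
proof (rule sums_integral)
  show i: "integrable sphere_measure (f k)" for k by (rule sphere_integrable(1)[OF f w(1)])
  show "AE y in sphere_measure. summable (\<lambda>k. norm (f k y))"
    using AE_sphere_measure
    by eventually_elim (rule summable_comparison_test'[OF w(2), of 0], use w(1) in auto)
  have "norm (\<integral>y. norm (f k y) \<partial>sphere_measure) \<le> w k" for k
    using sphere_integrable(2)[of "\<lambda>y. norm (f k y)" "w k"] f w(1) by simp
  then show "summable (\<lambda>k. \<integral>y. norm (f k y) \<partial>sphere_measure)"
    by (intro summable_comparison_test'[OF w(2), of 0])
qed

context sph
begin

text \<open>The zonal harmonic of degree \<open>k\<close>: the reproducing kernel of the spherical
  harmonics of that degree, as \<open>integral_zon_hcomp\<close> shows.\<close>

definition zon :: "nat \<Rightarrow> real^'n \<Rightarrow> real^'n \<Rightarrow> real" where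
  "zon k x y = (\<Sum>j=1..d k. Y k j x * Y k j y)"

text \<open>The integral kernel of the operator that multiplies components of degree
  \<open>k\<close> by \<open>m k\<close>. With \<open>m k = r ^ k\<close> it is the Poisson kernel,
  with \<open>m k = r ^ k * fr t k\<close> its fractional derivative of order
  \<open>t\<close>.\<close>

definition ker :: "(nat \<Rightarrow> real) \<Rightarrow> real^'n \<Rightarrow> real^'n \<Rightarrow> real" where
  "ker m x y = (\<Sum>k. m k * zon k x y)"

lemma zon_commute: "zon k x y = zon k y x"
  by (simp add: zon_def mult.commute)

lemma ker_commute: "ker m x y = ker m y x"
  by (simp add: ker_def zon_commute)

lemma zon_eq_hcomp: "zon k x y = hcomp (\<lambda>k j. Y k j x) k y"
  by (simp add: zon_def hcomp_def)

lemma zon_bound: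
  assumes "x \<in> sphere 0 1" "y \<in> sphere 0 1" shows "\<bar>zon k x y\<bar> \<le> gC ^ 3 * (real k + 1) ^ (3 * CARD('n))"
proof -
  have "\<bar>zon k x y\<bar> \<le> wt (\<lambda>k j. Y k j x) k" unfolding zon_eq_hcomp by (rule abs_hcomp_le[OF assms(2)])
  also have "\<dots> \<le> gC * (real k + 1) ^ CARD('n) * gC\<^sup>2 * (real k + 1) ^ (2 * CARD('n))"
    by (rule wt_le) (use gC assms in auto)
  also have "\<dots> = (gC * gC\<^sup>2) * ((real k + 1) ^ CARD('n) * (real k + 1) ^ (2 * CARD('n)))"
    by (simp only: mult_ac)
  also have "\<dots> = gC ^ 3 * (real k + 1) ^ (3 * CARD('n))"
    by (simp only: power_add[symmetric]) (simp add: power2_eq_square power3_eq_cube)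
  finally show ?thesis .
qed

lemma zon_poly: "zon k x \<in> poly_fun"
  using hcomp_poly by (simp add: zon_eq_hcomp[abs_def])

lemma zon_measurable_pair [measurable]: "(\<lambda>(x, y). zon k x y) \<in> borel_measurable (borel \<Otimes>\<^sub>M borel)"
proof -
  have "(\<lambda>z. Y k j (fst z) * Y k j (snd z)) \<in> borel_measurable (borel \<Otimes>\<^sub>M borel)" if "j \<in> {1..d k}" for j
    using Y_measurable[OF that] by measurable
  then show ?thesis
    unfolding zon_def case_prod_beta by (intro borel_measurable_sum)
qed

lemma ker_measurable_pair: "(\<lambda>(x, y). ker m x y) \<in> borel_measurable (borel \<Otimes>\<^sub>M borel)"
proof -
  have "(\<lambda>z. \<Sum>k. m k * (case z of (x, y) \<Rightarrow> zon k x y)) \<in> borel_measurable (borel \<Otimes>\<^sub>M borel)"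
    by measurable
  then show ?thesis by (simp add: ker_def case_prod_beta)
qed

lemma ker_measurable: "ker m x \<in> borel_measurable borel"
  using measurable_Pair2[OF ker_measurable_pair, of x] by simp

lemma integral_zon_hcomp: "(\<integral>y. zon k x y * hcomp b k' y \<partial>sphere_measure) = (if k = k' then hcomp b k x else 0)"
proof -
  have "(\<integral>y. zon k x y * hcomp b k' y \<partial>sphere_measure)
     = (\<integral>y. (\<Sum>j=1..d k'. b k' j * (hcomp (\<lambda>k j. Y k j x) k y * Y k' j y)) \<partial>sphere_measure)"
    by (intro Bochner_Integration.integral_cong refl)
       (simp add: zon_eq_hcomp hcomp_def[of b k'] sum_distrib_left mult_ac)
  also have "\<dots> = (\<Sum>j=1..d k'. b k' j * (\<integral>y. hcomp (\<lambda>k j. Y k j x) k y * Y k' j y \<partial>sphere_measure))"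
    by (subst Bochner_Integration.integral_sum) (auto intro!: integrable_mult_right integrable_Y_mult hcomp_poly)
  also have "\<dots> = (\<Sum>j=1..d k'. b k' j * (if k = k' then Y k j x else 0))"
    by (intro sum.cong refl) (simp add: integral_hcomp_Y)
  finally show ?thesis by (auto simp: hcomp_def)
qed

text \<open>The \<open>L1\<close> norm of a zonal kernel is the norm of the corresponding multiplier on bounded harmonic
  polynomials: test against a polynomial approximation of \<open>K / (|K| + \<epsilon>)\<close>.\<close>

lemma ker_L1_bound:
  assumes m: "summable (\<lambda>k. \<bar>m k\<bar> * (gC ^ 3 * (real k + 1) ^ (3 * CARD('n))))" and x: "x \<in> sphere 0 1"
    and A: "\<And>b K. (\<And>z. z \<in> sphere 0 1 \<Longrightarrow> \<bar>trig b K z\<bar> \<le> 1) \<Longrightarrow> \<bar>\<Sum>k<K. m k * hcomp b k x\<bar> \<le> A"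
  shows "(\<integral>\<^sup>+y. ennreal \<bar>ker m x y\<bar> \<partial>sphere_measure) \<le> ennreal A"
proof -
  let ?w = "\<lambda>k. \<bar>m k\<bar> * (gC ^ 3 * (real k + 1) ^ (3 * CARD('n)))"
  define B where "B = suminf ?w"
  have w: "\<bar>m k * zon k x y\<bar> \<le> ?w k" if "y \<in> sphere 0 1" for k y
    unfolding abs_mult by (intro mult_left_mono zon_bound x that) simp
  have B0: "B \<ge> 0" unfolding B_def using gC(1) by (intro suminf_nonneg m) simp
  have KB: "\<bar>ker m x y\<bar> \<le> B" if "y \<in> sphere 0 1" for y
    unfolding ker_def B_def real_norm_def[symmetric]
    by (rule norm_suminf_le) (use w[OF that] m in auto)
  have Km [measurable]: "ker m x \<in> borel_measurable borel" by (rule ker_measurable)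
  have Kc: "continuous_on (sphere 0 1) (ker m x)"
    unfolding ker_def[abs_def]
  proof (rule uniform_limit_theorem)
    show "uniform_limit (sphere 0 1) (\<lambda>n y. \<Sum>k<n. m k * zon k x y) (\<lambda>y. \<Sum>k. m k * zon k x y) sequentially"
      by (rule Weierstrass_m_test[OF _ m]) (use w in auto)
    show "\<forall>\<^sub>F n in sequentially. continuous_on (sphere 0 1) (\<lambda>y. \<Sum>k<n. m k * zon k x y)"
      by (intro always_eventually allI poly_fun_continuous poly_fun_sum poly_fun_cmult zon_poly)
  qed simp
  have iK: "integrable sphere_measure (\<lambda>y. \<bar>ker m x y\<bar>)"
    by (rule sphere_integrable(1)[where B = B]) (use KB in auto)
  have rep: "(\<integral>y. ker m x y * hcomp b k' y \<partial>sphere_measure) = m k' * hcomp b k' x" for b k'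
  proof -
    have "(\<lambda>k. \<integral>y. (m k * zon k x y) * hcomp b k' y \<partial>sphere_measure) sums
        (\<integral>y. (\<Sum>k. (m k * zon k x y) * hcomp b k' y) \<partial>sphere_measure)"
    proof (rule sphere_integral_suminf)
      show "(\<lambda>y. m k * zon k x y * hcomp b k' y) \<in> borel_measurable borel" for k
        by (intro poly_fun_measurable pmult poly_fun_cmult zon_poly hcomp_poly)
      show "\<bar>m k * zon k x y * hcomp b k' y\<bar> \<le> ?w k * wt b k'" if "y \<in> sphere 0 1" for k y
        unfolding abs_mult[of _ "hcomp b k' y"]
        using w[OF that, of k] abs_hcomp_le[OF that, of b k'] by (intro mult_mono) auto
      show "summable (\<lambda>k. ?w k * wt b k')" by (intro summable_mult2 m)
    qed
    moreover have "(\<lambda>k. \<integral>y. (m k * zon k x y) * hcomp b k' y \<partial>sphere_measure) = (\<lambda>k. if k = k' then m k' * hcomp b k' x else 0)"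
      by (auto simp: mult.assoc integral_zon_hcomp)
    ultimately have "(\<lambda>k. if k = k' then m k' * hcomp b k' x else 0) sums (\<integral>y. (\<Sum>k. (m k * zon k x y) * hcomp b k' y) \<partial>sphere_measure)"
      by simp
    moreover have "(\<integral>y. (\<Sum>k. (m k * zon k x y) * hcomp b k' y) \<partial>sphere_measure) = (\<integral>y. ker m x y * hcomp b k' y \<partial>sphere_measure)"
    proof (rule integral_cong_sphere)
      show "(\<lambda>y. \<Sum>k. m k * zon k x y * hcomp b k' y) \<in> borel_measurable borel"
        using poly_fun_measurable[OF zon_poly] by measurable
      fix y :: "real^'n" assume "y \<in> sphere 0 1"
      then have "summable (\<lambda>k. m k * zon k x y)"
        using w by (intro summable_comparison_test'[OF m, of 0]) auto
      then show "(\<Sum>k. m k * zon k x y * hcomp b k' y) = ker m x y * hcomp b k' y"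
        unfolding ker_def by (rule suminf_mult2[symmetric])
    qed measurable
    ultimately show ?thesis
      using sums_unique2 sums_single[of k' "\<lambda>k. m k' * hcomp b k' x"] by (metis (no_types, lifting) sums_cong)
  qed
  have main: "(\<integral>y. \<bar>ker m x y\<bar> \<partial>sphere_measure) \<le> A * (1 + \<epsilon>) + (B * \<epsilon> + \<epsilon>)" if e: "\<epsilon> > 0" for \<epsilon>
  proof -
    define \<phi> where "\<phi> y = ker m x y / (\<bar>ker m x y\<bar> + \<epsilon>)" for y
    have pos: "\<bar>ker m x y\<bar> + \<epsilon> > 0" for y using e by (simp add: add_nonneg_pos)
    have "continuous_on (sphere 0 1) \<phi>"
      unfolding \<phi>_def using pos by (intro continuous_intros Kc) (metis less_irrefl)
    then obtain b K where b: "\<forall>k\<ge>K. \<forall>j. b k j = 0" "\<And>y. y \<in> sphere 0 1 \<Longrightarrow> \<bar>\<phi> y - trig b K y\<bar> \<le> \<epsilon>"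
      using e by (rule trig_dense) (rule that)
    have phi1: "\<bar>\<phi> y\<bar> \<le> 1" for y
      using e pos[of y] by (simp add: \<phi>_def abs_divide divide_le_eq)
    \<comment> \<open>The approximant may reach \<open>1 + \<epsilon>\<close> on the sphere;
      dividing by this makes it a legitimate test polynomial in hypothesis \<open>A\<close>.\<close>
    let ?b = "\<lambda>k j. (1 / (1 + \<epsilon>)) * b k j"
    have tb: "trig ?b K y = trig b K y / (1 + \<epsilon>)" for y
      using hcomp_mult[of "\<lambda>k. 1 / (1 + \<epsilon>)" b] by (simp add: trig_def sum_divide_distrib)
    have "\<bar>\<Sum>k<K. m k * hcomp ?b k x\<bar> \<le> A"
    proof (rule A)
      fix z :: "real^'n" assume z: "z \<in> sphere 0 1"
      show "\<bar>trig ?b K z\<bar> \<le> 1"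
        unfolding tb using b(2)[OF z] phi1[of z] e by (simp add: abs_divide divide_le_eq)
    qed
    then have "\<bar>(\<Sum>k<K. m k * hcomp b k x) / (1 + \<epsilon>)\<bar> \<le> A"
      using hcomp_mult[of "\<lambda>k. 1 / (1 + \<epsilon>)" b] by (simp add: sum_divide_distrib)
    then have Am: "(\<Sum>k<K. m k * hcomp b k x) \<le> A * (1 + \<epsilon>)"
      using e by (simp add: abs_divide divide_le_eq abs_le_iff)
    have trigB: "\<bar>trig b K y\<bar> \<le> 1 + \<epsilon>" if "y \<in> sphere 0 1" for y
      using b(2)[OF that] phi1[of y] by linarith
    have ih: "integrable sphere_measure (\<lambda>y. ker m x y * hcomp b k y)" for k
      by (rule sphere_integrable(1)[where B = "B * wt b k"])
         (auto simp: abs_mult intro!: mult_mono KB abs_hcomp_le B0)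
    have "(\<integral>y. ker m x y * trig b K y \<partial>sphere_measure) = (\<Sum>k<K. m k * hcomp b k x)"
      unfolding trig_def sum_distrib_left using ih by (subst Bochner_Integration.integral_sum) (auto simp: rep)
    moreover have it: "integrable sphere_measure (\<lambda>y. ker m x y * trig b K y)"
      unfolding trig_def sum_distrib_left using ih by (intro Bochner_Integration.integrable_sum)
    moreover have "(\<integral>y. \<bar>ker m x y\<bar> \<partial>sphere_measure) \<le> (\<integral>y. ker m x y * trig b K y + (B * \<epsilon> + \<epsilon>) \<partial>sphere_measure)"
    proof (rule integral_mono_AE[OF iK])
      show "integrable sphere_measure (\<lambda>y. ker m x y * trig b K y + (B * \<epsilon> + \<epsilon>))"
        by (intro Bochner_Integration.integrable_add it finite_measure.integrable_const finite_measure_sphere_measure)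
      show "AE y in sphere_measure. \<bar>ker m x y\<bar> \<le> ker m x y * trig b K y + (B * \<epsilon> + \<epsilon>)"
        using AE_sphere_measure
      proof eventually_elim
        fix y :: "real^'n" assume y: "y \<in> sphere 0 1"
        have "\<bar>ker m x y\<bar> - \<epsilon> \<le> ker m x y * \<phi> y"
        proof -
          have "(\<bar>ker m x y\<bar> - \<epsilon>) * (\<bar>ker m x y\<bar> + \<epsilon>) \<le> ker m x y * ker m x y"
            by (simp add: algebra_simps)
          then show ?thesis using pos[of y] by (simp add: \<phi>_def le_divide_eq)
        qed
        moreover have "\<bar>ker m x y * (\<phi> y - trig b K y)\<bar> \<le> B * \<epsilon>"
          unfolding abs_mult using KB[OF y] b(2)[OF y] B0 by (intro mult_mono) auto
        ultimately show "\<bar>ker m x y\<bar> \<le> ker m x y * trig b K y + (B * \<epsilon> + \<epsilon>)"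
          unfolding right_diff_distrib by linarith
      qed
    qed
    moreover have "(\<integral>y. ker m x y * trig b K y + (B * \<epsilon> + \<epsilon>) \<partial>sphere_measure)
       = (\<integral>y. ker m x y * trig b K y \<partial>sphere_measure) + (B * \<epsilon> + \<epsilon>)"
      using it finite_measure.integrable_const[OF finite_measure_sphere_measure]
      by (subst Bochner_Integration.integral_add) auto
    ultimately show ?thesis using Am by linarith
  qed
  have A0: "A \<ge> 0" using A[of "\<lambda>k j. 0" 0] by (simp add: trig_def)
  have "(\<integral>y. \<bar>ker m x y\<bar> \<partial>sphere_measure) \<le> A"
  proof (rule field_le_epsilon)
    fix e :: real assume e: "e > 0"
    have D: "A + B + 1 > 0" using A0 B0 by simp
    have "A * (1 + \<epsilon>) + (B * \<epsilon> + \<epsilon>) = A + \<epsilon> * (A + B + 1)" for \<epsilon>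
      by (simp add: algebra_simps)
    moreover have "e / (A + B + 1) > 0" using e D by simp
    ultimately have "(\<integral>y. \<bar>ker m x y\<bar> \<partial>sphere_measure) \<le> A + (e / (A + B + 1)) * (A + B + 1)"
      using main by metis
    then show "(\<integral>y. \<bar>ker m x y\<bar> \<partial>sphere_measure) \<le> A + e" using D by simp
  qed
  then show ?thesis
    using nn_integral_eq_integral[OF iK] by (simp add: ennreal_leI)
qed

text \<open>The multiplier \<open>r ^ k\<close> sends a harmonic polynomial to its dilate, and the
  maximum principle bounds the dilate by the values on the sphere. The mass bound is the dual form
  of this.\<close>

lemma poisson_L1:
  assumes r: "0 \<le> r" "r < 1" and x: "x \<in> sphere 0 1"
  shows "(\<integral>\<^sup>+y. ennreal \<bar>ker (\<lambda>k. r ^ k) x y\<bar> \<partial>sphere_measure) \<le> 1"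
proof -
  have "(\<integral>\<^sup>+y. ennreal \<bar>ker (\<lambda>k. r ^ k) x y\<bar> \<partial>sphere_measure) \<le> ennreal 1"
  proof (rule ker_L1_bound[OF _ x])
    have "summable (\<lambda>k. gC ^ 3 * ((real k + 1) ^ (3 * CARD('n)) * r ^ k))"
      by (intro summable_mult summable_poly_geometric r)
    then show "summable (\<lambda>k. \<bar>r ^ k\<bar> * (gC ^ 3 * (real k + 1) ^ (3 * CARD('n))))"
      using r by (simp add: mult_ac)
    fix b K assume "\<And>z. z \<in> sphere 0 1 \<Longrightarrow> \<bar>trig b K z\<bar> \<le> 1"
    then have "\<bar>trig b K (r *\<^sub>R x)\<bar> \<le> 1"
      by (rule poly_harmonic_bound_cball[OF trig_poly trig_lap]) (use r x in auto)
    then show "\<bar>\<Sum>k<K. r ^ k * hcomp b k x\<bar> \<le> 1" by (simp add: trig_scale)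
  qed
  then show ?thesis by simp
qed

section \<open>Multipliers of positive order\<close>

lemma trig_euler: "(\<Sum>i\<in>UNIV. x $ i * dpart i (trig b K) x) = (\<Sum>k<K. real k * hcomp b k x)"
proof -
  have "(\<Sum>i\<in>UNIV. x $ i * dpart i (trig b K) x) = (\<Sum>i\<in>UNIV. \<Sum>k<K. x $ i * dpart i (hcomp b k) x)"
    unfolding trig_def[abs_def] by (simp add: dpart_sum hcomp_poly sum_distrib_left)
  also have "\<dots> = (\<Sum>k<K. \<Sum>i\<in>UNIV. x $ i * dpart i (hcomp b k) x)" by (rule sum.swap)
  also have "\<dots> = (\<Sum>k<K. real k * hcomp b k x)"
    using hcomp_sph_harm by (intro sum.cong refl hom_poly_euler) (simp add: sph_harm_iff)
  finally show ?thesis .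
qed

text \<open>Multiplying degree \<open>k\<close> by \<open>real k + a\<close> is the radial
  derivative plus \<open>a\<close>. The gradient estimate on a ball reaching half way to the sphere
  costs one power of \<open>1 - norm x\<close>: the square of \<open>CARD('n)\<close> comes from the
  number of coordinates and the factor in the gradient estimate, \<open>2 ^ Suc l\<close> from
  halving the distance.\<close>

lemma trig_radial_bound:
  assumes M: "\<And>x. norm x < 1 \<Longrightarrow> \<bar>trig b K x\<bar> \<le> M / (1 - norm x) ^ l" and a: "a \<ge> 0" and x: "norm x < 1"
  shows "\<bar>trig (\<lambda>k j. (real k + a) * b k j) K x\<bar> \<le> (real CARD('n) ^ 2 * 2 ^ Suc l + a) * M / (1 - norm x) ^ Suc l"
proof -
  let ?n = "real CARD('n)"
  define \<delta> where "\<delta> = (1 - norm x) / 2"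
  have \<delta>: "\<delta> > 0" using x by (simp add: \<delta>_def)
  have M0: "M \<ge> 0" using M[of 0] by simp
  have g: "\<bar>dpart i (trig b K) x\<bar> \<le> ?n * (M / \<delta> ^ l) / \<delta>" for i
  proof (rule poly_harmonic_dpart_bound[OF trig_poly trig_lap \<delta>])
    fix y assume "y \<in> cball x \<delta>"
    then have ny: "norm y \<le> norm x + \<delta>"
      using norm_triangle_sub[of y x] by (simp add: dist_norm norm_minus_commute)
    then have y: "\<delta> \<le> 1 - norm y" by (simp add: \<delta>_def field_simps)
    have "\<bar>trig b K y\<bar> \<le> M / (1 - norm y) ^ l" using y \<delta> by (intro M) simp
    also have "\<dots> \<le> M / \<delta> ^ l" using y \<delta> M0 by (intro divide_left_mono power_mono) auto
    finally show "\<bar>trig b K y\<bar> \<le> M / \<delta> ^ l" .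
  qed
  have "\<bar>\<Sum>i\<in>UNIV. x $ i * dpart i (trig b K) x\<bar> \<le> (\<Sum>i\<in>(UNIV::'n set). 1 * (?n * (M / \<delta> ^ l) / \<delta>))"
  proof (rule order_trans[OF sum_abs sum_mono])
    fix i
    have "\<bar>x $ i\<bar> \<le> 1" using component_le_norm_cart[of x i] x by linarith
    then show "\<bar>x $ i * dpart i (trig b K) x\<bar> \<le> 1 * (?n * (M / \<delta> ^ l) / \<delta>)"
      unfolding abs_mult by (intro mult_mono g) auto
  qed
  also have "\<dots> = ?n ^ 2 * M / \<delta> ^ Suc l" by (simp add: power2_eq_square mult_ac)
  also have "\<dots> = ?n ^ 2 * 2 ^ Suc l * M / (1 - norm x) ^ Suc l" by (simp add: \<delta>_def power_divide)
  finally have e: "\<bar>\<Sum>i\<in>UNIV. x $ i * dpart i (trig b K) x\<bar> \<le> ?n ^ 2 * 2 ^ Suc l * M / (1 - norm x) ^ Suc l" .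
  have "\<bar>a * trig b K x\<bar> \<le> a * (M / (1 - norm x) ^ l)"
    unfolding abs_mult using a M[OF x] by (intro mult_mono) auto
  also have "\<dots> \<le> a * (M / (1 - norm x) ^ Suc l)"
    using a M0 x by (intro mult_left_mono divide_left_mono) (auto simp: mult_left_le_one_le)
  finally have f: "\<bar>a * trig b K x\<bar> \<le> a * M / (1 - norm x) ^ Suc l" by simp
  have "trig (\<lambda>k j. (real k + a) * b k j) K x = (\<Sum>i\<in>UNIV. x $ i * dpart i (trig b K) x) + a * trig b K x"
    using hcomp_mult[of "\<lambda>k. real k + a" b]
    by (simp add: trig_euler trig_def distrib_right sum.distrib sum_distrib_left)
  then show ?thesis using e f by (simp add: add_divide_distrib distrib_right)
qed

text \<open>The Pochhammer symbol is applied one factor \<open>real k + a + real l\<close> at a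
  time. The constant stands outside the quantifiers over \<open>b\<close> and \<open>K\<close>:
  uniformity over all finite expansions bounded by 1 is what \<open>ker_L1_bound\<close> asks
  for.\<close>

lemma trig_pochhammer_bound:
  assumes a: "a \<ge> 0"
  shows "\<exists>C\<ge>0. \<forall>b K. (\<forall>z\<in>sphere 0 1. \<bar>trig b K z\<bar> \<le> 1) \<longrightarrow>
    (\<forall>x. norm x < 1 \<longrightarrow> \<bar>trig (\<lambda>k j. pochhammer (real k + a) l * b k j) K x\<bar> \<le> C / (1 - norm x) ^ l)"
proof (induction l)
  case 0
  have "\<bar>trig b K x\<bar> \<le> 1" if "\<forall>z\<in>sphere 0 1. \<bar>trig b K z\<bar> \<le> 1" "norm x < 1" for b K x
    by (rule poly_harmonic_bound_cball[OF trig_poly trig_lap]) (use that in auto)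
  then show ?case by (intro exI[of _ 1]) auto
next
  case (Suc l)
  then obtain C where C: "C \<ge> 0" "\<And>b K x. \<forall>z\<in>sphere 0 1. \<bar>trig b K z\<bar> \<le> 1 \<Longrightarrow> norm x < 1 \<Longrightarrow>
    \<bar>trig (\<lambda>k j. pochhammer (real k + a) l * b k j) K x\<bar> \<le> C / (1 - norm x) ^ l" by blast
  let ?C = "(real CARD('n) ^ 2 * 2 ^ Suc l + (a + real l)) * C"
  have "\<bar>trig (\<lambda>k j. pochhammer (real k + a) (Suc l) * b k j) K x\<bar> \<le> ?C / (1 - norm x) ^ Suc l"
    if b: "\<forall>z\<in>sphere 0 1. \<bar>trig b K z\<bar> \<le> 1" and x: "norm x < 1" for b K x
  proof -
    have "(\<lambda>k j. pochhammer (real k + a) (Suc l) * b k j)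
       = (\<lambda>k j. (real k + (a + real l)) * (pochhammer (real k + a) l * b k j))"
      by (simp add: pochhammer_Suc mult_ac add_ac)
    then show ?thesis
      using trig_radial_bound[OF C(2)[OF b], of "a + real l" x] a x by simp
  qed
  moreover have "?C \<ge> 0" using C(1) a by simp
  ultimately show ?case by blast
qed

text \<open>The coefficient of degree \<open>k\<close> in \<open>Lam\<close>. It is the reciprocal
  of \<open>Beta (real k + real CARD('n) / 2) t\<close>, which is how radial integration inverts
  it.\<close>

definition fr :: "real \<Rightarrow> nat \<Rightarrow> real" where
  "fr t k = Gamma (real k + real CARD('n) / 2 + t) / (Gamma (real k + real CARD('n) / 2) * Gamma t)"

lemma half_dim_pos: "real k + real CARD('n) / 2 > 0"
  by (intro add_nonneg_pos) auto

lemma fr_pos: "t > 0 \<Longrightarrow> fr t k > 0"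
  unfolding fr_def using half_dim_pos[of k] by (intro divide_pos_pos mult_pos_pos Gamma_real_pos) auto

text \<open>Write \<open>Gamma (z + t) / Gamma z\<close> as \<open>Gamma (z + N) / Gamma z\<close>,
  a Pochhammer symbol, times \<open>Gamma (z + t) / Gamma (z + N)\<close>, a Beta value up to a
  constant. The former is a differential operator of integer order, the latter an average over
  dilations.\<close>

lemma fr_eq_Beta:
  assumes t: "t > 0" "t < real N"
  shows "fr t k = pochhammer (real k + real CARD('n) / 2) N * Beta (real k + real CARD('n) / 2 + t) (real N - t)
      / (Gamma (real N - t) * Gamma t)"
proof -
  have gen: "Gamma (z + t) / (Gamma z * Gamma t) = pochhammer z N * Beta (z + t) (real N - t) / (Gamma (real N - t) * Gamma t)"
    if z: "z > 0" for z :: real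
  proof -
    have "z \<notin> \<int>\<^sub>\<le>\<^sub>0" using z by (auto dest: nonpos_Ints_nonpos)
    then have "pochhammer z N = Gamma (z + real N) / Gamma z" by (rule pochhammer_Gamma)
    moreover have "Beta (z + t) (real N - t) = Gamma (z + t) * Gamma (real N - t) / Gamma (z + real N)"
      by (simp add: Beta_def)
    moreover have "Gamma (z + real N) > 0" "Gamma z > 0" "Gamma (real N - t) > 0" "Gamma t > 0"
      using z t by (auto intro!: Gamma_real_pos simp: add_pos_nonneg)
    ultimately show ?thesis by simp
  qed
  show ?thesis unfolding fr_def by (rule gen[OF half_dim_pos])
qed

text \<open>Any polynomial bound will do, so the exponent is a natural number \<open>N > t\<close>:
  in \<open>fr_eq_Beta\<close> the Pochhammer symbol grows at most like \<open>k ^ N\<close> and the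
  Beta factor decreases in its first argument.\<close>

lemma fr_growth:
  assumes t: "t > 0"
  obtains C p where "C \<ge> 0" "\<And>k. fr t k \<le> C * (real k + 1) ^ p"
proof -
  obtain N where N: "t < real N" using reals_Archimedean2 by blast
  let ?a = "real CARD('n) / 2"
  define B where "B = Beta (?a + t) (real N - t) / (Gamma (real N - t) * Gamma t)"
  have Gp: "Gamma (real N - t) * Gamma t > 0" using N t by (intro mult_pos_pos Gamma_real_pos) auto
  have B0: "B \<ge> 0" unfolding B_def Beta_def using N t half_dim_pos[of 0]
    by (intro divide_nonneg_nonneg mult_nonneg_nonneg less_imp_le[OF Gamma_real_pos]) auto
  have poch: "pochhammer (real k + ?a) N \<le> ((?a + real N) * (real k + 1)) ^ N" for k
  proof -
    have "pochhammer (real k + ?a) N = (\<Prod>i<N. real k + ?a + real i)" by (simp add: pochhammer_prod lessThan_atLeast0)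
    also have "\<dots> \<le> (\<Prod>i<N. (?a + real N) * (real k + 1))"
    proof (rule prod_mono)
      fix i assume i: "i \<in> {..<N}"
      have "1 \<le> ?a + real N" using i by (cases N) auto
      then have "1 * real k \<le> (?a + real N) * real k" by (intro mult_right_mono) auto
      then show "0 \<le> real k + ?a + real i \<and> real k + ?a + real i \<le> (?a + real N) * (real k + 1)"
        using i by (simp add: distrib_left)
    qed
    finally show ?thesis by simp
  qed
  have "fr t k \<le> B * (?a + real N) ^ N * (real k + 1) ^ N" for k
  proof -
    have "Beta (real k + ?a + t) (real N - t) \<le> Beta (?a + t) (real N - t)"
      using N t half_dim_pos[of 0] by (intro Beta_real_mono) auto
    then have "pochhammer (real k + ?a) N * Beta (real k + ?a + t) (real N - t)
      \<le> ((?a + real N) * (real k + 1)) ^ N * Beta (?a + t) (real N - t)"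
      using poch N t half_dim_pos[of k]
      by (intro mult_mono) (auto simp: Beta_def intro!: divide_nonneg_nonneg mult_nonneg_nonneg less_imp_le[OF Gamma_real_pos])
    then have "fr t k \<le> ((?a + real N) * (real k + 1)) ^ N * Beta (?a + t) (real N - t) / (Gamma (real N - t) * Gamma t)"
      unfolding fr_eq_Beta[OF t N] using Gp by (intro divide_right_mono) auto
    then show ?thesis by (simp add: B_def power_mult_distrib mult_ac)
  qed
  then show ?thesis using that[of "B * (?a + real N) ^ N" N] B0 by simp
qed

lemma fr_summable:
  assumes t: "t > 0" and r: "0 \<le> r" "r < 1"
  shows "summable (\<lambda>k. \<bar>r ^ k * fr t k\<bar> * (gC ^ 3 * (real k + 1) ^ (3 * CARD('n))))"
proof -
  obtain C p where C: "C \<ge> 0" "\<And>k. fr t k \<le> C * (real k + 1) ^ p" using fr_growth[OF t] by blast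
  have "summable (\<lambda>k. C * gC ^ 3 * ((real k + 1) ^ (p + 3 * CARD('n)) * r ^ k))"
    by (intro summable_mult summable_poly_geometric r)
  moreover have "norm (\<bar>r ^ k * fr t k\<bar> * (gC ^ 3 * (real k + 1) ^ (3 * CARD('n))))
     \<le> C * gC ^ 3 * ((real k + 1) ^ (p + 3 * CARD('n)) * r ^ k)" for k
  proof -
    have "r ^ k * fr t k * (gC ^ 3 * (real k + 1) ^ (3 * CARD('n)))
       \<le> r ^ k * (C * (real k + 1) ^ p) * (gC ^ 3 * (real k + 1) ^ (3 * CARD('n)))"
      using r gC(1) C(2) by (intro mult_right_mono mult_left_mono) auto
    then show ?thesis using r gC(1) fr_pos[OF t, of k] by (simp add: power_add mult_ac abs_mult)
  qed
  ultimately show ?thesis by (meson summable_comparison_test')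
qed

text \<open>The fractional multiplier is a derivative of integer order \<open>N > t\<close>, bounded by the gradient estimate,
  followed by a fractional integral written as a Beta integral over dilations.\<close>

lemma fr_kernel_L1:
  assumes t: "t > 0" and n2: "CARD('n) \<ge> 2"
  obtains C where "C > 0" "\<And>r x. 0 \<le> r \<Longrightarrow> r < 1 \<Longrightarrow> x \<in> sphere 0 1 \<Longrightarrow>
    (\<integral>\<^sup>+y. ennreal \<bar>ker (\<lambda>k. r ^ k * fr t k) x y\<bar> \<partial>sphere_measure) \<le> ennreal (C * (1 - r) powr (- t))"
proof -
  obtain N where N: "t < real N" using reals_Archimedean2 by blast
  let ?a = "real CARD('n) / 2"
  have "?a \<ge> 0" by simp
  from trig_pochhammer_bound[OF this, of N]
  obtain C where C: "C \<ge> 0" "\<And>b K x. \<forall>z\<in>sphere 0 1. \<bar>trig b K z\<bar> \<le> 1 \<Longrightarrow> norm x < 1 \<Longrightarrow>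
    \<bar>trig (\<lambda>k j. pochhammer (real k + ?a) N * b k j) K x\<bar> \<le> C / (1 - norm x) ^ N"
    by blast
  define G where "G = Gamma (real N - t) * Gamma t"
  have G: "G > 0" unfolding G_def using N t by (intro mult_pos_pos Gamma_real_pos) auto
  define D where "D = (C + 1) * (1 / (real N - t) + 1 / t) / G"
  have C1: "C + 1 > 0" using C(1) by simp
  have "1 / (real N - t) + 1 / t > 0" using N t by (intro add_pos_pos) auto
  then have D: "D > 0" unfolding D_def by (intro divide_pos_pos mult_pos_pos C1 G)
  have "(\<integral>\<^sup>+y. ennreal \<bar>ker (\<lambda>k. r ^ k * fr t k) x y\<bar> \<partial>sphere_measure) \<le> ennreal (D * (1 - r) powr (- t))"
    if r: "0 \<le> r" "r < 1" and x: "x \<in> sphere 0 1" for r x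
  proof (rule ker_L1_bound[OF fr_summable[OF t r] x])
    fix b K assume "\<And>z. z \<in> sphere 0 1 \<Longrightarrow> \<bar>trig b K z\<bar> \<le> 1"
    then have b: "\<forall>z\<in>sphere 0 1. \<bar>trig b K z\<bar> \<le> 1" by blast
    let ?p = "\<lambda>k. pochhammer (real k + ?a) N"
    \<comment> \<open>In degree \<open>k\<close> the dilation contributes \<open>s ^ k\<close>,
      which completes the weight to the integrand of
      \<open>Beta (real k + ?a + t) (real N - t)\<close>. The integral of \<open>F\<close> is
      therefore \<open>G\<close> times the value at \<open>x\<close> of the fractional multiplier
      applied to the finite expansion.\<close>
    define F where "F s = indicator {0<..<1} s * (s powr (?a + t - 1) * (1 - s) powr (real N - t - 1)) * trig (\<lambda>k j. ?p k * b k j) K ((r * s) *\<^sub>R x)" for s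
    have "has_bochner_integral lborel
       (\<lambda>s. \<Sum>k<K. (r ^ k * ?p k * hcomp b k x) * (indicator {0<..<1} s * (s powr (real k + ?a + t - 1) * (1 - s) powr (real N - t - 1))))
       (\<Sum>k<K. (r ^ k * ?p k * hcomp b k x) * Beta (real k + ?a + t) (real N - t))"
      using N t half_dim_pos
      by (intro has_bochner_integral_sum has_bochner_integral_mult_right has_bochner_integral_Beta) (auto intro: add_pos_pos)
    moreover have "(\<Sum>k<K. (r ^ k * ?p k * hcomp b k x) * (indicator {0<..<1} s * (s powr (real k + ?a + t - 1) * (1 - s) powr (real N - t - 1)))) = F s" for s
    proof (cases "0 < s \<and> s < 1")
      case True
      have "s powr (real k + ?a + t - 1) = s ^ k * s powr (?a + t - 1)" for k
        using True powr_add[of s "real k" "?a + t - 1"] by (simp add: powr_realpow algebra_simps)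
      then show ?thesis
        unfolding F_def trig_scale using True hcomp_mult[of ?p b]
        by (simp add: sum_distrib_left power_mult_distrib mult_ac)
    qed (simp add: F_def)
    moreover have "(\<Sum>k<K. (r ^ k * ?p k * hcomp b k x) * Beta (real k + ?a + t) (real N - t)) = G * (\<Sum>k<K. (r ^ k * fr t k) * hcomp b k x)"
      unfolding sum_distrib_left
    proof (rule sum.cong[OF refl])
      fix k
      have "G * fr t k = ?p k * Beta (real k + ?a + t) (real N - t)"
        using G unfolding fr_eq_Beta[OF t N] G_def[symmetric] by simp
      moreover have "(r ^ k * ?p k * hcomp b k x) * Beta (real k + ?a + t) (real N - t)
          = (r ^ k * hcomp b k x) * (?p k * Beta (real k + ?a + t) (real N - t))" by (simp only: mult_ac)
      moreover have "(r ^ k * hcomp b k x) * (G * fr t k) = G * ((r ^ k * fr t k) * hcomp b k x)" by (simp only: mult_ac)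
      ultimately show "(r ^ k * ?p k * hcomp b k x) * Beta (real k + ?a + t) (real N - t) = G * ((r ^ k * fr t k) * hcomp b k x)"
        by simp
    qed
    ultimately have bi: "has_bochner_integral lborel F (G * (\<Sum>k<K. (r ^ k * fr t k) * hcomp b k x))" by simp
    have "ennreal (norm (integral\<^sup>L lborel F)) \<le> (\<integral>\<^sup>+s. ennreal (norm (F s)) \<partial>lborel)"
      using bi by (intro integral_norm_bound_ennreal) (simp add: has_bochner_integral_iff)
    also have "\<dots> \<le> (\<integral>\<^sup>+s. ennreal C * (ennreal ((1 - s) powr (real N - t - 1) * (1 - r * s) powr (- ((real N - t) + t))) * indicator {0<..<1} s) \<partial>lborel)"
    proof (rule nn_integral_mono)
      fix s :: real
      show "ennreal (norm (F s)) \<le> ennreal C * (ennreal ((1 - s) powr (real N - t - 1) * (1 - r * s) powr (- ((real N - t) + t))) * indicator {0<..<1} s)"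
      proof (cases "0 < s \<and> s < 1")
        case s: True
        have rs: "0 \<le> r * s" "r * s < 1" using s r mult_strict_mono'[of r 1 s 1] by auto
        have nr: "norm ((r * s) *\<^sub>R x) = r * s" using x rs by simp
        have "norm ((r * s) *\<^sub>R x) < 1" unfolding nr by (rule rs(2))
        from C(2)[OF b this] have "\<bar>trig (\<lambda>k j. ?p k * b k j) K ((r * s) *\<^sub>R x)\<bar> \<le> C / (1 - r * s) ^ N"
          unfolding nr .
        also have "\<dots> = C * (1 - r * s) powr (- ((real N - t) + t))"
          using rs by (simp add: powr_minus powr_realpow divide_inverse)
        finally have 1: "\<bar>trig (\<lambda>k j. ?p k * b k j) K ((r * s) *\<^sub>R x)\<bar> \<le> C * (1 - r * s) powr (- ((real N - t) + t))" .
        \<comment> \<open>Here \<open>CARD('n) \<ge> 2\<close> enters: it makes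
          \<open>?a \<ge> 1\<close>, so the exponent is nonnegative and the power of
          \<open>s\<close> is at most 1.\<close>
        have "s powr (?a + t - 1) \<le> 1 powr (?a + t - 1)"
          using s n2 t by (intro powr_mono2) auto
        then have 2: "s powr (?a + t - 1) * (1 - s) powr (real N - t - 1) \<le> 1 * (1 - s) powr (real N - t - 1)"
          by (intro mult_right_mono) auto
        have "norm (F s) \<le> (1 * (1 - s) powr (real N - t - 1)) * (C * (1 - r * s) powr (- ((real N - t) + t)))"
        proof -
          have "norm (F s) = (s powr (?a + t - 1) * (1 - s) powr (real N - t - 1)) * \<bar>trig (\<lambda>k j. ?p k * b k j) K ((r * s) *\<^sub>R x)\<bar>"
            unfolding F_def using s by (simp add: abs_mult)
          also have "\<dots> \<le> (1 * (1 - s) powr (real N - t - 1)) * (C * (1 - r * s) powr (- ((real N - t) + t)))"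
            by (rule mult_mono[OF 2 1]) auto
          finally show ?thesis .
        qed
        then show ?thesis using s C(1) by (simp add: ennreal_mult[symmetric] mult_ac ennreal_leI)
      qed (simp add: F_def)
    qed
    also have "\<dots> = ennreal C * (\<integral>\<^sup>+s\<in>{0<..<1}. ennreal ((1 - s) powr (real N - t - 1) * (1 - r * s) powr (- ((real N - t) + t))) \<partial>lborel)"
      by (rule nn_integral_cmult) measurable
    also have "\<dots> \<le> ennreal C * ennreal ((1 / (real N - t) + 1 / t) * (1 - r) powr (- t))"
      using N t r by (intro mult_left_mono beta_kernel_integral) auto
    also have "\<dots> = ennreal (C * ((1 / (real N - t) + 1 / t) * (1 - r) powr (- t)))"
      using C N t by (intro ennreal_mult[symmetric]) auto
    finally have "norm (integral\<^sup>L lborel F) \<le> C * ((1 / (real N - t) + 1 / t) * (1 - r) powr (- t))"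
      using C N t by (subst (asm) ennreal_le_iff) auto
    then have "G * \<bar>\<Sum>k<K. (r ^ k * fr t k) * hcomp b k x\<bar> \<le> C * ((1 / (real N - t) + 1 / t) * (1 - r) powr (- t))"
      using bi G by (simp add: has_bochner_integral_integral_eq abs_mult)
    also have "\<dots> \<le> (C + 1) * ((1 / (real N - t) + 1 / t) * (1 - r) powr (- t))"
      using N t by (intro mult_right_mono) auto
    finally have "\<bar>\<Sum>k<K. (r ^ k * fr t k) * hcomp b k x\<bar> \<le> (C + 1) * ((1 / (real N - t) + 1 / t) * (1 - r) powr (- t)) / G"
      using G by (simp add: le_divide_eq mult.commute)
    then show "\<bar>\<Sum>k<K. (r ^ k * fr t k) * hcomp b k x\<bar> \<le> D * (1 - r) powr (- t)"
      by (simp add: D_def)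
  qed
  then show ?thesis using that D by blast
qed

end

section \<open>Mixed norm spaces\<close>

text \<open>The factor \<open>(1 + x) powr (e - 1)\<close> lies between \<open>1 / 2\<close> and
  \<open>2 powr e\<close> whatever the sign of \<open>e - 1\<close>, so weights in
  \<open>1 - x\<^sup>2\<close> and in \<open>1 - x\<close> are interchangeable up to
  constants.\<close>

lemma one_minus_square_powr_bounds:
  fixes x e :: real
  assumes "0 \<le> x" "x < 1" "e > 0"
  shows "(1 - x) powr (e - 1) / 2 \<le> (1 - x\<^sup>2) powr (e - 1)" "(1 - x\<^sup>2) powr (e - 1) \<le> 2 powr e * (1 - x) powr (e - 1)"
proof -
  have eq: "(1 - x\<^sup>2) powr (e - 1) = (1 - x) powr (e - 1) * (1 + x) powr (e - 1)"
    using assms by (subst powr_mult[symmetric]) (auto simp: power2_eq_square algebra_simps)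
  have "(1 + x) powr (-1) \<le> (1 + x) powr (e - 1)" using assms by (intro powr_mono) auto
  moreover have "(1 + x) powr (-1) \<ge> 1 / 2" using assms by (simp add: powr_minus field_simps)
  ultimately have "1 / 2 \<le> (1 + x) powr (e - 1)" by linarith
  then have "(1 - x) powr (e - 1) * (1 / 2) \<le> (1 - x) powr (e - 1) * (1 + x) powr (e - 1)"
    by (intro mult_left_mono) auto
  then show "(1 - x) powr (e - 1) / 2 \<le> (1 - x\<^sup>2) powr (e - 1)" by (simp add: eq)
  have "(1 + x) powr (e - 1) \<le> (1 + x) powr e" using assms by (intro powr_mono) auto
  also have "\<dots> \<le> 2 powr e" using assms by (intro powr_mono2) auto
  finally have "(1 - x) powr (e - 1) * (1 + x) powr (e - 1) \<le> (1 - x) powr (e - 1) * 2 powr e"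
    by (intro mult_left_mono) auto
  then show "(1 - x\<^sup>2) powr (e - 1) \<le> 2 powr e * (1 - x) powr (e - 1)" by (simp add: eq mult.commute)
qed

context sph
begin

lemma hseries_measurable [measurable]: "hseries Y d a \<in> borel_measurable borel"
  unfolding hseries_eq[abs_def] by measurable

lemma hseries_bound:
  assumes a: "adm a" and r: "0 \<le> r" "r < 1" and x: "x \<in> sphere 0 1"
  shows "\<bar>hseries Y d a (r *\<^sub>R x)\<bar> \<le> (\<Sum>k. wt a k * r ^ k)"
  unfolding hseries_eq real_norm_def[symmetric]
proof (rule norm_suminf_le)
  show "norm (hcomp a k (r *\<^sub>R x)) \<le> wt a k * r ^ k" for k
    using abs_hcomp_norm_le[of a k "r *\<^sub>R x"] r x by simp
qed (rule adm_wt_summable0[OF a r])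

lemma hseries_add:
  assumes "adm a" "adm b" "norm x < 1"
  shows "hseries Y d (\<lambda>k j. a k j + b k j) x = hseries Y d a x + hseries Y d b x"
  unfolding hseries_eq hcomp_add
  by (rule suminf_add[symmetric]) (intro summable_rabs_cancel[OF adm_hcomp_summable] assms)+

lemma hseries_cmult:
  assumes "adm a" "norm x < 1"
  shows "hseries Y d (\<lambda>k j. c * a k j) x = c * hseries Y d a x"
  unfolding hseries_eq using hcomp_mult[of "\<lambda>_. c" a]
  by (simp add: suminf_mult[OF summable_rabs_cancel[OF adm_hcomp_summable[OF assms]]])

lemma integral_hcomp_hcomp:
  "(\<integral>y. hcomp a k y * hcomp b k' y \<partial>sphere_measure) = (if k = k' then (\<Sum>j=1..d k. a k j * b k j) else 0)"
proof -
  have "(\<integral>y. hcomp a k y * hcomp b k' y \<partial>sphere_measure)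
     = (\<integral>y. (\<Sum>j=1..d k'. b k' j * (hcomp a k y * Y k' j y)) \<partial>sphere_measure)"
    by (intro Bochner_Integration.integral_cong refl) (simp add: hcomp_def[of b k'] sum_distrib_left mult_ac)
  also have "\<dots> = (\<Sum>j=1..d k'. b k' j * (\<integral>y. hcomp a k y * Y k' j y \<partial>sphere_measure))"
    by (subst Bochner_Integration.integral_sum) (auto intro!: integrable_mult_right integrable_Y_mult hcomp_poly)
  also have "\<dots> = (\<Sum>j=1..d k'. b k' j * (if k = k' then a k j else 0))"
    by (intro sum.cong refl) (simp add: integral_hcomp_Y)
  finally show ?thesis by (auto simp: mult.commute)
qed

text \<open>Orthogonality collapses the double series to its diagonal. The series of the first
  function is integrated against one component of the second (\<open>rep\<close>), and the series of
  the second is inserted afterwards. The radii are independent because the multiplier formula pairs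
  functions on spheres of radii \<open>R * \<rho>\<close> and \<rho>.\<close>

lemma hseries_parseval:
  assumes a: "adm a" and b: "adm b" and r: "0 \<le> r" "r < 1" and s: "0 \<le> s" "s < 1"
  shows "(\<lambda>k. (r * s) ^ k * (\<Sum>j=1..d k. a k j * b k j)) sums
    (\<integral>y. hseries Y d a (r *\<^sub>R y) * hseries Y d b (s *\<^sub>R y) \<partial>sphere_measure)"
proof -
  define B where "B = (\<Sum>k. wt a k * r ^ k)"
  have B: "\<bar>hseries Y d a (r *\<^sub>R y)\<bar> \<le> B" if "y \<in> sphere 0 1" for y
    unfolding B_def by (rule hseries_bound[OF a r that])
  have B0: "B \<ge> 0" unfolding B_def using r wt_nonneg by (intro suminf_nonneg adm_wt_summable0 a) auto
  have bd: "\<bar>r ^ k * hcomp c k y\<bar> \<le> wt c k * r ^ k" if "y \<in> sphere 0 1" "0 \<le> r" for c k y and r :: real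
    using abs_hcomp_le[OF that(1), of c k] that(2) by (simp add: abs_mult mult.commute mult_left_mono)
  have rep: "(\<integral>y. hseries Y d a (r *\<^sub>R y) * hcomp b k y \<partial>sphere_measure) = r ^ k * (\<Sum>j=1..d k. a k j * b k j)" for k
  proof -
    have "(\<lambda>k'. \<integral>y. (r ^ k' * hcomp a k' y) * hcomp b k y \<partial>sphere_measure) sums
       (\<integral>y. (\<Sum>k'. (r ^ k' * hcomp a k' y) * hcomp b k y) \<partial>sphere_measure)"
    proof (rule sphere_integral_suminf)
      show "\<bar>r ^ k' * hcomp a k' y * hcomp b k y\<bar> \<le> wt a k' * r ^ k' * wt b k" if "y \<in> sphere 0 1" for k' y
        unfolding abs_mult[of _ "hcomp b k y"] using r that
        by (intro mult_mono bd abs_hcomp_le) (auto intro: wt_nonneg mult_nonneg_nonneg)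
      show "summable (\<lambda>k'. wt a k' * r ^ k' * wt b k)" by (intro summable_mult2 adm_wt_summable0 a r)
    qed measurable
    moreover have "(\<lambda>k'. \<integral>y. (r ^ k' * hcomp a k' y) * hcomp b k y \<partial>sphere_measure)
       = (\<lambda>k'. if k' = k then r ^ k' * (\<Sum>j=1..d k'. a k' j * b k' j) else 0)"
      by (auto simp: mult.assoc integral_hcomp_hcomp)
    ultimately have "(\<integral>y. (\<Sum>k'. (r ^ k' * hcomp a k' y) * hcomp b k y) \<partial>sphere_measure) = r ^ k * (\<Sum>j=1..d k. a k j * b k j)"
      using sums_single[of k "\<lambda>k'. r ^ k' * (\<Sum>j=1..d k'. a k' j * b k' j)"] sums_unique2 by fastforce
    moreover have "(\<integral>y. (\<Sum>k'. (r ^ k' * hcomp a k' y) * hcomp b k y) \<partial>sphere_measure)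
       = (\<integral>y. hseries Y d a (r *\<^sub>R y) * hcomp b k y \<partial>sphere_measure)"
    proof (rule integral_cong_sphere)
      fix y :: "real^'n" assume y: "y \<in> sphere 0 1"
      have "summable (\<lambda>k'. r ^ k' * hcomp a k' y)"
        using sums_summable[OF adm_sums[OF a r y]] by (simp add: hterm_eq[abs_def])
      then show "(\<Sum>k'. (r ^ k' * hcomp a k' y) * hcomp b k y) = hseries Y d a (r *\<^sub>R y) * hcomp b k y"
        by (simp add: hseries_eq hcomp_scale suminf_mult2[symmetric])
    qed measurable
    ultimately show ?thesis by simp
  qed
  have "(\<lambda>k. \<integral>y. hseries Y d a (r *\<^sub>R y) * (s ^ k * hcomp b k y) \<partial>sphere_measure) sums
      (\<integral>y. (\<Sum>k. hseries Y d a (r *\<^sub>R y) * (s ^ k * hcomp b k y)) \<partial>sphere_measure)"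
  proof (rule sphere_integral_suminf)
    show "\<bar>hseries Y d a (r *\<^sub>R y) * (s ^ k * hcomp b k y)\<bar> \<le> B * (wt b k * s ^ k)" if "y \<in> sphere 0 1" for k y
      unfolding abs_mult[of "hseries Y d a (r *\<^sub>R y)"] using s that B0 by (intro mult_mono bd B) auto
    show "summable (\<lambda>k. B * (wt b k * s ^ k))" by (intro summable_mult adm_wt_summable0 b s)
  qed measurable
  moreover have "(\<integral>y. hseries Y d a (r *\<^sub>R y) * (s ^ k * hcomp b k y) \<partial>sphere_measure) = (r * s) ^ k * (\<Sum>j=1..d k. a k j * b k j)" for k
  proof -
    have "(\<integral>y. hseries Y d a (r *\<^sub>R y) * (s ^ k * hcomp b k y) \<partial>sphere_measure)
      = (\<integral>y. s ^ k * (hseries Y d a (r *\<^sub>R y) * hcomp b k y) \<partial>sphere_measure)" by (simp only: mult.left_commute)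
    then show ?thesis by (simp add: rep power_mult_distrib)
  qed
  moreover have "(\<integral>y. (\<Sum>k. hseries Y d a (r *\<^sub>R y) * (s ^ k * hcomp b k y)) \<partial>sphere_measure)
     = (\<integral>y. hseries Y d a (r *\<^sub>R y) * hseries Y d b (s *\<^sub>R y) \<partial>sphere_measure)"
  proof (rule integral_cong_sphere)
    fix y :: "real^'n" assume y: "y \<in> sphere 0 1"
    have "summable (\<lambda>k. s ^ k * hcomp b k y)"
      using sums_summable[OF adm_sums[OF b s y]] by (simp add: hterm_eq[abs_def])
    then show "(\<Sum>k. hseries Y d a (r *\<^sub>R y) * (s ^ k * hcomp b k y)) = hseries Y d a (r *\<^sub>R y) * hseries Y d b (s *\<^sub>R y)"
      by (simp add: hseries_eq[of b] hcomp_scale suminf_mult)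
  qed measurable
  ultimately show ?thesis by simp
qed

lemma adm_Y: "x \<in> sphere 0 1 \<Longrightarrow> adm (\<lambda>k j. Y k j x)"
  by (rule adm_poly[of _ gC "CARD('n)"]) (use gC in auto)

lemma adm_mult_seq:
  assumes m: "\<And>k. \<bar>m k\<bar> \<le> C * (real k + 1) ^ p" "C \<ge> 0" and a: "adm a"
  shows "adm (\<lambda>k j. m k * a k j)"
  by (rule adm_mult[OF adm_poly[OF m] a])

lemma adm_fr: "t > 0 \<Longrightarrow> adm a \<Longrightarrow> adm (\<lambda>k j. fr t k * a k j)"
proof -
  assume t: "t > 0" and a: "adm a"
  obtain C p where C: "C \<ge> 0" "\<And>k. fr t k \<le> C * (real k + 1) ^ p" using fr_growth[OF t] by blast
  show ?thesis
    by (rule adm_mult_seq[where C = C and p = p, OF _ C(1) a]) (simp add: C(2) abs_of_pos[OF fr_pos[OF t]])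
qed

text \<open>The function on the smaller sphere is the Poisson integral, with ratio
  \<open>r / R\<close>, of its values on the larger one, and the Poisson kernel is a contraction of
  every L^s.\<close>

lemma Mq_hseries_mono:
  assumes b: "adm b" and s: "1 \<le> s" and r: "0 \<le> r" "r \<le> R" "R < 1"
  shows "Mq s (hseries Y d b) r \<le> Mq s (hseries Y d b) R"
proof (cases "r = R")
  case False
  then have q: "0 \<le> r / R" "r / R < 1" "R > 0" using r by auto
  define H where "H y = hseries Y d b (R *\<^sub>R y)" for y
  let ?K = "ker (\<lambda>k. (r / R) ^ k)"
  have K: "?K x y = hseries Y d (\<lambda>k j. Y k j x) ((r / R) *\<^sub>R y)" for x y
    by (simp add: ker_def hseries_eq zon_eq_hcomp hcomp_scale)
  have HB: "\<bar>H y\<bar> \<le> (\<Sum>k. wt b k * R ^ k)" if "y \<in> sphere 0 1" for y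
    unfolding H_def by (rule hseries_bound[OF b _ r(3) that]) (use q in simp)
  have Hm [measurable]: "H \<in> borel_measurable borel" unfolding H_def by measurable
  have Km [measurable]: "?K x \<in> borel_measurable borel" for x by (rule ker_measurable)
  show ?thesis
    unfolding Mq_def
  proof (rule Lnorm_kernel[OF s ker_measurable_pair[of "\<lambda>k. (r / R) ^ k"]])
    show "(\<lambda>y. hseries Y d b (R *\<^sub>R y)) \<in> borel_measurable borel" by measurable
    show "(\<integral>\<^sup>+y. ennreal \<bar>?K x y\<bar> \<partial>sphere_measure) \<le> 1" if "x \<in> sphere 0 1" for x
      by (rule poisson_L1[OF q(1,2) that])
    show "(\<integral>\<^sup>+x. ennreal \<bar>?K x y\<bar> \<partial>sphere_measure) \<le> 1" if "y \<in> sphere 0 1" for y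
      using poisson_L1[OF q(1,2) that] by (subst ker_commute)
    fix x :: "real^'n" assume x: "x \<in> sphere 0 1"
    have "(\<lambda>k. (r / R * R) ^ k * (\<Sum>j=1..d k. Y k j x * b k j)) sums
        (\<integral>y. hseries Y d (\<lambda>k j. Y k j x) ((r / R) *\<^sub>R y) * hseries Y d b (R *\<^sub>R y) \<partial>sphere_measure)"
      by (rule hseries_parseval[OF adm_Y[OF x] b]) (use q r in auto)
    then have "hterm Y d b r x sums (\<integral>y. ?K x y * H y \<partial>sphere_measure)"
      using q by (simp add: K H_def hterm_def[abs_def] mult.commute)
    moreover have "hterm Y d b r x sums hseries Y d b (r *\<^sub>R x)"
      by (rule adm_sums[OF b _ _ x]) (use r in auto)
    ultimately have eq: "hseries Y d b (r *\<^sub>R x) = (\<integral>y. ?K x y * H y \<partial>sphere_measure)"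
      using sums_unique2 by blast
    have KB: "\<bar>?K x y\<bar> \<le> (\<Sum>k. wt (\<lambda>k j. Y k j x) k * (r / R) ^ k)" if "y \<in> sphere 0 1" for y
      unfolding K by (rule hseries_bound[OF adm_Y[OF x] q(1,2) that])
    have "integrable sphere_measure (\<lambda>y. ?K x y * H y)"
    proof (rule sphere_integrable(1))
      show "\<bar>?K x y * H y\<bar> \<le> (\<Sum>k. wt (\<lambda>k j. Y k j x) k * (r / R) ^ k) * (\<Sum>k. wt b k * R ^ k)" if "y \<in> sphere 0 1" for y
        unfolding abs_mult using KB[OF that] HB[OF that] by (intro mult_mono) auto
    qed measurable
    then have "ennreal (norm (\<integral>y. ?K x y * H y \<partial>sphere_measure)) \<le> (\<integral>\<^sup>+y. ennreal (norm (?K x y * H y)) \<partial>sphere_measure)"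
      by (rule integral_norm_bound_ennreal)
    then show "ennreal \<bar>hseries Y d b (r *\<^sub>R x)\<bar> \<le> (\<integral>\<^sup>+y. ennreal (\<bar>?K x y\<bar> * \<bar>hseries Y d b (R *\<^sub>R y)\<bar>) \<partial>sphere_measure)"
      by (simp add: eq abs_mult H_def)
  qed
qed simp

lemma Mq_hseries_finite:
  assumes b: "adm b" and s: "1 \<le> s" and r: "0 \<le> r" "r < 1"
  shows "Mq s (hseries Y d b) r < \<infinity>"
proof -
  have "Mq s (hseries Y d b) r \<le> ennreal (\<Sum>k. wt b k * r ^ k)"
    unfolding Mq_def
    by (rule Lnorm_bounded[OF s _ hseries_bound[OF b r]])
       (use r wt_nonneg in \<open>auto intro!: suminf_nonneg adm_wt_summable0 b\<close>)
  then show ?thesis by (auto intro: le_less_trans)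
qed

text \<open>For finite \<open>p\<close> the means increase with the radius, so the mean at
  \<open>r\<close> may be pulled out of the part of the norm integral over \<open>{r..1}\<close>,
  whose weight integrates to a multiple of \<open>(1 - r) powr (\<alpha> * e)\<close>. Both
  directions of the equivalence work with this growth bound, in the source space and in the target
  space respectively.\<close>

lemma Bspace_sup_bound:
  assumes b: "adm b" and s: "1 \<le> s" and p: "1 \<le> p" and \<alpha>: "\<alpha> > 0"
    and B: "hseries Y d b \<in> Bspace p s \<alpha>"
  obtains C where "C \<ge> 0" "\<And>r. 0 \<le> r \<Longrightarrow> r < 1 \<Longrightarrow> Mq s (hseries Y d b) r \<le> ennreal (C * (1 - r) powr (- \<alpha>))"
proof (cases "p = \<infinity>")
  case True
  define S where "S = (SUP r\<in>{0..<1}. Mq s (hseries Y d b) r * ennreal ((1 - r) powr \<alpha>))"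
  have S: "S < \<infinity>" using B True by (simp add: Bspace_def S_def)
  have "Mq s (hseries Y d b) r \<le> ennreal (enn2real S * (1 - r) powr (- \<alpha>))" if r: "0 \<le> r" "r < 1" for r
  proof -
    have "Mq s (hseries Y d b) r * ennreal ((1 - r) powr \<alpha>) \<le> S"
      unfolding S_def by (rule SUP_upper) (use r in auto)
    then have "(Mq s (hseries Y d b) r * ennreal ((1 - r) powr \<alpha>)) * ennreal ((1 - r) powr (- \<alpha>)) \<le> S * ennreal ((1 - r) powr (- \<alpha>))"
      by (rule mult_right_mono) simp
    also have "(Mq s (hseries Y d b) r * ennreal ((1 - r) powr \<alpha>)) * ennreal ((1 - r) powr (- \<alpha>)) = Mq s (hseries Y d b) r"
      using r by (simp add: mult.assoc ennreal_mult[symmetric] powr_add[symmetric])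
    also have "S * ennreal ((1 - r) powr (- \<alpha>)) = ennreal (enn2real S * (1 - r) powr (- \<alpha>))"
      using S by (simp add: ennreal_mult)
    finally show ?thesis .
  qed
  then show ?thesis using that[of "enn2real S"] by simp
next
  case False
  define e where "e = enn2real p"
  have e: "e \<ge> 1" unfolding e_def by (rule enn2real_ge_1[OF p False])
  define \<mu> where "\<mu> r = enn2real (Mq s (hseries Y d b) r)" for r
  have \<mu>: "Mq s (hseries Y d b) r = ennreal (\<mu> r)" if "0 \<le> r" "r < 1" for r
    using Mq_hseries_finite[OF b s that] by (simp add: \<mu>_def)
  have \<mu>0: "\<mu> r \<ge> 0" for r by (simp add: \<mu>_def)
  define I where "I = (\<integral>\<^sup>+r\<in>{0<..<1}. enn_powr (Mq s (hseries Y d b) r) e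
              * ennreal ((1 - r\<^sup>2) powr (\<alpha> * e - 1) * r ^ (CARD('n) - 1)) \<partial>lborel)"
  have I: "I < \<infinity>" using B False by (simp add: Bspace_def I_def e_def)
  \<comment> \<open>Three losses for \<open>r \<ge> 1 / 2\<close>: 2 from replacing
    \<open>1 - u\<^sup>2\<close> by \<open>1 - u\<close>, \<open>2 ^ (CARD('n) - 1)\<close> from
    \<open>u \<ge> 1 / 2\<close> in the radial density, and \<open>\<alpha> * e\<close> from
    integrating the power.\<close>
  define c where "c = 2 * 2 ^ (CARD('n) - 1) * (\<alpha> * e)"
  have ae: "\<alpha> * e > 0" using \<alpha> e by simp
  then have c: "c > 0" by (simp add: c_def)
  have half: "\<mu> r \<le> (c * enn2real I) powr (1 / e) * (1 - r) powr (- \<alpha>)" if r: "1 / 2 \<le> r" "r < 1" for r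
  proof -
    have "ennreal (\<mu> r powr e / (2 * 2 ^ (CARD('n) - 1))) * ennreal ((1 - r) powr (\<alpha> * e) / (\<alpha> * e))
      = ennreal (\<mu> r powr e / (2 * 2 ^ (CARD('n) - 1))) * (\<integral>\<^sup>+u. ennreal ((1 - u) powr (\<alpha> * e - 1)) * indicator {r..1} u \<partial>lborel)"
      using ae r by (simp add: nn_integral_one_minus_powr)
    also have "\<dots> = (\<integral>\<^sup>+u. ennreal (\<mu> r powr e / (2 * 2 ^ (CARD('n) - 1))) * (ennreal ((1 - u) powr (\<alpha> * e - 1)) * indicator {r..1} u) \<partial>lborel)"
      by (rule nn_integral_cmult[symmetric]) measurable
    also have "\<dots> \<le> I"
      unfolding I_def
    proof (rule nn_integral_mono_AE)
      show "AE u in lborel. ennreal (\<mu> r powr e / (2 * 2 ^ (CARD('n) - 1))) * (ennreal ((1 - u) powr (\<alpha> * e - 1)) * indicator {r..1} u)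
        \<le> enn_powr (Mq s (hseries Y d b) u) e * ennreal ((1 - u\<^sup>2) powr (\<alpha> * e - 1) * u ^ (CARD('n) - 1)) * indicator {0<..<1} u"
        using AE_lborel_singleton[of "1::real"]
      proof eventually_elim
        fix u :: real assume "u \<noteq> 1"
        show "ennreal (\<mu> r powr e / (2 * 2 ^ (CARD('n) - 1))) * (ennreal ((1 - u) powr (\<alpha> * e - 1)) * indicator {r..1} u)
        \<le> enn_powr (Mq s (hseries Y d b) u) e * ennreal ((1 - u\<^sup>2) powr (\<alpha> * e - 1) * u ^ (CARD('n) - 1)) * indicator {0<..<1} u"
        proof (cases "r \<le> u \<and> u \<le> 1")
          case True
          then have u: "1 / 2 \<le> u" "u < 1" "r \<le> u" using r \<open>u \<noteq> 1\<close> by auto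
          have "ennreal (\<mu> r) \<le> ennreal (\<mu> u)"
            using Mq_hseries_mono[OF b s _ u(3,2)] r u by (simp add: \<mu>)
          then have "\<mu> r \<le> \<mu> u" using \<mu>0 by simp
          then have 1: "\<mu> r powr e \<le> \<mu> u powr e" using e \<mu>0 by (intro powr_mono2) auto
          have 2: "(1 - u) powr (\<alpha> * e - 1) / 2 \<le> (1 - u\<^sup>2) powr (\<alpha> * e - 1)"
            using u ae by (intro one_minus_square_powr_bounds) auto
          have "(1 / 2) ^ (CARD('n) - 1) \<le> u ^ (CARD('n) - 1)" using u by (intro power_mono) auto
          then have 3: "1 / 2 ^ (CARD('n) - 1) \<le> u ^ (CARD('n) - 1)" by (simp add: power_one_over)
          have "\<mu> r powr e / (2 * 2 ^ (CARD('n) - 1)) * (1 - u) powr (\<alpha> * e - 1)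
             = \<mu> r powr e * ((1 - u) powr (\<alpha> * e - 1) / 2 * (1 / 2 ^ (CARD('n) - 1)))" by simp
          also have "\<dots> \<le> \<mu> u powr e * ((1 - u\<^sup>2) powr (\<alpha> * e - 1) * u ^ (CARD('n) - 1))"
            using 1 2 3 u by (intro mult_mono) auto
          finally have "ennreal (\<mu> r powr e / (2 * 2 ^ (CARD('n) - 1)) * (1 - u) powr (\<alpha> * e - 1))
            \<le> ennreal (\<mu> u powr e * ((1 - u\<^sup>2) powr (\<alpha> * e - 1) * u ^ (CARD('n) - 1)))" by (rule ennreal_leI)
          then show ?thesis
            using u True \<mu>0 by (simp add: \<mu> enn_powr_ennreal ennreal_mult[symmetric])
        qed simp
      qed
    qed
    finally have "ennreal (\<mu> r powr e / (2 * 2 ^ (CARD('n) - 1)) * ((1 - r) powr (\<alpha> * e) / (\<alpha> * e))) \<le> ennreal (enn2real I)"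
      using I ae by (simp add: ennreal_mult[symmetric])
    then have "\<mu> r powr e / (2 * 2 ^ (CARD('n) - 1)) * ((1 - r) powr (\<alpha> * e) / (\<alpha> * e)) \<le> enn2real I"
      by (subst (asm) ennreal_le_iff) auto
    then have "\<mu> r powr e * (1 - r) powr (\<alpha> * e) \<le> c * enn2real I"
    proof -
      assume le: "\<mu> r powr e / (2 * 2 ^ (CARD('n) - 1)) * ((1 - r) powr (\<alpha> * e) / (\<alpha> * e)) \<le> enn2real I"
      have "\<mu> r powr e * (1 - r) powr (\<alpha> * e) / c \<le> enn2real I"
        using le unfolding c_def times_divide_times_eq .
      then show ?thesis using c by (simp only: pos_divide_le_eq mult.commute)
    qed
    then have "(\<mu> r powr e * (1 - r) powr (\<alpha> * e)) powr (1 / e) \<le> (c * enn2real I) powr (1 / e)"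
      using e by (intro powr_mono2) auto
    also have "(\<mu> r powr e * (1 - r) powr (\<alpha> * e)) powr (1 / e) = \<mu> r * (1 - r) powr \<alpha>"
      using e \<mu>0 r by (simp add: powr_mult powr_powr)
    finally have "\<mu> r * (1 - r) powr \<alpha> * (1 - r) powr (- \<alpha>) \<le> (c * enn2real I) powr (1 / e) * (1 - r) powr (- \<alpha>)"
      by (intro mult_right_mono) auto
    then show ?thesis using r by (simp add: mult.assoc powr_add[symmetric])
  qed
  \<comment> \<open>For \<open>r < 1 / 2\<close> the mean is compared with the one at
    \<open>1 / 2\<close>; the factor \<open>2 powr \<alpha>\<close> is the value of
    \<open>(1 - r) powr (- \<alpha>)\<close> at that radius.\<close>
  define D where "D = (c * enn2real I) powr (1 / e) * 2 powr \<alpha>"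
  have "Mq s (hseries Y d b) r \<le> ennreal (D * (1 - r) powr (- \<alpha>))" if r: "0 \<le> r" "r < 1" for r
  proof (cases "1 / 2 \<le> r")
    case True
    have "\<mu> r \<le> (c * enn2real I) powr (1 / e) * (1 - r) powr (- \<alpha>)" by (rule half[OF True r(2)])
    also have "\<dots> \<le> D * (1 - r) powr (- \<alpha>)"
      unfolding D_def using \<alpha> ge_one_powr_ge_zero[of 2 \<alpha>] by (intro mult_right_mono) (auto simp: mult_le_cancel_left1)
    finally show ?thesis using \<mu>[OF r] by (simp add: ennreal_leI)
  next
    case False
    have "Mq s (hseries Y d b) r \<le> Mq s (hseries Y d b) (1 / 2)"
      by (rule Mq_hseries_mono[OF b s]) (use r False in auto)
    also have "\<dots> \<le> ennreal (D * 1)"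
      using half[of "1/2"] by (simp add: \<mu> D_def powr_minus powr_divide ennreal_leI)
    also have "D * 1 \<le> D * (1 - r) powr (- \<alpha>)"
    proof (rule mult_left_mono)
      have "(1::real) powr (- \<alpha>) \<le> (1 - r) powr (- \<alpha>)" using r \<alpha> by (intro powr_mono2') auto
      then show "1 \<le> (1 - r) powr (- \<alpha>)" by simp
    qed (simp add: D_def)
    finally show ?thesis by (simp add: ennreal_leI)
  qed
  then show ?thesis using that[of D] by (simp add: D_def)
qed

section \<open>Functions and their expansions\<close>

lemma Mq_cong: "(\<And>x. x \<in> sphere 0 1 \<Longrightarrow> f (r *\<^sub>R x) = g (r *\<^sub>R x)) \<Longrightarrow> Mq s f r = Mq s g r"
  unfolding Mq_def by (rule Lnorm_cong)

lemma Bspace_cong: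
  fixes f g :: "real^'n \<Rightarrow> real"
  assumes "f \<in> Bspace p s \<alpha>" "harmonic_on (ball 0 1) g"
    and "\<And>r x. 0 \<le> r \<Longrightarrow> r < 1 \<Longrightarrow> x \<in> sphere 0 1 \<Longrightarrow> f (r *\<^sub>R x) = g (r *\<^sub>R x)"
  shows "g \<in> Bspace p s \<alpha>"
proof -
  have M: "Mq s f r = Mq s g r" if "0 \<le> r" "r < 1" for r
    by (rule Mq_cong) (use assms(3) that in auto)
  have "(SUP r\<in>{0..<1}. Mq s f r * ennreal ((1 - r) powr \<alpha>)) = (SUP r\<in>{0..<1}. Mq s g r * ennreal ((1 - r) powr \<alpha>))"
    by (intro SUP_cong refl) (simp add: M)
  moreover have "(\<integral>\<^sup>+ r\<in>{0<..<1}. enn_powr (Mq s f r) (enn2real p)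
              * ennreal ((1 - r\<^sup>2) powr (\<alpha> * enn2real p - 1) * r ^ (CARD('n) - 1)) \<partial>lborel)
     = (\<integral>\<^sup>+ r\<in>{0<..<1}. enn_powr (Mq s g r) (enn2real p)
              * ennreal ((1 - r\<^sup>2) powr (\<alpha> * enn2real p - 1) * r ^ (CARD('n) - 1)) \<partial>lborel)"
    by (intro nn_integral_cong) (auto simp: M indicator_def)
  ultimately show ?thesis using assms(1,2) by (cases "p = \<infinity>") (simp_all add: Bspace_def)
qed

text \<open>Every member of a mixed norm space is represented by its expansion, so that the multiplier condition
  only involves admissible coefficient sequences.\<close>

lemma Bspace_expansion:
  assumes "f \<in> Bspace p s \<alpha>"
  obtains b where "adm b" "hseries Y d b \<in> Bspace p s \<alpha>" "\<And>k j. j \<in> {1..d k} \<Longrightarrow> hcoef Y d f k j = b k j"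
proof -
  have "harmonic_on (ball 0 1) f" using assms by (simp add: Bspace_def)
  then obtain b where b: "adm b" "\<And>r x. 0 \<le> r \<Longrightarrow> r < 1 \<Longrightarrow> x \<in> sphere 0 1 \<Longrightarrow> hterm Y d b r x sums f (r *\<^sub>R x)"
    by (rule harmonic_expansion) (rule that)
  have "f (r *\<^sub>R x) = hseries Y d b (r *\<^sub>R x)" if "0 \<le> r" "r < 1" "x \<in> sphere 0 1" for r x
    using b(2)[OF that] adm_sums[OF b(1) that] sums_unique2 by blast
  then have "hseries Y d b \<in> Bspace p s \<alpha>"
    by (intro Bspace_cong[OF assms adm_harmonic[OF b(1)]])
  then show ?thesis using that b(1) hcoef_eq[OF b(2)] by blast
qed

lemma hcoef_hseries:
  assumes "adm b" "j \<in> {1..d k}" shows "hcoef Y d (hseries Y d b) k j = b k j"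
  by (rule hcoef_eq[OF adm_sums[OF assms(1)] assms(2)])

lemma hterm_cong:
  assumes "\<And>k j. j \<in> {1..d k} \<Longrightarrow> a k j = b k j" shows "hterm Y d a = hterm Y d b"
proof (intro ext)
  fix r x k
  have "hcomp a k x = hcomp b k x" by (rule hcomp_cong) (use assms in auto)
  then show "hterm Y d a r x k = hterm Y d b r x k" by (simp add: hterm_eq)
qed

lemma hseries_cong:
  assumes "\<And>k j. j \<in> {1..d k} \<Longrightarrow> a k j = b k j"
  shows "hseries Y d a = hseries Y d b" "hseries_conv Y d a \<longleftrightarrow> hseries_conv Y d b"
  using hterm_cong[of a b] assms by (auto simp: hseries_def[abs_def] hseries_conv_def)

lemma hconv_hseries:
  assumes "adm b"
  shows "hseries Y d (hconv Y d c (hseries Y d b)) = hseries Y d (\<lambda>k j. c k j * b k j)"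
    "hseries_conv Y d (hconv Y d c (hseries Y d b)) \<longleftrightarrow> hseries_conv Y d (\<lambda>k j. c k j * b k j)"
  using hseries_cong[of "hconv Y d c (hseries Y d b)" "\<lambda>k j. c k j * b k j"] hcoef_hseries[OF assms]
  by (simp_all add: hconv_def)

text \<open>Harmonicity provides a second expansion, with admissible coefficients, and uniqueness
  identifies the two. In this way the qualitative hypotheses on a series become a growth condition
  on its coefficients.\<close>

lemma adm_of_harmonic:
  assumes conv: "hseries_conv Y d a" and h: "harmonic_on (ball 0 1) (hseries Y d a)"
  shows "adm a"
proof -
  obtain b where b: "adm b" "\<And>r x. 0 \<le> r \<Longrightarrow> r < 1 \<Longrightarrow> x \<in> sphere 0 1 \<Longrightarrow> hterm Y d b r x sums hseries Y d a (r *\<^sub>R x)"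
    using h by (rule harmonic_expansion) (rule that)
  have a: "hterm Y d a r x sums hseries Y d a (r *\<^sub>R x)" if "0 < r" "r < 1" "x \<in> sphere 0 1" for r x
  proof -
    have "norm (r *\<^sub>R x) = r" "(r *\<^sub>R x) /\<^sub>R r = x" using that by auto
    then have "hseries Y d a (r *\<^sub>R x) = suminf (hterm Y d a r x)" by (simp add: hseries_def)
    moreover have "summable (hterm Y d a r x)" using conv that by (auto simp: hseries_conv_def)
    ultimately show ?thesis by (simp add: summable_sums)
  qed
  have "a k j = b k j" if "j \<in> {1..d k}" for k j
    by (rule expansion_unique[where s = 1 and v = "\<lambda>r x. hseries Y d a (r *\<^sub>R x)", OF _ _ that]) (use a b(2) in auto)
  then show ?thesis using b(1) by (simp add: adm_def)
qed

end

text \<open>Substitute the square of \<rho> in the Beta integral. The power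
  \<open>2 * k + n - 1\<close> consists of \<open>\<rho> ^ (2 * k)\<close>, produced by pairing two
  components of degree \<open>k\<close>, and the radial density
  \<open>\<rho> ^ (n - 1)\<close>.\<close>

lemma has_bochner_integral_Beta_radial:
  fixes q :: real and k n :: nat
  assumes q: "q > 0" and n: "n \<ge> 1"
  shows "has_bochner_integral lborel (\<lambda>\<rho>. indicator {0<..<1} \<rho> * (2 * \<rho> ^ (2 * k + n - 1) * (1 - \<rho>\<^sup>2) powr (q - 1)))
     (Beta (real k + real n / 2) q)"
proof (rule has_bochner_integral_nn_integral)
  define p where "p = real k + real n / 2"
  have p: "p > 0" using n by (simp add: p_def add_nonneg_pos)
  have "ennreal (Beta p q) = (\<integral>\<^sup>+u. ennreal (u powr (p - 1) * (1 - u) powr (q - 1)) * indicator {0..1} u \<partial>lborel)"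
    by (rule nn_integral_has_integral_lebesgue'[symmetric, OF _ has_integral_Beta_real[OF p q]]) auto
  also have "\<dots> = (\<integral>\<^sup>+u. ennreal (u powr (p - 1) * (1 - u) powr (q - 1) * indicator {0\<^sup>2..1\<^sup>2} u) \<partial>lborel)"
    by (intro nn_integral_cong) (auto simp: indicator_def)
  also have "\<dots> = (\<integral>\<^sup>+\<rho>. ennreal ((\<rho>\<^sup>2) powr (p - 1) * (1 - \<rho>\<^sup>2) powr (q - 1) * (2 * \<rho>) * indicator {0..1} \<rho>) \<partial>lborel)"
  proof (rule nn_integral_substitution[where g = "\<lambda>x. x\<^sup>2" and g' = "\<lambda>x. 2 * x"])
    show "((\<lambda>x. x\<^sup>2) has_real_derivative 2 * x) (at x)" for x :: real
      by (auto intro!: derivative_eq_intros)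
    show "set_borel_measurable borel {0\<^sup>2..1\<^sup>2} (\<lambda>u::real. u powr (p - 1) * (1 - u) powr (q - 1))"
      unfolding set_borel_measurable_def by measurable
  qed (auto intro!: continuous_intros)
  also have "\<dots> = (\<integral>\<^sup>+\<rho>. ennreal (indicator {0<..<1} \<rho> * (2 * \<rho> ^ (2 * k + n - 1) * (1 - \<rho>\<^sup>2) powr (q - 1))) \<partial>lborel)"
    using AE_lborel_singleton[of "0::real"] AE_lborel_singleton[of "1::real"]
  proof (intro nn_integral_cong_AE, eventually_elim)
    fix \<rho> :: real assume \<rho>: "\<rho> \<noteq> 0" "\<rho> \<noteq> 1"
    show "ennreal ((\<rho>\<^sup>2) powr (p - 1) * (1 - \<rho>\<^sup>2) powr (q - 1) * (2 * \<rho>) * indicator {0..1} \<rho>)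
       = ennreal (indicator {0<..<1} \<rho> * (2 * \<rho> ^ (2 * k + n - 1) * (1 - \<rho>\<^sup>2) powr (q - 1)))"
    proof (cases "0 < \<rho> \<and> \<rho> < 1")
      case True
      have "(\<rho>\<^sup>2) powr (p - 1) * \<rho> = \<rho> powr (2 * (p - 1)) * \<rho> powr 1"
        using True by (simp add: powr_powr flip: powr_numeral)
      also have "\<dots> = \<rho> powr (2 * (p - 1) + 1)" by (rule powr_add[symmetric])
      also have "2 * (p - 1) + 1 = real (2 * k + n - 1)" using n by (simp add: p_def of_nat_diff)
      also have "\<rho> powr \<dots> = \<rho> ^ (2 * k + n - 1)" using True by (intro powr_realpow) simp
      finally have pw: "(\<rho>\<^sup>2) powr (p - 1) * \<rho> = \<rho> ^ (2 * k + n - 1)" .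
      have "(\<rho>\<^sup>2) powr (p - 1) * (1 - \<rho>\<^sup>2) powr (q - 1) * (2 * \<rho>) = 2 * ((\<rho>\<^sup>2) powr (p - 1) * \<rho>) * (1 - \<rho>\<^sup>2) powr (q - 1)"
        by (simp only: mult_ac)
      then have "(\<rho>\<^sup>2) powr (p - 1) * (1 - \<rho>\<^sup>2) powr (q - 1) * (2 * \<rho>) = 2 * \<rho> ^ (2 * k + n - 1) * (1 - \<rho>\<^sup>2) powr (q - 1)"
        unfolding pw .
      then show ?thesis using True by simp
    next
      case False
      then have "\<not> (0 \<le> \<rho> \<and> \<rho> \<le> 1)" using \<rho> by auto
      then show ?thesis using False by (auto simp: indicator_def)
    qed
  qed
  finally show "(\<integral>\<^sup>+\<rho>. ennreal (indicator {0<..<1} \<rho> * (2 * \<rho> ^ (2 * k + n - 1) * (1 - \<rho>\<^sup>2) powr (q - 1))) \<partial>lborel)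
     = ennreal (Beta (real k + real n / 2) q)" by (simp add: p_def)
  show "0 \<le> Beta (real k + real n / 2) q"
    unfolding Beta_def p_def[symmetric] using p q
    by (intro divide_nonneg_nonneg mult_nonneg_nonneg less_imp_le[OF Gamma_real_pos]) auto
  show "AE \<rho> in lborel. 0 \<le> indicator {0<..<1} \<rho> * (2 * \<rho> ^ (2 * k + n - 1) * (1 - \<rho>\<^sup>2) powr (q - 1))"
    by (intro AE_I2) (auto simp: indicator_def)
qed measurable

text \<open>The bound is independent of \<open>R\<close>: replacing \<open>1 - R\<^sup>2\<close> and
  \<open>1 - \<rho>\<^sup>2\<close> by \<open>1 - R\<close> and \<open>1 - \<rho>\<close> costs
  \<open>2 powr b\<close> and \<open>2 powr a\<close>, and the factor \<open>(1 - R) powr b\<close>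
  then cancels the growth in \<open>beta_kernel_integral\<close>.\<close>

lemma radial_kernel_integral:
  fixes a b R :: real
  assumes a: "a > 0" and b: "b > 0" and R: "0 \<le> R" "R < 1"
  shows "(\<integral>\<^sup>+\<rho>\<in>{0<..<1}. ennreal ((1 - R\<^sup>2) powr b * (1 - \<rho>\<^sup>2) powr (a - 1) * (1 - R * \<rho>) powr (- (a + b))) \<partial>lborel)
     \<le> ennreal (2 powr (a + b) * (1 / a + 1 / b))"
proof -
  have "1 - R\<^sup>2 \<le> 2 * (1 - R)" using zero_le_power2[of "1 - R"] by (simp add: power2_eq_square algebra_simps)
  moreover have "R\<^sup>2 \<le> 1" using R by (simp add: power_le_one)
  ultimately have "(1 - R\<^sup>2) powr b \<le> (2 * (1 - R)) powr b" using b by (intro powr_mono2) auto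
  also have "\<dots> = 2 powr b * (1 - R) powr b" by (intro powr_mult)
  finally have Rb: "(1 - R\<^sup>2) powr b \<le> 2 powr b * (1 - R) powr b" .
  have "(\<integral>\<^sup>+\<rho>\<in>{0<..<1}. ennreal ((1 - R\<^sup>2) powr b * (1 - \<rho>\<^sup>2) powr (a - 1) * (1 - R * \<rho>) powr (- (a + b))) \<partial>lborel)
    \<le> (\<integral>\<^sup>+\<rho>. ennreal (2 powr b * (1 - R) powr b * 2 powr a) *
        (ennreal ((1 - \<rho>) powr (a - 1) * (1 - R * \<rho>) powr (- (a + b))) * indicator {0<..<1} \<rho>) \<partial>lborel)"
  proof (rule nn_integral_mono)
    fix \<rho> :: real
    show "ennreal ((1 - R\<^sup>2) powr b * (1 - \<rho>\<^sup>2) powr (a - 1) * (1 - R * \<rho>) powr (- (a + b))) * indicator {0<..<1} \<rho>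
      \<le> ennreal (2 powr b * (1 - R) powr b * 2 powr a) *
        (ennreal ((1 - \<rho>) powr (a - 1) * (1 - R * \<rho>) powr (- (a + b))) * indicator {0<..<1} \<rho>)"
    proof (cases "0 < \<rho> \<and> \<rho> < 1")
      case True
      have "(1 - R\<^sup>2) powr b * (1 - \<rho>\<^sup>2) powr (a - 1) \<le> (2 powr b * (1 - R) powr b) * (2 powr a * (1 - \<rho>) powr (a - 1))"
        using Rb one_minus_square_powr_bounds(2)[of \<rho> a] True a by (intro mult_mono) auto
      then have "(1 - R\<^sup>2) powr b * (1 - \<rho>\<^sup>2) powr (a - 1) * (1 - R * \<rho>) powr (- (a + b))
        \<le> (2 powr b * (1 - R) powr b) * (2 powr a * (1 - \<rho>) powr (a - 1)) * (1 - R * \<rho>) powr (- (a + b))"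
        by (rule mult_right_mono) simp
      also have "\<dots> = (2 powr b * (1 - R) powr b * 2 powr a) * ((1 - \<rho>) powr (a - 1) * (1 - R * \<rho>) powr (- (a + b)))"
        by (simp only: mult_ac)
      finally show ?thesis using True by (simp add: ennreal_mult[symmetric] ennreal_leI)
    qed simp
  qed
  also have "\<dots> = ennreal (2 powr b * (1 - R) powr b * 2 powr a) *
      (\<integral>\<^sup>+\<rho>\<in>{0<..<1}. ennreal ((1 - \<rho>) powr (a - 1) * (1 - R * \<rho>) powr (- (a + b))) \<partial>lborel)"
    by (rule nn_integral_cmult) measurable
  also have "\<dots> \<le> ennreal (2 powr b * (1 - R) powr b * 2 powr a) * ennreal ((1 / a + 1 / b) * (1 - R) powr (- b))"
    by (intro mult_left_mono beta_kernel_integral a b R) simp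
  also have "\<dots> = ennreal ((2 powr b * (1 - R) powr b * 2 powr a) * ((1 / a + 1 / b) * (1 - R) powr (- b)))"
    using a b by (intro ennreal_mult[symmetric]) auto
  also have "(2 powr b * (1 - R) powr b * 2 powr a) * ((1 / a + 1 / b) * (1 - R) powr (- b))
     = (2 powr a * 2 powr b) * (1 / a + 1 / b) * ((1 - R) powr b * (1 - R) powr (- b))" by (simp only: mult_ac)
  also have "\<dots> = 2 powr (a + b) * (1 / a + 1 / b)" using R by (simp add: powr_add[symmetric])
  finally show ?thesis .
qed

lemma Lnorm_abs: "Lnorm s (\<lambda>x. \<bar>F x\<bar>) = Lnorm s F"
  by (intro antisym Lnorm_mono) auto

lemma Lnorm_1: "Lnorm 1 F = (\<integral>\<^sup>+x. ennreal \<bar>F x\<bar> \<partial>sphere_measure)"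
proof -
  have "enn_powr x 1 = x" for x by (cases x) (auto simp: enn_powr_ennreal)
  then show ?thesis by (simp add: Lnorm_def)
qed

text \<open>With respect to this measure the mixed norm with finite exponent \<open>p\<close> is the
  plain L^p norm of the radial mean times \<open>(1 - \<rho>\<^sup>2) powr \<alpha>\<close>,
  whatever \<open>p\<close> and \<alpha> are. Source and target thus live on one measure space,
  where the Schur test and the passage from \<open>p\<close> to \<open>q\<close> apply.\<close>

definition hyp_measure :: "nat \<Rightarrow> real measure" where
  "hyp_measure n = density lborel (\<lambda>\<rho>. ennreal (indicator {0<..<1} \<rho> * (\<rho> ^ (n - 1) / (1 - \<rho>\<^sup>2))))"

lemma sets_hyp_measure [simp, measurable_cong]: "sets (hyp_measure n) = sets borel"
  by (simp add: hyp_measure_def)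

lemma space_hyp_measure [simp]: "space (hyp_measure n) = UNIV"
  by (simp add: hyp_measure_def)

lemma sigma_finite_hyp_measure: "sigma_finite_measure (hyp_measure n)"
  unfolding hyp_measure_def 
  by (subst sigma_finite_measure.sigma_finite_iff_density_finite[OF sigma_finite_lborel]) auto

lemma nn_integral_hyp_measure:
  assumes "f \<in> borel_measurable borel"
  shows "(\<integral>\<^sup>+\<rho>. f \<rho> \<partial>hyp_measure n) = (\<integral>\<^sup>+\<rho>. ennreal (indicator {0<..<1} \<rho> * (\<rho> ^ (n - 1) / (1 - \<rho>\<^sup>2))) * f \<rho> \<partial>lborel)"
  unfolding hyp_measure_def by (rule nn_integral_density) (use assms in auto)

text \<open>The kernel between weighted radial means: \<open>b\<close> weighs the output radius,
  \<open>a\<close> the input radius. Exchanging the radii exchanges the exponents, so one integral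
  estimate covers both mass conditions of the Schur test.\<close>

definition hyp_ker :: "real \<Rightarrow> real \<Rightarrow> real \<Rightarrow> real \<Rightarrow> real" where
  "hyp_ker a b R \<rho> = indicator {0<..<1} R * (indicator {0<..<1} \<rho> *
     ((1 - R\<^sup>2) powr b * (1 - \<rho>\<^sup>2) powr a * (1 - R * \<rho>) powr (- (a + b))))"

lemma hyp_ker_commute: "hyp_ker a b R \<rho> = hyp_ker b a \<rho> R"
  by (simp add: hyp_ker_def mult_ac add.commute)

lemma hyp_ker_nonneg: "hyp_ker a b R \<rho> \<ge> 0"
  by (simp add: hyp_ker_def)

lemma hyp_ker_measurable [measurable]: "(\<lambda>(R, \<rho>). hyp_ker a b R \<rho>) \<in> borel_measurable (borel \<Otimes>\<^sub>M borel)"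
  unfolding hyp_ker_def by measurable

lemma hyp_ker_integral:
  assumes a: "a > 0" and b: "b > 0"
  shows "(\<integral>\<^sup>+\<rho>. ennreal (hyp_ker a b R \<rho>) \<partial>hyp_measure n) \<le> ennreal (2 powr (a + b) * (1 / a + 1 / b))"
proof (cases "0 < R \<and> R < 1")
  case True
  have "(\<integral>\<^sup>+\<rho>. ennreal (hyp_ker a b R \<rho>) \<partial>hyp_measure n)
     = (\<integral>\<^sup>+\<rho>. ennreal (indicator {0<..<1} \<rho> * (\<rho> ^ (n - 1) / (1 - \<rho>\<^sup>2))) * ennreal (hyp_ker a b R \<rho>) \<partial>lborel)"
    by (rule nn_integral_hyp_measure) measurable
  also have "\<dots> \<le> (\<integral>\<^sup>+\<rho>\<in>{0<..<1}. ennreal ((1 - R\<^sup>2) powr b * (1 - \<rho>\<^sup>2) powr (a - 1) * (1 - R * \<rho>) powr (- (a + b))) \<partial>lborel)"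
  proof (rule nn_integral_mono)
    fix \<rho> :: real
    show "ennreal (indicator {0<..<1} \<rho> * (\<rho> ^ (n - 1) / (1 - \<rho>\<^sup>2))) * ennreal (hyp_ker a b R \<rho>)
      \<le> ennreal ((1 - R\<^sup>2) powr b * (1 - \<rho>\<^sup>2) powr (a - 1) * (1 - R * \<rho>) powr (- (a + b))) * indicator {0<..<1} \<rho>"
    proof (cases "0 < \<rho> \<and> \<rho> < 1")
      case r: True
      have sq: "1 - \<rho>\<^sup>2 > 0" using r by (simp add: power_less_one_iff)
      have "\<rho> ^ (n - 1) / (1 - \<rho>\<^sup>2) * ((1 - R\<^sup>2) powr b * (1 - \<rho>\<^sup>2) powr a * (1 - R * \<rho>) powr (- (a + b)))
        = \<rho> ^ (n - 1) * ((1 - R\<^sup>2) powr b * (1 - \<rho>\<^sup>2) powr (a - 1) * (1 - R * \<rho>) powr (- (a + b)))"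
        using sq by (simp add: powr_diff)
      also have "\<dots> \<le> 1 * ((1 - R\<^sup>2) powr b * (1 - \<rho>\<^sup>2) powr (a - 1) * (1 - R * \<rho>) powr (- (a + b)))"
        using r by (intro mult_right_mono power_le_one) auto
      finally show ?thesis using r True sq by (simp add: hyp_ker_def ennreal_mult[symmetric] ennreal_leI)
    qed simp
  qed
  also have "\<dots> \<le> ennreal (2 powr (a + b) * (1 / a + 1 / b))"
    by (rule radial_kernel_integral[OF a b]) (use True in auto)
  finally show ?thesis .
qed (simp add: hyp_ker_def)

section \<open>Integral representation of multipliers\<close>

context sph
begin

text \<open>In the variable \<open>\<rho> *\<^sub>R y\<close> the kernel is an expansion with
  coefficients depending on \<open>x\<close>, so bounds, measurability and Parseval's identity for
  expansions apply to it.\<close>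

lemma Lam_eq_hseries: "Lam Y d c t x \<rho> y = hseries Y d (\<lambda>k j. fr t k * (c k j * Y k j x)) (\<rho> *\<^sub>R y)"
  unfolding Lam_def hseries_eq hcomp_scale hcomp_mult
  by (simp add: hcomp_def fr_def mult_ac)

lemma Lam_adm: "adm c \<Longrightarrow> t > 0 \<Longrightarrow> x \<in> sphere 0 1 \<Longrightarrow> adm (\<lambda>k j. fr t k * (c k j * Y k j x))"
  by (intro adm_fr adm_mult adm_Y)

lemma Lam_measurable:
  "(\<lambda>(x, \<rho>, y). Lam Y d c t x \<rho> y) \<in> borel_measurable (borel \<Otimes>\<^sub>M (borel \<Otimes>\<^sub>M borel))"
proof -
  have "(\<lambda>z. c k j * Y k j (fst z) * Y k j (snd (snd z))) \<in> borel_measurable (borel \<Otimes>\<^sub>M ((borel :: real measure) \<Otimes>\<^sub>M borel))"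
    if "j \<in> {1..d k}" for k j
    using Y_measurable[OF that] by measurable
  then have [measurable]: "(\<lambda>z. \<Sum>j=1..d k. c k j * Y k j (fst z) * Y k j (snd (snd z))) \<in> borel_measurable (borel \<Otimes>\<^sub>M ((borel :: real measure) \<Otimes>\<^sub>M borel))" for k
    by (intro borel_measurable_sum)
  show ?thesis
    unfolding Lam_def case_prod_beta by measurable
qed

lemma fr_Beta: "t > 0 \<Longrightarrow> fr t k * Beta (real k + real CARD('n) / 2) t = 1"
proof -
  assume t: "t > 0"
  let ?z = "real k + real CARD('n) / 2"
  have "Gamma (?z + t) > 0" "Gamma ?z > 0" "Gamma t > 0"
    using t half_dim_pos[of k] by (auto intro!: Gamma_real_pos)
  then show ?thesis unfolding fr_def Beta_def by simp
qed

text \<open>The density of the radial integral: its moment of order \<open>2 * k\<close> is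
  \<open>Beta (real k + real CARD('n) / 2) t\<close>, the reciprocal of \<open>fr t k\<close> when
  \<open>t > 0\<close>.\<close>

definition rweight :: "real \<Rightarrow> real \<Rightarrow> real" where
  "rweight t \<rho> = indicator {0<..<1} \<rho> * (2 * \<rho> ^ (CARD('n) - 1) * (1 - \<rho>\<^sup>2) powr (t - 1))"

lemma rweight_nonneg: "rweight t \<rho> \<ge> 0"
  by (simp add: rweight_def indicator_def)

lemma rweight_measurable [measurable]: "rweight t \<in> borel_measurable borel"
  unfolding rweight_def[abs_def] by measurable

text \<open>Parseval's identity at radii \<open>R * \<rho>\<close> and \<rho> yields
  \<open>(R * \<rho> * \<rho>) ^ k\<close> times \<open>fr t k\<close> in degree \<open>k\<close>;
  the radial moment of order \<open>2 * k\<close> cancels \<open>fr t k\<close> and leaves the term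
  of the product array at radius \<open>R\<close>.\<close>

lemma multiplier_representation:
  assumes c: "adm c" and b: "adm b" and t: "t > 0" and R: "0 \<le> R" "R < 1" and x: "x \<in> sphere 0 1"
  shows "has_bochner_integral lborel
     (\<lambda>\<rho>. rweight t \<rho> * (\<integral>y. Lam Y d c t x (R * \<rho>) y * hseries Y d b (\<rho> *\<^sub>R y) \<partial>sphere_measure))
     (hseries Y d (\<lambda>k j. c k j * b k j) (R *\<^sub>R x))"
proof -
  let ?cb = "\<lambda>k j. c k j * b k j"
  let ?e = "\<lambda>k \<rho>. indicator {0<..<1} \<rho> * (2 * \<rho> ^ (2 * k + CARD('n) - 1) * (1 - \<rho>\<^sup>2) powr (t - 1)) :: real"
  have cb: "adm ?cb" by (rule adm_mult[OF c b])
  define f where "f k \<rho> = (R ^ k * fr t k * hcomp ?cb k x) * ?e k \<rho>" for k \<rho>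
  have bi: "has_bochner_integral lborel (f k) (R ^ k * hcomp ?cb k x)" for k
  proof -
    have "has_bochner_integral lborel (f k) ((R ^ k * fr t k * hcomp ?cb k x) * Beta (real k + real CARD('n) / 2) t)"
      unfolding f_def by (intro has_bochner_integral_mult_right has_bochner_integral_Beta_radial t) simp
    moreover have "(R ^ k * fr t k * hcomp ?cb k x) * Beta (real k + real CARD('n) / 2) t
       = R ^ k * hcomp ?cb k x * (fr t k * Beta (real k + real CARD('n) / 2) t)" by (simp only: mult_ac)
    ultimately show ?thesis by (simp only: fr_Beta[OF t] mult_1_right)
  qed
  have bi_abs: "has_bochner_integral lborel (\<lambda>\<rho>. norm (f k \<rho>)) (\<bar>R ^ k * hcomp ?cb k x\<bar>)" for k
  proof -
    have "has_bochner_integral lborel (\<lambda>\<rho>. \<bar>R ^ k * fr t k * hcomp ?cb k x\<bar> * ?e k \<rho>) (\<bar>R ^ k * fr t k * hcomp ?cb k x\<bar> * Beta (real k + real CARD('n) / 2) t)"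
      by (intro has_bochner_integral_mult_right has_bochner_integral_Beta_radial t) simp
    moreover have "\<bar>R ^ k * fr t k * hcomp ?cb k x\<bar> * ?e k \<rho> = norm (f k \<rho>)" for \<rho>
      unfolding f_def by (simp add: abs_mult indicator_def)
    moreover have "\<bar>R ^ k * fr t k * hcomp ?cb k x\<bar> * Beta (real k + real CARD('n) / 2) t = \<bar>R ^ k * hcomp ?cb k x\<bar>"
    proof -
      have "\<bar>R ^ k * fr t k * hcomp ?cb k x\<bar> * Beta (real k + real CARD('n) / 2) t
         = \<bar>R ^ k * hcomp ?cb k x\<bar> * (fr t k * Beta (real k + real CARD('n) / 2) t)"
        unfolding abs_mult abs_of_pos[OF fr_pos[OF t]] by (simp only: mult_ac)
      then show ?thesis by (simp only: fr_Beta[OF t] mult_1_right)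
    qed
    ultimately show ?thesis by simp
  qed
  have hs: "hterm Y d ?cb R x sums hseries Y d ?cb (R *\<^sub>R x)" by (rule adm_sums[OF cb R x])
  have inner: "(\<lambda>k. f k \<rho>) sums (rweight t \<rho> * (\<integral>y. Lam Y d c t x (R * \<rho>) y * hseries Y d b (\<rho> *\<^sub>R y) \<partial>sphere_measure))" for \<rho>
  proof (cases "0 < \<rho> \<and> \<rho> < 1")
    case True
    have R\<rho>: "0 \<le> R * \<rho>" "R * \<rho> < 1" using R True mult_strict_mono'[of R 1 \<rho> 1] by auto
    have "(\<lambda>k. (R * \<rho> * \<rho>) ^ k * (\<Sum>j=1..d k. fr t k * (c k j * Y k j x) * b k j)) sums
      (\<integral>y. Lam Y d c t x (R * \<rho>) y * hseries Y d b (\<rho> *\<^sub>R y) \<partial>sphere_measure)"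
      unfolding Lam_eq_hseries by (rule hseries_parseval[OF Lam_adm[OF c t x] b R\<rho>]) (use True in auto)
    then have "(\<lambda>k. rweight t \<rho> * ((R * \<rho> * \<rho>) ^ k * (\<Sum>j=1..d k. fr t k * (c k j * Y k j x) * b k j))) sums
      (rweight t \<rho> * (\<integral>y. Lam Y d c t x (R * \<rho>) y * hseries Y d b (\<rho> *\<^sub>R y) \<partial>sphere_measure))"
      by (rule sums_mult)
    moreover have "rweight t \<rho> * ((R * \<rho> * \<rho>) ^ k * (\<Sum>j=1..d k. fr t k * (c k j * Y k j x) * b k j)) = f k \<rho>" for k
    proof -
      have "2 * k + CARD('n) - 1 = k + k + (CARD('n) - 1)"
        using one_le_card_finite[where 'n = 'n] by linarith
      then have "\<rho> ^ (2 * k + CARD('n) - 1) = \<rho> ^ k * \<rho> ^ k * \<rho> ^ (CARD('n) - 1)"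
        by (simp only: power_add)
      moreover have "(\<Sum>j=1..d k. fr t k * (c k j * Y k j x) * b k j) = fr t k * hcomp ?cb k x"
        by (simp add: hcomp_def sum_distrib_left mult_ac)
      ultimately show ?thesis
        using True by (simp add: f_def rweight_def power_mult_distrib mult_ac)
    qed
    ultimately show ?thesis by simp
  qed (simp add: f_def rweight_def)
  \<comment> \<open>The integrals of the absolute values of the terms are exactly
    \<open>\<bar>R ^ k * hcomp ?cb k x\<bar>\<close>, and these are summable; sum and radial
    integral may therefore be exchanged.\<close>
  have sums: "(\<lambda>k. integral\<^sup>L lborel (f k)) sums (\<integral>\<rho>. (\<Sum>k. f k \<rho>) \<partial>lborel)"
    and int: "integrable lborel (\<lambda>\<rho>. \<Sum>k. f k \<rho>)"
  proof -
    have i: "integrable lborel (f k)" for k using bi has_bochner_integral_iff by blast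
    have ae: "AE \<rho> in lborel. summable (\<lambda>k. norm (f k \<rho>))"
    proof (rule AE_I2)
      fix \<rho> :: real
      show "summable (\<lambda>k. norm (f k \<rho>))"
      proof (cases "0 < \<rho> \<and> \<rho> < 1")
        case True
        have "summable (\<lambda>k. wt (\<lambda>k j. fr t k * ?cb k j) k * R ^ k)"
          by (rule adm_wt_summable0[OF adm_fr[OF t cb] R])
        then have S: "summable (\<lambda>k. wt (\<lambda>k j. fr t k * ?cb k j) k * R ^ k * (2 * (1 - \<rho>\<^sup>2) powr (t - 1)))"
          by (rule summable_mult2)
        show ?thesis
        proof (rule summable_comparison_test'[OF S, of 0])
          fix k
          have 1: "\<bar>fr t k * hcomp ?cb k x\<bar> \<le> wt (\<lambda>k j. fr t k * ?cb k j) k"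
            using abs_hcomp_le[OF x, of "\<lambda>k j. fr t k * ?cb k j" k] by (simp add: hcomp_mult)
          have 2: "\<rho> ^ (2 * k + CARD('n) - 1) \<le> 1" using True by (intro power_le_one) auto
          have "norm (f k \<rho>) = \<bar>fr t k * hcomp ?cb k x\<bar> * R ^ k * (2 * \<rho> ^ (2 * k + CARD('n) - 1) * (1 - \<rho>\<^sup>2) powr (t - 1))"
            unfolding f_def using True R by (simp add: abs_mult mult_ac)
          also have "\<dots> \<le> wt (\<lambda>k j. fr t k * ?cb k j) k * R ^ k * (2 * 1 * (1 - \<rho>\<^sup>2) powr (t - 1))"
            using 1 2 R True wt_nonneg by (intro mult_mono mult_nonneg_nonneg) auto
          finally show "norm (norm (f k \<rho>)) \<le> wt (\<lambda>k j. fr t k * ?cb k j) k * R ^ k * (2 * (1 - \<rho>\<^sup>2) powr (t - 1))" by simp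
        qed
      qed (simp add: f_def)
    qed
    have "norm (R *\<^sub>R x) < 1" using R x by simp
    from adm_hcomp_summable[OF cb this]
    have s: "summable (\<lambda>k. \<integral>\<rho>. norm (f k \<rho>) \<partial>lborel)"
      by (simp only: has_bochner_integral_integral_eq[OF bi_abs] hcomp_scale)
    show "(\<lambda>k. integral\<^sup>L lborel (f k)) sums (\<integral>\<rho>. (\<Sum>k. f k \<rho>) \<partial>lborel)"
      by (rule sums_integral[OF i ae s])
    show "integrable lborel (\<lambda>\<rho>. \<Sum>k. f k \<rho>)"
      by (rule integrable_suminf[OF i ae s])
  qed
  have "(\<integral>\<rho>. (\<Sum>k. f k \<rho>) \<partial>lborel) = hseries Y d ?cb (R *\<^sub>R x)"
    using sums hs unfolding has_bochner_integral_integral_eq[OF bi] hterm_eq[abs_def] by (rule sums_unique2)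
  then have "has_bochner_integral lborel (\<lambda>\<rho>. \<Sum>k. f k \<rho>) (hseries Y d ?cb (R *\<^sub>R x))"
    using int by (simp add: has_bochner_integral_iff)
  then show ?thesis using sums_unique[OF inner] by simp
qed

end

section \<open>Sufficiency of the kernel condition\<close>

lemma Mq_measurable_1:
  fixes f :: "real^'n::finite \<Rightarrow> real"
  assumes [measurable]: "f \<in> borel_measurable borel"
  shows "(\<lambda>\<rho>. Mq 1 f \<rho>) \<in> borel_measurable borel"
  unfolding Mq_def Lnorm_1
proof (rule sigma_finite_measure.borel_measurable_nn_integral[OF sigma_finite_sphere_measure])
  have "(\<lambda>(\<rho>, y). ennreal \<bar>f (\<rho> *\<^sub>R y)\<bar>) \<in> borel_measurable (borel \<Otimes>\<^sub>M borel)" by measurable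
  then show "(\<lambda>(\<rho>, y). ennreal \<bar>f (\<rho> *\<^sub>R y)\<bar>) \<in> borel_measurable (borel \<Otimes>\<^sub>M sphere_measure)"
    unfolding measurable_cong_sets[OF sets_pair_measure_cong[OF refl sets_sphere_measure] refl] .
qed

context sph
begin

text \<open>The pointwise estimate behind the sufficiency of the kernel condition: Minkowski's inequality applied to
  the integral representation of the multiplier.\<close>

lemma multiplier_Mq_bound:
  assumes c: "adm c" and b: "adm b" and t: "t > 0" and s: "1 \<le> s" and A: "A > 0"
    and L: "\<And>\<rho> y. 0 \<le> \<rho> \<Longrightarrow> \<rho> < 1 \<Longrightarrow> y \<in> sphere 0 1 \<Longrightarrow> Lnorm s (\<lambda>x. Lam Y d c t x \<rho> y) \<le> ennreal (A * (1 - \<rho>) powr (- e))"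
    and R: "0 \<le> R" "R < 1"
  shows "Mq s (hseries Y d (\<lambda>k j. c k j * b k j)) R
    \<le> (\<integral>\<^sup>+\<rho>. ennreal (A * (1 - R * \<rho>) powr (- e) * rweight t \<rho>) * Mq 1 (hseries Y d b) \<rho> \<partial>lborel)"
    (is "_ \<le> ?V")
proof (cases "?V = \<infinity>")
  case False
  define H where "H = hseries Y d b"
  have Hm [measurable]: "H \<in> borel_measurable borel" unfolding H_def by measurable
  let ?N = "lborel \<Otimes>\<^sub>M (sphere_measure :: (real^'n) measure)"
  have setsN: "sets ?N = sets (borel \<Otimes>\<^sub>M borel)" by (intro sets_pair_measure_cong) auto
  \<comment> \<open>The indicator of the sphere is there because hypothesis \<open>L\<close> speaks
    of \<open>y\<close> on the sphere only, whereas the majorant \<open>W\<close> has to dominate at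
    every point of the product space.\<close>
  define w where "w z = rweight t (fst z) * indicator (sphere 0 1) (snd z) * \<bar>H (fst z *\<^sub>R snd z)\<bar>" for z :: "real \<times> (real^'n)"
  define G where "G x z = w z * \<bar>Lam Y d c t x (R * fst z) (snd z)\<bar>" for x z
  define W where "W z = w z * (A * (1 - R * fst z) powr (- e))" for z
  have wn: "w z \<ge> 0" for z using rweight_nonneg by (simp add: w_def)
  have sfN: "sigma_finite_measure ?N"
    by (rule sigma_finite_pair_measure[OF sigma_finite_lborel sigma_finite_sphere_measure])
  have [measurable]: "sphere 0 1 \<in> sets (borel :: (real^'n) measure)" by (simp add: borel_closed)
  have wm: "w \<in> borel_measurable (borel \<Otimes>\<^sub>M borel)" unfolding w_def[abs_def] by measurable
  have Gm: "(\<lambda>(x, z). G x z) \<in> borel_measurable (borel \<Otimes>\<^sub>M ?N)"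
  proof -
    have 1: "(\<lambda>v. w (snd v)) \<in> borel_measurable (borel \<Otimes>\<^sub>M (borel \<Otimes>\<^sub>M borel))"
      using wm by measurable
    have "(\<lambda>v::(real^'n) \<times> (real \<times> (real^'n)). (fst v, R * fst (snd v), snd (snd v))) \<in> (borel \<Otimes>\<^sub>M (borel \<Otimes>\<^sub>M borel)) \<rightarrow>\<^sub>M (borel \<Otimes>\<^sub>M (borel \<Otimes>\<^sub>M borel))"
      by measurable
    from measurable_compose[OF this Lam_measurable[of c t]]
    have 2: "(\<lambda>v. \<bar>Lam Y d c t (fst v) (R * fst (snd v)) (snd (snd v))\<bar>) \<in> borel_measurable (borel \<Otimes>\<^sub>M (borel \<Otimes>\<^sub>M borel))"
      by simp
    have "(\<lambda>v. w (snd v) * \<bar>Lam Y d c t (fst v) (R * fst (snd v)) (snd (snd v))\<bar>) \<in> borel_measurable (borel \<Otimes>\<^sub>M (borel \<Otimes>\<^sub>M borel))"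
      using 1 2 by (rule borel_measurable_times)
    then show ?thesis
      unfolding measurable_cong_sets[OF sets_pair_measure_cong[OF refl setsN] refl]
      by (simp add: G_def case_prod_beta)
  qed
  have Wm: "W \<in> borel_measurable ?N"
    unfolding measurable_cong_sets[OF setsN refl] W_def[abs_def] using wm by measurable
  have Wn: "W z \<ge> 0" for z unfolding W_def using wn A by (intro mult_nonneg_nonneg) auto
  have w0: "w z = 0 \<or> (0 < fst z \<and> fst z < 1 \<and> snd z \<in> sphere 0 1)" for z
    by (auto simp: w_def rweight_def indicator_def)
  have R\<rho>: "0 \<le> R * \<rho> \<and> R * \<rho> < 1" if "0 < \<rho>" "\<rho> < 1" for \<rho>
    using R that mult_strict_mono'[of R 1 \<rho> 1] by auto
  have G0: "G x z = 0" if "W z = 0" for x z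
  proof -
    have "w z = 0"
      using w0[of z] that A R\<rho>[of "fst z"] by (auto simp: W_def)
    then show ?thesis by (simp add: G_def)
  qed
  have GW: "Lnorm s (\<lambda>x. G x z) \<le> ennreal (W z)" for z
  proof (cases "w z = 0")
    case True
    have "Lnorm s (\<lambda>x. G x z) \<le> ennreal 0"
      by (rule Lnorm_bounded[OF s]) (simp_all add: G_def True)
    then show ?thesis by simp
  next
    case False
    then have z: "0 < fst z" "fst z < 1" "snd z \<in> sphere 0 1" using w0[of z] by auto
    have "(\<lambda>x. Lam Y d c t x (R * fst z) (snd z)) \<in> borel_measurable borel"
      using measurable_Pair1[OF Lam_measurable[of c t], of "(R * fst z, snd z)"] by (simp add: space_pair_measure)
    then have "Lnorm s (\<lambda>x. w z * \<bar>Lam Y d c t x (R * fst z) (snd z)\<bar>) \<le> ennreal (\<bar>w z\<bar> * (A * (1 - R * fst z) powr (- e)))"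
      using R\<rho>[OF z(1,2)] z A by (intro Lnorm_cmult[OF s]) (auto simp: Lnorm_abs intro!: L)
    then show ?thesis using wn by (simp add: G_def W_def)
  qed
  have intW: "(\<integral>\<^sup>+z. ennreal (W z) \<partial>?N) = ?V"
  proof -
    have "(\<integral>\<^sup>+z. ennreal (W z) \<partial>?N) = (\<integral>\<^sup>+\<rho>. (\<integral>\<^sup>+y. ennreal (W (\<rho>, y)) \<partial>sphere_measure) \<partial>lborel)"
      by (rule sigma_finite_measure.nn_integral_fst[OF sigma_finite_sphere_measure, symmetric]) (use Wm in measurable)
    also have "\<dots> = ?V"
    proof (rule nn_integral_cong)
      fix \<rho> :: real
      have "(\<integral>\<^sup>+y. ennreal (W (\<rho>, y)) \<partial>sphere_measure)
        = (\<integral>\<^sup>+y. ennreal (A * (1 - R * \<rho>) powr (- e) * rweight t \<rho>) * ennreal \<bar>H (\<rho> *\<^sub>R y)\<bar> \<partial>sphere_measure)"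
        using AE_sphere_measure
        by (intro nn_integral_cong_AE, eventually_elim)
           (use A rweight_nonneg in \<open>auto simp: W_def w_def ennreal_mult[symmetric] mult_ac intro!: arg_cong[where f = ennreal]\<close>)
      also have "\<dots> = ennreal (A * (1 - R * \<rho>) powr (- e) * rweight t \<rho>) * (\<integral>\<^sup>+y. ennreal \<bar>H (\<rho> *\<^sub>R y)\<bar> \<partial>sphere_measure)"
        by (rule nn_integral_cmult) measurable
      finally show "(\<integral>\<^sup>+y. ennreal (W (\<rho>, y)) \<partial>sphere_measure) = ennreal (A * (1 - R * \<rho>) powr (- e) * rweight t \<rho>) * Mq 1 (hseries Y d b) \<rho>"
        by (simp add: Mq_def Lnorm_1 H_def)
    qed
    finally show ?thesis .
  qed
  have F: "ennreal \<bar>hseries Y d (\<lambda>k j. c k j * b k j) (R *\<^sub>R x)\<bar> \<le> (\<integral>\<^sup>+z. ennreal (G x z) \<partial>?N)" if x: "x \<in> sphere 0 1" for x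
  proof -
    define I where "I \<rho> = (\<integral>y. Lam Y d c t x (R * \<rho>) y * H (\<rho> *\<^sub>R y) \<partial>sphere_measure)" for \<rho>
    have bi: "has_bochner_integral lborel (\<lambda>\<rho>. rweight t \<rho> * I \<rho>) (hseries Y d (\<lambda>k j. c k j * b k j) (R *\<^sub>R x))"
      unfolding I_def H_def by (rule multiplier_representation[OF c b t R x])
    then have "ennreal \<bar>hseries Y d (\<lambda>k j. c k j * b k j) (R *\<^sub>R x)\<bar> \<le> (\<integral>\<^sup>+\<rho>. ennreal (norm (rweight t \<rho> * I \<rho>)) \<partial>lborel)"
      using integral_norm_bound_ennreal[of lborel "\<lambda>\<rho>. rweight t \<rho> * I \<rho>"] by (auto simp: has_bochner_integral_iff)
    also have "\<dots> \<le> (\<integral>\<^sup>+\<rho>. (\<integral>\<^sup>+y. ennreal (G x (\<rho>, y)) \<partial>sphere_measure) \<partial>lborel)"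
    proof (rule nn_integral_mono)
      fix \<rho> :: real
      show "ennreal (norm (rweight t \<rho> * I \<rho>)) \<le> (\<integral>\<^sup>+y. ennreal (G x (\<rho>, y)) \<partial>sphere_measure)"
      proof (cases "0 < \<rho> \<and> \<rho> < 1")
        case True
        then have rr: "0 \<le> R * \<rho>" "R * \<rho> < 1" using R\<rho> by auto
        let ?a = "\<lambda>k j. fr t k * (c k j * Y k j x)"
        have [measurable]: "(\<lambda>y. Lam Y d c t x (R * \<rho>) y) \<in> borel_measurable borel"
          unfolding Lam_eq_hseries by measurable
        have "integrable sphere_measure (\<lambda>y. Lam Y d c t x (R * \<rho>) y * H (\<rho> *\<^sub>R y))"
        proof (rule sphere_integrable(1))
          show "\<bar>Lam Y d c t x (R * \<rho>) y * H (\<rho> *\<^sub>R y)\<bar> \<le> (\<Sum>k. wt ?a k * (R * \<rho>) ^ k) * (\<Sum>k. wt b k * \<rho> ^ k)"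
            if y: "y \<in> sphere 0 1" for y
          proof -
            have 1: "\<bar>Lam Y d c t x (R * \<rho>) y\<bar> \<le> (\<Sum>k. wt ?a k * (R * \<rho>) ^ k)"
              unfolding Lam_eq_hseries by (rule hseries_bound[OF Lam_adm[OF c t x] rr y])
            have 2: "\<bar>H (\<rho> *\<^sub>R y)\<bar> \<le> (\<Sum>k. wt b k * \<rho> ^ k)"
              unfolding H_def by (rule hseries_bound[OF b _ _ y]) (use True in auto)
            show ?thesis unfolding abs_mult
              by (rule mult_mono[OF 1 2]) (use order_trans[OF abs_ge_zero 1] in auto)
          qed
        qed measurable
        then have "ennreal (norm (I \<rho>)) \<le> (\<integral>\<^sup>+y. ennreal (norm (Lam Y d c t x (R * \<rho>) y * H (\<rho> *\<^sub>R y))) \<partial>sphere_measure)"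
          unfolding I_def by (rule integral_norm_bound_ennreal)
        then have "ennreal (rweight t \<rho>) * ennreal (norm (I \<rho>)) \<le> ennreal (rweight t \<rho>) * (\<integral>\<^sup>+y. ennreal (norm (Lam Y d c t x (R * \<rho>) y * H (\<rho> *\<^sub>R y))) \<partial>sphere_measure)"
          by (rule mult_left_mono) simp
        also have "\<dots> = (\<integral>\<^sup>+y. ennreal (rweight t \<rho>) * ennreal (norm (Lam Y d c t x (R * \<rho>) y * H (\<rho> *\<^sub>R y))) \<partial>sphere_measure)"
          by (rule nn_integral_cmult[symmetric]) measurable
        also have "\<dots> = (\<integral>\<^sup>+y. ennreal (G x (\<rho>, y)) \<partial>sphere_measure)"
          using AE_sphere_measure
          by (intro nn_integral_cong_AE, eventually_elim)
             (use rweight_nonneg in \<open>auto simp: G_def w_def ennreal_mult[symmetric] abs_mult mult_ac intro!: arg_cong[where f = ennreal]\<close>)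
        finally show ?thesis using rweight_nonneg[of t \<rho>] by (simp add: ennreal_mult[symmetric] abs_mult)
      qed (simp add: rweight_def)
    qed
    also have "\<dots> = (\<integral>\<^sup>+z. ennreal (G x z) \<partial>?N)"
    proof (rule sigma_finite_measure.nn_integral_fst[OF sigma_finite_sphere_measure])
      have "G x \<in> borel_measurable ?N" using measurable_Pair2[OF Gm, of x] by simp
      then show "(\<lambda>z. ennreal (G x z)) \<in> borel_measurable ?N" by measurable
    qed
    finally show ?thesis .
  qed
  \<comment> \<open>\<open>Lnorm_minkowski\<close> wants a strictly positive real bound, while the
    integral may be 0; a small \<epsilon> is added and removed at the end.\<close>
  show ?thesis
  proof (rule ennreal_le_epsilon)
    fix \<epsilon> :: real assume e: "\<epsilon> > 0"
    have fin: "?V < top" using False by (simp add: less_top)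
    have T: "?V + ennreal \<epsilon> = ennreal (enn2real ?V + \<epsilon>)"
      using fin e by (simp add: ennreal_plus)
    have "Lnorm s (\<lambda>x. hseries Y d (\<lambda>k j. c k j * b k j) (R *\<^sub>R x)) \<le> ennreal (enn2real ?V + \<epsilon>)"
    proof (rule Lnorm_minkowski[OF s sfN Gm Wm _ Wn G0 GW _ _ F])
      show "0 \<le> G x z" for x z using wn by (simp add: G_def)
      show "(\<integral>\<^sup>+z. ennreal (W z) \<partial>?N) \<le> ennreal (enn2real ?V + \<epsilon>)"
        unfolding intW T[symmetric] by simp
      show "0 < enn2real ?V + \<epsilon>" using e by (simp add: add_nonneg_pos)
    qed
    then show "Mq s (hseries Y d (\<lambda>k j. c k j * b k j)) R \<le> ?V + ennreal \<epsilon>"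
      unfolding T unfolding Mq_def .
  qed
qed simp

text \<open>The growth bound \<open>D\<close> on the means is inserted under the integral of
  \<open>multiplier_Mq_bound\<close>. The exponent of the kernel condition splits as
  \<open>(t - \<alpha>) + \<beta>\<close>, the form required by \<open>beta_kernel_integral\<close>,
  and \<open>t > \<alpha>\<close> makes the first part positive.\<close>

lemma multiplier_into_top:
  assumes c: "adm c" and b: "adm b" and t: "t > \<alpha>" and \<alpha>: "\<alpha> > 0" and \<beta>: "\<beta> > 0" and s: "1 \<le> s" and A: "A > 0"
    and L: "\<And>\<rho> y. 0 \<le> \<rho> \<Longrightarrow> \<rho> < 1 \<Longrightarrow> y \<in> sphere 0 1 \<Longrightarrow>
      Lnorm s (\<lambda>x. Lam Y d c t x \<rho> y) \<le> ennreal (A * (1 - \<rho>) powr (- (\<beta> - \<alpha> + t)))"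
    and D: "D \<ge> 0" "\<And>r. 0 \<le> r \<Longrightarrow> r < 1 \<Longrightarrow> Mq 1 (hseries Y d b) r \<le> ennreal (D * (1 - r) powr (- \<alpha>))"
    and R: "0 \<le> R" "R < 1"
  shows "Mq s (hseries Y d (\<lambda>k j. c k j * b k j)) R
    \<le> ennreal (A * 2 * 2 powr t * D * (1 / (t - \<alpha>) + 1 / \<beta>) * (1 - R) powr (- \<beta>))"
proof -
  let ?e = "\<beta> - \<alpha> + t"
  have t0: "t > 0" using t \<alpha> by simp
  let ?C = "A * 2 * 2 powr t * D"
  have C0: "?C \<ge> 0" using A D by simp
  have "Mq s (hseries Y d (\<lambda>k j. c k j * b k j)) R
    \<le> (\<integral>\<^sup>+\<rho>. ennreal (A * (1 - R * \<rho>) powr (- ?e) * rweight t \<rho>) * Mq 1 (hseries Y d b) \<rho> \<partial>lborel)"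
    by (rule multiplier_Mq_bound[OF c b t0 s A L R])
  also have "\<dots> \<le> (\<integral>\<^sup>+\<rho>. ennreal ?C * (ennreal ((1 - \<rho>) powr ((t - \<alpha>) - 1) * (1 - R * \<rho>) powr (- ((t - \<alpha>) + \<beta>))) * indicator {0<..<1} \<rho>) \<partial>lborel)"
  proof (rule nn_integral_mono)
    fix \<rho> :: real
    show "ennreal (A * (1 - R * \<rho>) powr (- ?e) * rweight t \<rho>) * Mq 1 (hseries Y d b) \<rho>
      \<le> ennreal ?C * (ennreal ((1 - \<rho>) powr ((t - \<alpha>) - 1) * (1 - R * \<rho>) powr (- ((t - \<alpha>) + \<beta>))) * indicator {0<..<1} \<rho>)"
    proof (cases "0 < \<rho> \<and> \<rho> < 1")
      case True
      have "\<rho> ^ (CARD('n) - 1) * (1 - \<rho>\<^sup>2) powr (t - 1) \<le> 1 * (2 powr t * (1 - \<rho>) powr (t - 1))"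
        using True t0 one_minus_square_powr_bounds(2)[of \<rho> t] by (intro mult_mono power_le_one) auto
      then have w: "rweight t \<rho> \<le> 2 * (2 powr t * (1 - \<rho>) powr (t - 1))"
        using True by (simp add: rweight_def)
      have "A * (1 - R * \<rho>) powr (- ?e) * rweight t \<rho> * (D * (1 - \<rho>) powr (- \<alpha>))
        \<le> A * (1 - R * \<rho>) powr (- ?e) * (2 * (2 powr t * (1 - \<rho>) powr (t - 1))) * (D * (1 - \<rho>) powr (- \<alpha>))"
        using w A D by (intro mult_right_mono mult_left_mono) auto
      also have "\<dots> = ?C * ((1 - \<rho>) powr (t - 1) * (1 - \<rho>) powr (- \<alpha>) * (1 - R * \<rho>) powr (- ?e))"
        by (simp only: mult_ac)
      also have "(1 - \<rho>) powr (t - 1) * (1 - \<rho>) powr (- \<alpha>) = (1 - \<rho>) powr ((t - \<alpha>) - 1)"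
        by (simp add: powr_add[symmetric] algebra_simps)
      finally have le: "A * (1 - R * \<rho>) powr (- ?e) * rweight t \<rho> * (D * (1 - \<rho>) powr (- \<alpha>))
        \<le> ?C * ((1 - \<rho>) powr ((t - \<alpha>) - 1) * (1 - R * \<rho>) powr (- ?e))" .
      have "ennreal (A * (1 - R * \<rho>) powr (- ?e) * rweight t \<rho>) * Mq 1 (hseries Y d b) \<rho>
        \<le> ennreal (A * (1 - R * \<rho>) powr (- ?e) * rweight t \<rho>) * ennreal (D * (1 - \<rho>) powr (- \<alpha>))"
        using True by (intro mult_left_mono D) auto
      also have "\<dots> = ennreal (A * (1 - R * \<rho>) powr (- ?e) * rweight t \<rho> * (D * (1 - \<rho>) powr (- \<alpha>)))"
        using A D rweight_nonneg by (intro ennreal_mult[symmetric] mult_nonneg_nonneg) auto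
      also have "\<dots> \<le> ennreal (?C * ((1 - \<rho>) powr ((t - \<alpha>) - 1) * (1 - R * \<rho>) powr (- ?e)))"
        by (rule ennreal_leI[OF le])
      also have "\<dots> = ennreal ?C * ennreal ((1 - \<rho>) powr ((t - \<alpha>) - 1) * (1 - R * \<rho>) powr (- ?e))"
        using C0 by (intro ennreal_mult) auto
      finally have X: "ennreal (A * (1 - R * \<rho>) powr (- ?e) * rweight t \<rho>) * Mq 1 (hseries Y d b) \<rho>
        \<le> ennreal ?C * ennreal ((1 - \<rho>) powr ((t - \<alpha>) - 1) * (1 - R * \<rho>) powr (- ?e))" .
      have eq: "- ?e = - ((t - \<alpha>) + \<beta>)" by simp
      have ind: "indicator {0<..<1} \<rho> = (1 :: ennreal)" using True by simp
      show ?thesis using X unfolding ind mult_1_right eq .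
    qed (simp add: rweight_def)
  qed
  also have "\<dots> = ennreal ?C * (\<integral>\<^sup>+\<rho>\<in>{0<..<1}. ennreal ((1 - \<rho>) powr ((t - \<alpha>) - 1) * (1 - R * \<rho>) powr (- ((t - \<alpha>) + \<beta>))) \<partial>lborel)"
    by (rule nn_integral_cmult) measurable
  also have "\<dots> \<le> ennreal ?C * ennreal ((1 / (t - \<alpha>) + 1 / \<beta>) * (1 - R) powr (- \<beta>))"
    by (intro mult_left_mono beta_kernel_integral R \<beta>) (use t in auto)
  also have "\<dots> = ennreal (?C * ((1 / (t - \<alpha>) + 1 / \<beta>) * (1 - R) powr (- \<beta>)))"
    using C0 t \<beta> by (intro ennreal_mult[symmetric]) auto
  finally show ?thesis by (simp add: mult.assoc)
qed


text \<open>Multiplied by their weights and measured by \<open>hyp_measure\<close>, the radial means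
  of the image are dominated by the integral operator with kernel
  \<open>hyp_ker (t - \<alpha>) \<beta>\<close> applied to those of the expansion of
  \<open>b\<close>; the Schur test bounds this operator on L^q.\<close>

lemma multiplier_into_finite:
  assumes c: "adm c" and b: "adm b" and t: "t > \<alpha>" and \<alpha>: "\<alpha> > 0" and \<beta>: "\<beta> > 0" and s: "1 \<le> s" and A: "A > 0"
    and L: "\<And>\<rho> y. 0 \<le> \<rho> \<Longrightarrow> \<rho> < 1 \<Longrightarrow> y \<in> sphere 0 1 \<Longrightarrow>
      Lnorm s (\<lambda>x. Lam Y d c t x \<rho> y) \<le> ennreal (A * (1 - \<rho>) powr (- (\<beta> - \<alpha> + t)))"
    and D: "D \<ge> 0" "\<And>r. 0 \<le> r \<Longrightarrow> r < 1 \<Longrightarrow> Mq 1 (hseries Y d b) r \<le> ennreal (D * (1 - r) powr (- \<alpha>))"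
    and p: "1 \<le> p" "p \<le> q"
    and I: "(\<integral>\<^sup>+ r\<in>{0<..<1}. enn_powr (Mq 1 (hseries Y d b) r) p
              * ennreal ((1 - r\<^sup>2) powr (\<alpha> * p - 1) * r ^ (CARD('n) - 1)) \<partial>lborel) < \<infinity>"
  shows "(\<integral>\<^sup>+ r\<in>{0<..<1}. enn_powr (Mq s (hseries Y d (\<lambda>k j. c k j * b k j)) r) q
              * ennreal ((1 - r\<^sup>2) powr (\<beta> * q - 1) * r ^ (CARD('n) - 1)) \<partial>lborel) < \<infinity>"
proof -
  let ?N = "CARD('n)"
  let ?F = "hseries Y d (\<lambda>k j. c k j * b k j)"
  define \<gamma> where "\<gamma> = t - \<alpha>"
  have \<gamma>: "\<gamma> > 0" using t by (simp add: \<gamma>_def)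
  have t0: "t > 0" using t \<alpha> by simp
  have q1: "q \<ge> 1" using p by simp
  define \<nu> where "\<nu> r = enn2real (Mq 1 (hseries Y d b) r)" for r
  have \<nu>: "Mq 1 (hseries Y d b) r = ennreal (\<nu> r)" if "0 \<le> r" "r < 1" for r
    using Mq_hseries_finite[OF b order_refl that] by (simp add: \<nu>_def)
  have \<nu>0: "\<nu> r \<ge> 0" for r by (simp add: \<nu>_def)
  have \<nu>m [measurable]: "\<nu> \<in> borel_measurable borel"
    unfolding \<nu>_def[abs_def] using Mq_measurable_1[OF hseries_measurable] by measurable
  define u where "u r = indicator {0<..<1} r * (\<nu> r * (1 - r\<^sup>2) powr \<alpha>)" for r
  have um [measurable]: "u \<in> borel_measurable borel" unfolding u_def[abs_def] by measurable
  have u0: "u r \<ge> 0" for r using \<nu>0 by (simp add: u_def)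
  have sq: "0 < 1 - r\<^sup>2" if "0 < r" "r < 1" for r :: real using that by (simp add: power_less_one_iff)
  have uD: "u r \<le> D * 2 powr \<alpha>" if r: "0 < r" "r < 1" for r
  proof -
    have "ennreal (\<nu> r) \<le> ennreal (D * (1 - r) powr (- \<alpha>))" using D(2)[of r] \<nu>[of r] r by simp
    then have n: "\<nu> r \<le> D * (1 - r) powr (- \<alpha>)" using D(1) by simp
    have "(1 - r\<^sup>2) powr \<alpha> = (1 - r) powr \<alpha> * (1 + r) powr \<alpha>"
      using r by (subst powr_mult[symmetric]) (auto simp: power2_eq_square algebra_simps)
    also have "\<dots> \<le> (1 - r) powr \<alpha> * 2 powr \<alpha>" using r \<alpha> by (intro mult_left_mono powr_mono2) auto
    finally have "\<nu> r * (1 - r\<^sup>2) powr \<alpha> \<le> (D * (1 - r) powr (- \<alpha>)) * ((1 - r) powr \<alpha> * 2 powr \<alpha>)"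
      using n D(1) by (intro mult_mono) auto
    also have "\<dots> = D * 2 powr \<alpha> * ((1 - r) powr (- \<alpha>) * (1 - r) powr \<alpha>)" by (simp only: mult_ac)
    also have "(1 - r) powr (- \<alpha>) * (1 - r) powr \<alpha> = 1" using r by (simp add: powr_add[symmetric])
    finally show ?thesis using r by (simp add: u_def)
  qed
  have up: "(\<integral>\<^sup>+r. ennreal (u r powr p) \<partial>hyp_measure ?N) < \<infinity>"
  proof -
    have "(\<integral>\<^sup>+r. ennreal (u r powr p) \<partial>hyp_measure ?N)
      = (\<integral>\<^sup>+r. ennreal (indicator {0<..<1} r * (r ^ (?N - 1) / (1 - r\<^sup>2))) * ennreal (u r powr p) \<partial>lborel)"
      by (rule nn_integral_hyp_measure) measurable
    also have "\<dots> = (\<integral>\<^sup>+ r\<in>{0<..<1}. enn_powr (Mq 1 (hseries Y d b) r) p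
              * ennreal ((1 - r\<^sup>2) powr (\<alpha> * p - 1) * r ^ (?N - 1)) \<partial>lborel)"
    proof (rule nn_integral_cong)
      fix r :: real
      show "ennreal (indicator {0<..<1} r * (r ^ (?N - 1) / (1 - r\<^sup>2))) * ennreal (u r powr p)
        = enn_powr (Mq 1 (hseries Y d b) r) p * ennreal ((1 - r\<^sup>2) powr (\<alpha> * p - 1) * r ^ (?N - 1)) * indicator {0<..<1} r"
      proof (cases "0 < r \<and> r < 1")
        case True
        have "r ^ (?N - 1) / (1 - r\<^sup>2) * (\<nu> r * (1 - r\<^sup>2) powr \<alpha>) powr p = \<nu> r powr p * ((1 - r\<^sup>2) powr (\<alpha> * p - 1) * r ^ (?N - 1))"
          using sq[of r] True \<nu>0 by (simp add: powr_mult powr_powr powr_diff)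
        then show ?thesis
          using True sq[of r] \<nu>[of r] \<nu>0 by (simp add: u_def enn_powr_ennreal ennreal_mult[symmetric])
      qed simp
    qed
    finally show ?thesis using I by simp
  qed
  \<comment> \<open>Here \<open>p \<le> q\<close> is used: \<open>u\<close> is bounded by
    \<open>D * 2 powr \<alpha>\<close>, so \<open>u powr q\<close> is at most a constant times
    \<open>u powr p\<close>.\<close>
  have uq: "(\<integral>\<^sup>+r. ennreal (u r powr q) \<partial>hyp_measure ?N) < \<infinity>"
  proof -
    have "(\<integral>\<^sup>+r. ennreal (u r powr q) \<partial>hyp_measure ?N)
       \<le> (\<integral>\<^sup>+r. ennreal ((D * 2 powr \<alpha>) powr (q - p)) * ennreal (u r powr p) \<partial>hyp_measure ?N)"
    proof (rule nn_integral_mono)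
      fix r :: real
      show "ennreal (u r powr q) \<le> ennreal ((D * 2 powr \<alpha>) powr (q - p)) * ennreal (u r powr p)"
      proof (cases "0 < r \<and> r < 1 \<and> u r > 0")
        case True
        have "u r powr q = u r powr (q - p) * u r powr p" by (simp add: powr_add[symmetric])
        also have "\<dots> \<le> (D * 2 powr \<alpha>) powr (q - p) * u r powr p"
          using True uD[of r] p by (intro mult_right_mono powr_mono2) auto
        finally show ?thesis by (simp add: ennreal_mult[symmetric] ennreal_leI)
      next
        case False
        then have "u r = 0" using u0[of r] by (auto simp: u_def indicator_def split: if_splits)
        then show ?thesis by simp
      qed
    qed
    also have "\<dots> = ennreal ((D * 2 powr \<alpha>) powr (q - p)) * (\<integral>\<^sup>+r. ennreal (u r powr p) \<partial>hyp_measure ?N)"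
      by (rule nn_integral_cmult) measurable
    also have "\<dots> < \<infinity>" using up by (simp add: ennreal_mult_less_top)
    finally show ?thesis .
  qed
  let ?K = "2 powr (\<gamma> + \<beta>) * (1 / \<gamma> + 1 / \<beta>)"
  have K: "?K > 0" using \<gamma> \<beta> by (intro mult_pos_pos add_pos_pos) auto
  have schur: "(\<integral>\<^sup>+R. enn_powr (\<integral>\<^sup>+\<rho>. ennreal (hyp_ker \<gamma> \<beta> R \<rho> * u \<rho>) \<partial>hyp_measure ?N) q \<partial>hyp_measure ?N)
     \<le> ennreal (?K powr (q - 1)) * (ennreal ?K * (\<integral>\<^sup>+\<rho>. ennreal (u \<rho> powr q) \<partial>hyp_measure ?N))"
  proof (rule schur_test[OF sigma_finite_hyp_measure sigma_finite_hyp_measure _ _ hyp_ker_nonneg u0 _ _ K q1])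
    show "(\<lambda>(R, \<rho>). hyp_ker \<gamma> \<beta> R \<rho>) \<in> borel_measurable (hyp_measure ?N \<Otimes>\<^sub>M hyp_measure ?N)"
      unfolding measurable_cong_sets[OF sets_pair_measure_cong[OF sets_hyp_measure sets_hyp_measure] refl]
      by (rule hyp_ker_measurable)
    show "AE R in hyp_measure ?N. (\<integral>\<^sup>+\<rho>. ennreal (hyp_ker \<gamma> \<beta> R \<rho>) \<partial>hyp_measure ?N) \<le> ennreal ?K"
      by (intro AE_I2 hyp_ker_integral \<gamma> \<beta>)
    show "AE \<rho> in hyp_measure ?N. (\<integral>\<^sup>+R. ennreal (hyp_ker \<gamma> \<beta> R \<rho>) \<partial>hyp_measure ?N) \<le> ennreal ?K"
      using hyp_ker_integral[OF \<beta> \<gamma>] by (intro AE_I2) (simp add: hyp_ker_commute[of \<gamma> \<beta>] add.commute)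
  qed measurable
  \<comment> \<open>The weight \<open>(1 - \<rho>\<^sup>2) powr (t - 1)\<close> of the
    representation is shared out: exponent \<gamma> goes to the kernel, \<alpha> to \<open>u\<close>
    and -1 to the measure. The 2 comes from \<open>rweight\<close>.\<close>
  have pt: "ennreal ((1 - R\<^sup>2) powr \<beta>) * Mq s ?F R \<le> ennreal (2 * A) * (\<integral>\<^sup>+\<rho>. ennreal (hyp_ker \<gamma> \<beta> R \<rho> * u \<rho>) \<partial>hyp_measure ?N)"
    if R: "0 < R" "R < 1" for R
  proof -
    have "ennreal ((1 - R\<^sup>2) powr \<beta>) * Mq s ?F R \<le> ennreal ((1 - R\<^sup>2) powr \<beta>) *
      (\<integral>\<^sup>+\<rho>. ennreal (A * (1 - R * \<rho>) powr (- (\<beta> - \<alpha> + t)) * rweight t \<rho>) * Mq 1 (hseries Y d b) \<rho> \<partial>lborel)"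
      using R by (intro mult_left_mono multiplier_Mq_bound[OF c b t0 s A L]) auto
    also have "\<dots> = (\<integral>\<^sup>+\<rho>. ennreal ((1 - R\<^sup>2) powr \<beta>) *
      (ennreal (A * (1 - R * \<rho>) powr (- (\<beta> - \<alpha> + t)) * rweight t \<rho>) * Mq 1 (hseries Y d b) \<rho>) \<partial>lborel)"
      by (rule nn_integral_cmult[symmetric]) (use Mq_measurable_1[OF hseries_measurable] in measurable)
    also have "\<dots> = (\<integral>\<^sup>+\<rho>. ennreal (2 * A) * (ennreal (indicator {0<..<1} \<rho> * (\<rho> ^ (?N - 1) / (1 - \<rho>\<^sup>2))) * ennreal (hyp_ker \<gamma> \<beta> R \<rho> * u \<rho>)) \<partial>lborel)"
    proof (rule nn_integral_cong)
      fix \<rho> :: real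
      show "ennreal ((1 - R\<^sup>2) powr \<beta>) * (ennreal (A * (1 - R * \<rho>) powr (- (\<beta> - \<alpha> + t)) * rweight t \<rho>) * Mq 1 (hseries Y d b) \<rho>)
        = ennreal (2 * A) * (ennreal (indicator {0<..<1} \<rho> * (\<rho> ^ (?N - 1) / (1 - \<rho>\<^sup>2))) * ennreal (hyp_ker \<gamma> \<beta> R \<rho> * u \<rho>))"
      proof (cases "0 < \<rho> \<and> \<rho> < 1")
        case True
        define X where "X = 1 - \<rho>\<^sup>2"
        have X: "X > 0" unfolding X_def using True sq[of \<rho>] by simp
        have exp: "- (\<beta> - \<alpha> + t) = - (\<gamma> + \<beta>)" by (simp add: \<gamma>_def)
        have "X powr (t - 1) = X powr (\<gamma> + \<alpha> - 1)" by (simp add: \<gamma>_def)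
        also have "\<dots> = X powr \<gamma> * X powr \<alpha> / X" using X by (simp add: powr_add powr_diff)
        finally have Xp: "X powr (t - 1) = X powr \<gamma> * X powr \<alpha> / X" .
        have hk: "hyp_ker \<gamma> \<beta> R \<rho> = (1 - R\<^sup>2) powr \<beta> * X powr \<gamma> * (1 - R * \<rho>) powr (- (\<gamma> + \<beta>))"
          using R True by (simp add: hyp_ker_def X_def)
        have uu: "u \<rho> = \<nu> \<rho> * X powr \<alpha>" using True by (simp add: u_def X_def)
        have rw: "rweight t \<rho> = 2 * \<rho> ^ (?N - 1) * X powr (t - 1)" using True by (simp add: rweight_def X_def)
        have "(1 - R\<^sup>2) powr \<beta> * (A * (1 - R * \<rho>) powr (- (\<gamma> + \<beta>)) * rweight t \<rho> * \<nu> \<rho>)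
          = 2 * A * ((\<rho> ^ (?N - 1) / X) * (hyp_ker \<gamma> \<beta> R \<rho> * u \<rho>))"
          unfolding rw Xp hk uu by simp
        then have id: "(1 - R\<^sup>2) powr \<beta> * ((A * (1 - R * \<rho>) powr (- (\<gamma> + \<beta>)) * rweight t \<rho>) * \<nu> \<rho>)
          = 2 * A * ((\<rho> ^ (?N - 1) / X) * (hyp_ker \<gamma> \<beta> R \<rho> * u \<rho>))" by (simp only: mult.assoc)
        have a1: "0 \<le> \<rho> ^ (?N - 1) / X" using X True by simp
        have a2: "0 \<le> hyp_ker \<gamma> \<beta> R \<rho> * u \<rho>" by (intro mult_nonneg_nonneg hyp_ker_nonneg u0)
        have a3: "0 \<le> 2 * A" using A by simp
        have z1: "0 \<le> (1 - R\<^sup>2) powr \<beta>" by simp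
        have z2: "0 \<le> A * (1 - R * \<rho>) powr (- (\<gamma> + \<beta>)) * rweight t \<rho>"
          using A rweight_nonneg by (intro mult_nonneg_nonneg) auto
        have ind: "indicator {0<..<1} \<rho> = (1 :: real)" using True by simp
        have nu: "Mq 1 (hseries Y d b) \<rho> = ennreal (\<nu> \<rho>)" using \<nu> True by simp
        show ?thesis
          unfolding exp nu ind mult_1_left X_def[symmetric]
            ennreal_mult[OF z2 \<nu>0, symmetric] ennreal_mult[OF z1 mult_nonneg_nonneg[OF z2 \<nu>0], symmetric]
            ennreal_mult[OF a1 a2, symmetric] ennreal_mult[OF a3 mult_nonneg_nonneg[OF a1 a2], symmetric]
          by (rule arg_cong[where f = ennreal, OF id])
      qed (simp add: rweight_def)
    qed
    also have "\<dots> = ennreal (2 * A) * (\<integral>\<^sup>+\<rho>. ennreal (indicator {0<..<1} \<rho> * (\<rho> ^ (?N - 1) / (1 - \<rho>\<^sup>2))) * ennreal (hyp_ker \<gamma> \<beta> R \<rho> * u \<rho>) \<partial>lborel)"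
      by (rule nn_integral_cmult) measurable
    also have "\<dots> = ennreal (2 * A) * (\<integral>\<^sup>+\<rho>. ennreal (hyp_ker \<gamma> \<beta> R \<rho> * u \<rho>) \<partial>hyp_measure ?N)"
      by (subst nn_integral_hyp_measure) measurable
    finally show ?thesis .
  qed
  have km: "(\<lambda>R. \<integral>\<^sup>+\<rho>. ennreal (hyp_ker \<gamma> \<beta> R \<rho> * u \<rho>) \<partial>hyp_measure ?N) \<in> borel_measurable borel"
  proof (rule sigma_finite_measure.borel_measurable_nn_integral[OF sigma_finite_hyp_measure])
    have "(\<lambda>(R, \<rho>). ennreal (hyp_ker \<gamma> \<beta> R \<rho> * u \<rho>)) \<in> borel_measurable (borel \<Otimes>\<^sub>M borel)" by measurable
    then show "(\<lambda>(R, \<rho>). ennreal (hyp_ker \<gamma> \<beta> R \<rho> * u \<rho>)) \<in> borel_measurable (borel \<Otimes>\<^sub>M hyp_measure ?N)"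
      unfolding measurable_cong_sets[OF sets_pair_measure_cong[OF refl sets_hyp_measure] refl] .
  qed
  have em: "(\<lambda>x. enn_powr x q) \<in> borel_measurable borel"
    unfolding enn_powr_def by measurable
  define J where "J R = enn_powr (\<integral>\<^sup>+\<rho>. ennreal (hyp_ker \<gamma> \<beta> R \<rho> * u \<rho>) \<partial>hyp_measure ?N) q" for R
  have Jm [measurable]: "J \<in> borel_measurable borel"
    unfolding J_def[abs_def] by (rule measurable_compose[OF km em])
  have "(\<integral>\<^sup>+ r\<in>{0<..<1}. enn_powr (Mq s ?F r) q * ennreal ((1 - r\<^sup>2) powr (\<beta> * q - 1) * r ^ (?N - 1)) \<partial>lborel)
     \<le> (\<integral>\<^sup>+R. ennreal ((2 * A) powr q) * (ennreal (indicator {0<..<1} R * (R ^ (?N - 1) / (1 - R\<^sup>2))) * J R) \<partial>lborel)"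
  proof (rule nn_integral_mono)
    fix r :: real
    show "enn_powr (Mq s ?F r) q * ennreal ((1 - r\<^sup>2) powr (\<beta> * q - 1) * r ^ (?N - 1)) * indicator {0<..<1} r
       \<le> ennreal ((2 * A) powr q) * (ennreal (indicator {0<..<1} r * (r ^ (?N - 1) / (1 - r\<^sup>2))) * J r)"
    proof (cases "0 < r \<and> r < 1")
      case True
      have X: "1 - r\<^sup>2 > 0" using True sq by simp
      have w: "0 \<le> r ^ (?N - 1) / (1 - r\<^sup>2)" using X True by simp
      have "enn_powr (ennreal ((1 - r\<^sup>2) powr \<beta>) * Mq s ?F r) q
         \<le> enn_powr (ennreal (2 * A) * (\<integral>\<^sup>+\<rho>. ennreal (hyp_ker \<gamma> \<beta> r \<rho> * u \<rho>) \<partial>hyp_measure ?N)) q"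
        using True q1 by (intro enn_powr_mono pt) auto
      then have le: "ennreal ((1 - r\<^sup>2) powr (\<beta> * q)) * enn_powr (Mq s ?F r) q \<le> ennreal ((2 * A) powr q) * J r"
        using q1 A by (simp add: enn_powr_mult powr_powr J_def)
      have eqw: "(1 - r\<^sup>2) powr (\<beta> * q - 1) * r ^ (?N - 1) = (1 - r\<^sup>2) powr (\<beta> * q) * (r ^ (?N - 1) / (1 - r\<^sup>2))"
        using X by (simp add: powr_diff)
      have "enn_powr (Mq s ?F r) q * ennreal ((1 - r\<^sup>2) powr (\<beta> * q - 1) * r ^ (?N - 1))
        = (ennreal ((1 - r\<^sup>2) powr (\<beta> * q)) * enn_powr (Mq s ?F r) q) * ennreal (r ^ (?N - 1) / (1 - r\<^sup>2))"
        unfolding eqw ennreal_mult[OF powr_ge_zero w] by (simp only: mult_ac)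
      also have "\<dots> \<le> (ennreal ((2 * A) powr q) * J r) * ennreal (r ^ (?N - 1) / (1 - r\<^sup>2))"
        by (rule mult_right_mono[OF le]) simp
      finally show ?thesis using True by (simp add: mult_ac)
    qed simp
  qed
  also have "\<dots> = ennreal ((2 * A) powr q) * (\<integral>\<^sup>+R. J R \<partial>hyp_measure ?N)"
    by (subst nn_integral_hyp_measure[OF Jm]) (rule nn_integral_cmult, measurable)
  also have "\<dots> \<le> ennreal ((2 * A) powr q) * (ennreal (?K powr (q - 1)) * (ennreal ?K * (\<integral>\<^sup>+\<rho>. ennreal (u \<rho> powr q) \<partial>hyp_measure ?N)))"
    unfolding J_def by (intro mult_left_mono schur) simp
  also have "\<dots> < \<infinity>" using uq by (simp add: ennreal_mult_less_top)
  finally show ?thesis .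
qed

theorem sufficient:
  assumes c: "adm c" and m: "t > \<alpha>" and \<alpha>: "\<alpha> > 0" and \<beta>: "\<beta> > 0" and s: "1 \<le> s" and p: "1 \<le> p" "p \<le> q" and A: "A > 0"
    and L: "\<And>\<rho> y. 0 \<le> \<rho> \<Longrightarrow> \<rho> < 1 \<Longrightarrow> y \<in> sphere 0 1 \<Longrightarrow>
      Lnorm s (\<lambda>x. Lam Y d c t x \<rho> y) \<le> ennreal (A * (1 - \<rho>) powr (- (\<beta> - \<alpha> + t)))"
  shows "c \<in> MH Y d (Bspace p 1 \<alpha>) (Bspace q s \<beta>)"
  unfolding MH_def
proof (intro CollectI ballI)
  fix f :: "real^'n \<Rightarrow> real" assume "f \<in> Bspace p 1 \<alpha>"
  then obtain b where b: "adm b" "hseries Y d b \<in> Bspace p 1 \<alpha>" "\<And>k j. j \<in> {1..d k} \<Longrightarrow> hcoef Y d f k j = b k j"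
    by (rule Bspace_expansion) (rule that)
  let ?cb = "\<lambda>k j. c k j * b k j"
  have cb: "adm ?cb" by (rule adm_mult[OF c b(1)])
  have eq: "hseries Y d (hconv Y d c f) = hseries Y d ?cb" "hseries_conv Y d (hconv Y d c f) \<longleftrightarrow> hseries_conv Y d ?cb"
    using hseries_cong[of "hconv Y d c f" ?cb] b(3) by (simp_all add: hconv_def)
  obtain D where D: "D \<ge> 0" "\<And>r. 0 \<le> r \<Longrightarrow> r < 1 \<Longrightarrow> Mq 1 (hseries Y d b) r \<le> ennreal (D * (1 - r) powr (- \<alpha>))"
    using Bspace_sup_bound[OF b(1) order_refl p(1) \<alpha> b(2)] by blast
  have "hseries Y d ?cb \<in> Bspace q s \<beta>"
  proof (cases "q = \<infinity>")
    case True
    let ?C = "A * 2 * 2 powr t * D * (1 / (t - \<alpha>) + 1 / \<beta>)"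
    have C0: "?C \<ge> 0" using A D m \<beta> by (intro mult_nonneg_nonneg add_nonneg_nonneg) auto
    have "(SUP r\<in>{0..<1}. Mq s (hseries Y d ?cb) r * ennreal ((1 - r) powr \<beta>)) \<le> ennreal ?C"
    proof (rule SUP_least)
      fix r :: real assume "r \<in> {0..<1}"
      then have r: "0 \<le> r" "r < 1" by auto
      have "Mq s (hseries Y d ?cb) r * ennreal ((1 - r) powr \<beta>) \<le> ennreal (?C * (1 - r) powr (- \<beta>)) * ennreal ((1 - r) powr \<beta>)"
        by (intro mult_right_mono multiplier_into_top[OF c b(1) m \<alpha> \<beta> s A L D r]) auto
      also have "\<dots> = ennreal (?C * (1 - r) powr (- \<beta>) * (1 - r) powr \<beta>)"
        using C0 by (intro ennreal_mult[symmetric]) auto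
      also have "?C * (1 - r) powr (- \<beta>) * (1 - r) powr \<beta> = ?C"
        using r by (simp add: mult.assoc powr_add[symmetric])
      finally show "Mq s (hseries Y d ?cb) r * ennreal ((1 - r) powr \<beta>) \<le> ennreal ?C" .
    qed
    then have "(SUP r\<in>{0..<1}. Mq s (hseries Y d ?cb) r * ennreal ((1 - r) powr \<beta>)) < \<infinity>"
      by (rule le_less_trans) simp
    then show ?thesis using True adm_harmonic[OF cb] by (simp add: Bspace_def)
  next
    case False
    then have pf: "p \<noteq> \<infinity>" using p(2) by (auto simp: top_unique)
    have pr: "1 \<le> enn2real p" by (rule enn2real_ge_1[OF p(1) pf])
    have pq: "enn2real p \<le> enn2real q" using p(2) False by (intro enn2real_mono) (auto simp: less_top)
    have "(\<integral>\<^sup>+ r\<in>{0<..<1}. enn_powr (Mq 1 (hseries Y d b) r) (enn2real p)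
              * ennreal ((1 - r\<^sup>2) powr (\<alpha> * enn2real p - 1) * r ^ (CARD('n) - 1)) \<partial>lborel) < \<infinity>"
      using b(2) pf by (simp add: Bspace_def)
    from multiplier_into_finite[OF c b(1) m \<alpha> \<beta> s A L D pr pq this]
    show ?thesis using False adm_harmonic[OF cb] by (simp add: Bspace_def)
  qed
  then show "hseries_conv Y d (hconv Y d c f) \<and> hseries Y d (hconv Y d c f) \<in> Bspace q s \<beta>"
    unfolding eq using adm_hseries_conv[OF cb] by simp
qed

end

section \<open>Necessity of the kernel condition\<close>

lemma measurable_pair_count_space_nat:
  assumes "\<And>i. (\<lambda>x. G x i) \<in> borel_measurable M"
  shows "(\<lambda>(x, i). G x i) \<in> borel_measurable (M \<Otimes>\<^sub>M count_space (UNIV :: nat set))"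
proof -
  have "(\<lambda>z. G (fst z) i) \<in> borel_measurable (M \<Otimes>\<^sub>M count_space (UNIV :: nat set))" for i
    by (rule measurable_compose[OF measurable_fst assms])
  then have "(\<lambda>z. G (fst z) (snd z)) \<in> borel_measurable (M \<Otimes>\<^sub>M count_space (UNIV :: nat set))"
    by (rule measurable_compose_countable[where g = snd]) measurable
  then show ?thesis by (simp add: case_prod_beta)
qed

lemma sigma_finite_count_nat: "sigma_finite_measure (count_space (UNIV :: nat set))"
  by (rule sigma_finite_measure_count_space)

text \<open>The countable triangle inequality is Minkowski's integral inequality for the counting
  measure, which treats all \<open>s\<close> at once.\<close>

lemma Lnorm_series_bound:
  fixes g :: "nat \<Rightarrow> real^'n::finite \<Rightarrow> real"
  assumes s: "1 \<le> s" and g: "\<And>i. g i \<in> borel_measurable borel"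
    and A: "\<And>i. 0 \<le> A i" "summable A" and gA: "\<And>i. Lnorm s (g i) \<le> ennreal (A i)"
    and F: "\<And>x. x \<in> sphere 0 1 \<Longrightarrow> ennreal \<bar>F x\<bar> \<le> (\<Sum>i. ennreal \<bar>g i x\<bar>)"
  shows "Lnorm s F \<le> ennreal (suminf A)"
proof (rule ennreal_le_epsilon)
  fix e :: real assume e: "e > 0"
  \<comment> \<open>Strictly positive majorants: where \<open>A i = 0\<close> and \<open>s\<close>
    is finite, \<open>g i\<close> need only vanish almost everywhere, whereas
    \<open>Lnorm_minkowski\<close> asks for pointwise vanishing. The added terms sum to
    \<open>e\<close>.\<close>
  define B where "B i = A i + e * (1 / 2) ^ Suc i" for i
  have B: "B i > 0" "A i \<le> B i" for i using A(1)[of i] e by (auto simp: B_def add_nonneg_pos)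
  have "(\<lambda>i. A i + e * (1 / 2) ^ Suc i) sums (suminf A + e * 1)"
    by (intro sums_add summable_sums A sums_mult power_half_series)
  then have Bs: "B sums (suminf A + e)" by (simp add: B_def[abs_def])
  have "Lnorm s F \<le> ennreal (suminf A + e)"
  proof (rule Lnorm_minkowski[where N = "count_space UNIV" and A = B and G = "\<lambda>x i. \<bar>g i x\<bar>", OF s sigma_finite_count_nat])
    show "(\<lambda>(x, w). \<bar>g w x\<bar>) \<in> borel_measurable (borel \<Otimes>\<^sub>M count_space UNIV)"
      using g by (intro measurable_pair_count_space_nat borel_measurable_abs)
    show "Lnorm s (\<lambda>x. \<bar>g w x\<bar>) \<le> ennreal (B w)" for w
      unfolding Lnorm_abs by (rule order_trans[OF gA ennreal_leI[OF B(2)]])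
    show "(\<integral>\<^sup>+w. ennreal (B w) \<partial>count_space UNIV) \<le> ennreal (suminf A + e)"
      unfolding nn_integral_count_space_nat
      by (rule eq_refl, rule suminf_ennreal_eq[OF _ Bs]) (rule less_imp_le[OF B(1)])
    show "0 < suminf A + e" using e A by (intro add_nonneg_pos suminf_nonneg) auto
    show "ennreal \<bar>F x\<bar> \<le> (\<integral>\<^sup>+w. ennreal \<bar>g w x\<bar> \<partial>count_space UNIV)" if "x \<in> sphere 0 1" for x
      unfolding nn_integral_count_space_nat by (rule F[OF that])
    show "0 \<le> B w" for w using B(1)[of w] by simp
    show "\<bar>g w x\<bar> = 0" if "B w = 0" for w x using B(1)[of w] that by simp
  qed simp_all
  then show "Lnorm s F \<le> ennreal (suminf A) + ennreal e"
    using e A by (simp add: ennreal_plus suminf_nonneg)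
qed

lemma Lnorm_diff_bound:
  fixes F G :: "real^'n::finite \<Rightarrow> real"
  assumes s: "1 \<le> s" and m: "F \<in> borel_measurable borel" "G \<in> borel_measurable borel"
    and ab: "0 \<le> a" "0 \<le> b" and F: "Lnorm s F \<le> ennreal a" and G: "Lnorm s G \<le> ennreal b"
  shows "Lnorm s (\<lambda>x. F x - G x) \<le> ennreal (a + b)"
proof -
  define g where "g i = (if i = 0 then F else if i = 1 then G else (\<lambda>x. 0))" for i :: nat
  define A where "A i = (if i = 0 then a else if i = 1 then b else 0)" for i :: nat
  have fin: "{..<2} = {0, 1::nat}" by auto
  have A: "A sums (a + b)"
    using sums_finite[of "{..<2}" A] by (auto simp: A_def fin)
  have "Lnorm s (\<lambda>x. F x - G x) \<le> ennreal (suminf A)"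
  proof (rule Lnorm_series_bound[OF s])
    have z: "Lnorm s (\<lambda>x::real^'n. 0) \<le> ennreal 0" by (rule Lnorm_bounded[OF s]) auto
    show "Lnorm s (g i) \<le> ennreal (A i)" for i
      using z F G by (auto simp: g_def A_def)
    show "g i \<in> borel_measurable borel" for i using m by (auto simp: g_def)
    fix x :: "real^'n"
    have "(\<Sum>i. ennreal \<bar>g i x\<bar>) = (\<Sum>i<2. ennreal \<bar>g i x\<bar>)"
      by (rule suminf_finite) (auto simp: g_def)
    also have "\<dots> = ennreal (\<bar>F x\<bar> + \<bar>G x\<bar>)" by (simp add: fin g_def ennreal_plus)
    finally have eq: "(\<Sum>i. ennreal \<bar>g i x\<bar>) = ennreal (\<bar>F x\<bar> + \<bar>G x\<bar>)" .
    show "ennreal \<bar>F x - G x\<bar> \<le> (\<Sum>i. ennreal \<bar>g i x\<bar>)" unfolding eq by (rule ennreal_leI) simp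
  qed (use A ab in \<open>auto simp: A_def sums_iff\<close>)
  then show ?thesis using A by (simp add: sums_iff)
qed

text \<open>Dependent choice of finite prefixes. By \<open>local\<close>, \<open>P i\<close> looks
  only at the entries up to \<open>i\<close>, so a sign chosen at stage \<open>i\<close> is never
  invalidated by later ones, and the diagonal of the prefixes satisfies every
  \<open>P i\<close>.\<close>

lemma sign_sequence_exists:
  fixes P :: "nat \<Rightarrow> (nat \<Rightarrow> real) \<Rightarrow> bool"
  assumes step: "\<And>i e. \<exists>\<sigma>\<in>{1, -1}. P i (e(i := \<sigma>))"
    and local: "\<And>i e e'. (\<And>l. l \<le> i \<Longrightarrow> e l = e' l) \<Longrightarrow> P i e \<Longrightarrow> P i e'"
  obtains e where "\<And>i. e i \<in> {1, -1}" "\<And>i. P i e"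
proof -
  have "\<exists>f. \<forall>n. (\<forall>i<n. f n i \<in> {1, -1} \<and> P i (f n)) \<and> (\<forall>l<n. f (Suc n) l = f n l)"
  proof (rule dependent_nat_choice)
    fix e :: "nat \<Rightarrow> real" and n assume e: "\<forall>i<n. e i \<in> {1, -1} \<and> P i e"
    obtain \<sigma> where \<sigma>: "\<sigma> \<in> {1, -1}" "P n (e(n := \<sigma>))" using step by blast
    have "\<forall>i<Suc n. (e(n := \<sigma>)) i \<in> {1, -1} \<and> P i (e(n := \<sigma>))"
    proof (intro allI impI)
      fix i assume "i < Suc n"
      show "(e(n := \<sigma>)) i \<in> {1, -1} \<and> P i (e(n := \<sigma>))"
      proof (cases "i = n")
        case False
        then have "i < n" using \<open>i < Suc n\<close> by simp
        have "P i (e(n := \<sigma>))"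
        proof (rule local[of i e])
          show "P i e" using e \<open>i < n\<close> by blast
        qed (use \<open>i < n\<close> in simp)
        then show ?thesis using e \<open>i < n\<close> by simp
      qed (use \<sigma> in simp)
    qed
    then show "\<exists>y. (\<forall>i<Suc n. y i \<in> {1, -1} \<and> P i y) \<and> (\<forall>l<n. y l = e l)"
      by (intro exI[of _ "e(n := \<sigma>)"]) simp
  qed simp
  then obtain f where ff: "\<forall>n. (\<forall>i<n. f n i \<in> {1, -1} \<and> P i (f n)) \<and> (\<forall>l<n. f (Suc n) l = f n l)"
    by (rule exE)
  have f: "f n i \<in> {1, -1} \<and> P i (f n)" "f (Suc n) i = f n i" if "i < n" for n i
    using ff that by simp_all
  define e where "e i = f (Suc i) i" for i
  have e: "f n l = e l" if "l < n" for n l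
    using that
  proof (induction n)
    case (Suc n)
    then show ?case using f(2)[of l n] by (cases "l = n") (auto simp: e_def)
  qed simp
  show ?thesis
  proof (rule that[of e])
    show "e i \<in> {1, -1}" for i using f(1)[of i "Suc i"] by (simp add: e_def)
    show "P i e" for i
    proof (rule local[of i "f (Suc i)"])
      show "f (Suc i) l = e l" if "l \<le> i" for l using that by (intro e) simp
      show "P i (f (Suc i))" using f(1)[of i "Suc i"] by simp
    qed
  qed
qed

text \<open>With ratio \<open>1 / 3\<close> the coefficients after the \<open>i\<close>-th add up to
  half of it; ratio \<open>1 / 2\<close> would make them equal to it and leave no margin for the
  hump.\<close>

lemma third_tail: "(\<lambda>l. (1 / 3 :: real) ^ (i + 1 + l)) sums ((1 / 3) ^ i / 2)"
proof -
  have "(\<lambda>l. (1 / 3 :: real) ^ (i + 1) * (1 / 3) ^ l) sums ((1 / 3) ^ (i + 1) * (1 / (1 - 1 / 3)))"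
    by (intro sums_mult geometric_sums) simp
  then show ?thesis by (simp add: power_add mult_ac)
qed

text \<open>A gliding hump argument replacing the closed graph theorem: if the norms of a pointwise bounded doubly
  indexed family were unbounded after weighting, a signed series with coefficients \<open>3^(-i)\<close> would have unbounded
  weighted norms. Following Sokal's proof of the uniform boundedness theorem, the \<open>i\<close>-th summand nearly attains the
  supremum for the \<open>i\<close>-th norm, and its sign is chosen so that it is not cancelled by the earlier summands.\<close>

lemma gliding_hump:
  fixes u :: "'i \<Rightarrow> 'w \<Rightarrow> real^'n::finite \<Rightarrow> real"
  assumes s: "1 \<le> s" and um: "\<And>R w. u R w \<in> borel_measurable borel"
    and Q: "\<And>R w x. R \<in> I \<Longrightarrow> w \<in> \<Omega> \<Longrightarrow> x \<in> sphere 0 1 \<Longrightarrow> \<bar>u R w x\<bar> \<le> Q R"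
    and \<Omega>: "\<Omega> \<noteq> {}" and \<tau>: "\<And>R. R \<in> I \<Longrightarrow> \<tau> R > 0"
    and bounded: "\<And>w e. (\<And>i. w i \<in> \<Omega>) \<Longrightarrow> (\<And>i. e i \<in> {1, -1}) \<Longrightarrow>
       \<exists>B. \<forall>R\<in>I. Lnorm s (\<lambda>x. \<Sum>i. e i * (1 / 3) ^ i * u R (w i) x) \<le> ennreal (B / \<tau> R)"
  obtains B where "B \<ge> 0" "\<And>R w. R \<in> I \<Longrightarrow> w \<in> \<Omega> \<Longrightarrow> Lnorm s (u R w) \<le> ennreal (B / \<tau> R)"
proof -
  have Q0: "Q R \<ge> 0" if "R \<in> I" for R
  proof -
    obtain w where "w \<in> \<Omega>" using \<Omega> by blast
    from Q[OF that this, of "axis undefined 1"] show ?thesis by simp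
  qed
  define v where "v R w = enn2real (Lnorm s (u R w))" for R w
  have LQ: "Lnorm s (u R w) \<le> ennreal (Q R)" if "R \<in> I" "w \<in> \<Omega>" for R w
    by (rule Lnorm_bounded[OF s Q0[OF that(1)] Q[OF that]])
  have v: "Lnorm s (u R w) = ennreal (v R w)" if "R \<in> I" "w \<in> \<Omega>" for R w
    using le_less_trans[OF LQ[OF that], of top] by (simp add: v_def)
  have v0: "v R w \<ge> 0" for R w by (simp add: v_def)
  have vQ: "v R w \<le> Q R" if "R \<in> I" "w \<in> \<Omega>" for R w
    using LQ[OF that] v[OF that] Q0[OF that(1)] by simp
  define \<Theta> where "\<Theta> R = (SUP w\<in>\<Omega>. v R w)" for R
  have bdd: "bdd_above (v R ` \<Omega>)" if "R \<in> I" for R using vQ[OF that] by (intro bdd_aboveI2)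
  have v\<Theta>: "v R w \<le> \<Theta> R" if "R \<in> I" "w \<in> \<Omega>" for R w
    unfolding \<Theta>_def by (rule cSUP_upper[OF that(2) bdd[OF that(1)]])
  have main: "\<exists>B\<ge>0. \<forall>R\<in>I. \<tau> R * \<Theta> R \<le> B"
  proof (rule ccontr)
    assume "\<not> ?thesis"
    \<comment> \<open>The factor \<open>3 ^ i\<close> undoes the coefficient of the
      \<open>i\<close>-th summand, and the factor \<open>i\<close> makes the surviving lower bound
      grow without limit.\<close>
    then have "\<exists>R\<in>I. \<tau> R * \<Theta> R > real i * 3 ^ i" for i :: nat
      by (meson mult_nonneg_nonneg not_le of_nat_0_le_iff zero_le_numeral zero_le_power)
    then obtain R where R: "\<And>i. R i \<in> I" "\<And>i. \<tau> (R i) * \<Theta> (R i) > real i * 3 ^ i" by metis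
    have \<Theta>pos: "\<Theta> (R i) > 0" for i
    proof -
      have "0 \<le> real i * 3 ^ i" by simp
      then have "0 < \<tau> (R i) * \<Theta> (R i)" using R(2)[of i] by linarith
      then show ?thesis using \<tau>[OF R(1)[of i]] by (simp add: zero_less_mult_iff)
    qed
    \<comment> \<open>The supremum need not be attained. Any fraction strictly between
      \<open>1 / 2\<close>, the relative size of the tail of coefficients, and 1 would do.\<close>
    have "\<exists>w\<in>\<Omega>. 9 / 10 * \<Theta> (R i) < v (R i) w" for i
    proof -
      have "9 / 10 * \<Theta> (R i) < (SUP w\<in>\<Omega>. v (R i) w)" using \<Theta>pos[of i] by (simp add: \<Theta>_def[symmetric])
      then show ?thesis using less_cSUP_iff[OF \<Omega> bdd[OF R(1)]] by blast
    qed
    then obtain w where w: "\<And>i. w i \<in> \<Omega>" "\<And>i. 9 / 10 * \<Theta> (R i) < v (R i) (w i)" by metis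
    define \<phi> where "\<phi> i l = u (R i) (w l)" for i l
    have \<phi>m [measurable]: "\<phi> i l \<in> borel_measurable borel" for i l unfolding \<phi>_def by (rule um)
    have \<phi>Q: "\<bar>\<phi> i l x\<bar> \<le> Q (R i)" if "x \<in> sphere 0 1" for i l x
      unfolding \<phi>_def by (rule Q[OF R(1) w(1) that])
    define \<delta> where "\<delta> i = (1 / 3 :: real) ^ i" for i :: nat
    have \<delta>: "\<delta> i > 0" for i by (simp add: \<delta>_def)
    define P where "P i e \<longleftrightarrow> Lnorm s (\<lambda>x. \<Sum>l\<le>i. e l * \<delta> l * \<phi> i l x) \<ge> ennreal (\<delta> i * (9 / 10 * \<Theta> (R i)))" for i and e :: "nat \<Rightarrow> real"
    obtain e where e: "\<And>i. e i \<in> {1, -1}" "\<And>i. P i e"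
    proof (rule sign_sequence_exists[of P])
      show "P i e'" if "\<And>l. l \<le> i \<Longrightarrow> e l = e' l" "P i e" for i e e'
      proof -
        have "(\<Sum>l\<le>i. e l * \<delta> l * \<phi> i l x) = (\<Sum>l\<le>i. e' l * \<delta> l * \<phi> i l x)" for x
          using that(1) by (intro sum.cong) auto
        then show ?thesis using that(2) by (simp add: P_def)
      qed
      fix i and e :: "nat \<Rightarrow> real"
      define h where "h x = (\<Sum>l<i. e l * \<delta> l * \<phi> i l x)" for x
      have hm [measurable]: "h \<in> borel_measurable borel" unfolding h_def by measurable
      have up: "(\<Sum>l\<le>i. (e(i := \<sigma>)) l * \<delta> l * \<phi> i l x) = h x + \<sigma> * \<delta> i * \<phi> i i x" for \<sigma> x
        by (simp add: h_def lessThan_Suc_atMost[symmetric])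
      \<comment> \<open>The \<open>i\<close>-th summand is half the difference of the two signed
        sums, so if both had norm at most \<open>?a\<close>, so would the summand, against the
        choice of \<open>w i\<close>.\<close>
      show "\<exists>\<sigma>\<in>{1, -1}. P i (e(i := \<sigma>))"
      proof (rule ccontr)
        let ?a = "\<delta> i * (9 / 10 * \<Theta> (R i))"
        have a: "?a \<ge> 0" using \<delta>[of i] \<Theta>pos[of i] by simp
        assume "\<not> ?thesis"
        then have "Lnorm s (\<lambda>x. h x + \<delta> i * \<phi> i i x) \<le> ennreal ?a" "Lnorm s (\<lambda>x. h x - \<delta> i * \<phi> i i x) \<le> ennreal ?a"
          unfolding P_def up by (auto simp: not_le less_imp_le)
        then have "Lnorm s (\<lambda>x. (h x + \<delta> i * \<phi> i i x) - (h x - \<delta> i * \<phi> i i x)) \<le> ennreal (?a + ?a)"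
          by (intro Lnorm_diff_bound[OF s _ _ a a]) measurable
        then have "Lnorm s (\<lambda>x. 2 * \<delta> i * \<phi> i i x) \<le> ennreal (2 * ?a)" by (simp add: mult.assoc)
        then have "Lnorm s (\<lambda>x. (1 / (2 * \<delta> i)) * (2 * \<delta> i * \<phi> i i x)) \<le> ennreal (\<bar>1 / (2 * \<delta> i)\<bar> * (2 * ?a))"
          using a by (intro Lnorm_cmult[OF s]) auto
        then have "Lnorm s (\<phi> i i) \<le> ennreal (9 / 10 * \<Theta> (R i))" using \<delta>[of i] by simp
        then have "v (R i) (w i) \<le> 9 / 10 * \<Theta> (R i)"
          unfolding \<phi>_def v[OF R(1) w(1)] using \<Theta>pos[of i] by simp
        then show False using w(2)[of i] by simp
      qed
    qed (rule that)
    obtain B where B: "\<And>r. r \<in> I \<Longrightarrow> Lnorm s (\<lambda>x. \<Sum>i. e i * (1 / 3) ^ i * u r (w i) x) \<le> ennreal (B / \<tau> r)"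
      using bounded[of w e, OF w(1) e(1)] by blast
    define C where "C = max B 0"
    have "real i * (4 / 10) \<le> C" for i
    proof -
      define F where "F x = (\<Sum>l. e l * \<delta> l * \<phi> i l x)" for x
      have Fm [measurable]: "F \<in> borel_measurable borel" unfolding F_def by measurable
      have ab: "\<bar>e l\<bar> = 1" for l using e(1)[of l] by auto
      have sF: "summable (\<lambda>l. e l * \<delta> l * \<phi> i l x)" "summable (\<lambda>l. \<bar>e l * \<delta> l * \<phi> i l x\<bar>)" if "x \<in> sphere 0 1" for x
      proof -
        have S: "summable (\<lambda>l. \<delta> l * Q (R i))" unfolding \<delta>_def by (intro summable_mult2 summable_geometric) simp
        show "summable (\<lambda>l. \<bar>e l * \<delta> l * \<phi> i l x\<bar>)"
          by (rule summable_comparison_test'[OF S, of 0])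
             (use \<delta> \<phi>Q[OF that] in \<open>auto simp: abs_mult ab abs_of_pos intro!: mult_left_mono less_imp_le\<close>)
        then show "summable (\<lambda>l. e l * \<delta> l * \<phi> i l x)" by (rule summable_rabs_cancel)
      qed
      let ?t = "\<lambda>l. \<delta> (i + 1 + l)"
      \<comment> \<open>The partial sum up to \<open>i\<close> is the full series minus its tail;
        \<open>g\<close> lists the full series followed by the tail terms, and \<open>A\<close>
        their norm bounds. Comparing with \<open>P i e\<close>, the difference of
        \<open>9 / 10\<close> and \<open>1 / 2\<close> gives the factor \<open>4 / 10\<close> of the
        claim.\<close>
      define g where "g j = (case j of 0 \<Rightarrow> F | Suc l \<Rightarrow> (\<lambda>x. e (i + 1 + l) * ?t l * \<phi> i (i + 1 + l) x))" for j
      define A where "A j = (case j of 0 \<Rightarrow> C / \<tau> (R i) | Suc l \<Rightarrow> ?t l * \<Theta> (R i))" for j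
      have C0: "C / \<tau> (R i) \<ge> 0" using \<tau>[OF R(1)[of i]] by (simp add: C_def)
      have ts: "?t sums (\<delta> i / 2)" unfolding \<delta>_def by (rule third_tail)
      have "(\<lambda>l. A (Suc l)) sums (\<delta> i / 2 * \<Theta> (R i))" unfolding A_def nat.case by (rule sums_mult2[OF ts])
      then have "A sums (\<delta> i / 2 * \<Theta> (R i) + A 0)" by (rule sums_Suc)
      then have As: "A sums (\<delta> i / 2 * \<Theta> (R i) + C / \<tau> (R i))" by (simp add: A_def)
      have "Lnorm s (\<lambda>x. \<Sum>l\<le>i. e l * \<delta> l * \<phi> i l x) \<le> ennreal (suminf A)"
      proof (rule Lnorm_series_bound[OF s, of g A])
        show "g j \<in> borel_measurable borel" for j unfolding g_def by (cases j) simp_all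
        show "0 \<le> A j" for j using C0 \<delta> \<Theta>pos[of i] by (auto simp: A_def less_imp_le split: nat.split)
        show "summable A" using As by (rule sums_summable)
        show "Lnorm s (g j) \<le> ennreal (A j)" for j
        proof (cases j)
          case 0
          have "Lnorm s F \<le> ennreal (B / \<tau> (R i))" using B[OF R(1)[of i]] by (simp add: F_def[abs_def] \<delta>_def \<phi>_def)
          also have "\<dots> \<le> ennreal (C / \<tau> (R i))"
            using \<tau>[OF R(1)[of i]] by (intro ennreal_leI divide_right_mono) (auto simp: C_def)
          finally show ?thesis using 0 by (simp add: g_def A_def)
        next
          case (Suc l)
          have "Lnorm s (\<phi> i (i + 1 + l)) \<le> ennreal (\<Theta> (R i))"
            unfolding \<phi>_def v[OF R(1) w(1)] by (rule ennreal_leI[OF v\<Theta>[OF R(1) w(1)]])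
          then have "Lnorm s (\<lambda>x. (e (i + 1 + l) * ?t l) * \<phi> i (i + 1 + l) x) \<le> ennreal (\<bar>e (i + 1 + l) * ?t l\<bar> * \<Theta> (R i))"
            using \<Theta>pos[of i] by (intro Lnorm_cmult[OF s]) auto
          then show ?thesis using Suc \<delta>[of "i + 1 + l"] by (simp add: g_def A_def abs_mult ab)
        qed
        fix x :: "real^'n" assume x: "x \<in> sphere 0 1"
        have "(\<Sum>l\<le>i. e l * \<delta> l * \<phi> i l x) = F x - (\<Sum>l. e (i + 1 + l) * ?t l * \<phi> i (i + 1 + l) x)"
        proof -
          have "{..<1 + i} = {..i}" by auto
          then show ?thesis
            using suminf_split_initial_segment[OF sF(1)[OF x], of "i + 1"]
            by (simp add: F_def add.commute add.left_commute)
        qed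
        moreover have st: "summable (\<lambda>l. \<bar>e (i + 1 + l) * ?t l * \<phi> i (i + 1 + l) x\<bar>)"
          using summable_ignore_initial_segment[OF sF(2)[OF x], of "i + 1"] by (simp add: add.commute add.left_commute)
        moreover have "\<bar>\<Sum>l. e (i + 1 + l) * ?t l * \<phi> i (i + 1 + l) x\<bar> \<le> (\<Sum>l. \<bar>e (i + 1 + l) * ?t l * \<phi> i (i + 1 + l) x\<bar>)"
          by (rule summable_rabs[OF st])
        ultimately have "\<bar>\<Sum>l\<le>i. e l * \<delta> l * \<phi> i l x\<bar> \<le> (\<Sum>l. \<bar>e (i + 1 + l) * ?t l * \<phi> i (i + 1 + l) x\<bar>) + \<bar>F x\<bar>"
          by linarith
        moreover have "(\<lambda>j. \<bar>g j x\<bar>) sums ((\<Sum>l. \<bar>e (i + 1 + l) * ?t l * \<phi> i (i + 1 + l) x\<bar>) + \<bar>F x\<bar>)"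
        proof -
          have "(\<lambda>l. \<bar>g (Suc l) x\<bar>) sums (\<Sum>l. \<bar>e (i + 1 + l) * ?t l * \<phi> i (i + 1 + l) x\<bar>)"
            using summable_sums[OF st] by (simp add: g_def)
          from sums_Suc[OF this] show ?thesis by (simp add: g_def)
        qed
        ultimately show "ennreal \<bar>\<Sum>l\<le>i. e l * \<delta> l * \<phi> i l x\<bar> \<le> (\<Sum>j. ennreal \<bar>g j x\<bar>)"
          by (subst suminf_ennreal_eq) (auto intro: ennreal_leI)
      qed
      then have "ennreal (\<delta> i * (9 / 10 * \<Theta> (R i))) \<le> ennreal (\<delta> i / 2 * \<Theta> (R i) + C / \<tau> (R i))"
        using e(2)[of i] As by (simp add: P_def sums_iff)
      then have "\<delta> i * (9 / 10 * \<Theta> (R i)) \<le> \<delta> i / 2 * \<Theta> (R i) + C / \<tau> (R i)"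
        using C0 \<delta>[of i] \<Theta>pos[of i] by (subst (asm) ennreal_le_iff) (auto intro!: add_nonneg_nonneg)
      then have "4 / 10 * (\<delta> i * \<Theta> (R i)) \<le> C / \<tau> (R i)" by linarith
      then have "4 / 10 * (\<delta> i * \<Theta> (R i)) * \<tau> (R i) \<le> C"
        using \<tau>[OF R(1)[of i]] by (simp add: pos_le_divide_eq)
      moreover have "real i \<le> \<delta> i * (\<tau> (R i) * \<Theta> (R i))"
      proof -
        have "\<delta> i * (real i * 3 ^ i) \<le> \<delta> i * (\<tau> (R i) * \<Theta> (R i))"
          using R(2)[of i] \<delta>[of i] by (intro mult_left_mono) auto
        moreover have "\<delta> i * (real i * 3 ^ i) = real i" by (simp add: \<delta>_def power_one_over)
        ultimately show ?thesis by simp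
      qed
      ultimately show ?thesis by (simp add: mult_ac)
    qed
    moreover obtain i :: nat where "real i > C / (4 / 10)" using reals_Archimedean2 by blast
    ultimately show False by (metis less_divide_eq not_less zero_less_divide_iff zero_less_numeral pos_divide_less_eq)
  qed
  then obtain B where B: "B \<ge> 0" "\<And>R. R \<in> I \<Longrightarrow> \<tau> R * \<Theta> R \<le> B" by blast
  show ?thesis
  proof (rule that[OF B(1)])
    fix R w assume Rw: "R \<in> I" "w \<in> \<Omega>"
    have "\<Theta> R \<le> B / \<tau> R" using B(2)[OF Rw(1)] \<tau>[OF Rw(1)] by (simp add: pos_le_divide_eq mult.commute)
    then show "Lnorm s (u R w) \<le> ennreal (B / \<tau> R)"
      unfolding v[OF Rw] using v\<Theta>[OF Rw] by (intro ennreal_leI) simp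
  qed
qed

text \<open>This is \<open>radial_kernel_integral\<close> at \<open>R = 0\<close>, where the kernel
  factor is 1; the second exponent is set to 1 arbitrarily.\<close>

lemma radial_weight_finite:
  fixes a :: real and n :: nat
  assumes a: "a > 0"
  shows "(\<integral>\<^sup>+ r\<in>{0<..<1}. ennreal ((1 - r\<^sup>2) powr (a - 1) * r ^ n) \<partial>lborel) < \<infinity>"
proof -
  have "(\<integral>\<^sup>+ r\<in>{0<..<1}. ennreal ((1 - r\<^sup>2) powr (a - 1) * r ^ n) \<partial>lborel)
    \<le> (\<integral>\<^sup>+ r\<in>{0<..<1}. ennreal ((1 - 0\<^sup>2) powr 1 * (1 - r\<^sup>2) powr (a - 1) * (1 - 0 * r) powr (- (a + 1))) \<partial>lborel)"
    by (intro nn_integral_mono) (auto simp: indicator_def intro!: ennreal_leI mult_left_le power_le_one)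
  also have "\<dots> \<le> ennreal (2 powr (a + 1) * (1 / a + 1 / 1))"
    by (rule radial_kernel_integral) (use a in auto)
  finally show ?thesis by (rule le_less_trans) simp
qed

section \<open>Growth of multiplier coefficients\<close>

context sph
begin

lemma Bspace_of_bounded:
  assumes b: "adm b" and \<alpha>: "\<alpha> > 0" and p: "1 \<le> p" and S: "S \<ge> 0"
    and M: "\<And>r. 0 \<le> r \<Longrightarrow> r < 1 \<Longrightarrow> Mq s (hseries Y d b) r \<le> ennreal S"
  shows "hseries Y d b \<in> Bspace p s \<alpha>"
proof (cases "p = \<infinity>")
  case True
  have "(SUP r\<in>{0..<1}. Mq s (hseries Y d b) r * ennreal ((1 - r) powr \<alpha>)) \<le> ennreal S"
  proof (rule SUP_least)
    fix r :: real assume "r \<in> {0..<1}"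
    then have r: "0 \<le> r" "r < 1" by auto
    have "(1 - r) powr \<alpha> \<le> 1 powr \<alpha>" using r \<alpha> by (intro powr_mono2) auto
    then have "Mq s (hseries Y d b) r * ennreal ((1 - r) powr \<alpha>) \<le> ennreal S * ennreal 1"
      by (intro mult_mono M r ennreal_leI) auto
    then show "Mq s (hseries Y d b) r * ennreal ((1 - r) powr \<alpha>) \<le> ennreal S" by simp
  qed
  then have "(SUP r\<in>{0..<1}. Mq s (hseries Y d b) r * ennreal ((1 - r) powr \<alpha>)) < \<infinity>"
    by (rule le_less_trans) simp
  then show ?thesis using True adm_harmonic[OF b] by (simp add: Bspace_def)
next
  case False
  define e where "e = enn2real p"
  have e: "e \<ge> 1" unfolding e_def by (rule enn2real_ge_1[OF p False])
  have "(\<integral>\<^sup>+ r\<in>{0<..<1}. enn_powr (Mq s (hseries Y d b) r) e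
              * ennreal ((1 - r\<^sup>2) powr (\<alpha> * e - 1) * r ^ (CARD('n) - 1)) \<partial>lborel)
    \<le> (\<integral>\<^sup>+ r. ennreal (S powr e) * (ennreal ((1 - r\<^sup>2) powr (\<alpha> * e - 1) * r ^ (CARD('n) - 1)) * indicator {0<..<1} r) \<partial>lborel)"
  proof (rule nn_integral_mono)
    fix r :: real
    show "enn_powr (Mq s (hseries Y d b) r) e * ennreal ((1 - r\<^sup>2) powr (\<alpha> * e - 1) * r ^ (CARD('n) - 1)) * indicator {0<..<1} r
      \<le> ennreal (S powr e) * (ennreal ((1 - r\<^sup>2) powr (\<alpha> * e - 1) * r ^ (CARD('n) - 1)) * indicator {0<..<1} r)"
    proof (cases "0 < r \<and> r < 1")
      case True
      have "enn_powr (Mq s (hseries Y d b) r) e \<le> enn_powr (ennreal S) e"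
        using True e by (intro enn_powr_mono M) auto
      then have "enn_powr (Mq s (hseries Y d b) r) e \<le> ennreal (S powr e)" using S by (simp add: enn_powr_ennreal)
      then show ?thesis unfolding mult.assoc by (rule mult_right_mono) simp
    qed simp
  qed
  also have "\<dots> = ennreal (S powr e) * (\<integral>\<^sup>+ r\<in>{0<..<1}. ennreal ((1 - r\<^sup>2) powr (\<alpha> * e - 1) * r ^ (CARD('n) - 1)) \<partial>lborel)"
    by (rule nn_integral_cmult) measurable
  also have "\<dots> < \<infinity>"
    using radial_weight_finite[of "\<alpha> * e" "CARD('n) - 1"] \<alpha> e by (simp add: ennreal_mult_less_top)
  finally show ?thesis using False adm_harmonic[OF b] by (simp add: Bspace_def e_def)
qed

lemma multiplier_image:
  assumes c: "c \<in> MH Y d X Z" and b: "adm b" "hseries Y d b \<in> X"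
  shows "hseries_conv Y d (\<lambda>k j. c k j * b k j)" "hseries Y d (\<lambda>k j. c k j * b k j) \<in> Z"
  using c b(2) unfolding MH_def mem_Collect_eq hconv_hseries[OF b(1), symmetric] by blast+

text \<open>A bounded function with slowly decaying coefficients shows that a multiplier has admissible
  coefficients.\<close>

lemma MH_adm:
  assumes c: "c \<in> MH Y d (Bspace p 1 \<alpha>) (Bspace q s \<beta>)" and p: "1 \<le> p" and \<alpha>: "\<alpha> > 0"
  shows "adm c"
proof -
  \<comment> \<open>\<open>2 * CARD('n)\<close> compensates the growth in \<open>wt_le\<close>, and
    the extra 2 leaves the convergent series of \<open>1 / (real k + 1)\<^sup>2\<close>.\<close>
  define M where "M = 2 * CARD('n) + 2"
  define b where "b k j = 1 / (real k + 1) ^ M" for k j :: nat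
  have b: "adm b"
  proof (rule adm_poly[of _ 1 0])
    fix k j :: nat
    have "1 \<le> (real k + 1) ^ M" by (rule one_le_power) simp
    then show "\<bar>b k j\<bar> \<le> 1 * (real k + 1) ^ 0" by (simp add: b_def)
  qed simp
  have wb: "wt b k \<le> gC\<^sup>2 * (1 / (real k + 1)\<^sup>2)" for k
  proof -
    have "wt b k \<le> 1 / (real k + 1) ^ M * gC\<^sup>2 * (real k + 1) ^ (2 * CARD('n))"
      by (rule wt_le) (simp_all add: b_def)
    also have "\<dots> = gC\<^sup>2 * (1 / (real k + 1)\<^sup>2)"
      unfolding M_def power_add by simp
    finally show ?thesis .
  qed
  have "summable (\<lambda>k. 1 / (real (Suc k))\<^sup>2)"
    using inverse_power_summable[of 2] by (subst summable_Suc_iff) (simp add: inverse_eq_divide)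
  then have S: "summable (\<lambda>k. gC\<^sup>2 * (1 / (real k + 1)\<^sup>2))"
    by (intro summable_mult) (simp add: add.commute)
  have bound: "Mq 1 (hseries Y d b) r \<le> ennreal (\<Sum>k. gC\<^sup>2 * (1 / (real k + 1)\<^sup>2))" if r: "0 \<le> r" "r < 1" for r
    unfolding Mq_def
  proof (rule Lnorm_bounded)
    fix x :: "real^'n" assume x: "x \<in> sphere 0 1"
    have "\<bar>hseries Y d b (r *\<^sub>R x)\<bar> \<le> (\<Sum>k. wt b k * r ^ k)" by (rule hseries_bound[OF b r x])
    also have "\<dots> \<le> (\<Sum>k. gC\<^sup>2 * (1 / (real k + 1)\<^sup>2))"
    proof (rule suminf_le[OF _ adm_wt_summable0[OF b r] S])
      fix k
      have "wt b k * r ^ k \<le> wt b k * 1" using r wt_nonneg by (intro mult_left_mono power_le_one) auto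
      then show "wt b k * r ^ k \<le> gC\<^sup>2 * (1 / (real k + 1)\<^sup>2)" using wb[of k] by simp
    qed
    finally show "\<bar>hseries Y d b (r *\<^sub>R x)\<bar> \<le> (\<Sum>k. gC\<^sup>2 * (1 / (real k + 1)\<^sup>2))" .
  qed (use S in \<open>auto intro!: suminf_nonneg\<close>)
  have "hseries Y d b \<in> Bspace p 1 \<alpha>"
    by (rule Bspace_of_bounded[OF b \<alpha> p _ bound]) (use S in \<open>auto intro!: suminf_nonneg\<close>)
  from multiplier_image[OF c b this]
  have "adm (\<lambda>k j. c k j * b k j)" by (intro adm_of_harmonic) (simp_all add: Bspace_def)
  then have "adm (\<lambda>k j. (real k + 1) ^ M * (c k j * b k j))"
    by (intro adm_mult_seq[of _ 1 M]) auto
  moreover have "(real k + 1) ^ M * (c k j * b k j) = c k j" for k j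
    using power_not_zero[of "real k + 1" M] by (simp add: b_def)
  ultimately show ?thesis by simp
qed

text \<open>The pair \<open>w\<close> holds a radius \<open>R\<close> and a pole \<open>y\<close>;
  the array belongs to the order-\<open>t\<close> derivative of the Poisson kernel with pole
  \<open>y\<close>, dilated by \<open>R\<close>. The prefactor
  \<open>(1 - R) powr (t - \<alpha>)\<close> normalises it in the source space.\<close>

definition tst :: "real \<Rightarrow> real \<Rightarrow> real \<times> (real^'n) \<Rightarrow> nat \<Rightarrow> nat \<Rightarrow> real" where
  "tst \<alpha> t w k j = (1 - fst w) powr (t - \<alpha>) * (fst w ^ k * fr t k) * Y k j (snd w)"

definition tst_index :: "(real \<times> (real^'n)) set" where
  "tst_index = {0..<1} \<times> sphere 0 1"

text \<open>A majorant of the test coefficients uniform in the index \<open>w\<close>; through it,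
  sums over infinitely many test functions are controlled coefficient by coefficient.\<close>

definition dom :: "real \<Rightarrow> nat \<Rightarrow> nat \<Rightarrow> real" where
  "dom t k j = fr t k * (gC * (real k + 1) ^ CARD('n))"

lemma dom_nonneg: "t > 0 \<Longrightarrow> dom t k j \<ge> 0"
  using gC(1) fr_pos[of t k] by (simp add: dom_def)

lemma adm_dom: "t > 0 \<Longrightarrow> adm (dom t)"
  unfolding dom_def[abs_def] by (intro adm_fr adm_poly[of _ gC "CARD('n)"]) (use gC(1) in auto)

lemma tst_bound:
  assumes t: "t > \<alpha>" "\<alpha> > 0" and w: "w \<in> tst_index" and j: "j \<in> {1..d k}"
  shows "\<bar>tst \<alpha> t w k j\<bar> \<le> dom t k j"
proof -
  have w': "0 \<le> fst w" "fst w < 1" "snd w \<in> sphere 0 1" using w by (auto simp: tst_index_def)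
  have "(1 - fst w) powr (t - \<alpha>) \<le> 1 powr (t - \<alpha>)" using w' t by (intro powr_mono2) auto
  then have 1: "(1 - fst w) powr (t - \<alpha>) \<le> 1" by simp
  have 2: "fst w ^ k \<le> 1" using w' by (intro power_le_one) auto
  have "\<bar>tst \<alpha> t w k j\<bar> = ((1 - fst w) powr (t - \<alpha>) * fst w ^ k) * (fr t k * \<bar>Y k j (snd w)\<bar>)"
    using w' fr_pos[of t k] t by (simp add: tst_def abs_mult mult_ac)
  also have "\<dots> \<le> (1 * 1) * (fr t k * (gC * (real k + 1) ^ CARD('n)))"
    using 1 2 w' fr_pos[of t k] t gC(3)[OF j w'(3)] by (intro mult_mono) auto
  finally show ?thesis by (simp add: dom_def)
qed

lemma adm_dominated:
  assumes "adm b" "\<And>k j. j \<in> {1..d k} \<Longrightarrow> \<bar>a k j\<bar> \<le> B * b k j" "B \<ge> 0"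
  shows "adm a"
proof -
  have "adm (\<lambda>k j. B * b k j)" by (rule adm_mult_seq[of "\<lambda>_. B" B 0, OF _ assms(3) assms(1)]) (use assms(3) in simp)
  then show ?thesis
    unfolding adm_def
  proof (intro allI impI)
    fix R :: real assume R: "0 < R \<and> R < 1"
    assume "\<forall>R. 0 < R \<and> R < 1 \<longrightarrow> (\<exists>C. \<forall>k. \<forall>j\<in>{1..d k}. \<bar>B * b k j\<bar> * R ^ k \<le> C)"
    then obtain C where C: "\<And>k j. j \<in> {1..d k} \<Longrightarrow> \<bar>B * b k j\<bar> * R ^ k \<le> C" using R by blast
    have "\<bar>a k j\<bar> * R ^ k \<le> C" if j: "j \<in> {1..d k}" for k j
    proof -
      have "\<bar>a k j\<bar> \<le> \<bar>B * b k j\<bar>" using assms(2)[OF j] by linarith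
      then have "\<bar>a k j\<bar> * R ^ k \<le> \<bar>B * b k j\<bar> * R ^ k" using R by (intro mult_right_mono) auto
      then show ?thesis using C[OF j] by simp
    qed
    then show "\<exists>C. \<forall>k. \<forall>j\<in>{1..d k}. \<bar>a k j\<bar> * R ^ k \<le> C" by blast
  qed
qed

lemma wt_dominated:
  assumes "\<And>j. j \<in> {1..d k} \<Longrightarrow> \<bar>a k j\<bar> \<le> B * \<bar>b k j\<bar>"
  shows "wt a k \<le> B * wt b k"
proof -
  have "(\<Sum>j=1..d k. \<bar>a k j\<bar>) \<le> (\<Sum>j=1..d k. B * \<bar>b k j\<bar>)" by (intro sum_mono assms) auto
  then have "(\<Sum>j=1..d k. \<bar>a k j\<bar>) * (gC * (real k + 1) ^ CARD('n)) \<le> (\<Sum>j=1..d k. B * \<bar>b k j\<bar>) * (gC * (real k + 1) ^ CARD('n))"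
    using gC(1) by (intro mult_right_mono) auto
  then show ?thesis by (simp add: wt_def sum_distrib_left[symmetric] mult.assoc)
qed

lemma tst_adm: "t > \<alpha> \<Longrightarrow> \<alpha> > 0 \<Longrightarrow> w \<in> tst_index \<Longrightarrow> adm (tst \<alpha> t w)"
  by (rule adm_dominated[OF adm_dom, of t _ 1]) (auto intro: tst_bound)

text \<open>Sum over \<open>i\<close> and expansion in \<open>k\<close> are interchanged. Finite
  partial sums are handled by linearity (\<open>head\<close>); the remainder is dominated by the
  tail of \<open>e\<close> times the common majorant \<open>W\<close> (\<open>close\<close>). The
  multiplier \<open>c\<close> is carried along, and \<open>c\<close> constantly 1 gives the
  statement for the functions themselves.\<close>

lemma superposition:
  fixes T :: "nat \<Rightarrow> nat \<Rightarrow> nat \<Rightarrow> real"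
  assumes e: "summable (\<lambda>i. \<bar>e i\<bar>)" and W: "adm W" "\<And>k j. W k j \<ge> 0"
    and T: "\<And>i k j. j \<in> {1..d k} \<Longrightarrow> \<bar>T i k j\<bar> \<le> W k j" and c: "adm c"
    and \<rho>: "0 \<le> \<rho>" "\<rho> < 1" and x: "x \<in> sphere 0 1"
  shows "adm (\<lambda>k j. \<Sum>i. e i * T i k j)"
    and "(\<lambda>i. e i * hseries Y d (\<lambda>k j. c k j * T i k j) (\<rho> *\<^sub>R x)) sums
       hseries Y d (\<lambda>k j. c k j * (\<Sum>i. e i * T i k j)) (\<rho> *\<^sub>R x)"
proof -
  define b where "b k j = (\<Sum>i. e i * T i k j)" for k j
  define tail where "tail I = (\<Sum>i. \<bar>e (i + I)\<bar>)" for I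
  have sT: "summable (\<lambda>i. \<bar>e i * T i k j\<bar>)" if j: "j \<in> {1..d k}" for k j
    by (rule summable_comparison_test'[OF summable_mult2[OF e, of "W k j"], of 0])
       (use T[OF j] in \<open>auto simp: abs_mult intro!: mult_left_mono\<close>)
  have bT: "\<bar>b k j - (\<Sum>i<I. e i * T i k j)\<bar> \<le> tail I * W k j" if j: "j \<in> {1..d k}" for k j I
  proof -
    have "b k j - (\<Sum>i<I. e i * T i k j) = (\<Sum>i. e (i + I) * T (i + I) k j)"
      unfolding b_def using suminf_split_initial_segment[OF summable_rabs_cancel[OF sT[OF j]], of I] by simp
    also have "\<bar>\<dots>\<bar> \<le> (\<Sum>i. \<bar>e (i + I)\<bar> * W k j)"
      unfolding real_norm_def[symmetric]
    proof (rule norm_suminf_le)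
      show "norm (e (i + I) * T (i + I) k j) \<le> norm (e (i + I)) * W k j" for i
        using T[OF j] by (simp add: abs_mult mult_left_mono)
      show "summable (\<lambda>i. norm (e (i + I)) * W k j)"
        using e by (intro summable_mult2) (simp add: summable_iff_shift[of "\<lambda>i. \<bar>e i\<bar>"])
    qed
    also have "\<dots> = tail I * W k j"
      unfolding tail_def using e by (intro suminf_mult2[symmetric]) (simp add: summable_iff_shift[of "\<lambda>i. \<bar>e i\<bar>"])
    finally show ?thesis .
  qed
  have tail0: "tail I \<ge> 0" for I
    unfolding tail_def using e by (intro suminf_nonneg) (simp_all add: summable_iff_shift[of "\<lambda>i. \<bar>e i\<bar>"])
  have ab: "adm b"
    by (rule adm_dominated[OF W(1), of _ "tail 0"]) (use bT[of _ _ 0] tail0 in auto)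
  then show "adm (\<lambda>k j. \<Sum>i. e i * T i k j)" by (simp add: b_def[abs_def])
  have aT: "adm (T i)" for i by (rule adm_dominated[OF W(1), of _ 1]) (use T in auto)
  have aP: "adm (\<lambda>k j. \<Sum>i<I. e i * T i k j)" for I
  proof (rule adm_dominated[OF W(1), of _ "\<Sum>i<I. \<bar>e i\<bar>"])
    show "\<bar>\<Sum>i<I. e i * T i k j\<bar> \<le> (\<Sum>i<I. \<bar>e i\<bar>) * W k j" if "j \<in> {1..d k}" for k j
      unfolding sum_distrib_right using T[OF that]
      by (intro order_trans[OF sum_abs] sum_mono) (auto simp: abs_mult intro!: mult_left_mono)
  qed (simp add: sum_nonneg)
  have \<rho>x: "norm (\<rho> *\<^sub>R x) < 1" using \<rho> x by simp
  have head: "hseries Y d (\<lambda>k j. c k j * (\<Sum>i<I. e i * T i k j)) (\<rho> *\<^sub>R x)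
     = (\<Sum>i<I. e i * hseries Y d (\<lambda>k j. c k j * T i k j) (\<rho> *\<^sub>R x))" for I
  proof (induction I)
    case 0
    then show ?case by (simp add: hseries_eq hcomp_def)
  next
    case (Suc I)
    have 1: "adm (\<lambda>k j. e I * (c k j * T I k j))"
      by (rule adm_mult_seq[of "\<lambda>_. e I" "\<bar>e I\<bar>" 0]) (auto intro: adm_mult c aT)
    have "hseries Y d (\<lambda>k j. c k j * (\<Sum>i<Suc I. e i * T i k j)) (\<rho> *\<^sub>R x)
       = hseries Y d (\<lambda>k j. c k j * (\<Sum>i<I. e i * T i k j) + e I * (c k j * T I k j)) (\<rho> *\<^sub>R x)"
      by (simp add: distrib_left mult_ac)
    also have "\<dots> = hseries Y d (\<lambda>k j. c k j * (\<Sum>i<I. e i * T i k j)) (\<rho> *\<^sub>R x) + hseries Y d (\<lambda>k j. e I * (c k j * T I k j)) (\<rho> *\<^sub>R x)"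
      by (rule hseries_add[OF adm_mult[OF c aP] 1 \<rho>x])
    also have "hseries Y d (\<lambda>k j. e I * (c k j * T I k j)) (\<rho> *\<^sub>R x) = e I * hseries Y d (\<lambda>k j. c k j * T I k j) (\<rho> *\<^sub>R x)"
      by (rule hseries_cmult[OF adm_mult[OF c aT] \<rho>x])
    finally show ?case by (simp add: Suc.IH)
  qed
  \<comment> \<open>\<open>K\<close> is the majorant at radius \<rho> of any array dominated by the
    product of \<open>c\<close> and \<open>W\<close>. It does not depend on \<open>I\<close>, so
    \<open>tail I * K\<close> tends to 0.\<close>
  define K where "K = (\<Sum>k. wt (\<lambda>k j. c k j * W k j) k * \<rho> ^ k)"
  have cW: "adm (\<lambda>k j. c k j * W k j)" by (rule adm_mult[OF c W(1)])
  have close: "\<bar>hseries Y d (\<lambda>k j. c k j * (\<Sum>i<I. e i * T i k j)) (\<rho> *\<^sub>R x) - hseries Y d (\<lambda>k j. c k j * b k j) (\<rho> *\<^sub>R x)\<bar> \<le> tail I * K" for I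
  proof -
    let ?D = "\<lambda>k j. c k j * (\<Sum>i<I. e i * T i k j) + (-1) * (c k j * b k j)"
    have neg: "adm (\<lambda>k j. (-1) * (c k j * b k j))"
      by (rule adm_mult_seq[of "\<lambda>_. -1" 1 0, OF _ _ adm_mult[OF c ab]]) auto
    have D: "adm ?D"
    proof (rule adm_dominated[of "\<lambda>k j. \<bar>c k j\<bar> * W k j" _ "tail I"])
      show "adm (\<lambda>k j. \<bar>c k j\<bar> * W k j)" using cW W(2) by (simp add: adm_def abs_mult)
      show "\<bar>?D k j\<bar> \<le> tail I * (\<bar>c k j\<bar> * W k j)" if "j \<in> {1..d k}" for k j
      proof -
        have "?D k j = - (c k j * (b k j - (\<Sum>i<I. e i * T i k j)))" by (simp add: algebra_simps)
        then have "\<bar>?D k j\<bar> = \<bar>c k j\<bar> * \<bar>b k j - (\<Sum>i<I. e i * T i k j)\<bar>" by (simp add: abs_mult)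
        also have "\<dots> \<le> \<bar>c k j\<bar> * (tail I * W k j)" by (intro mult_left_mono bT that) simp
        finally show ?thesis by (simp add: mult_ac)
      qed
    qed (rule tail0)
    have "hseries Y d ?D (\<rho> *\<^sub>R x) = hseries Y d (\<lambda>k j. c k j * (\<Sum>i<I. e i * T i k j)) (\<rho> *\<^sub>R x) + hseries Y d (\<lambda>k j. (-1) * (c k j * b k j)) (\<rho> *\<^sub>R x)"
      by (rule hseries_add[OF adm_mult[OF c aP] neg \<rho>x])
    also have "hseries Y d (\<lambda>k j. (-1) * (c k j * b k j)) (\<rho> *\<^sub>R x) = (-1) * hseries Y d (\<lambda>k j. c k j * b k j) (\<rho> *\<^sub>R x)"
      by (rule hseries_cmult[OF adm_mult[OF c ab] \<rho>x])
    finally have eq: "hseries Y d (\<lambda>k j. c k j * (\<Sum>i<I. e i * T i k j)) (\<rho> *\<^sub>R x) - hseries Y d (\<lambda>k j. c k j * b k j) (\<rho> *\<^sub>R x) = hseries Y d ?D (\<rho> *\<^sub>R x)"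
      by simp
    have "\<bar>hseries Y d ?D (\<rho> *\<^sub>R x)\<bar> \<le> (\<Sum>k. wt ?D k * \<rho> ^ k)" by (rule hseries_bound[OF D \<rho> x])
    also have "\<dots> \<le> (\<Sum>k. tail I * (wt (\<lambda>k j. c k j * W k j) k * \<rho> ^ k))"
    proof (rule suminf_le[OF _ adm_wt_summable0[OF D \<rho>] summable_mult[OF adm_wt_summable0[OF cW \<rho>]]])
      fix k
      have "wt ?D k \<le> tail I * wt (\<lambda>k j. c k j * W k j) k"
      proof (rule wt_dominated)
        fix j assume j: "j \<in> {1..d k}"
        have "?D k j = - (c k j * (b k j - (\<Sum>i<I. e i * T i k j)))" by (simp add: algebra_simps)
        then have "\<bar>?D k j\<bar> = \<bar>c k j\<bar> * \<bar>b k j - (\<Sum>i<I. e i * T i k j)\<bar>" by (simp add: abs_mult)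
        also have "\<dots> \<le> \<bar>c k j\<bar> * (tail I * W k j)" by (intro mult_left_mono bT j) simp
        finally show "\<bar>?D k j\<bar> \<le> tail I * \<bar>c k j * W k j\<bar>" using W(2) by (simp add: abs_mult mult_ac)
      qed
      then have "wt ?D k * \<rho> ^ k \<le> (tail I * wt (\<lambda>k j. c k j * W k j) k) * \<rho> ^ k"
        using \<rho> by (intro mult_right_mono) auto
      then show "wt ?D k * \<rho> ^ k \<le> tail I * (wt (\<lambda>k j. c k j * W k j) k * \<rho> ^ k)" by (simp only: mult.assoc)
    qed
    also have "\<dots> = tail I * K" unfolding K_def by (rule suminf_mult[OF adm_wt_summable0[OF cW \<rho>]])
    finally show ?thesis unfolding eq .
  qed
  have "tail \<longlonglongrightarrow> 0" unfolding tail_def using suminf_exist_split2[OF e] by simp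
  then have "(\<lambda>I. tail I * K) \<longlonglongrightarrow> 0" by (rule tendsto_mult_left_zero)
  then have "(\<lambda>I. hseries Y d (\<lambda>k j. c k j * (\<Sum>i<I. e i * T i k j)) (\<rho> *\<^sub>R x) - hseries Y d (\<lambda>k j. c k j * b k j) (\<rho> *\<^sub>R x)) \<longlonglongrightarrow> 0"
    by (rule Lim_null_comparison[rotated]) (use close in auto)
  then have "(\<lambda>I. hseries Y d (\<lambda>k j. c k j * (\<Sum>i<I. e i * T i k j)) (\<rho> *\<^sub>R x)) \<longlonglongrightarrow> hseries Y d (\<lambda>k j. c k j * b k j) (\<rho> *\<^sub>R x)"
    by (simp add: LIM_zero_iff)
  then show "(\<lambda>i. e i * hseries Y d (\<lambda>k j. c k j * T i k j) (\<rho> *\<^sub>R x)) sums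
       hseries Y d (\<lambda>k j. c k j * (\<Sum>i. e i * T i k j)) (\<rho> *\<^sub>R x)"
    unfolding sums_def head b_def .
qed


lemma hseries_tst:
  assumes t: "t > 0" and w: "w \<in> tst_index" and \<rho>: "0 \<le> \<rho>" "\<rho> < 1" and x: "x \<in> sphere 0 1"
  shows "hseries Y d (tst \<alpha> t w) (\<rho> *\<^sub>R x)
    = (1 - fst w) powr (t - \<alpha>) * ker (\<lambda>k. (fst w * \<rho>) ^ k * fr t k) (snd w) x"
proof -
  have w': "0 \<le> fst w" "fst w < 1" "snd w \<in> sphere 0 1" using w by (auto simp: tst_index_def)
  have r: "0 \<le> fst w * \<rho>" "fst w * \<rho> < 1" using w' \<rho> mult_strict_mono'[of "fst w" 1 \<rho> 1] by auto
  have S: "summable (\<lambda>k. (fst w * \<rho>) ^ k * fr t k * zon k (snd w) x)"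
  proof (rule summable_comparison_test'[OF fr_summable[OF t r], of 0])
    show "norm ((fst w * \<rho>) ^ k * fr t k * zon k (snd w) x) \<le> \<bar>(fst w * \<rho>) ^ k * fr t k\<bar> * (gC ^ 3 * (real k + 1) ^ (3 * CARD('n)))" for k
      unfolding real_norm_def abs_mult[of _ "zon k (snd w) x"] by (intro mult_left_mono zon_bound w' x) simp
  qed
  have "hcomp (tst \<alpha> t w) k (\<rho> *\<^sub>R x) = (1 - fst w) powr (t - \<alpha>) * ((fst w * \<rho>) ^ k * fr t k * zon k (snd w) x)" for k
  proof -
    have "hcomp (tst \<alpha> t w) k x = ((1 - fst w) powr (t - \<alpha>) * (fst w ^ k * fr t k)) * zon k (snd w) x"
      unfolding tst_def[abs_def] zon_eq_hcomp by (rule hcomp_mult)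
    then show ?thesis by (simp add: hcomp_scale power_mult_distrib mult_ac)
  qed
  then show ?thesis
    unfolding hseries_eq ker_def by (simp add: suminf_mult[OF S])
qed

text \<open>The radius \<open>fst w * \<rho>\<close> is shared by the index and the evaluation
  point, and the pole of the test function becomes the last argument of \<open>Lam\<close>. Norms in
  \<open>x\<close> of the images of test functions are thus those occurring in
  \<open>Nnorm\<close>.\<close>

lemma hseries_mult_tst:
  assumes c: "adm c" and t: "t > 0" and w: "w \<in> tst_index" and \<rho>: "0 \<le> \<rho>" "\<rho> < 1" and x: "x \<in> sphere 0 1"
  shows "hseries Y d (\<lambda>k j. c k j * tst \<alpha> t w k j) (\<rho> *\<^sub>R x)
    = (1 - fst w) powr (t - \<alpha>) * Lam Y d c t x (fst w * \<rho>) (snd w)"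
proof -
  have w': "0 \<le> fst w" "fst w < 1" "snd w \<in> sphere 0 1" using w by (auto simp: tst_index_def)
  have r: "0 \<le> fst w * \<rho>" "fst w * \<rho> < 1" using w' \<rho> mult_strict_mono'[of "fst w" 1 \<rho> 1] by auto
  let ?a = "\<lambda>k j. fr t k * (c k j * Y k j x)"
  have "norm ((fst w * \<rho>) *\<^sub>R snd w) < 1" using r w' by simp
  then have S: "summable (\<lambda>k. hcomp ?a k ((fst w * \<rho>) *\<^sub>R snd w))"
    by (rule summable_rabs_cancel[OF adm_hcomp_summable[OF Lam_adm[OF c t x]]])
  have "hcomp (\<lambda>k j. c k j * tst \<alpha> t w k j) k (\<rho> *\<^sub>R x) = (1 - fst w) powr (t - \<alpha>) * hcomp ?a k ((fst w * \<rho>) *\<^sub>R snd w)" for k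
    unfolding hcomp_scale by (simp add: hcomp_def tst_def power_mult_distrib sum_distrib_left mult_ac)
  then show ?thesis
    unfolding Lam_eq_hseries hseries_eq by (simp add: suminf_mult[OF S])
qed

lemma tst_Mq_bound:
  assumes t: "t > 0" and n2: "CARD('n) \<ge> 2"
  obtains C where "C > 0" "\<And>\<alpha> w \<rho>. w \<in> tst_index \<Longrightarrow> 0 \<le> \<rho> \<Longrightarrow> \<rho> < 1 \<Longrightarrow>
    Mq 1 (hseries Y d (tst \<alpha> t w)) \<rho> \<le> ennreal (C * ((1 - fst w) powr (t - \<alpha>) * (1 - fst w * \<rho>) powr (- t)))"
proof -
  obtain C where C: "C > 0" "\<And>r x. 0 \<le> r \<Longrightarrow> r < 1 \<Longrightarrow> x \<in> sphere 0 1 \<Longrightarrow>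
    (\<integral>\<^sup>+y. ennreal \<bar>ker (\<lambda>k. r ^ k * fr t k) x y\<bar> \<partial>sphere_measure) \<le> ennreal (C * (1 - r) powr (- t))"
    by (rule fr_kernel_L1[OF t n2]) (rule that)
  have "Mq 1 (hseries Y d (tst \<alpha> t w)) \<rho> \<le> ennreal (C * ((1 - fst w) powr (t - \<alpha>) * (1 - fst w * \<rho>) powr (- t)))"
    if w: "w \<in> tst_index" and \<rho>: "0 \<le> \<rho>" "\<rho> < 1" for \<alpha> w \<rho>
  proof -
    have w': "0 \<le> fst w" "fst w < 1" "snd w \<in> sphere 0 1" using w by (auto simp: tst_index_def)
    have r: "0 \<le> fst w * \<rho>" "fst w * \<rho> < 1" using w' \<rho> mult_strict_mono'[of "fst w" 1 \<rho> 1] by auto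
    let ?A = "(1 - fst w) powr (t - \<alpha>)"
    let ?m = "\<lambda>k. (fst w * \<rho>) ^ k * fr t k"
    have "Lnorm 1 (\<lambda>x. ker ?m (snd w) x) \<le> ennreal (C * (1 - fst w * \<rho>) powr (- t))"
      unfolding Lnorm_1 by (rule C(2)[OF r w'(3)])
    then have "Lnorm 1 (\<lambda>x. ?A * ker ?m (snd w) x) \<le> ennreal (\<bar>?A\<bar> * (C * (1 - fst w * \<rho>) powr (- t)))"
      using C(1) by (intro Lnorm_cmult ker_measurable) auto
    moreover have "Mq 1 (hseries Y d (tst \<alpha> t w)) \<rho> = Lnorm 1 (\<lambda>x. ?A * ker ?m (snd w) x)"
      unfolding Mq_def by (rule Lnorm_cong[OF hseries_tst[OF t w \<rho>]])
    ultimately show ?thesis by (simp add: mult_ac)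
  qed
  then show ?thesis using that C(1) by blast
qed

text \<open>A signed series of test functions has to be placed in the source space itself. For
  \<open>p = \<infinity>\<close> the growth bounds \<open>Ub\<close> are summed; for finite
  \<open>p\<close> Minkowski's inequality, with counting measure as the second measure, adds up
  uniform bounds on the single norms.\<close>

lemma tst_superposition_Bspace:
  assumes t: "t > \<alpha>" and \<alpha>: "\<alpha> > 0" and p: "1 \<le> p" and n2: "CARD('n) \<ge> 2"
    and w: "\<And>i. w i \<in> tst_index" and e: "\<And>i. \<bar>e i\<bar> = (1 / 3) ^ i"
  shows "hseries Y d (\<lambda>k j. \<Sum>i. e i * tst \<alpha> t (w i) k j) \<in> Bspace p 1 \<alpha>" "adm (\<lambda>k j. \<Sum>i. e i * tst \<alpha> t (w i) k j)"
proof -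
  let ?b = "\<lambda>k j. \<Sum>i. e i * tst \<alpha> t (w i) k j"
  have t0: "t > 0" using t \<alpha> by simp
  have es: "summable (\<lambda>i. \<bar>e i\<bar>)" unfolding e by (intro summable_geometric) simp
  have pos: "(1 / 3 :: real) ^ i > 0" for i by simp
  have one: "adm (\<lambda>k j. 1)" by (rule adm_poly[of _ 1 0]) auto
  have T: "\<bar>tst \<alpha> t (w i) k j\<bar> \<le> dom t k j" if "j \<in> {1..d k}" for i k j
    by (rule tst_bound[OF t \<alpha> w that])
  have sup: "adm ?b" "\<And>\<rho> x. 0 \<le> \<rho> \<Longrightarrow> \<rho> < 1 \<Longrightarrow> x \<in> sphere 0 1 \<Longrightarrow>
     (\<lambda>i. e i * hseries Y d (tst \<alpha> t (w i)) (\<rho> *\<^sub>R x)) sums hseries Y d ?b (\<rho> *\<^sub>R x)"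
  proof -
    have "(axis undefined 1 :: real^'n) \<in> sphere 0 1" by simp
    from superposition(1)[OF es adm_dom[OF t0] dom_nonneg[OF t0] T one _ _ this, of 0] show "adm ?b" by simp
    fix \<rho> :: real and x :: "real^'n" assume "0 \<le> \<rho>" "\<rho> < 1" "x \<in> sphere 0 1"
    from superposition(2)[OF es adm_dom[OF t0] dom_nonneg[OF t0] T one this]
    show "(\<lambda>i. e i * hseries Y d (tst \<alpha> t (w i)) (\<rho> *\<^sub>R x)) sums hseries Y d ?b (\<rho> *\<^sub>R x)" by simp
  qed
  show adm: "adm ?b" by (rule sup(1))
  obtain C where C: "C > 0" "\<And>\<alpha> w \<rho>. w \<in> tst_index \<Longrightarrow> 0 \<le> \<rho> \<Longrightarrow> \<rho> < 1 \<Longrightarrow>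
    Mq 1 (hseries Y d (tst \<alpha> t w)) \<rho> \<le> ennreal (C * ((1 - fst w) powr (t - \<alpha>) * (1 - fst w * \<rho>) powr (- t)))"
    by (rule tst_Mq_bound[OF t0 n2]) (rule that)
  have R: "0 \<le> fst (w i)" "fst (w i) < 1" for i using w[of i] by (auto simp: tst_index_def)
  have R\<rho>: "fst (w i) * \<rho> \<le> fst (w i)" "fst (w i) * \<rho> \<le> \<rho>" if "0 \<le> \<rho>" "\<rho> < 1" for i \<rho>
    using R[of i] that by (auto simp: mult_left_le mult_left_le_one_le)
  define U where "U i \<rho> = C * ((1 - fst (w i)) powr (t - \<alpha>) * (1 - fst (w i) * \<rho>) powr (- t))" for i \<rho>
  have U0: "U i \<rho> \<ge> 0" for i \<rho> using C(1) by (simp add: U_def)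
  have Ub: "U i \<rho> \<le> C * (1 - \<rho>) powr (- \<alpha>)" if \<rho>: "0 \<le> \<rho>" "\<rho> < 1" for i \<rho>
  proof -
    have q: "1 - fst (w i) * \<rho> > 0" using R\<rho>[OF \<rho>, of i] \<rho> by simp
    have "(1 - fst (w i)) powr (t - \<alpha>) * (1 - fst (w i) * \<rho>) powr (- t)
      \<le> (1 - fst (w i) * \<rho>) powr (t - \<alpha>) * (1 - fst (w i) * \<rho>) powr (- t)"
      using R\<rho>[OF \<rho>, of i] R[of i] t by (intro mult_right_mono powr_mono2) auto
    also have "\<dots> = (1 - fst (w i) * \<rho>) powr (- \<alpha>)" by (simp add: powr_add[symmetric])
    also have "\<dots> \<le> (1 - \<rho>) powr (- \<alpha>)" using R\<rho>[OF \<rho>, of i] \<rho> \<alpha> by (intro powr_mono2') auto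
    finally show ?thesis using C(1) by (simp add: U_def mult_left_mono)
  qed
  have sU: "summable (\<lambda>i. \<bar>e i\<bar> * U i \<rho>)" if \<rho>: "0 \<le> \<rho>" "\<rho> < 1" for \<rho>
    by (rule summable_comparison_test'[OF summable_mult2[OF es, of "C * (1 - \<rho>) powr (- \<alpha>)"], of 0])
       (use U0 Ub[OF \<rho>] in \<open>auto simp: abs_mult intro!: mult_left_mono\<close>)
  have Mb: "Mq 1 (hseries Y d ?b) \<rho> \<le> ennreal (\<Sum>i. \<bar>e i\<bar> * U i \<rho>)" if \<rho>: "0 \<le> \<rho>" "\<rho> < 1" for \<rho>
    unfolding Mq_def
  proof (rule Lnorm_series_bound[OF order_refl, where g = "\<lambda>i x. e i * hseries Y d (tst \<alpha> t (w i)) (\<rho> *\<^sub>R x)"])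
    show "(\<lambda>x. e i * hseries Y d (tst \<alpha> t (w i)) (\<rho> *\<^sub>R x)) \<in> borel_measurable borel" for i by measurable
    show "0 \<le> \<bar>e i\<bar> * U i \<rho>" for i using U0 by simp
    show "summable (\<lambda>i. \<bar>e i\<bar> * U i \<rho>)" by (rule sU[OF \<rho>])
    show "Lnorm 1 (\<lambda>x. e i * hseries Y d (tst \<alpha> t (w i)) (\<rho> *\<^sub>R x)) \<le> ennreal (\<bar>e i\<bar> * U i \<rho>)" for i
    proof (rule Lnorm_cmult[OF order_refl U0])
      show "Lnorm 1 (\<lambda>x. hseries Y d (tst \<alpha> t (w i)) (\<rho> *\<^sub>R x)) \<le> ennreal (U i \<rho>)"
        using C(2)[OF w \<rho>, of \<alpha> i] unfolding Mq_def U_def .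
    qed measurable
    fix x :: "real^'n" assume x: "x \<in> sphere 0 1"
    note S = sup(2)[OF \<rho> x]
    have as: "summable (\<lambda>i. \<bar>e i * hseries Y d (tst \<alpha> t (w i)) (\<rho> *\<^sub>R x)\<bar>)"
    proof (rule summable_comparison_test'[OF summable_mult2[OF es, of "\<Sum>k. wt (dom t) k * \<rho> ^ k"], of 0])
      fix i
      have a: "adm (tst \<alpha> t (w i))" by (rule tst_adm[OF t \<alpha> w])
      have "\<bar>hseries Y d (tst \<alpha> t (w i)) (\<rho> *\<^sub>R x)\<bar> \<le> (\<Sum>k. wt (tst \<alpha> t (w i)) k * \<rho> ^ k)"
        by (rule hseries_bound[OF a \<rho> x])
      also have "\<dots> \<le> (\<Sum>k. wt (dom t) k * \<rho> ^ k)"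
      proof (rule suminf_le[OF _ adm_wt_summable0[OF a \<rho>] adm_wt_summable0[OF adm_dom[OF t0] \<rho>]])
        fix k
        have "wt (tst \<alpha> t (w i)) k \<le> 1 * wt (dom t) k"
          using T[of _ k i] dom_nonneg[OF t0] by (intro wt_dominated) simp
        then show "wt (tst \<alpha> t (w i)) k * \<rho> ^ k \<le> wt (dom t) k * \<rho> ^ k" using \<rho> by (simp add: mult_right_mono)
      qed
      finally show "norm \<bar>e i * hseries Y d (tst \<alpha> t (w i)) (\<rho> *\<^sub>R x)\<bar> \<le> \<bar>e i\<bar> * (\<Sum>k. wt (dom t) k * \<rho> ^ k)"
        by (simp add: abs_mult mult_left_mono)
    qed
    have "\<bar>hseries Y d ?b (\<rho> *\<^sub>R x)\<bar> \<le> (\<Sum>i. \<bar>e i * hseries Y d (tst \<alpha> t (w i)) (\<rho> *\<^sub>R x)\<bar>)"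
      unfolding sums_unique[OF S] by (rule summable_rabs[OF as])
    then show "ennreal \<bar>hseries Y d ?b (\<rho> *\<^sub>R x)\<bar> \<le> (\<Sum>i. ennreal \<bar>e i * hseries Y d (tst \<alpha> t (w i)) (\<rho> *\<^sub>R x)\<bar>)"
      by (subst suminf_ennreal_eq[OF _ summable_sums[OF as]]) (auto intro: ennreal_leI)
  qed
  show "hseries Y d ?b \<in> Bspace p 1 \<alpha>"
  proof (cases "p = \<infinity>")
    case True
    let ?S = "(\<Sum>i. \<bar>e i\<bar>) * C"
    have S0: "?S \<ge> 0" using C(1) es by (intro mult_nonneg_nonneg suminf_nonneg) auto
    have "(SUP r\<in>{0..<1}. Mq 1 (hseries Y d ?b) r * ennreal ((1 - r) powr \<alpha>)) \<le> ennreal ?S"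
    proof (rule SUP_least)
      fix r :: real assume "r \<in> {0..<1}"
      then have r: "0 \<le> r" "r < 1" by auto
      have "(\<Sum>i. \<bar>e i\<bar> * U i r) \<le> (\<Sum>i. \<bar>e i\<bar> * (C * (1 - r) powr (- \<alpha>)))"
        by (intro suminf_le sU[OF r] summable_mult2[OF es] mult_left_mono Ub[OF r]) simp
      also have "\<dots> = ?S * (1 - r) powr (- \<alpha>)" by (simp add: suminf_mult2[OF es, symmetric])
      finally have le: "(\<Sum>i. \<bar>e i\<bar> * U i r) \<le> ?S * (1 - r) powr (- \<alpha>)" .
      have "Mq 1 (hseries Y d ?b) r * ennreal ((1 - r) powr \<alpha>) \<le> ennreal (?S * (1 - r) powr (- \<alpha>)) * ennreal ((1 - r) powr \<alpha>)"
        by (rule mult_right_mono[OF order_trans[OF Mb[OF r] ennreal_leI[OF le]]]) simp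
      also have "\<dots> = ennreal (?S * (1 - r) powr (- \<alpha>) * (1 - r) powr \<alpha>)"
        using S0 by (intro ennreal_mult[symmetric]) auto
      also have "?S * (1 - r) powr (- \<alpha>) * (1 - r) powr \<alpha> = ?S"
        using r by (simp add: mult.assoc powr_add[symmetric])
      finally show "Mq 1 (hseries Y d ?b) r * ennreal ((1 - r) powr \<alpha>) \<le> ennreal ?S" .
    qed
    then have "(SUP r\<in>{0..<1}. Mq 1 (hseries Y d ?b) r * ennreal ((1 - r) powr \<alpha>)) < \<infinity>"
      by (rule le_less_trans) simp
    then show ?thesis using True adm_harmonic[OF adm] by (simp add: Bspace_def)
  next
    case False
    define h where "h = enn2real p"
    have h: "h \<ge> 1" unfolding h_def by (rule enn2real_ge_1[OF p False])
    let ?N = "CARD('n)"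
    define wgt where "wgt \<rho> = indicator {0<..<1} \<rho> * ((1 - \<rho>\<^sup>2) powr (\<alpha> * h - 1) * \<rho> ^ (?N - 1))" for \<rho> :: real
    have wgtm [measurable]: "wgt \<in> borel_measurable borel" unfolding wgt_def[abs_def] by measurable
    have wgt0: "wgt \<rho> \<ge> 0" for \<rho> by (simp add: wgt_def indicator_def)
    define M where "M = density lborel (\<lambda>\<rho>. ennreal (wgt \<rho>))"
    have setsM [simp, measurable_cong]: "sets M = sets borel" by (simp add: M_def)
    have sfM: "sigma_finite_measure M"
      unfolding M_def by (subst sigma_finite_measure.sigma_finite_iff_density_finite[OF sigma_finite_lborel]) auto
    have intM: "(\<integral>\<^sup>+\<rho>. f \<rho> \<partial>M) = (\<integral>\<^sup>+\<rho>. ennreal (wgt \<rho>) * f \<rho> \<partial>lborel)" if "f \<in> borel_measurable borel" for f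
      unfolding M_def by (rule nn_integral_density) (use that in auto)
    \<comment> \<open>Raised to the power \<open>h\<close>, the bound \<open>U\<close> has the
      factors \<open>(1 - ?R) powr g\<close> and \<open>(1 - ?R * \<rho>) powr (- (a + g))\<close>
      with \<open>?R\<close> the radius of the index; together with the weight exponent
      \<open>a - 1\<close> they give the integrand of \<open>radial_kernel_integral\<close>, whose
      bound does not depend on \<open>?R\<close>.\<close>
    define a where "a = \<alpha> * h"
    define g where "g = (t - \<alpha>) * h"
    have ag: "a > 0" "g > 0" "a + g = t * h" using \<alpha> t h by (auto simp: a_def g_def algebra_simps)
    define K where "K = C powr h * (2 powr (a + g) * (1 / a + 1 / g))"
    have K0: "K > 0" unfolding K_def using C(1) ag by (intro mult_pos_pos add_pos_pos) auto
    have Um [measurable]: "U i \<in> borel_measurable borel" for i unfolding U_def[abs_def] by measurable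
    have UK: "(\<integral>\<^sup>+\<rho>. ennreal (U i \<rho> powr h) \<partial>M) \<le> ennreal K" for i
    proof -
      let ?R = "fst (w i)"
      have "(\<integral>\<^sup>+\<rho>. ennreal (U i \<rho> powr h) \<partial>M) = (\<integral>\<^sup>+\<rho>. ennreal (wgt \<rho>) * ennreal (U i \<rho> powr h) \<partial>lborel)"
        by (rule intM) measurable
      also have "\<dots> \<le> (\<integral>\<^sup>+\<rho>. ennreal (C powr h) * (ennreal ((1 - ?R\<^sup>2) powr g * (1 - \<rho>\<^sup>2) powr (a - 1) * (1 - ?R * \<rho>) powr (- (a + g))) * indicator {0<..<1} \<rho>) \<partial>lborel)"
      proof (rule nn_integral_mono)
        fix \<rho> :: real
        show "ennreal (wgt \<rho>) * ennreal (U i \<rho> powr h) \<le> ennreal (C powr h) * (ennreal ((1 - ?R\<^sup>2) powr g * (1 - \<rho>\<^sup>2) powr (a - 1) * (1 - ?R * \<rho>) powr (- (a + g))) * indicator {0<..<1} \<rho>)"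
        proof (cases "0 < \<rho> \<and> \<rho> < 1")
          case True
          have Ue: "U i \<rho> powr h = C powr h * ((1 - ?R) powr g * (1 - ?R * \<rho>) powr (- (a + g)))"
            unfolding U_def ag(3) using C(1) by (simp add: powr_mult powr_powr g_def)
          have "?R\<^sup>2 \<le> ?R * 1" unfolding power2_eq_square using R[of i] by (intro mult_left_mono) auto
          then have 1: "(1 - ?R) powr g \<le> (1 - ?R\<^sup>2) powr g" using R[of i] ag by (intro powr_mono2) auto
          have 2: "wgt \<rho> \<le> (1 - \<rho>\<^sup>2) powr (a - 1)"
            unfolding wgt_def a_def using True by (simp add: mult_left_le power_le_one)
          have "wgt \<rho> * U i \<rho> powr h \<le> (1 - \<rho>\<^sup>2) powr (a - 1) * (C powr h * ((1 - ?R\<^sup>2) powr g * (1 - ?R * \<rho>) powr (- (a + g))))"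
            unfolding Ue using 1 2 wgt0 by (intro mult_mono mult_left_mono mult_right_mono) auto
          also have "\<dots> = C powr h * ((1 - ?R\<^sup>2) powr g * (1 - \<rho>\<^sup>2) powr (a - 1) * (1 - ?R * \<rho>) powr (- (a + g)))"
            by (simp only: mult_ac)
          finally show ?thesis using True wgt0 by (simp add: ennreal_mult[symmetric] ennreal_leI)
        qed (simp add: wgt_def)
      qed
      also have "\<dots> = ennreal (C powr h) * (\<integral>\<^sup>+\<rho>\<in>{0<..<1}. ennreal ((1 - ?R\<^sup>2) powr g * (1 - \<rho>\<^sup>2) powr (a - 1) * (1 - ?R * \<rho>) powr (- (a + g))) \<partial>lborel)"
        by (rule nn_integral_cmult) measurable
      also have "\<dots> \<le> ennreal (C powr h) * ennreal (2 powr (a + g) * (1 / a + 1 / g))"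
        by (intro mult_left_mono radial_kernel_integral ag R) simp
      also have "\<dots> = ennreal K" unfolding K_def using ag by (intro ennreal_mult[symmetric]) auto
      finally show ?thesis .
    qed
    define E where "E = K powr (1 / h)"
    have E0: "E > 0" using K0 by (simp add: E_def)
    have Eh: "E powr h = K" unfolding E_def using K0 h by (simp add: powr_powr)
    let ?T = "(\<Sum>i. \<bar>e i\<bar>) * E"
    have As: "(\<lambda>i. \<bar>e i\<bar> * E) sums ?T" by (intro sums_mult2 summable_sums es)
    have T0: "?T > 0"
      using E0 pos by (intro mult_pos_pos suminf_pos es) (simp_all add: e)
    have mink: "(\<integral>\<^sup>+\<rho>. enn_powr (\<integral>\<^sup>+i. ennreal (\<bar>e i\<bar> * U i \<rho>) \<partial>count_space UNIV) h \<partial>M) \<le> ennreal (?T powr h)"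
    proof (rule minkowski_integral[OF sfM sigma_finite_count_nat, where A = "\<lambda>i. \<bar>e i\<bar> * E"])
      show "(\<lambda>(\<rho>, i). \<bar>e i\<bar> * U i \<rho>) \<in> borel_measurable (M \<Otimes>\<^sub>M count_space UNIV)"
        by (intro measurable_pair_count_space_nat) measurable
      show "0 \<le> \<bar>e i\<bar> * U i \<rho>" for \<rho> i using U0 by simp
      show "0 \<le> \<bar>e i\<bar> * E" for i using E0 by simp
      show "\<bar>e i\<bar> * U i \<rho> = 0" if "\<bar>e i\<bar> * E = 0" for \<rho> i using that E0 by simp
      show "(\<integral>\<^sup>+\<rho>. ennreal ((\<bar>e i\<bar> * U i \<rho>) powr h) \<partial>M) \<le> ennreal ((\<bar>e i\<bar> * E) powr h)" for i
      proof -
        have "(\<integral>\<^sup>+\<rho>. ennreal ((\<bar>e i\<bar> * U i \<rho>) powr h) \<partial>M) = (\<integral>\<^sup>+\<rho>. ennreal (\<bar>e i\<bar> powr h) * ennreal (U i \<rho> powr h) \<partial>M)"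
          using U0 by (simp add: powr_mult ennreal_mult)
        also have "\<dots> = ennreal (\<bar>e i\<bar> powr h) * (\<integral>\<^sup>+\<rho>. ennreal (U i \<rho> powr h) \<partial>M)"
          by (rule nn_integral_cmult) measurable
        also have "\<dots> \<le> ennreal (\<bar>e i\<bar> powr h) * ennreal K" by (intro mult_left_mono UK) simp
        also have "\<dots> = ennreal ((\<bar>e i\<bar> * E) powr h)" using E0 K0 by (simp add: powr_mult Eh ennreal_mult)
        finally show ?thesis .
      qed
      show "(\<integral>\<^sup>+i. ennreal (\<bar>e i\<bar> * E) \<partial>count_space UNIV) \<le> ennreal ?T"
        unfolding nn_integral_count_space_nat
        by (rule eq_refl, rule suminf_ennreal_eq[OF _ As]) (use E0 in simp)
    qed (use T0 h in auto)
    define V where "V \<rho> = enn_powr (\<integral>\<^sup>+i. ennreal (\<bar>e i\<bar> * U i \<rho>) \<partial>count_space UNIV) h" for \<rho>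
    have Vm: "V \<in> borel_measurable borel"
    proof -
      have "(\<lambda>\<rho>. \<integral>\<^sup>+i. ennreal (\<bar>e i\<bar> * U i \<rho>) \<partial>count_space UNIV) \<in> borel_measurable borel"
        unfolding nn_integral_count_space_nat by measurable
      moreover have "(\<lambda>x. enn_powr x h) \<in> borel_measurable borel" unfolding enn_powr_def by measurable
      ultimately show ?thesis unfolding V_def[abs_def] by (rule measurable_compose)
    qed
    have "(\<integral>\<^sup>+ r\<in>{0<..<1}. enn_powr (Mq 1 (hseries Y d ?b) r) h
              * ennreal ((1 - r\<^sup>2) powr (\<alpha> * h - 1) * r ^ (?N - 1)) \<partial>lborel)
       \<le> (\<integral>\<^sup>+\<rho>. ennreal (wgt \<rho>) * V \<rho> \<partial>lborel)"
    proof (rule nn_integral_mono)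
      fix r :: real
      show "enn_powr (Mq 1 (hseries Y d ?b) r) h * ennreal ((1 - r\<^sup>2) powr (\<alpha> * h - 1) * r ^ (?N - 1)) * indicator {0<..<1} r
         \<le> ennreal (wgt r) * V r"
      proof (cases "0 < r \<and> r < 1")
        case True
        then have r: "0 \<le> r" "r < 1" by auto
        have "(\<integral>\<^sup>+i. ennreal (\<bar>e i\<bar> * U i r) \<partial>count_space UNIV) = ennreal (\<Sum>i. \<bar>e i\<bar> * U i r)"
          unfolding nn_integral_count_space_nat
          by (rule suminf_ennreal_eq[OF _ summable_sums[OF sU[OF r]]]) (use U0 in simp)
        then have "enn_powr (Mq 1 (hseries Y d ?b) r) h \<le> V r"
          unfolding V_def using Mb[OF r] h by (intro enn_powr_mono) auto
        then have "ennreal (wgt r) * enn_powr (Mq 1 (hseries Y d ?b) r) h \<le> ennreal (wgt r) * V r"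
          by (rule mult_left_mono) simp
        then show ?thesis using True by (simp add: wgt_def mult.commute)
      qed simp
    qed
    also have "\<dots> = (\<integral>\<^sup>+\<rho>. V \<rho> \<partial>M)" by (rule intM[OF Vm, symmetric])
    also have "\<dots> \<le> ennreal (?T powr h)" unfolding V_def by (rule mink)
    finally have "(\<integral>\<^sup>+ r\<in>{0<..<1}. enn_powr (Mq 1 (hseries Y d ?b) r) h
              * ennreal ((1 - r\<^sup>2) powr (\<alpha> * h - 1) * r ^ (?N - 1)) \<partial>lborel) < \<infinity>"
      by (rule le_less_trans) simp
    then show ?thesis using False adm_harmonic[OF adm] by (simp add: Bspace_def h_def)
  qed
qed

text \<open>\<open>gliding_hump\<close> is applied to the images of the test functions with weight
  \<open>(1 - R) powr \<beta>\<close>. Its boundedness hypothesis concerns one superposition at a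
  time, and there membership of the image in the target space gives a growth bound of order
  \<beta>.\<close>

theorem necessary:
  assumes c: "c \<in> MH Y d (Bspace p 1 \<alpha>) (Bspace q s \<beta>)" and t: "t > \<alpha>" and \<alpha>: "\<alpha> > 0" and \<beta>: "\<beta> > 0"
    and s: "1 \<le> s" and p: "1 \<le> p" and q: "1 \<le> q" and n2: "CARD('n) \<ge> 2"
  obtains A where "A \<ge> 0" "\<And>\<rho> y. 0 \<le> \<rho> \<Longrightarrow> \<rho> < 1 \<Longrightarrow> y \<in> sphere 0 1 \<Longrightarrow>
      Lnorm s (\<lambda>x. Lam Y d c t x \<rho> y) \<le> ennreal (A * (1 - \<rho>) powr (- (\<beta> - \<alpha> + t)))"
proof -
  have t0: "t > 0" using t \<alpha> by simp
  have ac: "adm c" by (rule MH_adm[OF c p \<alpha>])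
  define u where "u R w x = hseries Y d (\<lambda>k j. c k j * tst \<alpha> t w k j) (R *\<^sub>R x)" for R w x
  define Q where "Q R = (\<Sum>k. wt (\<lambda>k j. c k j * dom t k j) k * R ^ k)" for R
  have cd: "adm (\<lambda>k j. c k j * dom t k j)" by (rule adm_mult[OF ac adm_dom[OF t0]])
  obtain B where B: "B \<ge> 0" "\<And>R w. R \<in> {0..<1} \<Longrightarrow> w \<in> tst_index \<Longrightarrow> Lnorm s (u R w) \<le> ennreal (B / (1 - R) powr \<beta>)"
  proof (rule gliding_hump[OF s, where u = u and I = "{0..<1}" and \<Omega> = tst_index and Q = Q and \<tau> = "\<lambda>R. (1 - R) powr \<beta>"])
    show "u R w \<in> borel_measurable borel" for R w unfolding u_def[abs_def] by measurable
    show "tst_index \<noteq> {}" unfolding tst_index_def by (auto intro!: exI[of _ "axis undefined 1"])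
    show "0 < (1 - R) powr \<beta>" if "R \<in> {0..<1}" for R using that by simp
    show "\<bar>u R w x\<bar> \<le> Q R" if R: "R \<in> {0..<1}" and w: "w \<in> tst_index" and x: "x \<in> sphere 0 1" for R w x
    proof -
      have R': "0 \<le> R" "R < 1" using R by auto
      have a: "adm (\<lambda>k j. c k j * tst \<alpha> t w k j)" by (rule adm_mult[OF ac tst_adm[OF t \<alpha> w]])
      have "\<bar>u R w x\<bar> \<le> (\<Sum>k. wt (\<lambda>k j. c k j * tst \<alpha> t w k j) k * R ^ k)"
        unfolding u_def by (rule hseries_bound[OF a R' x])
      also have "\<dots> \<le> Q R"
        unfolding Q_def
      proof (rule suminf_le[OF _ adm_wt_summable0[OF a R'] adm_wt_summable0[OF cd R']])
        fix k
        have "wt (\<lambda>k j. c k j * tst \<alpha> t w k j) k \<le> 1 * wt (\<lambda>k j. c k j * dom t k j) k"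
        proof (rule wt_dominated)
          fix j assume "j \<in> {1..d k}"
          then have "\<bar>tst \<alpha> t w k j\<bar> \<le> \<bar>dom t k j\<bar>" using tst_bound[OF t \<alpha> w] dom_nonneg[OF t0, of k j] by simp
          then show "\<bar>c k j * tst \<alpha> t w k j\<bar> \<le> 1 * \<bar>c k j * dom t k j\<bar>" by (simp add: abs_mult mult_left_mono)
        qed
        then show "wt (\<lambda>k j. c k j * tst \<alpha> t w k j) k * R ^ k \<le> wt (\<lambda>k j. c k j * dom t k j) k * R ^ k"
          using R' by (simp add: mult_right_mono)
      qed
      finally show ?thesis .
    qed
    fix w :: "nat \<Rightarrow> real \<times> (real^'n)" and e :: "nat \<Rightarrow> real" assume w: "\<And>i. w i \<in> tst_index" and e: "\<And>i. e i \<in> {1, -1}"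
    define e' where "e' i = e i * (1 / 3) ^ i" for i
    have e': "\<bar>e' i\<bar> = (1 / 3) ^ i" for i using e[of i] by (auto simp: e'_def abs_mult)
    have es: "summable (\<lambda>i. \<bar>e' i\<bar>)" unfolding e' by (intro summable_geometric) simp
    let ?b = "\<lambda>k j. \<Sum>i. e' i * tst \<alpha> t (w i) k j"
    note B = tst_superposition_Bspace[OF t \<alpha> p n2 w e']
    have Z: "hseries Y d (\<lambda>k j. c k j * ?b k j) \<in> Bspace q s \<beta>"
      by (rule multiplier_image(2)[OF c B(2) B(1)])
    obtain D where D: "D \<ge> 0" "\<And>r. 0 \<le> r \<Longrightarrow> r < 1 \<Longrightarrow> Mq s (hseries Y d (\<lambda>k j. c k j * ?b k j)) r \<le> ennreal (D * (1 - r) powr (- \<beta>))"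
      by (rule Bspace_sup_bound[OF adm_mult[OF ac B(2)] s q \<beta> Z]) (rule that)
    have "Lnorm s (\<lambda>x. \<Sum>i. e i * (1 / 3) ^ i * u R (w i) x) \<le> ennreal (D / (1 - R) powr \<beta>)" if "R \<in> {0..<1}" for R
    proof -
      have R: "0 \<le> R" "R < 1" using that by auto
      have "Mq s (hseries Y d (\<lambda>k j. c k j * ?b k j)) R = Lnorm s (\<lambda>x. \<Sum>i. e i * (1 / 3) ^ i * u R (w i) x)"
        unfolding Mq_def
      proof (rule Lnorm_cong)
        fix x :: "real^'n" assume x: "x \<in> sphere 0 1"
        have "(\<lambda>i. e' i * hseries Y d (\<lambda>k j. c k j * tst \<alpha> t (w i) k j) (R *\<^sub>R x)) sums
           hseries Y d (\<lambda>k j. c k j * ?b k j) (R *\<^sub>R x)"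
          by (rule superposition(2)[OF es adm_dom[OF t0] dom_nonneg[OF t0] tst_bound[OF t \<alpha> w] ac R x])
        from sums_unique[OF this]
        show "hseries Y d (\<lambda>k j. c k j * ?b k j) (R *\<^sub>R x) = (\<Sum>i. e i * (1 / 3) ^ i * u R (w i) x)"
          by (simp add: u_def e'_def)
      qed
      moreover have "D * (1 - R) powr (- \<beta>) = D / (1 - R) powr \<beta>"
        by (simp only: powr_minus divide_inverse)
      ultimately show ?thesis using D(2)[OF R] by (simp only:)
    qed
    then show "\<exists>B. \<forall>R\<in>{0..<1}. Lnorm s (\<lambda>x. \<Sum>i. e i * (1 / 3) ^ i * u R (w i) x) \<le> ennreal (B / (1 - R) powr \<beta>)"
      by (intro exI[of _ D] ballI)
  qed (rule that)
  let ?e = "\<beta> - \<alpha> + t"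
  have e0: "?e > 0" using t \<beta> by simp
  have "Lnorm s (\<lambda>x. Lam Y d c t x \<rho> y) \<le> ennreal (B * 2 powr ?e * (1 - \<rho>) powr (- ?e))"
    if \<rho>: "0 \<le> \<rho>" "\<rho> < 1" and y: "y \<in> sphere 0 1" for \<rho> y
  proof -
    \<comment> \<open>The radius is split evenly between the test function and the sphere on which
      its image is evaluated, so that the kernel appears at \<open>R * R = \<rho>\<close>.
      Normalisation and growth bound cost \<open>t - \<alpha>\<close> and \<beta> powers of
      \<open>1 - R\<close>, which add up to \<open>?e\<close>.\<close>
    define R where "R = sqrt \<rho>"
    have R: "0 \<le> R" "R < 1" "R * R = \<rho>" using \<rho> by (auto simp: R_def)
    have w: "(R, y) \<in> tst_index" using R y by (simp add: tst_index_def)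
    have Rp: "(1 - R) powr (t - \<alpha>) > 0" "(1 - R) powr \<beta> > 0" using R by auto
    have "Lnorm s (\<lambda>x. Lam Y d c t x \<rho> y) = Lnorm s (\<lambda>x. (1 - R) powr (- (t - \<alpha>)) * u R (R, y) x)"
    proof (rule Lnorm_cong)
      fix x :: "real^'n" assume x: "x \<in> sphere 0 1"
      have "u R (R, y) x = (1 - R) powr (t - \<alpha>) * Lam Y d c t x \<rho> y"
        unfolding u_def using hseries_mult_tst[OF ac t0 w R(1,2) x, of \<alpha>] R(3) by simp
      then show "Lam Y d c t x \<rho> y = (1 - R) powr (- (t - \<alpha>)) * u R (R, y) x"
        using R by (simp add: mult.assoc[symmetric] powr_add[symmetric])
    qed
    also have "\<dots> \<le> ennreal (\<bar>(1 - R) powr (- (t - \<alpha>))\<bar> * (B / (1 - R) powr \<beta>))"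
      using B(1) R Rp by (intro Lnorm_cmult[OF s] B(2) w) (auto simp: u_def[abs_def])
    also have "\<bar>(1 - R) powr (- (t - \<alpha>))\<bar> * (B / (1 - R) powr \<beta>) = B * ((1 - R) powr (- (t - \<alpha>)) * (1 - R) powr (- \<beta>))"
      by (simp add: powr_minus divide_inverse)
    also have "(1 - R) powr (- (t - \<alpha>)) * (1 - R) powr (- \<beta>) = (1 - R) powr (- ?e)"
      by (simp add: powr_add[symmetric] algebra_simps)
    also have "ennreal (B * (1 - R) powr (- ?e)) \<le> ennreal (B * (2 powr ?e * (1 - \<rho>) powr (- ?e)))"
    proof (intro ennreal_leI mult_left_mono B(1))
      \<comment> \<open>Since \<open>1 - \<rho>\<close> is at most \<open>2 * (1 - R)\<close>,
        passing from \<open>1 - R\<close> back to \<open>1 - \<rho>\<close> costs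
        \<open>2 powr ?e\<close>.\<close>
      have "(1 - R) * (1 + R) \<le> (1 - R) * 2" using R by (intro mult_left_mono) auto
      moreover have "(1 - R) * (1 + R) = 1 - \<rho>" unfolding R(3)[symmetric] by (simp add: algebra_simps)
      ultimately have "(1 - \<rho>) / 2 \<le> 1 - R" by simp
      then have "(1 - R) powr (- ?e) \<le> ((1 - \<rho>) / 2) powr (- ?e)" using \<rho> e0 by (intro powr_mono2') auto
      also have "((1 - \<rho>) / 2) powr (- ?e) = 2 powr ?e * (1 - \<rho>) powr (- ?e)"
      proof -
        have "((1 - \<rho>) / 2) powr (- ?e) = (1 - \<rho>) powr (- ?e) / 2 powr (- ?e)"
          by (rule powr_divide)
        also have "\<dots> = (1 - \<rho>) powr (- ?e) * 2 powr ?e"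
          by (simp only: powr_minus[of _ "?e"] divide_inverse inverse_inverse_eq)
        finally show ?thesis by (simp only: mult.commute)
      qed
      finally show "(1 - R) powr (- ?e) \<le> 2 powr ?e * (1 - \<rho>) powr (- ?e)" .
    qed
    finally show ?thesis by (simp only: mult.assoc)
  qed
  then show ?thesis by (intro that[of "B * 2 powr ?e"]) (use B(1) in auto)
qed

end

section \<open>Equivalence of the multiplier and kernel conditions\<close>

theorem mainTheorem6:
  fixes Y :: "nat \<Rightarrow> nat \<Rightarrow> real^'n::finite \<Rightarrow> real"
    and d :: "nat \<Rightarrow> nat" and c :: "nat \<Rightarrow> nat \<Rightarrow> real"
    and p q s :: ennreal and \<alpha> \<beta> m :: real
  assumes "CARD('n) \<ge> 2"
    and "sph_basis Y d"
    and "1 \<le> p" and "p \<le> q" and "1 \<le> s"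
    and "\<alpha> > 0" and "\<beta> > 0" and "m > \<alpha> - 1"
  shows "c \<in> MH Y d (Bspace p 1 \<alpha>) (Bspace q s \<beta>) \<longleftrightarrow>
         (hseries_conv Y d c \<and> harmonic_on (ball 0 1) (hseries Y d c) \<and>
          Nnorm Y d c s \<alpha> \<beta> m < \<infinity>)"
proof -
  interpret sph Y d by unfold_locales (rule assms(2))
  define t where "t = m + 1"
  have t: "t > \<alpha>" using assms(8) by (simp add: t_def)
  have exponent: "\<beta> - \<alpha> + m + 1 = \<beta> - \<alpha> + t" by (simp add: t_def)
  show ?thesis
  proof
    assume c: "c \<in> MH Y d (Bspace p 1 \<alpha>) (Bspace q s \<beta>)"
    have ac: "adm c" by (rule MH_adm[OF c assms(3,6)])
    have q: "1 \<le> q" using assms(3,4) by (rule order_trans)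
    obtain A where A: "A \<ge> 0" "\<And>\<rho> y. 0 \<le> \<rho> \<Longrightarrow> \<rho> < 1 \<Longrightarrow> y \<in> sphere 0 1 \<Longrightarrow>
      Lnorm s (\<lambda>x. Lam Y d c t x \<rho> y) \<le> ennreal (A * (1 - \<rho>) powr (- (\<beta> - \<alpha> + t)))"
      by (rule necessary[OF c t assms(6,7,5,3) q assms(1)]) (rule that)
    have "Nnorm Y d c s \<alpha> \<beta> m \<le> ennreal A"
      unfolding Nnorm_def exponent t_def[symmetric]
    proof (intro SUP_least)
      fix \<rho> :: real and y :: "real^'n" assume "\<rho> \<in> {0..<1}" and y: "y \<in> sphere 0 1"
      then have \<rho>: "0 \<le> \<rho>" "\<rho> < 1" by auto
      have "ennreal ((1 - \<rho>) powr (\<beta> - \<alpha> + t)) * Lnorm s (\<lambda>x. Lam Y d c t x \<rho> y)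
        \<le> ennreal ((1 - \<rho>) powr (\<beta> - \<alpha> + t)) * ennreal (A * (1 - \<rho>) powr (- (\<beta> - \<alpha> + t)))"
        by (intro mult_left_mono A(2) \<rho> y) simp
      also have "\<dots> = ennreal ((1 - \<rho>) powr (\<beta> - \<alpha> + t) * (A * (1 - \<rho>) powr (- (\<beta> - \<alpha> + t))))"
        using A(1) by (intro ennreal_mult[symmetric]) auto
      also have "(1 - \<rho>) powr (\<beta> - \<alpha> + t) * (A * (1 - \<rho>) powr (- (\<beta> - \<alpha> + t)))
         = A * ((1 - \<rho>) powr (\<beta> - \<alpha> + t) * (1 - \<rho>) powr (- (\<beta> - \<alpha> + t)))" by (simp only: mult_ac)
      also have "\<dots> = A" unfolding powr_add[symmetric] using \<rho> by simp
      finally show "ennreal ((1 - \<rho>) powr (\<beta> - \<alpha> + t)) * Lnorm s (\<lambda>x. Lam Y d c t x \<rho> y) \<le> ennreal A" .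
    qed
    then have "Nnorm Y d c s \<alpha> \<beta> m < \<infinity>" by (rule le_less_trans) simp
    then show "hseries_conv Y d c \<and> harmonic_on (ball 0 1) (hseries Y d c) \<and> Nnorm Y d c s \<alpha> \<beta> m < \<infinity>"
      using adm_hseries_conv[OF ac] adm_harmonic[OF ac] by blast
  next
    assume r: "hseries_conv Y d c \<and> harmonic_on (ball 0 1) (hseries Y d c) \<and> Nnorm Y d c s \<alpha> \<beta> m < \<infinity>"
    then have ac: "adm c" using adm_of_harmonic by blast
    \<comment> \<open>The norm may be 0 while \<open>sufficient\<close> asks for a positive
      constant, whence the summand 1.\<close>
    define A where "A = enn2real (Nnorm Y d c s \<alpha> \<beta> m) + 1"
    have A: "A > 0" by (simp add: A_def add_nonneg_pos)
    have NA: "Nnorm Y d c s \<alpha> \<beta> m \<le> ennreal A" using r by (simp add: A_def ennreal_plus)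
    show "c \<in> MH Y d (Bspace p 1 \<alpha>) (Bspace q s \<beta>)"
    proof (rule sufficient[OF ac t assms(6,7,5,3,4) A])
      fix \<rho> :: real and y :: "real^'n" assume \<rho>: "0 \<le> \<rho>" "\<rho> < 1" and y: "y \<in> sphere 0 1"
      let ?e = "\<beta> - \<alpha> + t"
      have "ennreal ((1 - \<rho>) powr ?e) * Lnorm s (\<lambda>x. Lam Y d c t x \<rho> y) \<le> Nnorm Y d c s \<alpha> \<beta> m"
        unfolding Nnorm_def exponent t_def[symmetric]
        by (rule SUP_upper2[of \<rho>], use \<rho> in simp, rule SUP_upper[OF y])
      then have "ennreal ((1 - \<rho>) powr (- ?e)) * (ennreal ((1 - \<rho>) powr ?e) * Lnorm s (\<lambda>x. Lam Y d c t x \<rho> y))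
        \<le> ennreal ((1 - \<rho>) powr (- ?e)) * ennreal A"
        by (intro mult_left_mono order_trans[OF _ NA]) auto
      moreover have "ennreal ((1 - \<rho>) powr (- ?e)) * ennreal ((1 - \<rho>) powr ?e) = 1"
        unfolding ennreal_mult[OF powr_ge_zero powr_ge_zero, symmetric] powr_add[symmetric] using \<rho> by simp
      moreover have "ennreal ((1 - \<rho>) powr (- ?e)) * ennreal A = ennreal (A * (1 - \<rho>) powr (- ?e))"
        using A by (subst ennreal_mult[symmetric]) (auto simp: mult.commute)
      ultimately show "Lnorm s (\<lambda>x. Lam Y d c t x \<rho> y) \<le> ennreal (A * (1 - \<rho>) powr (- ?e))"
        by (simp only: mult.assoc[symmetric] mult_1_left)
    qed
  qed
qed

end
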